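(* Let $\nu>0$ and $r\in[\frac12,1]$, and let $\mathbf u^0\in H^{r+s}$ for some $s>1$, with $\mathbf u^0$ divergence-free and mean-free. For each $\alpha>0$ let $\mathbf u_{\alpha,r}$ be the solution of the fractional Navier--Stokes--Voigt equations $$(I+\alpha^{2r}A^r)\frac{d}{dt}\mathbf u_{\alpha,r}+B(\mathbf u_{\alpha,r},\mathbf u_{\alpha,r})+\nu A\mathbf u_{\alpha,r}=\mathbf 0,\qquad\mathbf u_{\alpha,r}(0)=\mathbf u^0 .$$ Suppose there exists a finite time $T^{**}>0$ such that $$\sup_{t\in[0,T^{**})}\limsup_{\alpha\to0}\alpha^{2r}\|A^{r/2}\mathbf u_{\alpha,r}(t)\|_{L^2}^2>0 .$$ Then the Navier--Stokes equations $\partial_t\mathbf u+B(\mathbf u,\mathbf u)+\nu A\mathbf u=\mathbf 0$ with initial data $\mathbf u(0)=\mathbf u^0$ develop a singularity on the time interval $[0,T^{**}]$.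
   Context: All functions are $\mathbb R^3$-valued on the three-dimensional torus $\mathbb T^3=\mathbb R^3/\mathbb Z^3$, divergence-free and mean-free. $H$ (resp. $V^r$) is the closure in $L^2$ (resp. $H^r$) of the smooth divergence-free mean-free fields on $\mathbb T^3$, and $V=V^1$. $(\cdot,\cdot)$ is the $L^2$ inner product and $\langle\cdot,\cdot\rangle$ the duality pairing extending it. $P_\sigma:L^2\to H$ is the Leray--Helmholtz projection, $B(\mathbf u,\mathbf v)=P_\sigma((\mathbf u\cdot\nabla)\mathbf v)$, and $A=-P_\sigma\triangle$ is the Stokes operator with domain $\mathcal D(A)=H^2(\mathbb T^3)\cap H$. $A$ is positive self-adjoint on $H$ with orthonormal eigenbasis $A\boldsymbol\varphi_k=\lambda_k\boldsymbol\varphi_k$, and $A^s\sum_ku_k\boldsymbol\varphi_k=\sum_k\lambda_k^su_k\boldsymbol\varphi_k$; on divergence-free mean-free fields $\|\mathbf u\|_{H^s}^2$ is equivalent to $\|A^{s/2}\mathbf u\|_{L^2}^2$. A solution of the fractional Navier--Stokes--Voigt equations on $[0,T]$ is $\mathbf u\in C([0,T],V^r)\cap L^2(0,T;V\cap V^r)$ with $\frac{d}{dt}\mathbf u\in L^2(0,T;(V\cap V^r)')$ and $(\mathbf u(t),\mathbf v)+\alpha^{2r}(A^{r/2}\mathbf u(t),A^{r/2}\mathbf v)+\nu\int_0^t(A^{1/2}\mathbf u,A^{1/2}\mathbf v)\,d\tau=-\int_0^t\langle B(\mathbf u,\mathbf u),\mathbf v\rangle\,d\tau+(\mathbf u^0,\mathbf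 v)+\alpha^{2r}(A^{r/2}\mathbf u^0,A^{r/2}\mathbf v)$ for all $t\in[0,T]$, $\mathbf v\in V\cap V^r$; here $\mathbf u_{\alpha,r}$ is the unique such solution, defined for all times. A strong solution of the Navier--Stokes equations on $[0,T]$ is a (weak) solution with $\mathbf u\in C([0,T],V)\cap L^2([0,T],\mathcal D(A))$ and $\frac{d}{dt}\mathbf u\in L^2((0,T);H)$. The Navier--Stokes equations "develop a singularity on $[0,T^{**}]$" means that there is no strong (regular) solution on $[0,T^{**}]$ with initial data $\mathbf u^0$. *)

theory Defs
  imports "HOL-Analysis.Analysis"
begin

text \<open>
  Fields on the torus \<open>R^3/Z^3\<close> are encoded as \<open>Z^3\<close>-periodic functions on \<open>R^3\<close>, integrated over the
  unit cube. Elements of \<open>L^2\<close> and of its subspaces are representatives, not classes: the norms below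
  are seminorms, and an operator whose value is only determined almost everywhere returns some
  representative.
\<close>

type_synonym vfield = "real^3 \<Rightarrow> real^3"

definition T3 :: "(real^3) measure" where
  "T3 = lebesgue_on (cbox 0 One)"

definition torus_periodic :: "(real^3 \<Rightarrow> 'b) \<Rightarrow> bool" where
  "torus_periodic f \<longleftrightarrow> (\<forall>b\<in>Basis. \<forall>x. f (x + b) = f x)"


subsection \<open>Smooth functions\<close>

definition partial :: "'a \<Rightarrow> ('a::euclidean_space \<Rightarrow> 'b::real_normed_vector) \<Rightarrow> 'a \<Rightarrow> 'b" where
  "partial b f x = frechet_derivative f (at x) b"

primrec Ck :: "nat \<Rightarrow> ('a::euclidean_space \<Rightarrow> 'b::real_normed_vector) \<Rightarrow> bool" where
  "Ck 0 f \<longleftrightarrow> continuous_on UNIV f"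
| "Ck (Suc k) f \<longleftrightarrow> (\<forall>x. f differentiable (at x)) \<and> (\<forall>b\<in>Basis. Ck k (partial b f))"

definition smooth :: "('a::euclidean_space \<Rightarrow> 'b::real_normed_vector) \<Rightarrow> bool" where
  "smooth f \<longleftrightarrow> (\<forall>k. Ck k f)"

definition smooth_solenoidal :: "vfield set" where
  "smooth_solenoidal = {v. smooth v \<and> torus_periodic v
     \<and> (\<forall>x. (\<Sum>b\<in>Basis. partial b v x \<bullet> b) = 0) \<and> (\<integral>x. v x \<partial>T3) = 0}"


subsection \<open>The spaces \<open>L^2\<close>, \<open>H^s\<close>, \<open>H\<close> and \<open>V^s\<close>\<close>

definition L2_fields :: "vfield set" where
  "L2_fields = {u. torus_periodic u \<and> u \<in> borel_measurable T3 \<and> integrable T3 (\<lambda>x. (norm (u x))\<^sup>2)}"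

definition ip :: "vfield \<Rightarrow> vfield \<Rightarrow> real" where
  "ip u v = (\<integral>x. u x \<bullet> v x \<partial>T3)"

definition L2norm :: "vfield \<Rightarrow> real" where
  "L2norm u = sqrt (ip u u)"

definition frequencies :: "(real^3) set" where
  "frequencies = {k. \<forall>b\<in>Basis. k \<bullet> b \<in> \<int>}"

definition fourier :: "vfield \<Rightarrow> real^3 \<Rightarrow> complex^3" where
  "fourier u k = (\<chi> j. \<integral>x. complex_of_real (u x $ j) * cis (- 2 * pi * (k \<bullet> x)) \<partial>T3)"

definition sobolev_weight :: "real \<Rightarrow> vfield \<Rightarrow> real^3 \<Rightarrow> real" where
  "sobolev_weight s u k = (1 + (2 * pi * norm k)\<^sup>2) powr s * (norm (fourier u k))\<^sup>2"

text \<open>Only used with \<open>s \<ge> 0\<close>.\<close>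

definition sobolev :: "real \<Rightarrow> vfield set" where
  "sobolev s = {u \<in> L2_fields. sobolev_weight s u summable_on frequencies}"

definition sobolev_norm :: "real \<Rightarrow> vfield \<Rightarrow> real" where
  "sobolev_norm s u = sqrt (infsum (sobolev_weight s u) frequencies)"

definition H_space :: "vfield set" where
  "H_space = {u \<in> L2_fields. \<forall>\<epsilon>>0. \<exists>v\<in>smooth_solenoidal. L2norm (u - v) < \<epsilon>}"

definition V_space :: "real \<Rightarrow> vfield set" where
  "V_space s = {u \<in> sobolev s. \<forall>\<epsilon>>0. \<exists>v\<in>smooth_solenoidal. sobolev_norm s (u - v) < \<epsilon>}"

definition weakly_divergence_free :: "vfield \<Rightarrow> bool" where
  "weakly_divergence_free u \<longleftrightarrow>
     (\<forall>\<psi> :: real^3 \<Rightarrow> real. smooth \<psi> \<and> torus_periodic \<psi> \<longrightarrow>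
        (\<integral>x. (\<Sum>b\<in>Basis. (u x \<bullet> b) * partial b \<psi> x) \<partial>T3) = 0)"

definition mean_free :: "vfield \<Rightarrow> bool" where
  "mean_free u \<longleftrightarrow> (\<integral>x. u x \<partial>T3) = 0"


subsection \<open>Leray projection, nonlinearity and Stokes operator\<close>

definition leray :: "vfield \<Rightarrow> vfield" where
  "leray f = (SOME g. g \<in> H_space \<and> (\<forall>v\<in>H_space. ip (f - g) v = 0))"

definition is_weak_partial :: "real^3 \<Rightarrow> vfield \<Rightarrow> vfield \<Rightarrow> bool" where
  "is_weak_partial b u w \<longleftrightarrow> w \<in> L2_fields \<and>
     (\<forall>\<psi> :: real^3 \<Rightarrow> real. smooth \<psi> \<and> torus_periodic \<psi> \<longrightarrow>
        (\<integral>x. partial b \<psi> x *\<^sub>R u x \<partial>T3) = - (\<integral>x. \<psi> x *\<^sub>R w x \<partial>T3))"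

definition weak_partial :: "real^3 \<Rightarrow> vfield \<Rightarrow> vfield" where
  "weak_partial b u = (SOME w. is_weak_partial b u w)"

definition advection :: "vfield \<Rightarrow> vfield \<Rightarrow> vfield" where
  "advection u w = (\<lambda>x. \<Sum>b\<in>Basis. (u x \<bullet> b) *\<^sub>R weak_partial b w x)"

text \<open>
  The pairing \<open>\<langle>B(u,w), v\<rangle>\<close>. For \<open>u, w \<in> V\<close> the field \<open>(u \<cdot> \<nabla>) w\<close> is only in \<open>L^(3/2)\<close>, so
  \<open>B(u,w) = P (u \<cdot> \<nabla>) w\<close> is an element of the dual of \<open>V\<close>. The projection \<open>P\<close> is self-adjoint and is
  extended by duality, \<open>\<langle>P f, v\<rangle> = (f, P v)\<close>; the integral converges absolutely for \<open>v \<in> V\<close>.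
\<close>

definition B_pairing :: "vfield \<Rightarrow> vfield \<Rightarrow> vfield \<Rightarrow> real" where
  "B_pairing u w v = ip (advection u w) (leray v)"

definition stokes_domain :: "vfield set" where
  "stokes_domain = sobolev 2 \<inter> H_space"

definition stokes :: "vfield \<Rightarrow> vfield" where
  "stokes u = leray (\<lambda>x. - (\<Sum>b\<in>Basis. weak_partial b (weak_partial b u) x))"

definition stokes_eigenbasis :: "(nat \<Rightarrow> vfield) \<Rightarrow> (nat \<Rightarrow> real) \<Rightarrow> bool" where
  "stokes_eigenbasis \<phi> lam \<longleftrightarrow>
     (\<forall>k. \<phi> k \<in> stokes_domain \<and> 0 < lam k
          \<and> (AE x in T3. stokes (\<phi> k) x = lam k *\<^sub>R \<phi> k x)) \<and>
     (\<forall>j k. ip (\<phi> j) (\<phi> k) = (if j = k then 1 else 0)) \<and>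
     (\<forall>u\<in>H_space. (\<lambda>n. L2norm (\<lambda>x. u x - (\<Sum>k<n. ip u (\<phi> k) *\<^sub>R \<phi> k x))) \<longlonglongrightarrow> 0)"

text \<open>The power \<open>A^s u\<close>, an unspecified field if \<open>u\<close> is not in the domain of \<open>A^s\<close>.\<close>

definition stokes_powr :: "(nat \<Rightarrow> vfield) \<Rightarrow> (nat \<Rightarrow> real) \<Rightarrow> real \<Rightarrow> vfield \<Rightarrow> vfield" where
  "stokes_powr \<phi> lam s u = (SOME w. w \<in> H_space \<and>
     (\<lambda>n. L2norm (\<lambda>x. w x - (\<Sum>k<n. (lam k powr s * ip u (\<phi> k)) *\<^sub>R \<phi> k x))) \<longlonglongrightarrow> 0)"


subsection \<open>Functions of time with values in a seminormed space \<open>(X, N)\<close>\<close>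

definition continuous_into :: "real \<Rightarrow> 'x set \<Rightarrow> ('x \<Rightarrow> real) \<Rightarrow> (real \<Rightarrow> 'x::minus) \<Rightarrow> bool" where
  "continuous_into T X N u \<longleftrightarrow> (\<forall>t\<in>{0..T}. u t \<in> X) \<and>
     (\<forall>t\<^sub>0\<in>{0..T}. ((\<lambda>t. N (u t - u t\<^sub>0)) \<longlongrightarrow> 0) (at t\<^sub>0 within {0..T}))"

definition strongly_measurable_into ::
    "real \<Rightarrow> 'x set \<Rightarrow> ('x \<Rightarrow> real) \<Rightarrow> (real \<Rightarrow> 'x::minus) \<Rightarrow> bool" where
  "strongly_measurable_into T X N u \<longleftrightarrow> (\<exists>\<sigma> :: nat \<Rightarrow> real \<Rightarrow> 'x.
     (\<forall>n. simple_function (lebesgue_on {0..T}) (\<sigma> n) \<and> \<sigma> n ` {0..T} \<subseteq> X) \<and>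
     (AE t in lebesgue_on {0..T}. u t \<in> X \<and> (\<lambda>n. N (\<sigma> n t - u t)) \<longlonglongrightarrow> 0))"

definition L2_into :: "real \<Rightarrow> 'x set \<Rightarrow> ('x \<Rightarrow> real) \<Rightarrow> (real \<Rightarrow> 'x::minus) \<Rightarrow> bool" where
  "L2_into T X N u \<longleftrightarrow> strongly_measurable_into T X N u \<and>
     integrable (lebesgue_on {0..T}) (\<lambda>t. (N (u t))\<^sup>2)"

definition dual_space :: "vfield set \<Rightarrow> (vfield \<Rightarrow> real) \<Rightarrow> (vfield \<Rightarrow> real) set" where
  "dual_space X N = {g.
     (\<forall>u\<in>X. \<forall>v\<in>X. \<forall>a b. g (\<lambda>x. a *\<^sub>R u x + b *\<^sub>R v x) = a * g u + b * g v) \<and>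
     (\<exists>C. \<forall>v\<in>X. \<bar>g v\<bar> \<le> C * N v)}"

definition dual_norm :: "vfield set \<Rightarrow> (vfield \<Rightarrow> real) \<Rightarrow> (vfield \<Rightarrow> real) \<Rightarrow> real" where
  "dual_norm X N g = (SUP v\<in>{v\<in>X. N v \<le> 1}. \<bar>g v\<bar>)"

text \<open>
  \<open>g\<close> is the distributional derivative of \<open>u\<close> on \<open>(0,T)\<close> as a function with values in the dual of \<open>X\<close>,
  where a field \<open>w\<close> is identified with the functional \<open>ip w\<close>.
\<close>

definition weak_time_derivative ::
    "real \<Rightarrow> vfield set \<Rightarrow> (real \<Rightarrow> vfield) \<Rightarrow> (real \<Rightarrow> vfield \<Rightarrow> real) \<Rightarrow> bool" where
  "weak_time_derivative T X u g \<longleftrightarrow>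
     (\<forall>\<psi> :: real \<Rightarrow> real. \<forall>v\<in>X.
        smooth \<psi> \<and> (\<exists>a b. 0 < a \<and> b < T \<and> (\<forall>t. t \<notin> {a..b} \<longrightarrow> \<psi> t = 0)) \<longrightarrow>
        (\<integral>t. deriv \<psi> t * ip (u t) v \<partial>lebesgue_on {0..T})
          = - (\<integral>t. \<psi> t * g t v \<partial>lebesgue_on {0..T}))"


subsection \<open>Fractional Navier--Stokes--Voigt equations\<close>

definition V_cap_norm :: "real \<Rightarrow> vfield \<Rightarrow> real" where
  "V_cap_norm r u = sobolev_norm 1 u + sobolev_norm r u"

definition nsv_solution ::
    "(nat \<Rightarrow> vfield) \<Rightarrow> (nat \<Rightarrow> real) \<Rightarrow> real \<Rightarrow> real \<Rightarrow> real \<Rightarrow> real \<Rightarrow> vfield \<Rightarrow> (real \<Rightarrow> vfield) \<Rightarrow> bool" where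
  "nsv_solution \<phi> lam \<nu> r \<alpha> T u\<^sub>0 u \<longleftrightarrow>
     continuous_into T (V_space r) (sobolev_norm r) u \<and>
     L2_into T (V_space 1 \<inter> V_space r) (V_cap_norm r) u \<and>
     (\<exists>g. L2_into T (dual_space (V_space 1 \<inter> V_space r) (V_cap_norm r))
                    (dual_norm (V_space 1 \<inter> V_space r) (V_cap_norm r)) g \<and>
          weak_time_derivative T (V_space 1 \<inter> V_space r) u g) \<and>
     (\<forall>t\<in>{0..T}. \<forall>v\<in>V_space 1 \<inter> V_space r.
        ip (u t) v
        + \<alpha> powr (2 * r) * ip (stokes_powr \<phi> lam (r / 2) (u t)) (stokes_powr \<phi> lam (r / 2) v)
        + \<nu> * (\<integral>\<tau>. ip (stokes_powr \<phi> lam (1 / 2) (u \<tau>)) (stokes_powr \<phi> lam (1 / 2) v)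
                 \<partial>lebesgue_on {0..t})
        = - (\<integral>\<tau>. B_pairing (u \<tau>) (u \<tau>) v \<partial>lebesgue_on {0..t})
          + ip u\<^sub>0 v
          + \<alpha> powr (2 * r) * ip (stokes_powr \<phi> lam (r / 2) u\<^sub>0) (stokes_powr \<phi> lam (r / 2) v))"


subsection \<open>Navier--Stokes equations\<close>

text \<open>The weak formulation at \<open>t = 0\<close> contains the initial condition.\<close>

definition nse_weak_solution ::
    "(nat \<Rightarrow> vfield) \<Rightarrow> (nat \<Rightarrow> real) \<Rightarrow> real \<Rightarrow> real \<Rightarrow> vfield \<Rightarrow> (real \<Rightarrow> vfield) \<Rightarrow> bool" where
  "nse_weak_solution \<phi> lam \<nu> T u\<^sub>0 u \<longleftrightarrow>
     (\<forall>t\<in>{0..T}. u t \<in> H_space) \<and>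
     (\<forall>v\<in>H_space. continuous_on {0..T} (\<lambda>t. ip (u t) v)) \<and>
     L2_into T (V_space 1) (sobolev_norm 1) u \<and>
     (\<forall>t\<in>{0..T}. \<forall>v\<in>V_space 1.
        ip (u t) v
        + \<nu> * (\<integral>\<tau>. ip (stokes_powr \<phi> lam (1 / 2) (u \<tau>)) (stokes_powr \<phi> lam (1 / 2) v)
                 \<partial>lebesgue_on {0..t})
        = - (\<integral>\<tau>. B_pairing (u \<tau>) (u \<tau>) v \<partial>lebesgue_on {0..t}) + ip u\<^sub>0 v)"

definition nse_strong_solution ::
    "(nat \<Rightarrow> vfield) \<Rightarrow> (nat \<Rightarrow> real) \<Rightarrow> real \<Rightarrow> real \<Rightarrow> vfield \<Rightarrow> (real \<Rightarrow> vfield) \<Rightarrow> bool" where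
  "nse_strong_solution \<phi> lam \<nu> T u\<^sub>0 u \<longleftrightarrow>
     nse_weak_solution \<phi> lam \<nu> T u\<^sub>0 u \<and>
     continuous_into T (V_space 1) (sobolev_norm 1) u \<and>
     L2_into T stokes_domain (sobolev_norm 2) u \<and>
     (\<exists>h. L2_into T H_space L2norm h \<and> weak_time_derivative T H_space u (\<lambda>t. ip (h t)))"

definition nse_develops_singularity ::
    "(nat \<Rightarrow> vfield) \<Rightarrow> (nat \<Rightarrow> real) \<Rightarrow> real \<Rightarrow> vfield \<Rightarrow> real \<Rightarrow> bool" where
  "nse_develops_singularity \<phi> lam \<nu> u\<^sub>0 T \<longleftrightarrow> \<not> (\<exists>u. nse_strong_solution \<phi> lam \<nu> T u\<^sub>0 u)"

end

theory Submission
  imports Defs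
begin

text \<open>
  Suppose that a strong solution \<open>w\<close> of the Navier--Stokes equations exists on \<open>[0,T]\<close>. In the Stokes
  eigenbasis both equations become systems for the coefficient sequences, \<open>b\<close> of \<open>w\<close> and \<open>a\<close> of the Voigt
  solution, with a trilinear form that is antisymmetric in its last two arguments and bounded by
  \<open>C \<parallel>x\<parallel>\<^sub>1\<^sub>/\<^sub>2 \<parallel>y\<parallel>\<^sub>1 \<parallel>z\<parallel>\<^sub>1\<close> and \<open>C \<parallel>x\<parallel>\<^sub>1 \<parallel>y\<parallel>\<^sub>1 \<parallel>z\<parallel>\<^sub>1\<^sub>/\<^sub>2\<close>. With \<open>\<epsilon> = \<alpha>\<^sup>2\<^sup>r\<close> and \<open>P\<^sub>R\<close> the truncation to
  eigenvalues \<open>\<le> R\<close>, compare \<open>a\<close> with \<open>P\<^sub>R b\<close> through the relative energy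
  \<open>\<parallel>a\<parallel>\<^sub>0\<^sup>2 + \<epsilon> \<parallel>a\<parallel>\<^sub>r\<^sup>2 - 2 \<Sum>\<^sub>k (1 + \<epsilon> \<lambda>\<^sub>k\<^sup>r) a\<^sub>k (P\<^sub>R b)\<^sub>k + \<parallel>P\<^sub>R b\<parallel>\<^sub>0\<^sup>2\<close>. Since \<open>\<parallel>b\<parallel>\<^sub>1\<close> is bounded in time, Gronwall's
  inequality bounds it by a constant depending on \<open>R\<close> times \<open>\<epsilon>\<close>, plus a term that tends to \<open>0\<close> as \<open>R \<rightarrow> \<infinity>\<close>.
  Fixing a large \<open>R\<close> and then letting \<open>\<epsilon> \<rightarrow> 0\<close> gives \<open>\<epsilon> \<parallel>a(t)\<parallel>\<^sub>r\<^sup>2 \<rightarrow> 0\<close> for every \<open>t\<close>, which contradicts the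
  assumption on the Voigt energies.
\<close>

section \<open>Weighted sequence spaces and the trilinear form\<close>

text \<open>The truncation is forced by the cross term of the relative energy. Its time derivative
  contains \<open>\<epsilon> * lam k powr r * a k\<close> times the derivative of
  \<open>b k\<close>, and summing this over all modes would ask for more regularity of
  \<open>b\<close> than the bound on \<open>\<parallel>b\<parallel>\<^sub>1\<close> offers. For
  \<open>P\<^sub>R b\<close> the sum is finite, of size \<epsilon> with a constant depending on
  \<open>R\<close>, but \<open>P\<^sub>R b\<close> solves the equation only up to tails; hence
  \<open>R\<close> has to be fixed before \<epsilon> tends to 0. The half norm interpolates between
  the norms of index 0 and 1. The term quadratic in \<open>a - P\<^sub>R b\<close> is therefore
  absorbed by the viscosity up to a multiple of the squared 0-norm, which is what Gronwall's
  inequality can treat. The condition \<open>1/2 \<le> r\<close> acts qualitatively: for each single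
  \<epsilon> it keeps \<open>\<parallel>a\<parallel>\<^sub>1\<^sub>/\<^sub>2\<close> bounded in
  time, so that the energy transferred through a spectral cutoff vanishes in the limit, and it makes
  the nonlinear term of each mode equation continuous in time. No bound uniform in \<epsilon> is
  drawn from it.\<close>

definition ell :: "(nat \<Rightarrow> real) \<Rightarrow> real \<Rightarrow> (nat \<Rightarrow> real) set" where
  "ell lam s = {c. summable (\<lambda>k. lam k powr s * (c k)\<^sup>2)}"

text \<open>In Stokes coordinates this is the squared \<open>L^2\<close> norm of
  \<open>A^(s/2) u\<close>, so that \<open>s\<close> is the Sobolev index. It is meaningful only on
  \<open>ell lam s\<close>, where the series converges.\<close>

definition nsq :: "(nat \<Rightarrow> real) \<Rightarrow> real \<Rightarrow> (nat \<Rightarrow> real) \<Rightarrow> real" where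
  "nsq lam s c = (\<Sum>k. lam k powr s * (c k)\<^sup>2)"

text \<open>The cutoff is by eigenvalue and not by index, since \<open>lam\<close> need not be
  ordered.\<close>

definition trunc :: "(nat \<Rightarrow> real) \<Rightarrow> real \<Rightarrow> (nat \<Rightarrow> real) \<Rightarrow> nat \<Rightarrow> real" where
  "trunc lam R c = (\<lambda>k. if lam k \<le> R then c k else 0)"

definition unit_seq :: "nat \<Rightarrow> nat \<Rightarrow> real" where
  "unit_seq k = (\<lambda>j. if j = k then 1 else 0)"

lemma ell_bound:
  assumes "c \<in> ell lam s" "\<And>k. (d k)\<^sup>2 \<le> K * (c k)\<^sup>2"
  shows "d \<in> ell lam s"
proof -
  have s: "summable (\<lambda>k. K * (lam k powr s * (c k)\<^sup>2))"
    using assms(1) by (auto simp: ell_def intro: summable_mult)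
  have "norm (lam k powr s * (d k)\<^sup>2) \<le> K * (lam k powr s * (c k)\<^sup>2)" for k
    using mult_left_mono[OF assms(2)[of k], of "lam k powr s"] by (simp add: mult.left_commute)
  then show ?thesis
    unfolding ell_def mem_Collect_eq by (rule summable_comparison_test'[OF s])
qed

lemma nsq_nonneg: "c \<in> ell lam s \<Longrightarrow> 0 \<le> nsq lam s c"
  unfolding nsq_def ell_def by (rule suminf_nonneg) auto

text \<open>Minkowski's inequality for the finite sums \<open>L2_set\<close>, with the weight
  written as a square, passes to the series.\<close>

lemma ell_add:
  assumes "c \<in> ell lam s" "d \<in> ell lam s"
  shows "(\<lambda>k. c k + d k) \<in> ell lam s"
    and "sqrt (nsq lam s (\<lambda>k. c k + d k)) \<le> sqrt (nsq lam s c) + sqrt (nsq lam s d)"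
proof -
  let ?w = "\<lambda>k. lam k powr (s/2)"
  have w: "lam k powr s = (?w k)\<^sup>2" for k
    by (simp add: powr_add[symmetric] power2_eq_square)
  have sm: "summable (\<lambda>k. (?w k * e k)\<^sup>2) \<longleftrightarrow> e \<in> ell lam s" for e
    unfolding ell_def w by (simp add: power_mult_distrib)
  have ns: "nsq lam s e = (\<Sum>k. (?w k * e k)\<^sup>2)" for e
    unfolding nsq_def w by (simp add: power_mult_distrib)
  have fin: "(\<Sum>k\<in>A. (?w k * (c k + d k))\<^sup>2) \<le> (sqrt (nsq lam s c) + sqrt (nsq lam s d))\<^sup>2"
    if "finite A" for A
  proof -
    have "L2_set (\<lambda>k. ?w k * c k + ?w k * d k) A
        \<le> L2_set (\<lambda>k. ?w k * c k) A + L2_set (\<lambda>k. ?w k * d k) A"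
      by (rule L2_set_triangle_ineq)
    also have "L2_set (\<lambda>k. ?w k * c k) A \<le> sqrt (nsq lam s c)"
      unfolding L2_set_def ns using assms(1) that by (auto simp: sm intro!: sum_le_suminf)
    also have "L2_set (\<lambda>k. ?w k * d k) A \<le> sqrt (nsq lam s d)"
      unfolding L2_set_def ns using assms(2) that by (auto simp: sm intro!: sum_le_suminf)
    finally have "sqrt (\<Sum>k\<in>A. (?w k * (c k + d k))\<^sup>2) \<le> sqrt (nsq lam s c) + sqrt (nsq lam s d)"
      by (simp add: L2_set_def algebra_simps)
    then show ?thesis
      by (meson real_sqrt_le_iff real_le_lsqrt sqrt_le_D)
  qed
  have s: "summable (\<lambda>k. (?w k * (c k + d k))\<^sup>2)"
    by (rule summableI_nonneg_bounded[where x="(sqrt (nsq lam s c) + sqrt (nsq lam s d))\<^sup>2"])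
       (auto intro: fin)
  then show "(\<lambda>k. c k + d k) \<in> ell lam s" by (simp add: sm)
  have "nsq lam s (\<lambda>k. c k + d k) \<le> (sqrt (nsq lam s c) + sqrt (nsq lam s d))\<^sup>2"
    unfolding ns[of "\<lambda>k. c k + d k"] by (rule suminf_le_const[OF s]) (auto intro: fin)
  then show "sqrt (nsq lam s (\<lambda>k. c k + d k)) \<le> sqrt (nsq lam s c) + sqrt (nsq lam s d)"
    using assms by (intro real_le_lsqrt) (auto intro!: add_nonneg_nonneg simp: nsq_nonneg)
qed

lemma ell_scale:
  assumes "c \<in> ell lam s"
  shows "(\<lambda>k. a * c k) \<in> ell lam s" "nsq lam s (\<lambda>k. a * c k) = a\<^sup>2 * nsq lam s c"
proof -
  have eq: "lam k powr s * (a * c k)\<^sup>2 = a\<^sup>2 * (lam k powr s * (c k)\<^sup>2)" for k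
    by (simp add: power_mult_distrib)
  show "(\<lambda>k. a * c k) \<in> ell lam s" "nsq lam s (\<lambda>k. a * c k) = a\<^sup>2 * nsq lam s c"
    using assms unfolding ell_def nsq_def eq mem_Collect_eq
    by (intro summable_mult suminf_mult; assumption)+
qed

lemma ell_diff:
  assumes "c \<in> ell lam s" "d \<in> ell lam s"
  shows "(\<lambda>k. c k - d k) \<in> ell lam s"
    and "sqrt (nsq lam s (\<lambda>k. c k - d k)) \<le> sqrt (nsq lam s c) + sqrt (nsq lam s d)"
  using ell_add[OF assms(1) ell_scale(1)[OF assms(2), of "-1"]] ell_scale(2)[OF assms(2), of "-1"]
  by simp_all

lemma nsq_abs_diff:
  assumes "c \<in> ell lam s" "d \<in> ell lam s"
  shows "\<bar>sqrt (nsq lam s c) - sqrt (nsq lam s d)\<bar> \<le> sqrt (nsq lam s (\<lambda>k. c k - d k))"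
proof -
  have "sqrt (nsq lam s c) \<le> sqrt (nsq lam s (\<lambda>k. c k - d k)) + sqrt (nsq lam s d)"
    using ell_add(2)[OF ell_diff(1)[OF assms] assms(2)] by simp
  moreover have "sqrt (nsq lam s d) \<le> sqrt (nsq lam s (\<lambda>k. d k - c k)) + sqrt (nsq lam s c)"
    using ell_add(2)[OF ell_diff(1)[OF assms(2,1)] assms(1)] by simp
  moreover have "nsq lam s (\<lambda>k. d k - c k) = nsq lam s (\<lambda>k. c k - d k)"
    unfolding nsq_def by (intro suminf_cong) (simp add: power2_commute)
  ultimately show ?thesis by (simp add: abs_le_iff)
qed

lemma nsq_ge_term:
  assumes "c \<in> ell lam s"
  shows "lam k powr s * (c k)\<^sup>2 \<le> nsq lam s c"
  using sum_le_suminf[of "\<lambda>k. lam k powr s * (c k)\<^sup>2" "{k}"] assms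
  by (auto simp: ell_def nsq_def)

text \<open>The properties of the equations on which the energy argument rests, so that it can be
  carried out on sequences. The exponents are critical in three dimensions:
  \<open>1/2 + 1 + 1\<close>, minus the one derivative in the form, is \<open>3/2\<close>. The half
  norm may fall on the transporting argument or on the test argument.\<close>

locale mode_system =
  fixes lam :: "nat \<Rightarrow> real"
    and beta :: "(nat \<Rightarrow> real) \<Rightarrow> (nat \<Rightarrow> real) \<Rightarrow> (nat \<Rightarrow> real) \<Rightarrow> real"
    and C :: real
  assumes lam_ge_1: "1 \<le> lam k"
    and finite_lam_le: "finite {k. lam k \<le> R}"
    and beta_add1: "\<lbrakk>x \<in> ell lam 1; x' \<in> ell lam 1; y \<in> ell lam 1; z \<in> ell lam 1\<rbrakk>
      \<Longrightarrow> beta (\<lambda>k. x k + x' k) y z = beta x y z + beta x' y z"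
    and beta_add2: "\<lbrakk>x \<in> ell lam 1; y \<in> ell lam 1; y' \<in> ell lam 1; z \<in> ell lam 1\<rbrakk>
      \<Longrightarrow> beta x (\<lambda>k. y k + y' k) z = beta x y z + beta x y' z"
    and beta_scale3: "\<lbrakk>x \<in> ell lam 1; y \<in> ell lam 1; z \<in> ell lam 1\<rbrakk>
      \<Longrightarrow> beta x y (\<lambda>k. a * z k) = a * beta x y z"
    and beta_antisym: "\<lbrakk>x \<in> ell lam 1; y \<in> ell lam 1; z \<in> ell lam 1\<rbrakk>
      \<Longrightarrow> beta x z y = - beta x y z"
    and C_nonneg: "0 \<le> C"
    and beta_bound1: "\<lbrakk>x \<in> ell lam 1; y \<in> ell lam 1; z \<in> ell lam 1\<rbrakk>
      \<Longrightarrow> \<bar>beta x y z\<bar> \<le> C * sqrt (nsq lam (1/2) x) * sqrt (nsq lam 1 y) * sqrt (nsq lam 1 z)"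
    and beta_bound3: "\<lbrakk>x \<in> ell lam 1; y \<in> ell lam 1; z \<in> ell lam 1\<rbrakk>
      \<Longrightarrow> \<bar>beta x y z\<bar> \<le> C * sqrt (nsq lam 1 x) * sqrt (nsq lam 1 y) * sqrt (nsq lam (1/2) z)"
begin

abbreviation "E \<equiv> ell lam"
abbreviation "N \<equiv> nsq lam"
abbreviation "tr \<equiv> trunc lam"
abbreviation "F R \<equiv> {k. lam k \<le> R}"

lemma ell_mono:
  assumes "s \<le> t" "c \<in> E t"
  shows "c \<in> E s" "N s c \<le> N t c"
proof -
  have le: "lam k powr s * (c k)\<^sup>2 \<le> lam k powr t * (c k)\<^sup>2" for k
    using lam_ge_1[of k] assms(1) by (intro mult_right_mono powr_mono) auto
  show s: "c \<in> E s" unfolding ell_def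
    apply simp
    apply (rule summable_comparison_test'[where N=0 and g="\<lambda>k. lam k powr t * (c k)\<^sup>2"])
    using assms(2) le by (auto simp: ell_def)
  show "N s c \<le> N t c"
    unfolding nsq_def using s assms(2) le by (intro suminf_le) (auto simp: ell_def)
qed

lemma ell_finite_support: "finite {k. c k \<noteq> 0} \<Longrightarrow> c \<in> E s"
  unfolding ell_def by (auto intro!: summable_finite[of "{k. c k \<noteq> 0}"])

lemma trunc_ell: "tr R c \<in> E s"
  by (rule ell_finite_support, rule finite_subset[OF _ finite_lam_le[of R]]) (auto simp: trunc_def)

lemma unit_ell: "unit_seq k \<in> E s"
  by (rule ell_finite_support) (auto simp: unit_seq_def)

lemma nsq_trunc: "N s (tr R c) = (\<Sum>k\<in>F R. lam k powr s * (c k)\<^sup>2)"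
  unfolding nsq_def by (subst suminf_finite[of "F R"]) (auto simp: trunc_def finite_lam_le)

lemma nsq_mono_abs:
  assumes "c \<in> E s" "\<And>k. (d k)\<^sup>2 \<le> (c k)\<^sup>2"
  shows "N s d \<le> N s c"
  unfolding nsq_def using assms ell_bound[of c lam s d 1]
  by (intro suminf_le mult_left_mono) (auto simp: ell_def)

lemma nsq_trunc_le: "c \<in> E s \<Longrightarrow> N s (tr R c) \<le> N s c"
  by (rule nsq_mono_abs) (auto simp: trunc_def)

lemma tail_ell: "c \<in> E s \<Longrightarrow> (\<lambda>k. c k - tr R c k) \<in> E s"
  by (rule ell_diff(1)) (auto intro: trunc_ell)

lemma nsq_tail_le: "c \<in> E s \<Longrightarrow> N s (\<lambda>k. c k - tr R c k) \<le> N s c"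
  by (rule nsq_mono_abs) (auto simp: trunc_def)

lemma beta_zero3: "x \<in> E 1 \<Longrightarrow> y \<in> E 1 \<Longrightarrow> beta x y (\<lambda>k. 0) = 0"
  using beta_scale3[of x y "unit_seq 0" 0] unit_ell by simp

text \<open>Antisymmetry exchanges the last two arguments, so additivity carries over from the
  second to the third.\<close>

lemma beta_add3:
  assumes "x \<in> E 1" "y \<in> E 1" "z \<in> E 1" "z' \<in> E 1"
  shows "beta x y (\<lambda>k. z k + z' k) = beta x y z + beta x y z'"
  using beta_antisym[of x "\<lambda>k. z k + z' k" y] beta_antisym[of x z y] beta_antisym[of x z' y]
    beta_add2[of x z z' y] assms ell_add(1) by auto

lemma beta_diff3:
  assumes "x \<in> E 1" "y \<in> E 1" "z \<in> E 1" "z' \<in> E 1"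
  shows "beta x y (\<lambda>k. z k - z' k) = beta x y z - beta x y z'"
  using beta_add3[OF assms(1-3) ell_scale(1)[OF assms(4)], of "-1"] beta_scale3[OF assms(1,2,4), of "-1"]
  by simp

lemma beta_cancel: "x \<in> E 1 \<Longrightarrow> y \<in> E 1 \<Longrightarrow> beta x y y = 0"
  using beta_antisym[of x y y] by simp

lemma beta_finite_sum:
  assumes "x \<in> E 1" "y \<in> E 1" "finite A"
  shows "beta x y (\<lambda>k. if k \<in> A then c k else 0) = (\<Sum>k\<in>A. c k * beta x y (unit_seq k))"
  using assms(3)
proof (induction A rule: finite_induct)
  case empty then show ?case using beta_zero3[OF assms(1,2)] by simp
next
  case (insert a A)
  have "(\<lambda>k. if k \<in> insert a A then c k else 0)
      = (\<lambda>k. c a * unit_seq a k + (if k \<in> A then c k else 0))"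
    using insert by (auto simp: unit_seq_def fun_eq_iff)
  moreover have "(\<lambda>k. if k \<in> A then c k else 0) \<in> E 1"
    by (rule ell_finite_support) (auto intro: finite_subset[OF _ insert(1)])
  ultimately show ?case
    using insert assms(1,2)
    by (simp add: beta_add3 beta_scale3 ell_scale(1) unit_ell)
qed

text \<open>The mode equations are tested with the sequences \<open>unit_seq k\<close>; this
  assembles such tests into one truncated test sequence.\<close>

lemma beta_trunc:
  assumes "x \<in> E 1" "y \<in> E 1"
  shows "beta x y (tr R c) = (\<Sum>k\<in>F R. c k * beta x y (unit_seq k))"
  using beta_finite_sum[OF assms finite_lam_le[of R], of c] by (simp add: trunc_def)

text \<open>The sets \<open>F (real n)\<close> exhaust the modes without following their numbering,
  so the series is first read as an unordered sum.\<close>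

lemma sum_modes_tendsto:
  fixes g :: "nat \<Rightarrow> real"
  assumes "summable g" "\<And>k. 0 \<le> g k"
  shows "(\<lambda>n. \<Sum>k\<in>F (real n). g k) \<longlonglongrightarrow> suminf g"
proof -
  have "(g has_sum suminf g) UNIV"
    using assms by (simp add: sums_nonneg_imp_has_sum summable_sums)
  then have "(sum g \<longlongrightarrow> suminf g) (finite_subsets_at_top UNIV)"
    by (simp add: has_sum_def)
  moreover have "filterlim (\<lambda>n. F (real n)) (finite_subsets_at_top UNIV) sequentially"
    unfolding filterlim_finite_subsets_at_top
  proof (intro allI impI)
    fix X :: "nat set" assume X: "finite X \<and> X \<subseteq> UNIV"
    obtain n0 where n0: "\<And>k. k \<in> X \<Longrightarrow> lam k \<le> real n0"
    proof -
      obtain n0 where "(\<Sum>k\<in>X. lam k) \<le> real n0" using real_arch_simple by blast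
      moreover have "lam k \<le> (\<Sum>k\<in>X. lam k)" if "k \<in> X" for k
        using X that lam_ge_1 by (intro member_le_sum) (auto intro: order_trans[of 0 1])
      ultimately show ?thesis using that by (meson order_trans)
    qed
    show "\<forall>\<^sub>F n in sequentially. finite (F (real n)) \<and> X \<subseteq> F (real n) \<and> F (real n) \<subseteq> UNIV"
      using eventually_ge_at_top[of n0]
      apply eventually_elim
      using n0 finite_lam_le by (auto, meson of_nat_mono order_trans)
  qed
  ultimately show ?thesis by (rule filterlim_compose)
qed

lemma nsq_tail_eq: "c \<in> E s \<Longrightarrow> N s (\<lambda>k. c k - tr R c k) = N s c - (\<Sum>k\<in>F R. lam k powr s * (c k)\<^sup>2)"
proof -
  assume c: "c \<in> E s"
  have "N s (\<lambda>k. c k - tr R c k) = (\<Sum>k. lam k powr s * (c k)\<^sup>2 - lam k powr s * (tr R c k)\<^sup>2)"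
    unfolding nsq_def by (intro suminf_cong) (auto simp: trunc_def)
  also have "\<dots> = N s c - N s (tr R c)"
    unfolding nsq_def using c trunc_ell[of R c s] by (intro suminf_diff[symmetric]) (auto simp: ell_def)
  finally show ?thesis by (simp add: nsq_trunc)
qed

lemma nsq_tail_tendsto:
  assumes "c \<in> E s"
  shows "(\<lambda>n. N s (\<lambda>k. c k - tr (real n) c k)) \<longlonglongrightarrow> 0"
proof -
  have "(\<lambda>n. N s c - (\<Sum>k\<in>F (real n). lam k powr s * (c k)\<^sup>2)) \<longlonglongrightarrow> N s c - N s c"
    unfolding nsq_def using assms
    by (intro tendsto_intros sum_modes_tendsto) (auto simp: ell_def)
  then show ?thesis by (simp add: nsq_tail_eq[OF assms])
qed

text \<open>Above the cutoff \<open>sqrt (lam k) \<le> lam k / sqrt R\<close>: half a derivative is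
  traded for decay in \<open>R\<close>.\<close>

lemma nsq_half_tail:
  assumes "c \<in> E 1" "0 < R"
  shows "N (1/2) (\<lambda>k. c k - tr R c k) \<le> N 1 c / sqrt R"
proof -
  have t: "(\<lambda>k. c k - tr R c k) \<in> E (1/2)"
    by (rule tail_ell, rule ell_mono(1)[OF _ assms(1)]) simp
  have le: "lam k powr (1/2) * (c k - tr R c k)\<^sup>2 \<le> (lam k powr 1 * (c k)\<^sup>2) / sqrt R" for k
  proof (cases "lam k \<le> R")
    case True then show ?thesis using assms(2) lam_ge_1[of k] by (simp add: trunc_def)
  next
    case False
    then have "sqrt R * sqrt (lam k) \<le> sqrt (lam k) * sqrt (lam k)"
      using assms(2) by (intro mult_right_mono) auto
    then have "sqrt (lam k) \<le> lam k / sqrt R"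
      using lam_ge_1[of k] assms(2) by (simp add: field_simps)
    then have "sqrt (lam k) * (c k)\<^sup>2 \<le> lam k / sqrt R * (c k)\<^sup>2"
      by (rule mult_right_mono) simp
    then show ?thesis using False lam_ge_1[of k] by (simp add: trunc_def powr_half_sqrt)
  qed
  have "N (1/2) (\<lambda>k. c k - tr R c k) \<le> (\<Sum>k. (lam k powr 1 * (c k)\<^sup>2) / sqrt R)"
    unfolding nsq_def using t assms(1) le
    by (intro suminf_le) (auto simp: ell_def intro: summable_divide)
  also have "\<dots> = N 1 c / sqrt R"
    unfolding nsq_def using assms(1) by (intro suminf_divide) (auto simp: ell_def)
  finally show ?thesis .
qed

text \<open>Young's inequality in each mode, from
  \<open>(2 * \<mu> * sqrt (lam k) - 1)\<^sup>2 \<ge> 0\<close>. The free \<mu> is later made small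
  enough for the viscosity to absorb the first term.\<close>

lemma nsq_half_interpolate:
  assumes "c \<in> E 1" "0 < \<mu>"
  shows "N (1/2) c \<le> \<mu> * N 1 c + N 0 c / (4 * \<mu>)"
proof -
  have e: "c \<in> E (1/2)" "c \<in> E 0" by (auto intro: ell_mono(1)[OF _ assms(1)])
  have le: "lam k powr (1/2) * (c k)\<^sup>2 \<le> \<mu> * (lam k powr 1 * (c k)\<^sup>2) + (lam k powr 0 * (c k)\<^sup>2) / (4*\<mu>)" for k
  proof -
    have l: "0 < lam k" using lam_ge_1[of k] by linarith
    have "0 \<le> (2 * \<mu> * sqrt (lam k) - 1)\<^sup>2" by simp
    also have "(2 * \<mu> * sqrt (lam k) - 1)\<^sup>2 = 4 * \<mu>\<^sup>2 * lam k + 1 - 4 * \<mu> * sqrt (lam k)"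
      using l by (simp add: power2_eq_square algebra_simps)
    finally have "4 * \<mu> * sqrt (lam k) \<le> 4 * \<mu>\<^sup>2 * lam k + 1" by simp
    then have "sqrt (lam k) \<le> \<mu> * lam k + 1 / (4 * \<mu>)"
      using assms(2) by (simp add: field_simps power2_eq_square)
    then have "sqrt (lam k) * (c k)\<^sup>2 \<le> (\<mu> * lam k + 1 / (4 * \<mu>)) * (c k)\<^sup>2"
      by (rule mult_right_mono) simp
    then show ?thesis using l by (simp add: powr_half_sqrt algebra_simps)
  qed
  have "N (1/2) c \<le> (\<Sum>k. \<mu> * (lam k powr 1 * (c k)\<^sup>2) + (lam k powr 0 * (c k)\<^sup>2) / (4*\<mu>))"
    unfolding nsq_def using e assms(1) le
    by (intro suminf_le summable_add summable_mult summable_divide) (auto simp: ell_def)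
  also have "\<dots> = \<mu> * N 1 c + N 0 c / (4 * \<mu>)"
    unfolding nsq_def using e assms(1)
    by (subst suminf_add[symmetric]; (intro summable_mult summable_divide)?)
       (auto simp: ell_def suminf_mult suminf_divide)
  finally show ?thesis .
qed

end

section \<open>The relative energy and the bound on its flux\<close>

context mode_system
begin

text \<open>
  For \<open>\<epsilon> = 0\<close> the relative energy is \<open>\<parallel>x - P\<^sub>R y\<parallel>\<^sup>2\<close>, where \<open>P\<^sub>R\<close> truncates to \<open>lam k \<le> R\<close>; \<open>rel_flux\<close> is its
  time derivative, up to the dissipation of \<open>x\<close>, along a Voigt solution \<open>x\<close> and a Navier--Stokes solution \<open>y\<close>.
\<close>

definition rel_energy :: "real \<Rightarrow> real \<Rightarrow> real \<Rightarrow> (nat \<Rightarrow> real) \<Rightarrow> (nat \<Rightarrow> real) \<Rightarrow> real" where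
  "rel_energy \<epsilon> r R x y = N 0 x + \<epsilon> * N r x
     - 2 * (\<Sum>k\<in>F R. (1 + \<epsilon> * lam k powr r) * (x k * y k)) + (\<Sum>k\<in>F R. (y k)\<^sup>2)"

text \<open>This is -2 times the pairing of \<open>A^r x\<close> with the time derivative of the
  truncated Navier--Stokes solution \<open>y\<close>: the price of testing the Voigt system with a
  solution of the unregularized one.\<close>

definition coupling :: "real \<Rightarrow> real \<Rightarrow> real \<Rightarrow> (nat \<Rightarrow> real) \<Rightarrow> (nat \<Rightarrow> real) \<Rightarrow> real" where
  "coupling \<nu> r R x y =
     2 * (\<Sum>k\<in>F R. lam k powr r * x k * (\<nu> * lam k * y k + beta y y (unit_seq k)))"

definition rel_flux :: "real \<Rightarrow> real \<Rightarrow> real \<Rightarrow> real \<Rightarrow> (nat \<Rightarrow> real) \<Rightarrow> (nat \<Rightarrow> real) \<Rightarrow> real" where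
  "rel_flux \<nu> \<epsilon> r R x y =
     4 * \<nu> * (\<Sum>k\<in>F R. lam k * (x k * y k)) - 2 * \<nu> * (\<Sum>k\<in>F R. lam k * (y k)\<^sup>2)
     + 2 * (\<Sum>k\<in>F R. y k * beta x x (unit_seq k))
     + 2 * (\<Sum>k\<in>F R. (x k - y k) * beta y y (unit_seq k))
     + \<epsilon> * coupling \<nu> r R x y"

text \<open>Insert \<open>x = v + W\<close> and \<open>y = z + v\<close>. The terms with equal last
  arguments vanish, and \<open>beta v v W\<close> cancels against \<open>beta v v (tr R W)\<close>
  up to the high modes of \<open>W\<close>. Every remaining term is quadratic in \<open>W\<close> or
  contains one of the tails \<open>z\<close> and \<open>W - tr R W\<close>.\<close>

lemma beta_decomposition:
  fixes x y v W z :: "nat \<Rightarrow> real" and R :: real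
  assumes x: "x \<in> E 1" and y: "y \<in> E 1"
  defines "v \<equiv> tr R y"
  defines "W \<equiv> (\<lambda>k. x k - v k)" and "z \<equiv> (\<lambda>k. y k - v k)"
  shows "beta x x v + beta y y (tr R W)
    = beta W W v + beta z y (tr R W) + beta v z (tr R W) - beta v v (\<lambda>k. W k - tr R W k)"
proof -
  have e: "v \<in> E 1" "W \<in> E 1" "z \<in> E 1" "tr R W \<in> E 1"
    using x y by (auto simp: v_def W_def z_def intro!: trunc_ell ell_diff)
  have xe: "x = (\<lambda>k. v k + W k)" and ye: "y = (\<lambda>k. z k + v k)" by (auto simp: W_def z_def)
  have vW: "(\<lambda>k. v k + W k) \<in> E 1" "(\<lambda>k. z k + v k) \<in> E 1" using e by (auto intro: ell_add)
  have "beta x x v = beta v x v + beta W x v"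
    by (subst (1) xe, subst beta_add1) (use e x in auto)
  also have "beta v x v = beta v v v + beta v W v"
    by (subst xe, subst beta_add2) (use e in auto)
  also have "beta W x v = beta W v v + beta W W v"
    by (subst xe, subst beta_add2) (use e in auto)
  finally have 1: "beta x x v = - beta v v W + beta W W v"
    using beta_antisym[of v W v] e by (simp add: beta_cancel)
  have "beta y y (tr R W) = beta z y (tr R W) + beta v y (tr R W)"
    by (subst (1) ye, subst beta_add1) (use e y in auto)
  also have "beta v y (tr R W) = beta v z (tr R W) + beta v v (tr R W)"
    by (subst ye, subst beta_add2) (use e in auto)
  finally have 2: "beta y y (tr R W) = beta z y (tr R W) + beta v z (tr R W) + beta v v (tr R W)"
    by simp
  have 3: "beta v v (\<lambda>k. W k - tr R W k) = beta v v W - beta v v (tr R W)"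
    using e by (intro beta_diff3) auto
  show ?thesis using 1 2 3 by simp
qed

lemma young: "0 < (c::real) \<Longrightarrow> 2 * p * q \<le> c * p\<^sup>2 + q\<^sup>2 / c"
proof -
  assume c: "0 < c"
  have "0 \<le> (c * p - q)\<^sup>2 / c" using c by simp
  also have "\<dots> = c * p\<^sup>2 + q\<^sup>2 / c - 2 * p * q"
    using c by (simp add: power2_eq_square field_simps)
  finally show ?thesis by simp
qed

lemma nsq_diff_trunc:
  assumes "x \<in> E s"
  shows "N s (\<lambda>k. x k - tr R y k) = N s x - 2 * (\<Sum>k\<in>F R. lam k powr s * (x k * y k))
     + (\<Sum>k\<in>F R. lam k powr s * (y k)\<^sup>2)"
proof -
  have "N s (\<lambda>k. x k - tr R y k) = (\<Sum>k. lam k powr s * (x k)\<^sup>2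
      - (if k \<in> F R then lam k powr s * (2 * (x k * y k) - (y k)\<^sup>2) else 0))"
    unfolding nsq_def by (intro suminf_cong) (auto simp: trunc_def power2_eq_square algebra_simps)
  also have "\<dots> = N s x - (\<Sum>k. if k \<in> F R then lam k powr s * (2 * (x k * y k) - (y k)\<^sup>2) else 0)"
    unfolding nsq_def
  proof (rule suminf_diff[symmetric])
    show "summable (\<lambda>k. if k \<in> F R then lam k powr s * (2 * (x k * y k) - (y k)\<^sup>2) else 0)"
      by (rule summable_finite[OF finite_lam_le[of R]]) auto
  qed (use assms in \<open>auto simp: ell_def\<close>)
  also have "(\<Sum>k. if k \<in> F R then lam k powr s * (2 * (x k * y k) - (y k)\<^sup>2) else 0)
      = (\<Sum>k\<in>F R. lam k powr s * (2 * (x k * y k) - (y k)\<^sup>2))"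
    using finite_lam_le[of R] by (subst suminf_finite[of "F R"]) auto
  finally show ?thesis
    by (simp add: algebra_simps sum_subtractf sum_distrib_left)
qed

text \<open>The available dissipation \<open>2 * \<nu> * N 1 W\<close>, with
  \<open>W = x - tr R y\<close>, is split evenly: one half absorbs the term quadratic in
  \<open>W\<close>, the other the terms linear in \<open>W\<close>. What is left is
  \<open>N 0 W\<close>, the tails and the coupling.\<close>

lemma rel_flux_bound:
  assumes x: "x \<in> E 1" and y: "y \<in> E 1" and \<nu>: "0 < \<nu>" and R: "0 < R"
    and M: "0 \<le> M" "N 1 y \<le> M\<^sup>2"
  shows "rel_flux \<nu> \<epsilon> r R x y - 2 * \<nu> * N 1 x
    \<le> 2 * C\<^sup>2 * M\<^sup>2 * (C\<^sup>2 * M\<^sup>2 + 1) / \<nu> ^ 3 * N 0 (\<lambda>k. x k - tr R y k)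
      + (8 * C\<^sup>2 * M\<^sup>2 * N 1 (\<lambda>k. y k - tr R y k) + 2 * C\<^sup>2 * M ^ 4 / sqrt R) / \<nu>
      + \<epsilon> * coupling \<nu> r R x y"
proof -
  define v where "v = tr R y"
  define W where "W = (\<lambda>k. x k - v k)"
  define z where "z = (\<lambda>k. y k - v k)"
  have e: "v \<in> E 1" "W \<in> E 1" "z \<in> E 1" "tr R W \<in> E 1" "(\<lambda>k. W k - tr R W k) \<in> E 1"
    using x y by (auto simp: v_def W_def z_def intro!: trunc_ell ell_diff)
  define p where "p = sqrt (N 1 W)"
  define q where "q = sqrt (N (1/2) W)"
  define sz where "sz = sqrt (N 1 z)"
  have Wh: "W \<in> E (1/2)" "W \<in> E 0" by (auto intro: ell_mono(1)[OF _ e(2)])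
  have nn: "0 \<le> p" "0 \<le> q" "0 \<le> sz" "p\<^sup>2 = N 1 W" "q\<^sup>2 = N (1/2) W" "sz\<^sup>2 = N 1 z"
    using e Wh by (auto simp: p_def q_def sz_def nsq_nonneg)
  have sv: "sqrt (N 1 v) \<le> M" "sqrt (N 1 y) \<le> M" "sqrt (N (1/2) v) \<le> M"
  proof -
    show "sqrt (N 1 y) \<le> M" using M by (simp add: real_le_lsqrt)
    have "N 1 v \<le> N 1 y" unfolding v_def by (rule nsq_trunc_le[OF y])
    then show "sqrt (N 1 v) \<le> M" using M by (simp add: real_le_lsqrt)
    moreover have "N (1/2) v \<le> N 1 v" by (rule ell_mono(2)[OF _ e(1)]) simp
    ultimately show "sqrt (N (1/2) v) \<le> M" using real_sqrt_le_mono order_trans by blast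
  qed
  have sPW: "sqrt (N 1 (tr R W)) \<le> p"
    unfolding p_def using nsq_trunc_le[OF e(2)] by simp
  have sz2: "sqrt (N (1/2) z) \<le> sz"
    unfolding sz_def using ell_mono(2)[OF _ e(3), of "1/2"] by simp
  have tailW: "sqrt (N (1/2) (\<lambda>k. W k - tr R W k)) \<le> p / sqrt (sqrt R)"
    using real_sqrt_le_mono[OF nsq_half_tail[OF e(2) R]] by (simp add: p_def real_sqrt_divide)
  \<comment> \<open>Chosen so that
    \<open>(2 * C\<^sup>2 * M\<^sup>2 / \<nu>) * \<mu> \<le> \<nu> / 2\<close>: in \<open>t1\<close>
    Young's inequality and the interpolation each use \<nu>/2 of the dissipation. The
    \<open>+ 1\<close> keeps the denominator positive when \<open>C * M = 0\<close>.\<close>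
  define \<mu> where "\<mu> = \<nu>\<^sup>2 / (4 * (C\<^sup>2 * M\<^sup>2 + 1))"
  have cm: "0 < C\<^sup>2 * M\<^sup>2 + 1" by (simp add: add_nonneg_pos)
  have \<mu>: "0 < \<mu>" using \<nu> cm by (simp add: \<mu>_def)
  have t1: "2 * beta W W v \<le> \<nu> * N 1 W + 2 * C\<^sup>2 * M\<^sup>2 * (C\<^sup>2 * M\<^sup>2 + 1) / \<nu> ^ 3 * N 0 W"
  proof -
    have "\<bar>beta W W v\<bar> \<le> C * q * p * sqrt (N 1 v)"
      unfolding p_def q_def by (rule beta_bound1) (use e in auto)
    also have "\<dots> \<le> C * q * p * M"
      using sv nn C_nonneg by (intro mult_left_mono) auto
    finally have "2 * beta W W v \<le> 2 * p * (C * M * q)" by (simp add: abs_le_iff algebra_simps)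
    also have "\<dots> \<le> (\<nu>/2) * p\<^sup>2 + (C * M * q)\<^sup>2 / (\<nu>/2)" using \<nu> by (intro young) simp
    also have "(C * M * q)\<^sup>2 / (\<nu>/2) = (2 * C\<^sup>2 * M\<^sup>2 / \<nu>) * q\<^sup>2"
      by (simp add: power_mult_distrib)
    also have "\<dots> \<le> (2 * C\<^sup>2 * M\<^sup>2 / \<nu>) * (\<mu> * N 1 W + N 0 W / (4 * \<mu>))"
      unfolding nn using \<nu> by (intro mult_left_mono nsq_half_interpolate e \<mu>) auto
    also have "\<dots> = (2 * C\<^sup>2 * M\<^sup>2 / \<nu>) * \<mu> * N 1 W + (2 * C\<^sup>2 * M\<^sup>2 / \<nu>) / (4 * \<mu>) * N 0 W"
      by (simp add: algebra_simps)
    also have "(2 * C\<^sup>2 * M\<^sup>2 / \<nu>) * \<mu> * N 1 W \<le> \<nu> / 2 * N 1 W"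
    proof (rule mult_right_mono)
      show "(2 * C\<^sup>2 * M\<^sup>2 / \<nu>) * \<mu> \<le> \<nu> / 2"
        using \<nu> cm unfolding \<mu>_def by (simp add: field_simps power2_eq_square)
    qed (use e in \<open>auto simp: nsq_nonneg\<close>)
    also have "(2 * C\<^sup>2 * M\<^sup>2 / \<nu>) / (4 * \<mu>) = 2 * C\<^sup>2 * M\<^sup>2 * (C\<^sup>2 * M\<^sup>2 + 1) / \<nu> ^ 3"
      using \<nu> cm unfolding \<mu>_def by (simp add: field_simps power2_eq_square power3_eq_cube)
    finally show ?thesis using nn by simp
  qed
  \<comment> \<open>\<open>p * g\<close> dominates the three terms linear in \<open>W\<close>. The
    high modes of \<open>W\<close> bring the factor \<open>R^(-1/4)\<close>, which becomes
    \<open>1 / sqrt R\<close> after squaring.\<close>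
  define g where "g = 2 * C * M * sz + C * M\<^sup>2 / sqrt (sqrt R)"
  have t2: "2 * (beta z y (tr R W) + beta v z (tr R W) - beta v v (\<lambda>k. W k - tr R W k)) \<le> 2 * p * g"
  proof -
    have "\<bar>beta z y (tr R W)\<bar> \<le> C * sqrt (N (1/2) z) * sqrt (N 1 y) * sqrt (N 1 (tr R W))"
      by (rule beta_bound1) (use e y in auto)
    also have "\<dots> \<le> C * sz * M * p"
      using sz2 sv sPW nn C_nonneg M e y
      by (intro mult_mono mult_nonneg_nonneg) (auto intro!: nsq_nonneg ell_mono(1)[OF _ e(3)])
    finally have a: "\<bar>beta z y (tr R W)\<bar> \<le> C * sz * M * p" .
    have "\<bar>beta v z (tr R W)\<bar> \<le> C * sqrt (N (1/2) v) * sqrt (N 1 z) * sqrt (N 1 (tr R W))"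
      by (rule beta_bound1) (use e y in auto)
    also have "\<dots> \<le> C * M * sz * p"
      using sz2 sv sPW nn C_nonneg M e y sz_def
      by (intro mult_mono mult_nonneg_nonneg) (auto intro!: nsq_nonneg ell_mono(1)[OF _ e(1)])
    finally have b: "\<bar>beta v z (tr R W)\<bar> \<le> C * M * sz * p" .
    have "\<bar>beta v v (\<lambda>k. W k - tr R W k)\<bar>
        \<le> C * sqrt (N 1 v) * sqrt (N 1 v) * sqrt (N (1/2) (\<lambda>k. W k - tr R W k))"
      by (rule beta_bound3) (use e y in auto)
    also have "\<dots> \<le> C * M * M * (p / sqrt (sqrt R))"
      using tailW sv sPW nn C_nonneg M e y
      by (intro mult_mono mult_nonneg_nonneg) (auto intro!: nsq_nonneg ell_mono(1)[OF _ e(5)])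
    finally have c: "\<bar>beta v v (\<lambda>k. W k - tr R W k)\<bar> \<le> C * M * M * (p / sqrt (sqrt R))" .
    have "C * sz * M * p + C * M * sz * p + C * M * M * (p / sqrt (sqrt R)) = p * g"
      by (simp add: g_def algebra_simps power2_eq_square)
    then have "beta z y (tr R W) + beta v z (tr R W) - beta v v (\<lambda>k. W k - tr R W k) \<le> p * g"
      using abs_le_D1[OF a] abs_le_D1[OF b] abs_le_D2[OF c] by linarith
    then show ?thesis by simp
  qed
  also have "2 * p * g \<le> \<nu> * p\<^sup>2 + g\<^sup>2 / \<nu>" by (rule young[OF \<nu>])
  also have "g\<^sup>2 \<le> 8 * C\<^sup>2 * M\<^sup>2 * N 1 z + 2 * C\<^sup>2 * M ^ 4 / sqrt R"
  proof -
    have "g\<^sup>2 \<le> 2 * (2 * C * M * sz)\<^sup>2 + 2 * (C * M\<^sup>2 / sqrt (sqrt R))\<^sup>2"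
      unfolding g_def using sum_squares_bound[of "2 * C * M * sz" "C * M\<^sup>2 / sqrt (sqrt R)"]
      by (simp add: power2_sum)
    also have "(2 * C * M * sz)\<^sup>2 = 4 * C\<^sup>2 * M\<^sup>2 * N 1 z"
      by (simp add: power_mult_distrib nn)
    also have "(C * M\<^sup>2 / sqrt (sqrt R))\<^sup>2 = C\<^sup>2 * M ^ 4 / sqrt R"
      using R by (simp add: power_mult_distrib power_divide flip: power_mult)
    finally show ?thesis by simp
  qed
  finally have t2': "2 * (beta z y (tr R W) + beta v z (tr R W) - beta v v (\<lambda>k. W k - tr R W k))
      \<le> \<nu> * N 1 W + (8 * C\<^sup>2 * M\<^sup>2 * N 1 z + 2 * C\<^sup>2 * M ^ 4 / sqrt R) / \<nu>"
    using \<nu> nn by (simp add: divide_right_mono)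
  have W1: "N 1 W = N 1 x - 2 * (\<Sum>k\<in>F R. lam k * (x k * y k)) + (\<Sum>k\<in>F R. lam k * (y k)\<^sup>2)"
    unfolding W_def v_def using nsq_diff_trunc[OF x, of R y] lam_ge_1
    by (simp add: order_trans[OF zero_le_one])
  have s1: "(\<Sum>k\<in>F R. y k * beta x x (unit_seq k)) = beta x x v"
    unfolding v_def by (rule beta_trunc[OF x x, symmetric])
  have s2: "(\<Sum>k\<in>F R. (x k - y k) * beta y y (unit_seq k)) = beta y y (tr R W)"
    unfolding beta_trunc[OF y y] by (intro sum.cong) (auto simp: W_def v_def trunc_def)
  \<comment> \<open>The three viscous sums complete the square to
    \<open>- 2 * \<nu> * N 1 W\<close>.\<close>
  have "rel_flux \<nu> \<epsilon> r R x y - 2 * \<nu> * N 1 x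
      = - 2 * \<nu> * N 1 W + 2 * (beta x x v + beta y y (tr R W)) + \<epsilon> * coupling \<nu> r R x y"
    unfolding rel_flux_def s1 s2 W1 by (simp add: algebra_simps)
  also have "beta x x v + beta y y (tr R W)
    = beta W W v + beta z y (tr R W) + beta v z (tr R W) - beta v v (\<lambda>k. W k - tr R W k)"
    using beta_decomposition[OF x y, of R] unfolding W_def z_def v_def .
  finally show ?thesis
    using t1 t2' unfolding W_def z_def v_def by (simp add: algebra_simps)
qed

text \<open>Only finitely many modes enter, so the crude bounds of each \<open>x k\<close> by
  \<open>A\<close> and of each \<open>y k\<close> by \<open>M\<close> suffice; the result depends on
  \<open>R\<close> but not on the sequences.\<close>

lemma coupling_bound:
  assumes x: "x \<in> E 0" and y: "y \<in> E 1" and \<nu>: "0 \<le> \<nu>"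
    and M: "0 \<le> M" "N 1 y \<le> M\<^sup>2" and A: "0 \<le> A" "N 0 x \<le> A\<^sup>2"
  shows "coupling \<nu> r R x y
    \<le> 2 * (\<Sum>k\<in>F R. lam k powr r * A * (\<nu> * lam k * M + C * M * M * sqrt (N (1/2) (unit_seq k))))"
  unfolding coupling_def
proof (intro mult_left_mono sum_mono)
  fix k
  have l: "1 \<le> lam k" by (rule lam_ge_1)
  have "(x k)\<^sup>2 \<le> A\<^sup>2" using nsq_ge_term[OF x, of k] A l by simp
  then have xk: "\<bar>x k\<bar> \<le> A" using A abs_le_square_iff[of "x k" A] by simp
  have "(y k)\<^sup>2 \<le> lam k * (y k)\<^sup>2" using l mult_right_mono[of 1 "lam k" "(y k)\<^sup>2"] by simp
  then have "(y k)\<^sup>2 \<le> M\<^sup>2" using nsq_ge_term[OF y, of k] M l by simp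
  then have yk: "\<bar>y k\<bar> \<le> M" using M abs_le_square_iff[of "y k" M] by simp
  have sy: "sqrt (N 1 y) \<le> M" using M by (simp add: real_le_lsqrt)
  have "\<bar>beta y y (unit_seq k)\<bar> \<le> C * sqrt (N 1 y) * sqrt (N 1 y) * sqrt (N (1/2) (unit_seq k))"
    by (rule beta_bound3) (use y unit_ell in auto)
  also have "\<dots> \<le> C * M * M * sqrt (N (1/2) (unit_seq k))"
    using sy M C_nonneg y unit_ell by (intro mult_mono mult_nonneg_nonneg) (auto simp: nsq_nonneg)
  finally have b: "\<bar>\<nu> * lam k * y k + beta y y (unit_seq k)\<bar>
      \<le> \<nu> * lam k * M + C * M * M * sqrt (N (1/2) (unit_seq k))"
    using mult_left_mono[OF yk, of "\<nu> * lam k"] \<nu> l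
    by (intro order_trans[OF abs_triangle_ineq]) (simp add: abs_mult)
  have "\<bar>lam k powr r * x k * (\<nu> * lam k * y k + beta y y (unit_seq k))\<bar>
      \<le> lam k powr r * A * (\<nu> * lam k * M + C * M * M * sqrt (N (1/2) (unit_seq k)))"
    unfolding abs_mult using xk b A
    by (intro mult_mono) (auto intro: mult_nonneg_nonneg)
  then show "lam k powr r * x k * (\<nu> * lam k * y k + beta y y (unit_seq k))
      \<le> lam k powr r * A * (\<nu> * lam k * M + C * M * M * sqrt (N (1/2) (unit_seq k)))"
    by linarith
qed simp

end

section \<open>Gronwall's inequality and the energy balance of mode flows\<close>

lemma AE_lebesgue_on_subset:
  assumes "AE x in lebesgue_on S. P x" "A \<subseteq> S" "A \<in> sets lebesgue" "S \<in> sets lebesgue"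
  shows "AE x in lebesgue_on A. P x"
proof -
  have "AE x in lebesgue. x \<in> S \<longrightarrow> P x"
    using assms(1,4) by (subst (asm) AE_restrict_space_iff) auto
  then have "AE x in lebesgue. x \<in> A \<longrightarrow> P x" by eventually_elim (use assms(2) in auto)
  then show ?thesis using assms(3) by (subst AE_restrict_space_iff) auto
qed

text \<open>The right-hand side \<open>I\<close> of the hypothesis is differentiable even if
  \<open>g\<close> is not, and the hypothesis says that \<open>exp (- L * t) * I t\<close> does not
  increase.\<close>

lemma gronwall_integral:
  fixes g :: "real \<Rightarrow> real"
  assumes cont: "continuous_on {0..T} g" and L: "0 \<le> L"
    and le: "\<And>t. t \<in> {0..T} \<Longrightarrow> g t \<le> \<eta> + L * integral {0..t} g"
    and t: "t \<in> {0..T}"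
  shows "g t \<le> \<eta> * exp (L * t)"
proof -
  define I where "I t = \<eta> + L * integral {0..t} g" for t
  have d: "(I has_real_derivative L * g s) (at s within {0..T})" if "s \<in> {0..T}" for s
    unfolding I_def using integral_has_real_derivative[OF cont that]
    by (auto intro!: derivative_eq_intros)
  have Ic: "continuous_on {0..T} I" by (rule DERIV_continuous_on[OF d])
  have "exp (- L * 0) * I 0 \<ge> exp (- L * t) * I t"
  proof (rule DERIV_nonpos_imp_decreasing_open[where f="\<lambda>s. exp (- L * s) * I s"])
    show "continuous_on {0..t} (\<lambda>s. exp (- L * s) * I s)"
      using t by (intro continuous_intros continuous_on_subset[OF Ic]) auto
    fix s assume s: "0 < s" "s < t"
    then have dI: "(I has_real_derivative L * g s) (at s)"
      using d[of s] t by (simp add: at_within_Icc_at)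
    have "((\<lambda>s. exp (- L * s) * I s) has_real_derivative exp (- L * s) * L * (g s - I s)) (at s)"
      using dI by (auto intro!: derivative_eq_intros simp: algebra_simps)
    moreover have "exp (- L * s) * L * (g s - I s) \<le> 0"
      using le[of s] s t L by (intro mult_nonneg_nonpos) (auto simp: I_def)
    ultimately show "\<exists>y. ((\<lambda>s. exp (- L * s) * I s) has_real_derivative y) (at s) \<and> y \<le> 0" by blast
  qed (use t in simp)
  then have "exp (- L * t) * I t \<le> \<eta>" by (simp add: I_def)
  then have "I t \<le> \<eta> * exp (L * t)" by (simp add: exp_minus field_simps)
  then show ?thesis using le[OF t] by (simp add: I_def)
qed

context mode_system
begin

text \<open>
  The mode equations of the Voigt system; \<open>\<epsilon> = 0\<close>, \<open>r = 1\<close> gives those of the Navier--Stokes system.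
\<close>

definition mode_flow :: "real \<Rightarrow> real \<Rightarrow> real \<Rightarrow> real \<Rightarrow> (real \<Rightarrow> nat \<Rightarrow> real) \<Rightarrow> bool" where
  "mode_flow \<nu> \<epsilon> r T a \<longleftrightarrow>
     (\<forall>t\<in>{0..T}. a t \<in> E r) \<and>
     (\<exists>K. \<forall>t\<in>{0..T}. N (1/2) (a t) \<le> K) \<and>
     (AE t in lebesgue_on {0..T}. a t \<in> E 1) \<and>
     integrable (lebesgue_on {0..T}) (\<lambda>t. N 1 (a t)) \<and>
     continuous_on {0..T} (\<lambda>t. N 0 (a t)) \<and>
     (\<forall>k. continuous_on {0..T} (\<lambda>t. beta (a t) (a t) (unit_seq k))) \<and>
     (\<forall>k. \<forall>t\<in>{0..T}. ((\<lambda>t. (1 + \<epsilon> * lam k powr r) * a t k) has_real_derivative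
        - (\<nu> * lam k * a t k) - beta (a t) (a t) (unit_seq k)) (at t within {0..T}))"

text \<open>The energy balance is stated at the right end of the interval; restriction lets it be
  read at every intermediate time.\<close>

lemma mode_flow_restrict:
  assumes "mode_flow \<nu> \<epsilon> r T a" "0 \<le> S" "S \<le> T"
  shows "mode_flow \<nu> \<epsilon> r S a"
proof -
  have sub: "{0..S} \<subseteq> {0..T}" using assms by auto
  obtain K where K: "\<forall>t\<in>{0..T}. N (1/2) (a t) \<le> K" using assms(1) unfolding mode_flow_def by blast
  show ?thesis unfolding mode_flow_def
  proof (intro conjI allI ballI)
    show "\<exists>K. \<forall>t\<in>{0..S}. N (1/2) (a t) \<le> K" using K sub by blast
    show "((\<lambda>t. (1 + \<epsilon> * lam k powr r) * a t k) has_real_derivative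
        - (\<nu> * lam k * a t k) - beta (a t) (a t) (unit_seq k)) (at t within {0..S})"
      if "t \<in> {0..S}" for k t
      using assms(1) subsetD[OF sub that] unfolding mode_flow_def
      by (intro DERIV_subset[OF _ sub]) simp
    show "continuous_on {0..S} (\<lambda>t. N 0 (a t))"
      "continuous_on {0..S} (\<lambda>t. beta (a t) (a t) (unit_seq k))" for k
      using assms(1) unfolding mode_flow_def by (simp_all add: continuous_on_subset[OF _ sub])
    show "AE t in lebesgue_on {0..S}. a t \<in> E 1"
      using assms(1) unfolding mode_flow_def by (intro AE_lebesgue_on_subset[OF _ sub]) simp_all
    show "integrable (lebesgue_on {0..S}) (\<lambda>t. N 1 (a t))"
      using assms(1) unfolding mode_flow_def by (intro integrable_subinterval[OF _ sub]) simp
    show "a t \<in> E r" if "t \<in> {0..S}" for t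
      using assms(1) subsetD[OF sub that] unfolding mode_flow_def by simp
  qed
qed

lemma mode_flow_derivative:
  assumes "mode_flow \<nu> \<epsilon> r T a" "0 \<le> \<epsilon>" "t \<in> {0..T}"
  shows "((\<lambda>t. a t k) has_real_derivative
    (- (\<nu> * lam k * a t k) - beta (a t) (a t) (unit_seq k)) / (1 + \<epsilon> * lam k powr r)) (at t within {0..T})"
proof -
  have "0 < 1 + \<epsilon> * lam k powr r" using assms(2) by (intro add_pos_nonneg) auto
  then have eq: "(\<lambda>t. (1 + \<epsilon> * lam k powr r) * a t k / (1 + \<epsilon> * lam k powr r)) = (\<lambda>t. a t k)" by simp
  have "((\<lambda>t. (1 + \<epsilon> * lam k powr r) * a t k) has_real_derivative
      - (\<nu> * lam k * a t k) - beta (a t) (a t) (unit_seq k)) (at t within {0..T})"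
    using assms(1,3) unfolding mode_flow_def by simp
  then show ?thesis
    unfolding eq[symmetric] by (rule DERIV_cdivide)
qed

lemma mode_flow_continuous:
  assumes "mode_flow \<nu> \<epsilon> r T a" "0 \<le> \<epsilon>"
  shows "continuous_on {0..T} (\<lambda>t. a t k)"
  using mode_flow_derivative[OF assms] by (rule DERIV_continuous_on)

text \<open>
  The modes below \<open>n\<close> satisfy the balance with the extra term \<open>beta a a (P\<^sub>n a)\<close>, which tends to
  \<open>beta a a a = 0\<close> and is dominated by \<open>N 1 (a t)\<close> because \<open>N (1/2) (a t)\<close> is bounded in time.
\<close>

lemma rel_energy_balance:
  assumes a: "mode_flow \<nu> \<epsilon> r T a" and b: "mode_flow \<nu> 0 1 T b"
    and \<epsilon>: "0 \<le> \<epsilon>" and \<nu>: "0 \<le> \<nu>" and T: "0 \<le> T" and r: "0 \<le> r"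
  shows "integrable (lebesgue_on {0..T}) (\<lambda>t. rel_flux \<nu> \<epsilon> r R (a t) (b t) - 2 * \<nu> * N 1 (a t))"
    and "rel_energy \<epsilon> r R (a T) (b T) - rel_energy \<epsilon> r R (a 0) (b 0)
      = (\<integral>t. rel_flux \<nu> \<epsilon> r R (a t) (b t) - 2 * \<nu> * N 1 (a t) \<partial>lebesgue_on {0..T})"
proof -
  let ?M = "lebesgue_on {0..T}"
  let ?w = "\<lambda>k. 1 + \<epsilon> * lam k powr r"
  let ?ba = "\<lambda>t k. beta (a t) (a t) (unit_seq k)"
  let ?bb = "\<lambda>t k. beta (b t) (b t) (unit_seq k)"
  have w: "0 < ?w k" for k using \<epsilon> by (intro add_pos_nonneg) auto
  have ca: "continuous_on {0..T} (\<lambda>t. a t k)" and cb: "continuous_on {0..T} (\<lambda>t. b t k)" for k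
    using mode_flow_continuous[OF a \<epsilon>] mode_flow_continuous[OF b] by auto
  have cba: "continuous_on {0..T} (\<lambda>t. ?ba t k)" and cbb: "continuous_on {0..T} (\<lambda>t. ?bb t k)" for k
    using a b unfolding mode_flow_def by auto
  have cflux: "continuous_on {0..T} (\<lambda>t. rel_flux \<nu> \<epsilon> r R (a t) (b t))"
    unfolding rel_flux_def coupling_def by (intro continuous_intros ca cb cba cbb)
  \<comment> \<open>\<open>Dn n\<close> is the derivative of \<open>Qn n\<close>, in which only the
    square terms of \<open>a\<close> are cut at level \<open>n\<close>. The mixed terms are already
    finite sums over \<open>F R\<close> and stay fixed while \<open>n\<close> grows.\<close>
  define Dn where "Dn n t = rel_flux \<nu> \<epsilon> r R (a t) (b t)
      - 2 * \<nu> * (\<Sum>k\<in>F (real n). lam k * (a t k)\<^sup>2) - 2 * (\<Sum>k\<in>F (real n). a t k * ?ba t k)" for n t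
  define Qn where "Qn n t = (\<Sum>k\<in>F (real n). ?w k * (a t k)\<^sup>2)
      - 2 * (\<Sum>k\<in>F R. ?w k * (a t k * b t k)) + (\<Sum>k\<in>F R. (b t k)\<^sup>2)" for n t
  have cDn: "continuous_on {0..T} (Dn n)" for n
    unfolding Dn_def by (intro continuous_intros ca cb cba cflux)
  have dQ: "(Qn n has_real_derivative Dn n t) (at t within {0..T})" if t: "t \<in> {0..T}" for n t
  proof -
    let ?da = "\<lambda>k. (- (\<nu> * lam k * a t k) - ?ba t k) / ?w k"
    let ?db = "\<lambda>k. - (\<nu> * lam k * b t k) - ?bb t k"
    have da: "((\<lambda>t. a t k) has_real_derivative ?da k) (at t within {0..T})" for k
      by (rule mode_flow_derivative[OF a \<epsilon> t])
    have db: "((\<lambda>t. b t k) has_real_derivative ?db k) (at t within {0..T})" for k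
      using mode_flow_derivative[OF b _ t, of k] by simp
    have sq: "((\<lambda>t. (f t)\<^sup>2) has_real_derivative 2 * f t * D) (at t within {0..T})"
      if "(f has_real_derivative D) (at t within {0..T})" for f D
      using that by (auto intro!: derivative_eq_intros)
    have "(Qn n has_real_derivative (\<Sum>k\<in>F (real n). ?w k * (2 * a t k * ?da k))
        - 2 * (\<Sum>k\<in>F R. ?w k * (a t k * ?db k + ?da k * b t k)) + (\<Sum>k\<in>F R. 2 * b t k * ?db k))
        (at t within {0..T})"
      unfolding Qn_def
    proof (intro DERIV_add DERIV_diff DERIV_sum DERIV_cmult)
      fix k
      show "((\<lambda>t. (a t k)\<^sup>2) has_real_derivative 2 * a t k * ?da k) (at t within {0..T})"
        by (rule sq[OF da])
      show "((\<lambda>t. (b t k)\<^sup>2) has_real_derivative 2 * b t k * ?db k) (at t within {0..T})"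
        by (rule sq[OF db])
      show "((\<lambda>t. a t k * b t k) has_real_derivative a t k * ?db k + ?da k * b t k) (at t within {0..T})"
        by (rule DERIV_mult'[OF da db])
    qed
    also have "(\<Sum>k\<in>F (real n). ?w k * (2 * a t k * ?da k))
        = (\<Sum>k\<in>F (real n). - (2 * \<nu> * (lam k * (a t k)\<^sup>2)) - 2 * (a t k * ?ba t k))"
    proof (intro sum.cong refl)
      fix k
      have "?w k * (2 * a t k * ?da k) = 2 * a t k * (- (\<nu> * lam k * a t k) - ?ba t k)"
        using w[of k] by simp
      then show "?w k * (2 * a t k * ?da k) = - (2 * \<nu> * (lam k * (a t k)\<^sup>2)) - 2 * (a t k * ?ba t k)"
        by (simp add: algebra_simps power2_eq_square)
    qed
    also have "(\<Sum>k\<in>F R. ?w k * (a t k * ?db k + ?da k * b t k))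
        = (\<Sum>k\<in>F R. - (2 * \<nu> * (lam k * (a t k * b t k))) - a t k * ?bb t k - b t k * ?ba t k
            - \<epsilon> * (lam k powr r * a t k * (\<nu> * lam k * b t k + ?bb t k)))"
    proof (intro sum.cong refl)
      fix k
      have "?w k * (?da k * b t k) = (- (\<nu> * lam k * a t k) - ?ba t k) * b t k"
        using w[of k] by simp
      then show "?w k * (a t k * ?db k + ?da k * b t k)
        = - (2 * \<nu> * (lam k * (a t k * b t k))) - a t k * ?bb t k - b t k * ?ba t k
            - \<epsilon> * (lam k powr r * a t k * (\<nu> * lam k * b t k + ?bb t k))"
        unfolding distrib_left[of "?w k"] by (simp add: algebra_simps)
    qed
    also have "(\<Sum>k\<in>F (real n). - (2 * \<nu> * (lam k * (a t k)\<^sup>2)) - 2 * (a t k * ?ba t k))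
        - 2 * (\<Sum>k\<in>F R. - (2 * \<nu> * (lam k * (a t k * b t k))) - a t k * ?bb t k - b t k * ?ba t k
            - \<epsilon> * (lam k powr r * a t k * (\<nu> * lam k * b t k + ?bb t k)))
        + (\<Sum>k\<in>F R. 2 * b t k * ?db k) = Dn n t"
      unfolding Dn_def rel_flux_def coupling_def
      by (simp add: sum_subtractf sum.distrib sum_distrib_left sum_negf algebra_simps power2_eq_square)
    finally show ?thesis .
  qed
  have ftc: "Qn n T - Qn n 0 = (\<integral>t. Dn n t \<partial>?M)" for n
  proof -
    have "(Dn n has_integral Qn n T - Qn n 0) {0..T}"
      by (rule fundamental_theorem_of_calculus[OF T])
         (use dQ in \<open>simp add: has_real_derivative_iff_has_vector_derivative\<close>)
    moreover have "(\<integral>t. Dn n t \<partial>?M) = integral {0..T} (Dn n)"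
      by (rule lebesgue_integral_eq_integral[OF continuous_imp_integrable_real[OF cDn]]) simp
    ultimately show ?thesis by (simp add: integral_unique)
  qed
  obtain K where K: "\<And>t. t \<in> {0..T} \<Longrightarrow> N (1/2) (a t) \<le> K"
    using a unfolding mode_flow_def by blast
  have aE: "AE t in ?M. t \<in> {0..T} \<and> a t \<in> E 1"
    using a unfolding mode_flow_def by (auto simp: AE_space intro: AE_mp)
  define dom where "dom t = \<bar>rel_flux \<nu> \<epsilon> r R (a t) (b t)\<bar> + (2 * \<nu> + 2 * (C * sqrt K)) * N 1 (a t)" for t
  have iN: "integrable ?M (\<lambda>t. N 1 (a t))" using a unfolding mode_flow_def by blast
  have iflux: "integrable ?M (\<lambda>t. rel_flux \<nu> \<epsilon> r R (a t) (b t))"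
    by (rule continuous_imp_integrable_real[OF cflux])
  have mf: "(\<lambda>t. rel_flux \<nu> \<epsilon> r R (a t) (b t) - 2 * \<nu> * N 1 (a t)) \<in> borel_measurable ?M"
    using iN iflux by simp
  have ms: "Dn n \<in> borel_measurable ?M" for n
    using continuous_imp_integrable_real[OF cDn] by auto
  have iw: "integrable ?M dom"
    unfolding dom_def using iN iflux by simp
  have sumF: "(\<Sum>k\<in>F R'. lam k * (c k)\<^sup>2) = N 1 (tr R' c)" for R' c
    unfolding nsq_trunc using lam_ge_1 by (simp add: order_trans[OF zero_le_one])
  have lim: "AE t in ?M. (\<lambda>n. Dn n t) \<longlonglongrightarrow> rel_flux \<nu> \<epsilon> r R (a t) (b t) - 2 * \<nu> * N 1 (a t)"
    using aE
  proof eventually_elim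
    case (elim t)
    then have x: "a t \<in> E 1" and t: "t \<in> {0..T}" by auto
    have "(\<lambda>n. \<Sum>k\<in>F (real n). lam k powr 1 * (a t k)\<^sup>2) \<longlonglongrightarrow> N 1 (a t)"
      unfolding nsq_def using x by (intro sum_modes_tendsto) (auto simp: ell_def)
    then have l1: "(\<lambda>n. \<Sum>k\<in>F (real n). lam k * (a t k)\<^sup>2) \<longlonglongrightarrow> N 1 (a t)"
      using lam_ge_1 by (simp add: order_trans[OF zero_le_one])
    have l2: "(\<lambda>n. \<Sum>k\<in>F (real n). a t k * ?ba t k) \<longlonglongrightarrow> 0"
    proof (rule Lim_null_comparison)
      show "\<forall>\<^sub>F n in sequentially. norm (\<Sum>k\<in>F (real n). a t k * ?ba t k)
        \<le> C * sqrt (N (1/2) (a t)) * sqrt (N 1 (a t)) * sqrt (N 1 (\<lambda>k. a t k - tr (real n) (a t) k))"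
      proof (rule always_eventually, rule allI)
        fix n
        have "(\<Sum>k\<in>F (real n). a t k * ?ba t k) = beta (a t) (a t) (tr (real n) (a t))"
          by (rule beta_trunc[OF x x, symmetric])
        also have "\<dots> = - beta (a t) (a t) (\<lambda>k. a t k - tr (real n) (a t) k)"
          by (subst beta_diff3[OF x x x trunc_ell]) (simp add: beta_cancel[OF x x])
        finally show "norm (\<Sum>k\<in>F (real n). a t k * ?ba t k)
          \<le> C * sqrt (N (1/2) (a t)) * sqrt (N 1 (a t)) * sqrt (N 1 (\<lambda>k. a t k - tr (real n) (a t) k))"
          using beta_bound1[OF x x tail_ell[OF x, of "real n"]] by simp
      qed
      show "(\<lambda>n. C * sqrt (N (1/2) (a t)) * sqrt (N 1 (a t)) * sqrt (N 1 (\<lambda>k. a t k - tr (real n) (a t) k)))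
          \<longlonglongrightarrow> 0"
        using tendsto_mult_left[OF tendsto_real_sqrt[OF nsq_tail_tendsto[OF x]],
            of "C * sqrt (N (1/2) (a t)) * sqrt (N 1 (a t))"] by simp
    qed
    show ?case
      unfolding Dn_def using tendsto_diff[OF tendsto_diff[OF tendsto_const tendsto_mult_left[OF l1]] tendsto_mult_left[OF l2]]
      by simp
  qed
  have bound: "AE t in ?M. norm (Dn n t) \<le> dom t" for n
    using aE
  proof eventually_elim
    case (elim t)
    then have x: "a t \<in> E 1" and t: "t \<in> {0..T}" by auto
    have h: "a t \<in> E (1/2)" by (rule ell_mono(1)[OF _ x]) simp
    have s1: "N 1 (tr (real n) (a t)) \<le> N 1 (a t)" by (rule nsq_trunc_le[OF x])
    have n1: "0 \<le> N 1 (tr (real n) (a t))" by (rule nsq_nonneg[OF trunc_ell])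
    have "\<bar>beta (a t) (a t) (tr (real n) (a t))\<bar>
        \<le> C * sqrt (N (1/2) (a t)) * sqrt (N 1 (a t)) * sqrt (N 1 (tr (real n) (a t)))"
      by (rule beta_bound1[OF x x trunc_ell])
    also have "\<dots> \<le> C * sqrt K * sqrt (N 1 (a t)) * sqrt (N 1 (a t))"
      using K[OF t] s1 C_nonneg x nsq_nonneg[OF h] order_trans[OF nsq_nonneg[OF h] K[OF t]]
      by (intro mult_mono mult_nonneg_nonneg) (auto simp: nsq_nonneg n1)
    also have "\<dots> = C * sqrt K * N 1 (a t)"
      using nsq_nonneg[OF x] by simp
    finally have s2: "\<bar>beta (a t) (a t) (tr (real n) (a t))\<bar> \<le> C * sqrt K * N 1 (a t)" .
    have s3: "2 * \<nu> * N 1 (tr (real n) (a t)) \<le> 2 * \<nu> * N 1 (a t)" "0 \<le> 2 * \<nu> * N 1 (tr (real n) (a t))"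
      using s1 n1 \<nu> by (auto intro: mult_left_mono)
    show ?case
      unfolding Dn_def sumF beta_trunc[OF x x, symmetric] dom_def
      using s2 s3 by (simp add: algebra_simps)
  qed
  show int: "integrable ?M (\<lambda>t. rel_flux \<nu> \<epsilon> r R (a t) (b t) - 2 * \<nu> * N 1 (a t))"
    by (rule integrable_dominated_convergence[OF mf ms iw lim bound])
  have "(\<lambda>n. Qn n T - Qn n 0) \<longlonglongrightarrow> (\<integral>t. rel_flux \<nu> \<epsilon> r R (a t) (b t) - 2 * \<nu> * N 1 (a t) \<partial>?M)"
    unfolding ftc by (rule integral_dominated_convergence[OF mf ms iw lim bound])
  moreover have "(\<lambda>n. Qn n t) \<longlonglongrightarrow> rel_energy \<epsilon> r R (a t) (b t)" if t: "t \<in> {0..T}" for t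
  proof -
    have x: "a t \<in> E r" using a t unfolding mode_flow_def by blast
    have x0: "a t \<in> E 0" by (rule ell_mono(1)[OF r x])
    have eq: "?w k * (a t k)\<^sup>2 = lam k powr 0 * (a t k)\<^sup>2 + \<epsilon> * (lam k powr r * (a t k)\<^sup>2)" for k
      using lam_ge_1[of k] by (simp add: algebra_simps)
    have "summable (\<lambda>k. ?w k * (a t k)\<^sup>2)"
      unfolding eq using x x0 by (intro summable_add summable_mult) (auto simp: ell_def)
    moreover have "(\<Sum>k. ?w k * (a t k)\<^sup>2) = N 0 (a t) + \<epsilon> * N r (a t)"
      unfolding eq nsq_def using x x0
      by (subst suminf_add[symmetric]; (intro summable_mult)?) (auto simp: ell_def suminf_mult)
    ultimately have "(\<lambda>n. \<Sum>k\<in>F (real n). ?w k * (a t k)\<^sup>2) \<longlonglongrightarrow> N 0 (a t) + \<epsilon> * N r (a t)"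
      using sum_modes_tendsto[of "\<lambda>k. ?w k * (a t k)\<^sup>2"] w by (simp add: less_imp_le)
    then show ?thesis
      unfolding Qn_def rel_energy_def by (intro tendsto_intros)
  qed
  ultimately show "rel_energy \<epsilon> r R (a T) (b T) - rel_energy \<epsilon> r R (a 0) (b 0)
      = (\<integral>t. rel_flux \<nu> \<epsilon> r R (a t) (b t) - 2 * \<nu> * N 1 (a t) \<partial>?M)"
    using T by (intro LIMSEQ_unique[OF tendsto_diff]) auto
qed

end

section \<open>Vanishing of the Voigt energy\<close>

context mode_system
begin

lemma nsq_0_diff_trunc:
  assumes "x \<in> E 0"
  shows "N 0 (\<lambda>k. x k - tr R y k) = N 0 x - 2 * (\<Sum>k\<in>F R. x k * y k) + (\<Sum>k\<in>F R. (y k)\<^sup>2)"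
proof -
  have "lam k \<noteq> 0" for k using lam_ge_1[of k] by auto
  then show ?thesis using nsq_diff_trunc[OF assms, of R y] by simp
qed

lemma rel_energy_eq:
  assumes "x \<in> E r" "0 \<le> r"
  shows "rel_energy \<epsilon> r R x y = N 0 (\<lambda>k. x k - tr R y k)
    + \<epsilon> * (N r x - 2 * (\<Sum>k\<in>F R. lam k powr r * (x k * y k)))"
  unfolding rel_energy_def nsq_0_diff_trunc[OF ell_mono(1)[OF assms(2,1)]]
  by (simp add: algebra_simps sum.distrib sum_distrib_left)

text \<open>The mixed term is split unevenly by Young's inequality, so that half of
  \<open>\<epsilon> * N r x\<close>, the quantity to be estimated, survives.\<close>

lemma rel_energy_lower:
  assumes x: "x \<in> E r" and y: "y \<in> E r" and r: "0 \<le> r" and \<epsilon>: "0 \<le> \<epsilon>"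
  shows "N 0 (\<lambda>k. x k - tr R y k) + \<epsilon> * (N r x / 2 - 2 * N r y) \<le> rel_energy \<epsilon> r R x y"
proof -
  have "2 * (\<Sum>k\<in>F R. lam k powr r * (x k * y k))
      \<le> (\<Sum>k\<in>F R. (lam k powr r * (x k)\<^sup>2) / 2 + 2 * (lam k powr r * (y k)\<^sup>2))"
    unfolding sum_distrib_left
  proof (rule sum_mono)
    fix k
    have "2 * (x k) * y k \<le> 1/2 * (x k)\<^sup>2 + (y k)\<^sup>2 / (1/2)" by (rule young) simp
    then have "lam k powr r * (2 * (x k) * y k) \<le> lam k powr r * (1/2 * (x k)\<^sup>2 + (y k)\<^sup>2 / (1/2))"
      by (rule mult_left_mono) simp
    then show "2 * (lam k powr r * (x k * y k)) \<le> (lam k powr r * (x k)\<^sup>2) / 2 + 2 * (lam k powr r * (y k)\<^sup>2)"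
      by (simp add: algebra_simps)
  qed
  also have "\<dots> = N r (tr R x) / 2 + 2 * N r (tr R y)"
    unfolding nsq_trunc by (simp add: sum.distrib sum_distrib_left sum_divide_distrib)
  also have "\<dots> \<le> N r x / 2 + 2 * N r y"
    using nsq_trunc_le[OF x, of R] nsq_trunc_le[OF y, of R] by simp
  finally have "N r x / 2 - 2 * N r y \<le> N r x - 2 * (\<Sum>k\<in>F R. lam k powr r * (x k * y k))"
    by simp
  then show ?thesis
    unfolding rel_energy_eq[OF x r] using \<epsilon> by (simp add: mult_left_mono)
qed

text \<open>At cutoff 0 no mode is left, because every eigenvalue is at least 1, and the relative
  energy balance turns into the energy inequality of \<open>a\<close> alone. The energy is at most
  \<open>2 * M\<^sup>2\<close>; it is rounded up to the square of \<open>2 * M\<close> because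
  \<open>coupling_bound\<close> expects a square.\<close>

lemma flow_energy_bound:
  assumes a: "mode_flow \<nu> \<epsilon> r T a" and \<epsilon>: "0 \<le> \<epsilon>" "\<epsilon> \<le> 1" and \<nu>: "0 \<le> \<nu>" and r: "0 \<le> r" "r \<le> 1"
    and b: "mode_flow \<nu> 0 1 T b"
    and a0: "a 0 \<in> E 1" "N 1 (a 0) \<le> M\<^sup>2" and s: "s \<in> {0..T}"
  shows "N 0 (a s) \<le> (2 * M)\<^sup>2"
proof -
  have s0: "0 \<le> s" using s by auto
  have as: "mode_flow \<nu> \<epsilon> r s a" and bs: "mode_flow \<nu> 0 1 s b"
    using mode_flow_restrict[OF a] mode_flow_restrict[OF b] s by auto
  have "\<not> lam k \<le> 0" for k using lam_ge_1[of k] by simp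
  then have F0: "F 0 = {}" by simp
  have fl: "rel_flux \<nu> \<epsilon> r 0 x y = 0" for x y by (simp add: rel_flux_def coupling_def F0)
  have en: "rel_energy \<epsilon> r 0 x y = N 0 x + \<epsilon> * N r x" for x y by (simp add: rel_energy_def F0)
  have "rel_energy \<epsilon> r 0 (a s) (b s) - rel_energy \<epsilon> r 0 (a 0) (b 0)
      = (\<integral>t. rel_flux \<nu> \<epsilon> r 0 (a t) (b t) - 2 * \<nu> * N 1 (a t) \<partial>lebesgue_on {0..s})"
    by (rule rel_energy_balance(2)[OF as bs \<epsilon>(1) \<nu> s0 r(1)])
  also have "\<dots> \<le> (\<integral>t. 0 \<partial>lebesgue_on {0..s})"
  proof (rule integral_mono_AE[OF rel_energy_balance(1)[OF as bs \<epsilon>(1) \<nu> s0 r(1)]])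
    have "AE t in lebesgue_on {0..s}. a t \<in> E 1" using as unfolding mode_flow_def by blast
    then show "AE t in lebesgue_on {0..s}. rel_flux \<nu> \<epsilon> r 0 (a t) (b t) - 2 * \<nu> * N 1 (a t) \<le> 0"
      by eventually_elim (use \<nu> in \<open>simp add: fl nsq_nonneg\<close>)
  qed simp
  finally have "N 0 (a s) + \<epsilon> * N r (a s) \<le> N 0 (a 0) + \<epsilon> * N r (a 0)" by (simp add: en)
  moreover have "a s \<in> E r" using a s unfolding mode_flow_def by blast
  then have "0 \<le> \<epsilon> * N r (a s)" using \<epsilon> nsq_nonneg by simp
  moreover have "N 0 (a 0) \<le> M\<^sup>2" using ell_mono(2)[OF _ a0(1), of 0] a0(2) by simp
  moreover have "\<epsilon> * N r (a 0) \<le> 1 * M\<^sup>2"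
    using ell_mono[OF r(2) a0(1)] a0(2) \<epsilon> by (intro mult_mono) (auto simp: nsq_nonneg)
  ultimately have "N 0 (a s) \<le> 2 * M\<^sup>2" by simp
  also have "\<dots> \<le> 4 * M\<^sup>2" by simp
  finally show ?thesis by (simp add: power_mult_distrib)
qed

text \<open>The threshold is obtained before \<open>a\<close> is introduced: all constants come from
  \<open>b\<close>, \<nu>, \<open>r\<close>, \<open>M\<close>, \<open>T\<close> and \<delta>, which
  makes the estimate uniform over all flows with the given initial value.\<close>

theorem voigt_energy_vanishes:
  assumes b: "mode_flow \<nu> 0 1 T b" and \<nu>: "0 < \<nu>" and r: "0 \<le> r" "r \<le> 1"
    and M: "0 \<le> M" "\<And>t. t \<in> {0..T} \<Longrightarrow> N 1 (b t) \<le> M\<^sup>2"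
    and t: "t \<in> {0..T}" and \<delta>: "0 < \<delta>"
  obtains \<epsilon>\<^sub>0 where "0 < \<epsilon>\<^sub>0"
    "\<And>\<epsilon> a. \<lbrakk>0 < \<epsilon>; \<epsilon> < \<epsilon>\<^sub>0; mode_flow \<nu> \<epsilon> r T a; a 0 = b 0\<rbrakk> \<Longrightarrow> \<epsilon> * N r (a t) \<le> \<delta>"
proof -
  have T: "0 \<le> T" using t by auto
  have bE: "b s \<in> E 1" if "s \<in> {0..T}" for s using b that unfolding mode_flow_def by blast
  define L where "L = 2 * C\<^sup>2 * M\<^sup>2 * (C\<^sup>2 * M\<^sup>2 + 1) / \<nu> ^ 3"
  have L: "0 \<le> L" unfolding L_def using \<nu> by simp
  \<comment> \<open>The factor produced at the end: Gronwall's inequality bounds \<open>g\<close> by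
    \<open>\<eta> * exp (L * T)\<close>, and inserting this into
    \<open>\<eta> + L * integral {0..t} g\<close> gives at most \<open>\<eta> * G\<close>.\<close>
  define G where "G = 1 + L * T * exp (L * T)"
  have G: "0 < G" unfolding G_def using L T by (simp add: add_pos_nonneg)
  \<comment> \<open>The part of \<open>rel_flux_bound\<close> that disappears as the cutoff
    \<open>R = n\<close> grows: pointwise in time because \<open>b s\<close> lies in
    \<open>E 1\<close>, and in the mean by domination.\<close>
  define \<kappa> where "\<kappa> n s = (8 * C\<^sup>2 * M\<^sup>2 * N 1 (\<lambda>k. b s k - tr (real n) (b s) k) + 2 * C\<^sup>2 * M ^ 4 / sqrt (real n)) / \<nu>"
    for n s
  have iN: "integrable (lebesgue_on {0..T}) (\<lambda>s. N 1 (b s))"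
    using b unfolding mode_flow_def by blast
  have cb: "continuous_on {0..T} (\<lambda>s. b s k)" for k by (rule mode_flow_continuous[OF b]) simp
  have itail: "integrable (lebesgue_on {0..T}) (\<lambda>s. N 1 (\<lambda>k. b s k - tr (real n) (b s) k))" for n
  proof -
    have "integrable (lebesgue_on {0..T}) (\<lambda>s. N 1 (b s) - (\<Sum>k\<in>F (real n). lam k powr 1 * (b s k)\<^sup>2))"
      by (intro Bochner_Integration.integrable_diff[OF iN] continuous_imp_integrable_real continuous_intros cb)
    then show ?thesis
      by (rule Bochner_Integration.integrable_cong[THEN iffD1, rotated -1])
         (auto simp: nsq_tail_eq[OF bE])
  qed
  have i\<kappa>: "integrable (lebesgue_on {0..T}) (\<kappa> n)" for n
    unfolding \<kappa>_def
    by (intro integrable_divide Bochner_Integration.integrable_add integrable_mult_right itail) auto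
  have \<kappa>_nonneg: "0 \<le> \<kappa> n s" if "s \<in> {0..T}" for n s
    unfolding \<kappa>_def using \<nu> nsq_nonneg[OF tail_ell[OF bE[OF that]]]
    by (intro divide_nonneg_nonneg add_nonneg_nonneg mult_nonneg_nonneg) auto
  have lim\<kappa>: "(\<lambda>n. \<integral>s. \<kappa> n s \<partial>lebesgue_on {0..T}) \<longlonglongrightarrow> (\<integral>s. 0 \<partial>lebesgue_on {0..T})"
  proof (rule integral_dominated_convergence)
    show "integrable (lebesgue_on {0..T}) (\<lambda>s. (8 * C\<^sup>2 * M\<^sup>2 * N 1 (b s) + 2 * C\<^sup>2 * M ^ 4) / \<nu>)"
      using iN by (intro integrable_divide Bochner_Integration.integrable_add integrable_mult_right) auto
    show "AE s in lebesgue_on {0..T}. (\<lambda>n. \<kappa> n s) \<longlonglongrightarrow> 0"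
    proof (rule AE_I2)
      fix s assume "s \<in> space (lebesgue_on {0..T})"
      then have "b s \<in> E 1" using bE by simp
      then have "(\<lambda>n. \<kappa> n s) \<longlonglongrightarrow> (8 * C\<^sup>2 * M\<^sup>2 * 0 + 2 * C\<^sup>2 * M ^ 4 * 0) / \<nu>"
        unfolding \<kappa>_def divide_inverse[of _ "sqrt _"]
        by (intro tendsto_intros nsq_tail_tendsto tendsto_inverse_0_at_top
            filterlim_compose[OF sqrt_at_top] filterlim_real_sequentially) (use \<nu> in auto)
      then show "(\<lambda>n. \<kappa> n s) \<longlonglongrightarrow> 0" by simp
    qed
    show "AE s in lebesgue_on {0..T}. norm (\<kappa> n s) \<le> (8 * C\<^sup>2 * M\<^sup>2 * N 1 (b s) + 2 * C\<^sup>2 * M ^ 4) / \<nu>" for n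
    proof (rule AE_I2)
      fix s assume "s \<in> space (lebesgue_on {0..T})"
      then have s: "s \<in> {0..T}" by simp
      \<comment> \<open>For \<open>n = 0\<close> the quotient is 0 by convention.\<close>
      have "1 / sqrt (real n) \<le> 1" by (cases "n = 0") auto
      then have "2 * C\<^sup>2 * M ^ 4 / sqrt (real n) \<le> 2 * C\<^sup>2 * M ^ 4"
        using mult_left_mono[of "1 / sqrt (real n)" 1 "2 * C\<^sup>2 * M ^ 4"] M by simp
      then have "\<kappa> n s \<le> (8 * C\<^sup>2 * M\<^sup>2 * N 1 (b s) + 2 * C\<^sup>2 * M ^ 4) / \<nu>"
        unfolding \<kappa>_def using nsq_tail_le[OF bE[OF s], of "real n"] \<nu>
        by (intro divide_right_mono add_mono mult_left_mono) auto
      then show "norm (\<kappa> n s) \<le> (8 * C\<^sup>2 * M\<^sup>2 * N 1 (b s) + 2 * C\<^sup>2 * M ^ 4) / \<nu>"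
        using \<kappa>_nonneg[OF s, of n] by simp
    qed
  qed (use i\<kappa> in auto)
  have b0: "b 0 \<in> E 1" using bE T by auto
  have "(\<lambda>n. N 0 (\<lambda>k. b 0 k - tr (real n) (b 0) k) + (\<integral>s. \<kappa> n s \<partial>lebesgue_on {0..T})) \<longlonglongrightarrow> 0 + 0"
    using lim\<kappa> by (intro tendsto_add nsq_tail_tendsto ell_mono(1)[OF _ b0]) auto
  \<comment> \<open>Half of the admissible size of \<eta>: the other
    \<open>\<delta> / (4 * G)\<close> is reserved for the terms with \<epsilon>, so that
    \<open>\<eta> * G \<le> \<delta> / 2\<close>.\<close>
  then have "\<forall>\<^sub>F n in sequentially. N 0 (\<lambda>k. b 0 k - tr (real n) (b 0) k)
      + (\<integral>s. \<kappa> n s \<partial>lebesgue_on {0..T}) < \<delta> / (4 * G)"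
    using \<delta> G by (intro order_tendstoD) auto
  then have "\<forall>\<^sub>F n in sequentially. N 0 (\<lambda>k. b 0 k - tr (real n) (b 0) k)
      + (\<integral>s. \<kappa> n s \<partial>lebesgue_on {0..T}) < \<delta> / (4 * G) \<and> 0 < n"
    by (intro eventually_conj) (auto simp: eventually_gt_at_top)
  then obtain n where n: "N 0 (\<lambda>k. b 0 k - tr (real n) (b 0) k)
      + (\<integral>s. \<kappa> n s \<partial>lebesgue_on {0..T}) < \<delta> / (4 * G)" "0 < n"
    using eventually_happens by fastforce
  let ?R = "real n"
  \<comment> \<open>The bound of \<open>coupling_bound\<close> with \<open>A = 2 * M\<close>, the
    value supplied by \<open>flow_energy_bound\<close>.\<close>
  define c where "c = 2 * (\<Sum>k\<in>F ?R. lam k powr r * (2 * M) *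
      (\<nu> * lam k * M + C * M * M * sqrt (N (1/2) (unit_seq k))))"
  have c: "0 \<le> c"
    unfolding c_def using M \<nu> C_nonneg lam_ge_1 unit_ell
    by (intro mult_nonneg_nonneg sum_nonneg add_nonneg_nonneg)
       (auto simp: nsq_nonneg intro: order_trans[OF zero_le_one])
  \<comment> \<open>The minimum with 1 is what \<open>flow_energy_bound\<close> requires; the
    \<open>+ 1\<close> in the denominator keeps it positive.\<close>
  define \<epsilon>\<^sub>0 where "\<epsilon>\<^sub>0 = min 1 (\<delta> / (4 * G * (3 * M\<^sup>2 + c * T + 1)))"
  have K: "0 < 3 * M\<^sup>2 + c * T + 1" using c T by (simp add: add_nonneg_pos)
  have \<epsilon>\<^sub>0: "0 < \<epsilon>\<^sub>0" unfolding \<epsilon>\<^sub>0_def using \<delta> G K by simp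
  show ?thesis
  proof (rule that[OF \<epsilon>\<^sub>0])
    fix \<epsilon> a assume \<epsilon>: "0 < \<epsilon>" "\<epsilon> < \<epsilon>\<^sub>0" and a: "mode_flow \<nu> \<epsilon> r T a" and a0: "a 0 = b 0"
    have \<epsilon>1: "0 \<le> \<epsilon>" "\<epsilon> \<le> 1" using \<epsilon> by (auto simp: \<epsilon>\<^sub>0_def)
    have aE: "a s \<in> E r" "a s \<in> E 0" if "s \<in> {0..T}" for s
      using a that ell_mono(1)[OF r(1)] unfolding mode_flow_def by blast+
    have ca: "continuous_on {0..T} (\<lambda>s. a s k)" for k by (rule mode_flow_continuous[OF a \<epsilon>1(1)])
    have aN: "N 0 (a s) \<le> (2 * M)\<^sup>2" if "s \<in> {0..T}" for s
      by (rule flow_energy_bound[OF a \<epsilon>1 _ r b _ _ that]) (use \<nu> a0 b0 M(2)[of 0] T in auto)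
    define g where "g s = N 0 (\<lambda>k. a s k - tr ?R (b s) k)" for s
    have cg: "continuous_on {0..T} g"
    proof -
      have "continuous_on {0..T} (\<lambda>s. N 0 (a s) - 2 * (\<Sum>k\<in>F ?R. a s k * b s k) + (\<Sum>k\<in>F ?R. (b s k)\<^sup>2))"
        using a unfolding mode_flow_def by (intro continuous_intros ca cb) blast
      then show ?thesis
        unfolding g_def by (rule continuous_on_eq) (simp add: nsq_0_diff_trunc[OF aE(2)])
    qed
    have g0: "0 \<le> g s" if "s \<in> {0..T}" for s
      unfolding g_def using aE(2)[OF that] by (intro nsq_nonneg ell_diff trunc_ell)
    \<comment> \<open>Of the \<open>3 * M\<^sup>2\<close>, one part bounds the relative energy at
      time 0 beyond its tail, and two come from the term \<open>2 * N r y\<close> lost in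
      \<open>rel_energy_lower\<close>.\<close>
    define \<eta> where "\<eta> = N 0 (\<lambda>k. b 0 k - tr ?R (b 0) k) + (\<integral>s. \<kappa> n s \<partial>lebesgue_on {0..T}) + \<epsilon> * (3 * M\<^sup>2 + c * T)"
    have main: "g s + \<epsilon> * N r (a s) / 2 \<le> \<eta> + L * integral {0..s} g" if s: "s \<in> {0..T}" for s
    proof -
      have s0: "0 \<le> s" and sub: "{0..s} \<subseteq> {0..T}" using s by auto
      have as: "mode_flow \<nu> \<epsilon> r s a" and bs: "mode_flow \<nu> 0 1 s b"
        using mode_flow_restrict[OF a] mode_flow_restrict[OF b] s by auto
      have ig: "integrable (lebesgue_on {0..s}) g"
        by (rule continuous_imp_integrable_real[OF continuous_on_subset[OF cg sub]])
      have i\<kappa>s: "integrable (lebesgue_on {0..s}) (\<kappa> n)"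
        by (rule integrable_subinterval[OF i\<kappa> sub])
      have "rel_energy \<epsilon> r ?R (a s) (b s) - rel_energy \<epsilon> r ?R (a 0) (b 0)
          = (\<integral>t. rel_flux \<nu> \<epsilon> r ?R (a t) (b t) - 2 * \<nu> * N 1 (a t) \<partial>lebesgue_on {0..s})"
        by (rule rel_energy_balance(2)[OF as bs \<epsilon>1(1) _ s0 r(1)]) (use \<nu> in simp)
      also have "\<dots> \<le> (\<integral>t. L * g t + \<kappa> n t + \<epsilon> * c \<partial>lebesgue_on {0..s})"
      proof (rule integral_mono_AE[OF rel_energy_balance(1)[OF as bs \<epsilon>1(1) _ s0 r(1)]])
        show "integrable (lebesgue_on {0..s}) (\<lambda>t. L * g t + \<kappa> n t + \<epsilon> * c)"
          using ig i\<kappa>s by (intro Bochner_Integration.integrable_add integrable_mult_right) auto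
        have "AE t in lebesgue_on {0..s}. a t \<in> E 1" using as unfolding mode_flow_def by blast
        then show "AE t in lebesgue_on {0..s}. rel_flux \<nu> \<epsilon> r ?R (a t) (b t) - 2 * \<nu> * N 1 (a t)
            \<le> L * g t + \<kappa> n t + \<epsilon> * c"
        proof (rule lebesgue_on_mono)
          fix \<tau> assume x: "a \<tau> \<in> E 1" and "\<tau> \<in> {0..s}"
          then have \<tau>: "\<tau> \<in> {0..T}" using sub by blast
          have "rel_flux \<nu> \<epsilon> r ?R (a \<tau>) (b \<tau>) - 2 * \<nu> * N 1 (a \<tau>)
              \<le> L * g \<tau> + \<kappa> n \<tau> + \<epsilon> * coupling \<nu> r ?R (a \<tau>) (b \<tau>)"
            unfolding L_def g_def \<kappa>_def
            by (rule rel_flux_bound[OF x bE[OF \<tau>] \<nu> _ M(1) M(2)[OF \<tau>]]) (use n in simp)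
          moreover have "coupling \<nu> r ?R (a \<tau>) (b \<tau>) \<le> c"
            unfolding c_def
            by (rule coupling_bound[OF aE(2)[OF \<tau>] bE[OF \<tau>] _ M(1) M(2)[OF \<tau>] _ aN[OF \<tau>]])
               (use \<nu> M in auto)
          then have "\<epsilon> * coupling \<nu> r ?R (a \<tau>) (b \<tau>) \<le> \<epsilon> * c" using \<epsilon>1 by (intro mult_left_mono)
          ultimately show "rel_flux \<nu> \<epsilon> r ?R (a \<tau>) (b \<tau>) - 2 * \<nu> * N 1 (a \<tau>)
            \<le> L * g \<tau> + \<kappa> n \<tau> + \<epsilon> * c" by linarith
        qed
      qed (use \<nu> in simp)
      also have "\<dots> = L * (\<integral>t. g t \<partial>lebesgue_on {0..s}) + (\<integral>t. \<kappa> n t \<partial>lebesgue_on {0..s}) + s * (\<epsilon> * c)"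
        using ig i\<kappa>s s0 by (simp add: measure_restrict_space)
      also have "(\<integral>t. g t \<partial>lebesgue_on {0..s}) = integral {0..s} g"
        by (rule lebesgue_integral_eq_integral[OF ig]) simp
      also have "(\<integral>t. \<kappa> n t \<partial>lebesgue_on {0..s}) \<le> (\<integral>t. \<kappa> n t \<partial>lebesgue_on {0..T})"
        unfolding lebesgue_integral_eq_integral[OF i\<kappa>s, simplified] lebesgue_integral_eq_integral[OF i\<kappa>, simplified]
        using integrable_on_lebesgue_on[OF i\<kappa>s] integrable_on_lebesgue_on[OF i\<kappa>] \<kappa>_nonneg sub
        by (intro integral_subset_le) auto
      also have "s * (\<epsilon> * c) \<le> T * (\<epsilon> * c)"
        using s c \<epsilon>1 by (intro mult_right_mono) auto
      finally have "rel_energy \<epsilon> r ?R (a s) (b s) \<le> rel_energy \<epsilon> r ?R (a 0) (b 0)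
          + L * integral {0..s} g + (\<integral>t. \<kappa> n t \<partial>lebesgue_on {0..T}) + \<epsilon> * (c * T)"
        by (simp add: algebra_simps)
      moreover have "rel_energy \<epsilon> r ?R (a 0) (b 0) \<le> N 0 (\<lambda>k. b 0 k - tr ?R (b 0) k) + \<epsilon> * M\<^sup>2"
      proof -
        have b0r: "b 0 \<in> E r" "N r (b 0) \<le> M\<^sup>2"
          using ell_mono[OF r(2) b0] M(2)[of 0] T by auto
        have "0 \<le> (\<Sum>k\<in>F ?R. lam k powr r * (b 0 k * b 0 k))" by (intro sum_nonneg) auto
        then have "N r (b 0) - 2 * (\<Sum>k\<in>F ?R. lam k powr r * (b 0 k * b 0 k)) \<le> M\<^sup>2"
          using b0r by linarith
        then show ?thesis
          unfolding a0 rel_energy_eq[OF b0r(1) r(1)] using \<epsilon>1 by (simp add: mult_left_mono)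
      qed
      moreover have "g s + \<epsilon> * (N r (a s) / 2 - 2 * M\<^sup>2) \<le> rel_energy \<epsilon> r ?R (a s) (b s)"
      proof -
        have bs': "b s \<in> E r" "N r (b s) \<le> M\<^sup>2"
          using ell_mono[OF r(2) bE[OF s]] M(2)[OF s] by auto
        have "\<epsilon> * (N r (a s) / 2 - 2 * M\<^sup>2) \<le> \<epsilon> * (N r (a s) / 2 - 2 * N r (b s))"
          using bs' \<epsilon>1 by (intro mult_left_mono) auto
        then show ?thesis
          using rel_energy_lower[OF aE(1)[OF s] bs'(1) r(1) \<epsilon>1(1), of ?R] unfolding g_def by linarith
      qed
      ultimately show ?thesis unfolding \<eta>_def by (simp add: algebra_simps)
    qed
    have Nr0: "0 \<le> \<epsilon> * N r (a s) / 2" if "s \<in> {0..T}" for s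
      using nsq_nonneg[OF aE(1)[OF that]] \<epsilon>1 by simp
    have \<eta>0: "0 \<le> \<eta>"
      using main[of 0] g0[of 0] Nr0[of 0] T by simp
    have gle: "g s \<le> \<eta> * exp (L * T)" if s: "s \<in> {0..T}" for s
    proof -
      have "g s \<le> \<eta> * exp (L * s)"
      proof (rule gronwall_integral[OF cg L _ s])
        show "g t' \<le> \<eta> + L * integral {0..t'} g" if "t' \<in> {0..T}" for t'
          using main[OF that] Nr0[OF that] by linarith
      qed
      also have "\<dots> \<le> \<eta> * exp (L * T)" using s L \<eta>0 by (intro mult_left_mono) (auto intro: mult_left_mono)
      finally show ?thesis .
    qed
    have "integral {0..t} g \<le> integral {0..t} (\<lambda>_. \<eta> * exp (L * T))"
      using t by (intro integral_le integrable_continuous_real continuous_on_subset[OF cg] gle) auto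
    also have "\<dots> = t * (\<eta> * exp (L * T))" using t by simp
    also have "\<dots> \<le> T * (\<eta> * exp (L * T))" using t \<eta>0 by (intro mult_right_mono) auto
    finally have "L * integral {0..t} g \<le> L * (T * (\<eta> * exp (L * T)))" using L by (rule mult_left_mono)
    then have "\<epsilon> * N r (a t) / 2 \<le> \<eta> * G"
      using main[OF t] g0[OF t] unfolding G_def by (simp add: algebra_simps)
    also have "\<eta> \<le> \<delta> / (4 * G) + \<delta> / (4 * G)"
    proof -
      have "\<epsilon> * (3 * M\<^sup>2 + c * T) \<le> \<delta> / (4 * G * (3 * M\<^sup>2 + c * T + 1)) * (3 * M\<^sup>2 + c * T + 1)"
        using \<epsilon> K c T unfolding \<epsilon>\<^sub>0_def by (intro mult_mono) auto
      also have "\<dots> = \<delta> / (4 * G)" using K by simp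
      finally show ?thesis unfolding \<eta>_def using n(1) by linarith
    qed
    finally have "\<epsilon> * N r (a t) / 2 \<le> (\<delta> / (4 * G) + \<delta> / (4 * G)) * G" using G by simp
    also have "\<dots> = \<delta> / 2" using G by (simp add: distrib_right)
    finally show "\<epsilon> * N r (a t) \<le> \<delta>" by simp
  qed
qed

end

section \<open>Lattice sums\<close>

lemma frequencies_iff: "k \<in> frequencies \<longleftrightarrow> (\<forall>i. k $ i \<in> \<int>)"
  unfolding frequencies_def by (auto simp: Basis_vec_def cart_eq_inner_axis)

lemma frequencies_closed [simp]:
  "0 \<in> frequencies"
  "k \<in> frequencies \<Longrightarrow> l \<in> frequencies \<Longrightarrow> k + l \<in> frequencies"
  "k \<in> frequencies \<Longrightarrow> l \<in> frequencies \<Longrightarrow> k - l \<in> frequencies"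
  "k \<in> frequencies \<Longrightarrow> - k \<in> frequencies"
  by (auto simp: frequencies_iff)

lemma norm_frequency_ge_1:
  assumes "k \<in> frequencies" "k \<noteq> 0"
  shows "1 \<le> norm k"
proof -
  obtain i where i: "k $ i \<noteq> 0" using assms(2) by (auto simp: vec_eq_iff)
  then have "1 \<le> \<bar>k $ i\<bar>" using assms(1) by (auto simp: frequencies_iff Ints_nonzero_abs_ge1)
  then show ?thesis using component_le_norm_cart[of k i] by linarith
qed

text \<open>The maximum norm of a lattice point as a natural number. Its level sets are surfaces of
  cubes, whose points are easily counted face by face.\<close>

definition freq_height :: "real^3 \<Rightarrow> nat" where
  "freq_height k = nat \<lfloor>Max (range (\<lambda>i. \<bar>k $ i\<bar>))\<rfloor>"

lemma freq_height:
  assumes "k \<in> frequencies"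
  shows "real (freq_height k) \<le> norm k"
    and "\<exists>i. \<bar>k $ i\<bar> = real (freq_height k)"
    and "\<bar>k $ j\<bar> \<le> real (freq_height k)"
proof -
  have "Max (range (\<lambda>i. \<bar>k $ i\<bar>)) \<in> range (\<lambda>i. \<bar>k $ i\<bar>)" by (intro Max_in) auto
  then obtain i where i: "Max (range (\<lambda>i. \<bar>k $ i\<bar>)) = \<bar>k $ i\<bar>" by (rule imageE)
  have "\<bar>k $ i\<bar> \<in> \<int>" using assms by (auto simp: frequencies_iff)
  then have q: "real (freq_height k) = \<bar>k $ i\<bar>"
    unfolding freq_height_def i by (auto elim!: Ints_cases)
  show "real (freq_height k) \<le> norm k" unfolding q by (rule component_le_norm_cart)
  show "\<exists>i. \<bar>k $ i\<bar> = real (freq_height k)" using q by metis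
  show "\<bar>k $ j\<bar> \<le> real (freq_height k)" unfolding q i[symmetric] by (intro Max_ge) auto
qed

lemma freq_height_pos:
  assumes "k \<in> frequencies" "k \<noteq> 0"
  shows "1 \<le> freq_height k"
proof (rule ccontr)
  assume "\<not> 1 \<le> freq_height k"
  then have "k $ j = 0" for j using freq_height(3)[OF assms(1), of j] by simp
  then show False using assms(2) by (simp add: vec_eq_iff)
qed

text \<open>Parametrizes a face of the cube: \<sigma> is the fixed coordinate, at position
  \<open>j\<close>, and \<open>p\<close> supplies the other two.\<close>

definition face_point :: "nat \<Rightarrow> int \<Rightarrow> int \<times> int \<Rightarrow> real^3" where
  "face_point j \<sigma> p = (if j = 0 then vector [real_of_int \<sigma>, real_of_int (fst p), real_of_int (snd p)]
     else if j = 1 then vector [real_of_int (fst p), real_of_int \<sigma>, real_of_int (snd p)]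
     else vector [real_of_int (fst p), real_of_int (snd p), real_of_int \<sigma>])"

lemma frequency_shell_subset:
  "{k \<in> frequencies. freq_height k = n} \<subseteq>
    (\<Union>\<sigma>\<in>{int n, - int n}. \<Union>j\<in>{0,1,2}. face_point j \<sigma> ` ({- int n..int n} \<times> {- int n..int n}))"
proof
  fix k :: "real^3" assume "k \<in> {k \<in> frequencies. freq_height k = n}"
  then have k: "k \<in> frequencies" "freq_height k = n" by auto
  have "\<forall>i. \<exists>m. k $ i = real_of_int m" using k(1) by (auto simp: frequencies_iff elim: Ints_cases)
  then obtain f where f: "\<And>i. k $ i = real_of_int (f i)" by (auto dest!: choice)
  have b: "f i \<in> {- int n..int n}" for i
  proof -
    have "real_of_int \<bar>f i\<bar> \<le> real_of_int (int n)" using freq_height(3)[OF k(1), of i] by (simp add: k(2) f)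
    then have "\<bar>f i\<bar> \<le> int n" by (simp only: of_int_le_iff)
    then show ?thesis by (simp add: abs_le_iff)
  qed
  obtain i where "\<bar>k $ i\<bar> = real n" using freq_height(2)[OF k(1)] k(2) by auto
  then have "real_of_int \<bar>f i\<bar> = real_of_int (int n)" by (simp add: f)
  then have s: "f i \<in> {int n, - int n}" by (simp only: of_int_eq_iff) auto
  have "i = 1 \<or> i = 2 \<or> i = 3" by (rule exhaust_3)
  then obtain j p where "j \<in> {0,1,2}" "p \<in> {- int n..int n} \<times> {- int n..int n}" "k = face_point j (f i) p"
  proof (elim disjE)
    assume "i = 1"
    then have "k = face_point 0 (f i) (f 2, f 3)" by (simp add: face_point_def vec_eq_iff forall_3 f)
    then show ?thesis using that[of 0 "(f 2, f 3)"] b by simp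
  next
    assume "i = 2"
    then have "k = face_point 1 (f i) (f 1, f 3)" by (simp add: face_point_def vec_eq_iff forall_3 f)
    then show ?thesis using that[of 1 "(f 1, f 3)"] b by simp
  next
    assume "i = 3"
    then have "k = face_point 2 (f i) (f 1, f 2)" by (simp add: face_point_def vec_eq_iff forall_3 f)
    then show ?thesis using that[of 2 "(f 1, f 2)"] b by simp
  qed
  then show "k \<in> (\<Union>\<sigma>\<in>{int n, - int n}. \<Union>j\<in>{0,1,2}. face_point j \<sigma> ` ({- int n..int n} \<times> {- int n..int n}))"
    using s by blast
qed

lemma finite_frequency_shell: "finite {k \<in> frequencies. freq_height k = n}"
  by (rule finite_subset[OF frequency_shell_subset]) simp

text \<open>Six faces with \<open>(2 * n + 1)\<^sup>2\<close> points each, and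
  \<open>2 * n + 1 \<le> 3 * n\<close>: this is the origin of 54.\<close>

lemma card_frequency_shell:
  assumes "1 \<le> n"
  shows "card {k \<in> frequencies. freq_height k = n} \<le> 54 * n\<^sup>2"
proof -
  let ?B = "{- int n..int n} \<times> {- int n..int n}"
  have cB: "card ?B = (2 * n + 1)\<^sup>2" 
  proof -
    have "nat (int n - - int n + 1) = 2 * n + 1" by linarith
    then show ?thesis by (simp only: card_cartesian_product card_atLeastAtMost_int power2_eq_square)
  qed
  have "card {k \<in> frequencies. freq_height k = n}
      \<le> card (\<Union>\<sigma>\<in>{int n, - int n}. \<Union>j\<in>{0,1,2}. face_point j \<sigma> ` ?B)"
    by (rule card_mono[OF _ frequency_shell_subset]) simp
  also have "\<dots> \<le> (\<Sum>\<sigma>\<in>{int n, - int n}. card (\<Union>j\<in>{0,1,2}. face_point j \<sigma> ` ?B))"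
    by (rule card_UN_le) simp
  also have "\<dots> \<le> (\<Sum>\<sigma>\<in>{int n, - int n}. \<Sum>j\<in>{0,1,2::nat}. card ?B)"
    by (intro sum_mono order_trans[OF card_UN_le] card_image_le) simp_all
  also have "\<dots> = 6 * (2 * n + 1)\<^sup>2" unfolding cB using assms by simp
  also have "\<dots> \<le> 6 * (3 * n)\<^sup>2" using assms by (intro mult_left_mono power_mono) auto
  finally show ?thesis by (simp add: power_mult_distrib)
qed

lemma finite_frequency_ball: "finite {k \<in> frequencies. norm k \<le> R}"
proof -
  have "{k \<in> frequencies. norm k \<le> R} \<subseteq> (\<Union>n\<in>{..nat \<lfloor>R\<rfloor>}. {k \<in> frequencies. freq_height k = n})"
  proof clarsimp
    fix k assume "k \<in> frequencies" "norm k \<le> R"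
    then have "real (freq_height k) \<le> R" using freq_height(1) by (blast intro: order_trans)
    then show "freq_height k \<le> nat \<lfloor>R\<rfloor>" by (simp add: le_nat_floor)
  qed
  then show ?thesis by (rule finite_subset) (simp add: finite_frequency_shell)
qed

text \<open>The shell of height \<open>n\<close> contributes at most \<open>54 * n ^ (2 - d)\<close>
  and at most \<open>R\<close> shells meet \<open>K\<close>, so the sum grows like the integral of
  \<open>norm x\<close> to the power \<open>-d\<close> over the ball.\<close>

lemma lattice_sum_bound:
  assumes "finite K" "K \<subseteq> frequencies" "\<And>k. k \<in> K \<Longrightarrow> k \<noteq> 0 \<and> norm k \<le> R"
    and d: "d \<in> {1, 2}" and R: "0 \<le> R"
  shows "(\<Sum>k\<in>K. 1 / norm k ^ d) \<le> 54 * R ^ (3 - d)"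
proof -
  let ?N = "nat \<lfloor>R\<rfloor>"
  have N: "real ?N \<le> R" using R by simp
  have q: "freq_height ` K \<subseteq> {1..?N}"
  proof
    fix n assume "n \<in> freq_height ` K"
    then obtain k where k: "k \<in> K" "n = freq_height k" by auto
    then have "real n \<le> R" using freq_height(1)[of k] assms(2,3) by fastforce
    then show "n \<in> {1..?N}" using freq_height_pos[of k] k assms(2,3) by (auto simp: le_nat_floor)
  qed
  have "(\<Sum>k\<in>K. 1 / norm k ^ d) = (\<Sum>n\<in>{1..?N}. \<Sum>k\<in>{k \<in> K. freq_height k = n}. 1 / norm k ^ d)"
    by (rule sum.group[symmetric]) (use assms(1) q in auto)
  also have "\<dots> \<le> (\<Sum>n\<in>{1..?N}. 54 * R ^ (2 - d))"
  proof (rule sum_mono)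
    fix n assume n: "n \<in> {1..?N}"
    then have nR: "real n \<le> R" using N by (auto intro: order_trans[of _ "real ?N"])
    have "(\<Sum>k\<in>{k \<in> K. freq_height k = n}. 1 / norm k ^ d) \<le> (\<Sum>k\<in>{k \<in> K. freq_height k = n}. 1 / real n ^ d)"
    proof (rule sum_mono)
      fix k assume "k \<in> {k \<in> K. freq_height k = n}"
      then have "real n \<le> norm k" using freq_height(1)[of k] assms(2) by auto
      moreover have "0 < real n" using n by simp
      ultimately have "0 < real n ^ d" "real n ^ d \<le> norm k ^ d" by (auto intro: power_mono)
      then show "1 / norm k ^ d \<le> 1 / real n ^ d" by (simp add: frac_le)
    qed
    also have "\<dots> = real (card {k \<in> K. freq_height k = n}) / real n ^ d" by simp
    also have "\<dots> \<le> real (54 * n\<^sup>2) / real n ^ d"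
    proof -
      have "card {k \<in> K. freq_height k = n} \<le> card {k \<in> frequencies. freq_height k = n}"
        using assms(2) by (intro card_mono finite_frequency_shell) auto
      also have "\<dots> \<le> 54 * n\<^sup>2" using n by (intro card_frequency_shell) simp
      finally have "real (card {k \<in> K. freq_height k = n}) \<le> real (54 * n\<^sup>2)" by (rule of_nat_mono)
      then show ?thesis by (rule divide_right_mono) simp
    qed
    also have "real (54 * n\<^sup>2) / real n ^ d = 54 * real n ^ (2 - d)"
      using d n by (auto simp: power2_eq_square)
    also have "\<dots> \<le> 54 * R ^ (2 - d)" using nR by (intro mult_left_mono power_mono) auto
    finally show "(\<Sum>k\<in>{k \<in> K. freq_height k = n}. 1 / norm k ^ d) \<le> 54 * R ^ (2 - d)" .
  qed
  also have "\<dots> = real ?N * (54 * R ^ (2 - d))" by simp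
  also have "\<dots> \<le> R * (54 * R ^ (2 - d))" using N R by (intro mult_right_mono) auto
  also have "\<dots> = 54 * R ^ (3 - d)" using d by (auto simp: power2_eq_square)
  finally show ?thesis .
qed

text \<open>
  The trilinear estimate at the critical exponents \<open>1/2 + 0 + 1 = 3/2\<close>. On the pairs with
  \<open>\<bar>k\<bar> \<le> \<bar>k + l\<bar>\<close> the factors \<open>x k\<close>, \<open>y l\<close> are grouped and \<open>\<Sum> 1 / \<bar>k\<bar>\<close> is summed over \<open>\<bar>k\<bar> \<le> \<bar>k + l\<bar>\<close>;
  on the remaining pairs \<open>y l\<close>, \<open>z (k + l)\<close> are grouped and \<open>\<Sum> 1 / \<bar>k + l\<bar>\<^sup>2\<close> is summed over \<open>\<bar>k + l\<bar> < \<bar>k\<bar>\<close>.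
\<close>

lemma lattice_trilinear_finite:
  fixes x y z :: "real^3 \<Rightarrow> real"
  assumes K: "finite K" "K \<subseteq> frequencies" and L: "finite L" "L \<subseteq> frequencies"
    and nonneg: "\<And>k. 0 \<le> x k" "\<And>k. 0 \<le> y k" "\<And>k. 0 \<le> z k" and zero: "x 0 = 0" "z 0 = 0"
    and X: "0 \<le> X" "\<And>S. \<lbrakk>finite S; S \<subseteq> frequencies\<rbrakk> \<Longrightarrow> (\<Sum>k\<in>S. norm k * (x k)\<^sup>2) \<le> X\<^sup>2"
    and Y: "0 \<le> Y" "\<And>S. \<lbrakk>finite S; S \<subseteq> frequencies\<rbrakk> \<Longrightarrow> (\<Sum>k\<in>S. (y k)\<^sup>2) \<le> Y\<^sup>2"
    and Z: "0 \<le> Z" "\<And>S. \<lbrakk>finite S; S \<subseteq> frequencies\<rbrakk> \<Longrightarrow> (\<Sum>k\<in>S. (norm k)\<^sup>2 * (z k)\<^sup>2) \<le> Z\<^sup>2"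
  shows "(\<Sum>(k,l)\<in>K \<times> L. x k * y l * z (k + l)) \<le> 16 * X * Y * Z"
proof -
  define Q where "Q = (\<lambda>(k,l). k + l) ` (K \<times> L)"
  have Q: "finite Q" "Q \<subseteq> frequencies" using K L by (auto simp: Q_def intro!: frequencies_closed(2))
  define P1 where "P1 = {(k,l) \<in> K \<times> L. k \<noteq> 0 \<and> k + l \<noteq> 0 \<and> norm k \<le> norm (k + l)}"
  define P2 where "P2 = {(k,l) \<in> K \<times> L. k \<noteq> 0 \<and> k + l \<noteq> 0 \<and> norm (k + l) < norm k}"
  have fin: "finite P1" "finite P2"
    by (rule finite_subset[of _ "K \<times> L"]; use K L in \<open>auto simp: P1_def P2_def\<close>)+
  have s: "sqrt 54 \<le> 8" by (rule real_le_lsqrt) auto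
  \<comment> \<open>Cauchy--Schwarz together with \<open>54 \<le> 8\<^sup>2\<close>. The pairs in
    \<open>P1\<close> and those in \<open>P2\<close> contribute a factor 8 each, whence the 16 of
    the statement.\<close>
  have cs: "(\<Sum>i\<in>A. a i * b i) \<le> 8 * B" 
    if "(\<Sum>i\<in>A. (a i)\<^sup>2) * (\<Sum>i\<in>A. (b i)\<^sup>2) \<le> 54 * B\<^sup>2" "0 \<le> B" 
    for A and a b :: "(real^3) \<times> (real^3) \<Rightarrow> real" and B
  proof -
    have "(\<Sum>i\<in>A. a i * b i)\<^sup>2 \<le> 54 * B\<^sup>2"
      by (rule order_trans[OF Cauchy_Schwarz_ineq_sum that(1)])
    also have "\<dots> \<le> (8 * B)\<^sup>2" by (simp add: power_mult_distrib)
    finally show ?thesis by (rule power2_le_imp_le) (use that(2) in simp)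
  qed
  have prodle: "a * b \<le> 54 * (X * Y * Z)\<^sup>2"
    if "a \<le> A\<^sup>2" "b \<le> 54 * B\<^sup>2" "A * B = X * Y * Z" "0 \<le> b" for a b A B
  proof -
    have "a * b \<le> A\<^sup>2 * (54 * B\<^sup>2)" by (intro mult_mono that) auto
    then show ?thesis unfolding that(3)[symmetric] by (simp add: power_mult_distrib mult.left_commute)
  qed
  have e1: "(\<Sum>(k,l)\<in>P1. x k * y l * z (k + l)) \<le> 8 * (X * Y * Z)"
  proof -
    have "(\<Sum>(k,l)\<in>P1. x k * y l * z (k + l))
        = (\<Sum>i\<in>P1. (\<lambda>(k,l). sqrt (norm k) * x k * y l) i * (\<lambda>(k,l). z (k + l) / sqrt (norm k)) i)"
      by (intro sum.cong) (auto simp: P1_def)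
    also have "\<dots> \<le> 8 * (X * Y * Z)"
    proof (rule cs, rule prodle)
      have "(\<Sum>i\<in>P1. ((\<lambda>(k,l). sqrt (norm k) * x k * y l) i)\<^sup>2) = (\<Sum>(k,l)\<in>P1. (norm k * (x k)\<^sup>2) * (y l)\<^sup>2)"
        by (intro sum.cong) (auto simp: power_mult_distrib)
      also have "\<dots> \<le> (\<Sum>(k,l)\<in>K \<times> L. (norm k * (x k)\<^sup>2) * (y l)\<^sup>2)"
        using K L by (intro sum_mono2) (auto simp: P1_def)
      also have "\<dots> = (\<Sum>k\<in>K. norm k * (x k)\<^sup>2) * (\<Sum>l\<in>L. (y l)\<^sup>2)"
        by (simp add: sum_product sum.cartesian_product)
      also have "\<dots> \<le> X\<^sup>2 * Y\<^sup>2" by (intro mult_mono X Y K L sum_nonneg) auto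
      finally show "(\<Sum>i\<in>P1. ((\<lambda>(k,l). sqrt (norm k) * x k * y l) i)\<^sup>2) \<le> (X * Y)\<^sup>2"
        by (simp add: power_mult_distrib)
      have "(\<Sum>i\<in>P1. ((\<lambda>(k,l). z (k + l) / sqrt (norm k)) i)\<^sup>2) = (\<Sum>(k,l)\<in>P1. (z (k + l))\<^sup>2 * (1 / norm k ^ 1))"
        by (intro sum.cong) (auto simp: power_divide)
      also have "\<dots> = (\<Sum>(p,k)\<in>(\<lambda>(k,l). (k + l, k)) ` P1. (z p)\<^sup>2 * (1 / norm k ^ 1))"
        by (subst sum.reindex) (auto simp: inj_on_def intro!: sum.cong)
      also have "\<dots> \<le> (\<Sum>(p,k)\<in>(SIGMA p:Q. {k \<in> K. k \<noteq> 0 \<and> norm k \<le> norm p}). (z p)\<^sup>2 * (1 / norm k ^ 1))"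
        using K Q by (intro sum_mono2 finite_SigmaI) (auto simp: P1_def Q_def)
      also have "\<dots> = (\<Sum>p\<in>Q. (z p)\<^sup>2 * (\<Sum>k\<in>{k \<in> K. k \<noteq> 0 \<and> norm k \<le> norm p}. 1 / norm k ^ 1))"
        using K Q by (subst sum.Sigma[symmetric]) (auto simp: sum_distrib_left)
      also have "\<dots> \<le> (\<Sum>p\<in>Q. (z p)\<^sup>2 * (54 * norm p ^ (3 - 1)))"
        using K by (intro sum_mono mult_left_mono lattice_sum_bound) auto
      also have "\<dots> = 54 * (\<Sum>p\<in>Q. (norm p)\<^sup>2 * (z p)\<^sup>2)"
        by (simp add: sum_distrib_left algebra_simps)
      also have "\<dots> \<le> 54 * Z\<^sup>2" by (intro mult_left_mono Z Q) auto
      finally show "(\<Sum>i\<in>P1. ((\<lambda>(k,l). z (k + l) / sqrt (norm k)) i)\<^sup>2) \<le> 54 * Z\<^sup>2" .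
    qed (use X Y Z in \<open>auto intro: sum_nonneg\<close>)
    finally show ?thesis .
  qed
  have e2: "(\<Sum>(k,l)\<in>P2. x k * y l * z (k + l)) \<le> 8 * (X * Y * Z)"
  proof -
    have "(\<Sum>(k,l)\<in>P2. x k * y l * z (k + l))
        = (\<Sum>i\<in>P2. (\<lambda>(k,l). norm (k + l) * z (k + l) * y l) i * (\<lambda>(k,l). x k / norm (k + l)) i)"
      by (intro sum.cong) (auto simp: P2_def)
    also have "\<dots> \<le> 8 * (X * Y * Z)"
    proof (rule cs, rule prodle)
      have "(\<Sum>i\<in>P2. ((\<lambda>(k,l). norm (k + l) * z (k + l) * y l) i)\<^sup>2)
          = (\<Sum>(k,l)\<in>P2. ((norm (k + l))\<^sup>2 * (z (k + l))\<^sup>2) * (y l)\<^sup>2)"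
        by (intro sum.cong) (auto simp: power_mult_distrib)
      also have "\<dots> = (\<Sum>(p,l)\<in>(\<lambda>(k,l). (k + l, l)) ` P2. ((norm p)\<^sup>2 * (z p)\<^sup>2) * (y l)\<^sup>2)"
        by (subst sum.reindex) (auto simp: inj_on_def intro!: sum.cong)
      also have "\<dots> \<le> (\<Sum>(p,l)\<in>Q \<times> L. ((norm p)\<^sup>2 * (z p)\<^sup>2) * (y l)\<^sup>2)"
        using Q L by (intro sum_mono2) (auto simp: P2_def Q_def)
      also have "\<dots> = (\<Sum>p\<in>Q. (norm p)\<^sup>2 * (z p)\<^sup>2) * (\<Sum>l\<in>L. (y l)\<^sup>2)"
        by (simp add: sum_product sum.cartesian_product)
      also have "\<dots> \<le> Z\<^sup>2 * Y\<^sup>2" by (intro mult_mono Z Y Q L sum_nonneg) auto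
      finally show "(\<Sum>i\<in>P2. ((\<lambda>(k,l). norm (k + l) * z (k + l) * y l) i)\<^sup>2) \<le> (Z * Y)\<^sup>2"
        by (simp add: power_mult_distrib)
      have "(\<Sum>i\<in>P2. ((\<lambda>(k,l). x k / norm (k + l)) i)\<^sup>2) = (\<Sum>(k,l)\<in>P2. (x k)\<^sup>2 * (1 / norm (k + l) ^ 2))"
        by (intro sum.cong) (auto simp: power_divide)
      also have "\<dots> = (\<Sum>(k,p)\<in>(\<lambda>(k,l). (k, k + l)) ` P2. (x k)\<^sup>2 * (1 / norm p ^ 2))"
        by (subst sum.reindex) (auto simp: inj_on_def intro!: sum.cong)
      also have "\<dots> \<le> (\<Sum>(k,p)\<in>(SIGMA k:K. {p \<in> Q. p \<noteq> 0 \<and> norm p \<le> norm k}). (x k)\<^sup>2 * (1 / norm p ^ 2))"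
        using K Q by (intro sum_mono2 finite_SigmaI) (auto simp: P2_def Q_def)
      also have "\<dots> = (\<Sum>k\<in>K. (x k)\<^sup>2 * (\<Sum>p\<in>{p \<in> Q. p \<noteq> 0 \<and> norm p \<le> norm k}. 1 / norm p ^ 2))"
        using K Q by (subst sum.Sigma[symmetric]) (auto simp: sum_distrib_left)
      also have "\<dots> \<le> (\<Sum>k\<in>K. (x k)\<^sup>2 * (54 * norm k ^ (3 - 2)))"
        using Q by (intro sum_mono mult_left_mono lattice_sum_bound) auto
      also have "\<dots> = 54 * (\<Sum>k\<in>K. norm k * (x k)\<^sup>2)"
        by (simp add: sum_distrib_left algebra_simps)
      also have "\<dots> \<le> 54 * X\<^sup>2" by (intro mult_left_mono X K) auto
      finally show "(\<Sum>i\<in>P2. ((\<lambda>(k,l). x k / norm (k + l)) i)\<^sup>2) \<le> 54 * X\<^sup>2" .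
    qed (use X Y Z in \<open>auto intro: sum_nonneg\<close>)
    finally show ?thesis .
  qed
  have "(\<Sum>(k,l)\<in>K \<times> L. x k * y l * z (k + l)) = (\<Sum>(k,l)\<in>P1 \<union> P2. x k * y l * z (k + l))"
    using K L zero by (intro sum.mono_neutral_right) (auto simp: P1_def P2_def)
  also have "\<dots> = (\<Sum>(k,l)\<in>P1. x k * y l * z (k + l)) + (\<Sum>(k,l)\<in>P2. x k * y l * z (k + l))"
    by (intro sum.union_disjoint fin) (auto simp: P1_def P2_def)
  finally show ?thesis using e1 e2 by simp
qed

lemma lattice_trilinear:
  fixes x y z :: "real^3 \<Rightarrow> real"
  assumes nonneg: "\<And>k. 0 \<le> x k" "\<And>k. 0 \<le> y k" "\<And>k. 0 \<le> z k" and zero: "x 0 = 0" "z 0 = 0"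
    and X: "0 \<le> X" "\<And>S. \<lbrakk>finite S; S \<subseteq> frequencies\<rbrakk> \<Longrightarrow> (\<Sum>k\<in>S. norm k * (x k)\<^sup>2) \<le> X\<^sup>2"
    and Y: "0 \<le> Y" "\<And>S. \<lbrakk>finite S; S \<subseteq> frequencies\<rbrakk> \<Longrightarrow> (\<Sum>k\<in>S. (y k)\<^sup>2) \<le> Y\<^sup>2"
    and Z: "0 \<le> Z" "\<And>S. \<lbrakk>finite S; S \<subseteq> frequencies\<rbrakk> \<Longrightarrow> (\<Sum>k\<in>S. (norm k)\<^sup>2 * (z k)\<^sup>2) \<le> Z\<^sup>2"
  shows "(\<lambda>(k,l). x k * y l * z (k + l)) summable_on (frequencies \<times> frequencies)"
    and "(\<Sum>\<^sub>\<infinity>(k,l)\<in>frequencies \<times> frequencies. x k * y l * z (k + l)) \<le> 16 * X * Y * Z"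
proof -
  have fin: "(\<Sum>(k,l)\<in>P. x k * y l * z (k + l)) \<le> 16 * X * Y * Z"
    if P: "finite P" "P \<subseteq> frequencies \<times> frequencies" for P
  proof -
    have "(\<Sum>(k,l)\<in>P. x k * y l * z (k + l)) \<le> (\<Sum>(k,l)\<in>fst ` P \<times> snd ` P. x k * y l * z (k + l))"
      using P nonneg by (intro sum_mono2) (auto simp: rev_image_eqI)
    also have "\<dots> \<le> 16 * X * Y * Z"
      by (rule lattice_trilinear_finite) (use P assms in auto)
    finally show ?thesis .
  qed
  show s: "(\<lambda>(k,l). x k * y l * z (k + l)) summable_on (frequencies \<times> frequencies)"
    using nonneg fin by (intro nonneg_bdd_above_summable_on bdd_aboveI) auto
  show "(\<Sum>\<^sub>\<infinity>(k,l)\<in>frequencies \<times> frequencies. x k * y l * z (k + l)) \<le> 16 * X * Y * Z"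
    by (rule infsum_le_finite_sums[OF s fin])
qed

section \<open>Integration on the torus\<close>

lemma space_T3 [simp]: "space T3 = cbox 0 One"
  by (simp add: T3_def)

lemma measure_T3: "measure T3 (cbox 0 One) = 1" "emeasure T3 (cbox 0 One) = 1"
proof -
  have "emeasure lebesgue (cbox 0 (One::real^3)) = 1"
    by (subst emeasure_completion) (auto simp: emeasure_lborel_cbox_eq)
  then show "emeasure T3 (cbox 0 One) = 1" by (simp add: T3_def emeasure_restrict_space)
  then show "measure T3 (cbox 0 One) = 1" by (simp add: measure_def)
qed

lemma finite_measure_T3: "finite_measure T3"
  by (rule finite_measureI) (simp add: measure_T3)

interpretation T3: finite_measure T3
  by (rule finite_measure_T3)

lemma T3_measurable_continuous:
  fixes f :: "real^3 \<Rightarrow> 'b::topological_space"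
  assumes "continuous_on UNIV f"
  shows "f \<in> borel_measurable T3"
  unfolding T3_def
  by (intro measurable_restrict_space1 measurable_completion) (simp add: borel_measurable_continuous_onI[OF assms])

lemma T3_integrable_continuous:
  fixes f :: "real^3 \<Rightarrow> 'b::euclidean_space"
  assumes "continuous_on UNIV f"
  shows "integrable T3 f"
  unfolding T3_def by (rule continuous_imp_integrable) (rule continuous_on_subset[OF assms], simp)

lemma T3_integral_continuous:
  fixes f :: "real^3 \<Rightarrow> 'b::euclidean_space"
  assumes "continuous_on UNIV f"
  shows "(\<integral>x. f x \<partial>T3) = integral (cbox 0 One) f"
  using lebesgue_integral_eq_integral[of "cbox 0 One" f] T3_integrable_continuous[OF assms]
  unfolding T3_def by auto

text \<open>The slice that the shifted cube gains on one side is one period away from the slice it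
  loses on the other.\<close>

lemma integral_periodic_shift:
  fixes f :: "real^3 \<Rightarrow> 'b::euclidean_space"
  assumes cont: "continuous_on UNIV f" and b: "b \<in> Basis" and per: "\<And>x. f (x + b) = f x"
    and h: "0 \<le> h" "h \<le> 1"
  shows "integral (cbox 0 One) (\<lambda>x. f (x + h *\<^sub>R b)) = integral (cbox 0 One) f"
proof -
  \<comment> \<open>The unit cube with its range in direction \<open>b\<close> replaced by the
    interval from \<open>p\<close> to \<open>q\<close>.\<close>
  define slab where "slab p q = cbox (p *\<^sub>R b) (One + (q - 1) *\<^sub>R b)" for p q :: real
  have fi: "f integrable_on slab p q" for p q
    unfolding slab_def by (intro integrable_continuous continuous_on_subset[OF cont]) auto
  have mem_slab: "x \<in> slab p q \<longleftrightarrow> p \<le> x \<bullet> b \<and> x \<bullet> b \<le> q \<and> (\<forall>i\<in>Basis - {b}. 0 \<le> x \<bullet> i \<and> x \<bullet> i \<le> 1)"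
    for x p q
  proof -
    have "x \<in> slab p q \<longleftrightarrow> (\<forall>i\<in>insert b (Basis - {b}).
        (p *\<^sub>R b) \<bullet> i \<le> x \<bullet> i \<and> x \<bullet> i \<le> (One + (q - 1) *\<^sub>R b) \<bullet> i)"
      using b unfolding slab_def mem_box by (simp add: insert_absorb)
    moreover have "b \<bullet> i = 0" "(One + (q - 1) *\<^sub>R b) \<bullet> i = 1" if "i \<in> Basis - {b}" for i
      using that b by (auto simp: inner_add_left inner_Basis)
    moreover have "(One + (q - 1) *\<^sub>R b) \<bullet> b = q"
      using b by (simp add: inner_add_left)
    ultimately show ?thesis using b by (simp only: ball_simps) auto
  qed
  have split: "integral (slab p q) f = integral (slab p c) f + integral (slab c q) f"
    if "p \<le> c" "c \<le> q" for p c q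
  proof -
    have "slab p q \<inter> {x. x \<bullet> b \<le> c} = slab p c" "slab p q \<inter> {x. x \<bullet> b \<ge> c} = slab c q"
      using that by (auto simp: set_eq_iff mem_slab)
    then have "(f has_integral (integral (slab p c) f + integral (slab c q) f)) (slab p q)"
      unfolding slab_def using fi[unfolded slab_def] b
      by (intro has_integral_split[where c=c and k=b]) (auto simp: integrable_integral)
    then show ?thesis by (rule integral_unique)
  qed
  have shift: "integral (slab (p + d) (q + d)) f = integral (slab p q) (\<lambda>x. f (x + d *\<^sub>R b))" for p q d
    using integral_shift_cbox_plus[of "p *\<^sub>R b" "One + (q - 1) *\<^sub>R b" f "d *\<^sub>R b"]
    by (simp add: slab_def o_def algebra_simps)
  have cube: "cbox 0 One = slab 0 1" by (simp add: slab_def)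
  have "integral (slab 0 1) (\<lambda>x. f (x + h *\<^sub>R b)) = integral (slab h (1 + h)) f"
    using shift[of 0 h 1] by (simp add: add.commute)
  also have "\<dots> = integral (slab h 1) f + integral (slab 1 (1 + h)) f"
    using h by (intro split) auto
  also have "integral (slab 1 (1 + h)) f = integral (slab 0 h) f"
    using shift[of 0 1 h] by (simp add: per add.commute)
  also have "integral (slab h 1) f + integral (slab 0 h) f = integral (slab 0 1) f"
    using split[of 0 h 1] h by simp
  finally show ?thesis unfolding cube .
qed

text \<open>The integral of \<open>f (x + h *\<^sub>R b)\<close> does not depend on
  \<open>h\<close>; its derivative at \<open>h = 0\<close>, taken under the integral, is the
  integral of the derivative.\<close>

lemma integral_periodic_derivative:
  fixes f :: "real^3 \<Rightarrow> 'b::euclidean_space"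
  assumes d: "\<And>x. (f has_derivative f' x) (at x)" and c: "continuous_on UNIV (\<lambda>x. f' x b)"
    and b: "b \<in> Basis" and per: "\<And>x. f (x + b) = f x"
  shows "(\<integral>x. f' x b \<partial>T3) = 0"
proof -
  have cf: "continuous_on UNIV f"
    using d by (meson continuous_at_imp_continuous_on has_derivative_continuous)
  have "((\<lambda>h. integral (cbox 0 One) (\<lambda>x. f (x + h *\<^sub>R b))) has_vector_derivative
      integral (cbox 0 One) (\<lambda>x. f' (x + 0 *\<^sub>R b) b)) (at 0 within {0..1})"
  proof (rule leibniz_rule_vector_derivative)
    fix h :: real and x :: "real^3"
    have "((\<lambda>h. f (x + h *\<^sub>R b)) has_derivative (\<lambda>h'. f' (x + h *\<^sub>R b) (h' *\<^sub>R b))) (at h within {0..1})"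
      by (rule has_derivative_compose[OF _ d]) (auto intro!: derivative_eq_intros)
    then show "((\<lambda>h. f (x + h *\<^sub>R b)) has_vector_derivative f' (x + h *\<^sub>R b) b) (at h within {0..1})"
      unfolding has_vector_derivative_def
      using linear_cmul[OF has_derivative_linear[OF d[of "x + h *\<^sub>R b"]]] by simp
    show "(\<lambda>x. f (x + h *\<^sub>R b)) integrable_on cbox 0 One"
      by (intro integrable_continuous continuous_on_compose2[OF cf] continuous_intros) auto
  next
    have "continuous_on ({0..1} \<times> cbox 0 One) (\<lambda>p. f' (snd p + fst p *\<^sub>R b) b)"
      by (rule continuous_on_compose2[OF c]) (auto intro!: continuous_intros)
    then show "continuous_on ({0..1} \<times> cbox 0 One) (\<lambda>(h, x). f' (x + h *\<^sub>R b) b)"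
      by (simp add: case_prod_beta)
  qed auto
  moreover have "((\<lambda>h. integral (cbox 0 One) (\<lambda>x. f (x + h *\<^sub>R b))) has_vector_derivative 0) (at 0 within {0..1})"
  proof (rule has_vector_derivative_transform[where f="\<lambda>h. integral (cbox 0 One) f"])
    show "integral (cbox 0 One) (\<lambda>x. f (x + h *\<^sub>R b)) = integral (cbox 0 One) f" if "h \<in> {0..1}" for h
      using that by (intro integral_periodic_shift[OF cf b per]) auto
  qed auto
  ultimately have "integral (cbox 0 One) (\<lambda>x. f' (x + 0 *\<^sub>R b) b) = 0"
    by (rule vector_derivative_unique_within_closed_interval[of 0 1 0, unfolded cbox_interval, rotated 2]) simp_all
  then show ?thesis using T3_integral_continuous[OF c] by simp
qed

section \<open>Characters of the torus\<close>

definition wave :: "real^3 \<Rightarrow> real^3 \<Rightarrow> complex" where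
  "wave k x = cis (2 * pi * (k \<bullet> x))"

lemma wave_add: "wave (k + l) x = wave k x * wave l x"
  by (simp add: wave_def cis_mult inner_add_left ring_distribs)

lemma wave_0 [simp]: "wave 0 x = 1"
  by (simp add: wave_def)

lemma cnj_wave: "cnj (wave k x) = wave (- k) x"
  by (simp add: wave_def cis_cnj)

lemma norm_wave [simp]: "norm (wave k x) = 1"
  by (simp add: wave_def)

lemma continuous_wave [continuous_intros]: "continuous_on S (wave k)"
  unfolding wave_def by (intro continuous_intros)

lemma cis_2pi_int: "n \<in> \<int> \<Longrightarrow> cis (2 * pi * n) = 1"
  by (simp add: cis_multiple_2pi)

lemma wave_periodic:
  assumes "k \<in> frequencies" "b \<in> Basis"
  shows "wave k (x + b) = wave k x"
proof -
  have "k \<bullet> b \<in> \<int>" using assms by (simp add: frequencies_def)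
  then show ?thesis
    using cis_2pi_int[of "k \<bullet> b"] by (simp add: wave_def inner_add_right ring_distribs flip: cis_mult)
qed

lemma has_derivative_wave:
  "(wave k has_derivative (\<lambda>v. 2 * pi * \<i> * of_real (k \<bullet> v) * wave k x)) (at x)"
proof -
  have "bounded_linear (\<lambda>x. \<i> * complex_of_real (2 * pi * (k \<bullet> x)))"
    by (intro bounded_linear_const_mult bounded_linear_compose[OF bounded_linear_of_real] bounded_linear_inner_right)
  then have "((\<lambda>x. \<i> * complex_of_real (2 * pi * (k \<bullet> x))) has_derivative
      (\<lambda>v. \<i> * complex_of_real (2 * pi * (k \<bullet> v)))) (at x)"
    by (rule bounded_linear_imp_has_derivative)
  from has_derivative_compose[OF this DERIV_exp[unfolded has_field_derivative_def]]
  show ?thesis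
    unfolding wave_def cis_conv_exp by (simp add: algebra_simps)
qed

text \<open>For nonzero \<open>k\<close> the wave is a multiple of its own derivative in some
  coordinate direction, and the integral of a periodic derivative vanishes.\<close>

lemma integral_wave:
  assumes k: "k \<in> frequencies"
  shows "(\<integral>x. wave k x \<partial>T3) = (if k = 0 then 1 else 0)"
proof (cases "k = 0")
  case True
  then show ?thesis by (simp add: measure_T3)
next
  case False
  then obtain b where b: "b \<in> Basis" "k \<bullet> b \<noteq> 0" using euclidean_all_zero_iff by blast
  have "(\<integral>x. 2 * pi * \<i> * of_real (k \<bullet> b) * wave k x \<partial>T3) = 0"
    by (rule integral_periodic_derivative[where f="wave k" and b=b, OF has_derivative_wave])
       (intro continuous_intros b wave_periodic k)+
  then show ?thesis using b False by simp
qed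

section \<open>Square-integrable fields: inner product and completeness\<close>

lemma L2_fieldsD:
  assumes "u \<in> L2_fields"
  shows "torus_periodic u" "u \<in> borel_measurable T3" "integrable T3 (\<lambda>x. (norm (u x))\<^sup>2)"
  using assms by (auto simp: L2_fields_def)

lemma integrable_product_bound:
  fixes h :: "real^3 \<Rightarrow> 'b::{banach, second_countable_topology}"
  assumes "integrable T3 (\<lambda>x. (f x)\<^sup>2)" "integrable T3 (\<lambda>x. (g x)\<^sup>2)" "h \<in> borel_measurable T3"
    and "\<And>x. norm (h x) \<le> f x * (g x :: real)"
  shows "integrable T3 h"
proof (rule Bochner_Integration.integrable_bound)
  show "integrable T3 (\<lambda>x. (f x)\<^sup>2 + (g x)\<^sup>2)" using assms by simp
  have "norm (h x) \<le> norm ((f x)\<^sup>2 + (g x)\<^sup>2)" for x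
  proof -
    have "2 * (f x * g x) \<le> (f x)\<^sup>2 + (g x)\<^sup>2" using sum_squares_bound[of "f x" "g x"] by (simp add: mult.assoc)
    moreover have "0 \<le> f x * g x" using assms(4)[of x] norm_ge_zero order_trans by blast
    ultimately show ?thesis using assms(4)[of x] by simp
  qed
  then show "AE x in T3. norm (h x) \<le> norm ((f x)\<^sup>2 + (g x)\<^sup>2)" by simp
qed (rule assms(3))

lemma integrable_inner_L2:
  assumes "u \<in> L2_fields" "v \<in> L2_fields"
  shows "integrable T3 (\<lambda>x. u x \<bullet> v x)"
proof (rule integrable_product_bound[of "\<lambda>x. norm (u x)" "\<lambda>x. norm (v x)"])
  show "(\<lambda>x. u x \<bullet> v x) \<in> borel_measurable T3"
    by (intro borel_measurable_inner L2_fieldsD assms)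
  show "norm (u x \<bullet> v x) \<le> norm (u x) * norm (v x)" for x
    using Cauchy_Schwarz_ineq2[of "u x" "v x"] by simp
qed (intro L2_fieldsD assms)+

lemma integrable_L2:
  assumes "u \<in> L2_fields"
  shows "integrable T3 u" "integrable T3 (\<lambda>x. u x $ j)"
proof -
  show "integrable T3 u"
    by (rule integrable_product_bound[of "\<lambda>x. norm (u x)" "\<lambda>x. 1"]) (simp_all add: L2_fieldsD assms)
  then have "integrable T3 (\<lambda>x. u x \<bullet> axis j 1)" by simp
  then show "integrable T3 (\<lambda>x. u x $ j)" by (simp add: inner_axis)
qed

lemma continuous_in_L2_fields:
  assumes "continuous_on UNIV u" "torus_periodic u"
  shows "u \<in> L2_fields"
  unfolding L2_fields_def
  using assms T3_measurable_continuous[OF assms(1)]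
  by (auto intro!: T3_integrable_continuous continuous_intros)

lemma L2_fields_add [intro]:
  assumes "u \<in> L2_fields" "v \<in> L2_fields"
  shows "(\<lambda>x. u x + v x) \<in> L2_fields"
proof -
  have "integrable T3 (\<lambda>x. (norm (u x + v x))\<^sup>2)"
  proof (rule Bochner_Integration.integrable_bound)
    show "integrable T3 (\<lambda>x. 2 * (norm (u x))\<^sup>2 + 2 * (norm (v x))\<^sup>2)"
      using assms by (auto simp: L2_fields_def)
    have "(norm (u x + v x))\<^sup>2 \<le> 2 * (norm (u x))\<^sup>2 + 2 * (norm (v x))\<^sup>2" for x
    proof -
      have "(norm (u x + v x))\<^sup>2 \<le> (norm (u x) + norm (v x))\<^sup>2" by (intro power_mono norm_triangle_ineq) auto
      also have "\<dots> \<le> 2 * (norm (u x))\<^sup>2 + 2 * (norm (v x))\<^sup>2"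
        using sum_squares_bound[of "norm (u x)" "norm (v x)"] by (simp add: power2_sum)
      finally show ?thesis .
    qed
    then show "AE x in T3. norm ((norm (u x + v x))\<^sup>2) \<le> norm (2 * (norm (u x))\<^sup>2 + 2 * (norm (v x))\<^sup>2)"
      by simp
  qed (use assms in \<open>auto simp: L2_fields_def\<close>)
  then show ?thesis using assms by (auto simp: L2_fields_def torus_periodic_def)
qed

lemma L2_fields_scale [intro]: "u \<in> L2_fields \<Longrightarrow> (\<lambda>x. a *\<^sub>R u x) \<in> L2_fields"
  by (auto simp: L2_fields_def torus_periodic_def power_mult_distrib)

lemma L2_fields_diff [intro]:
  assumes "u \<in> L2_fields" "v \<in> L2_fields"
  shows "(\<lambda>x. u x - v x) \<in> L2_fields" "u - v \<in> L2_fields"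
  using L2_fields_add[OF assms(1) L2_fields_scale[OF assms(2), of "-1"]]
  by (simp_all add: fun_diff_def)

lemma L2_fields_zero [simp, intro]: "(\<lambda>x. 0) \<in> L2_fields"
  by (rule continuous_in_L2_fields) (auto simp: torus_periodic_def)

lemma L2_fields_sum [intro]:
  "(\<And>k. k \<in> A \<Longrightarrow> f k \<in> L2_fields) \<Longrightarrow> (\<lambda>x. \<Sum>k\<in>A. f k x) \<in> L2_fields"
  by (induction A rule: infinite_finite_induct) auto

lemma ip_commute: "ip u v = ip v u"
  by (simp add: ip_def inner_commute)

lemma ip_scale_left: "ip (\<lambda>x. a *\<^sub>R u x) w = a * ip u w"
  unfolding ip_def by simp

lemma ip_diff_left:
  "u \<in> L2_fields \<Longrightarrow> v \<in> L2_fields \<Longrightarrow> w \<in> L2_fields \<Longrightarrow> ip (\<lambda>x. u x - v x) w = ip u w - ip v w"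
  unfolding ip_def by (simp add: inner_diff_left integrable_inner_L2)

lemma ip_sum_left:
  "(\<And>k. k \<in> A \<Longrightarrow> f k \<in> L2_fields) \<Longrightarrow> w \<in> L2_fields \<Longrightarrow>
    ip (\<lambda>x. \<Sum>k\<in>A. f k x) w = (\<Sum>k\<in>A. ip (f k) w)"
  unfolding ip_def by (simp add: inner_sum_left integrable_inner_L2)

lemma ip_scale_right: "ip w (\<lambda>x. a *\<^sub>R u x) = a * ip w u"
  unfolding ip_def by simp

lemma ip_diff_right:
  "u \<in> L2_fields \<Longrightarrow> v \<in> L2_fields \<Longrightarrow> w \<in> L2_fields \<Longrightarrow> ip w (\<lambda>x. u x - v x) = ip w u - ip w v"
  unfolding ip_def by (simp add: inner_diff_right integrable_inner_L2)

lemma ip_self_nonneg: "0 \<le> ip u u"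
  unfolding ip_def by simp

lemma ip_self: "ip u u = (\<integral>x. (norm (u x))\<^sup>2 \<partial>T3)"
  by (simp add: ip_def power2_norm_eq_inner)

lemma L2norm_nonneg [simp]: "0 \<le> L2norm u"
  by (simp add: L2norm_def ip_self_nonneg)

lemma L2norm_sq: "(L2norm u)\<^sup>2 = ip u u"
  by (simp add: L2norm_def ip_self_nonneg)

text \<open>Fields are representatives, so \<open>ip\<close> is only positive semidefinite; the
  quadratic polynomial in \<open>t\<close> is used also when \<open>ip v v = 0\<close> without
  \<open>v\<close> being 0.\<close>

lemma ip_le_L2norm:
  assumes u: "u \<in> L2_fields" and v: "v \<in> L2_fields"
  shows "\<bar>ip u v\<bar> \<le> L2norm u * L2norm v"
proof -
  have q: "0 \<le> ip u u - 2 * t * ip u v + t\<^sup>2 * ip v v" for t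
  proof -
    have tv: "(\<lambda>x. t *\<^sub>R v x) \<in> L2_fields" by (rule L2_fields_scale[OF v])
    have w: "(\<lambda>x. u x - t *\<^sub>R v x) \<in> L2_fields" by (rule L2_fields_diff(1)[OF u tv])
    have "0 \<le> ip (\<lambda>x. u x - t *\<^sub>R v x) (\<lambda>x. u x - t *\<^sub>R v x)" by (rule ip_self_nonneg)
    also have "\<dots> = ip (\<lambda>x. u x - t *\<^sub>R v x) u - t * ip (\<lambda>x. u x - t *\<^sub>R v x) v"
      by (simp only: ip_diff_right[OF u tv w] ip_scale_right)
    also have "\<dots> = ip u u - 2 * t * ip u v + t\<^sup>2 * ip v v"
      by (simp only: ip_diff_left[OF u tv u] ip_diff_left[OF u tv v] ip_scale_left ip_commute[of v u])
         (simp add: power2_eq_square algebra_simps)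
    finally show ?thesis .
  qed
  have "(ip u v)\<^sup>2 \<le> ip u u * ip v v"
  proof (cases "ip v v = 0")
    case True
    have "ip u v = 0"
    proof (rule ccontr)
      assume n: "ip u v \<noteq> 0"
      \<comment> \<open>At this \<open>t\<close> the polynomial, linear because
        \<open>ip v v = 0\<close>, takes the value -1.\<close>
      show False using q[of "(ip u u + 1) / (2 * ip u v)"] n True by simp
    qed
    then show ?thesis using True by simp
  next
    case False
    then have p: "0 < ip v v" using ip_self_nonneg[of v] by simp
    have "0 \<le> ip v v * (ip u u - 2 * (ip u v / ip v v) * ip u v + (ip u v / ip v v)\<^sup>2 * ip v v)"
      by (rule mult_nonneg_nonneg[OF less_imp_le[OF p] q])
    also have "\<dots> = ip u u * ip v v - (ip u v)\<^sup>2"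
      using p by (simp add: power2_eq_square field_simps)
    finally show ?thesis by simp
  qed
  then have "sqrt ((ip u v)\<^sup>2) \<le> sqrt (ip u u * ip v v)" by (rule real_sqrt_le_mono)
  then show ?thesis by (simp add: L2norm_def real_sqrt_mult)
qed

lemma L2norm_minus_commute: "L2norm (\<lambda>x. u x - v x) = L2norm (\<lambda>x. v x - u x)"
  by (simp add: L2norm_def ip_self norm_minus_commute)

lemma L2norm_cong_AE:
  assumes "u \<in> borel_measurable T3" "v \<in> borel_measurable T3" "AE x in T3. u x = v x"
  shows "L2norm u = L2norm v"
  unfolding L2norm_def ip_def using assms by (intro arg_cong[of _ _ sqrt] integral_cong_AE) auto

lemma L2norm_eq_0_AE:
  assumes "u \<in> L2_fields" "L2norm u = 0"
  shows "AE x in T3. u x = 0"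
proof -
  have "(\<integral>x. (norm (u x))\<^sup>2 \<partial>T3) = 0" using assms(2) by (simp add: L2norm_def ip_self)
  then have "AE x in T3. (norm (u x))\<^sup>2 = 0"
    using integral_nonneg_eq_0_iff_AE[of T3 "\<lambda>x. (norm (u x))\<^sup>2"] L2_fieldsD[OF assms(1)] by auto
  then show ?thesis by eventually_elim simp
qed

lemma nn_integral_L2norm:
  assumes "u \<in> L2_fields"
  shows "(\<integral>\<^sup>+x. ennreal ((norm (u x))\<^sup>2) \<partial>T3) = ennreal ((L2norm u)\<^sup>2)"
  unfolding L2norm_sq ip_self using L2_fieldsD[OF assms] by (intro nn_integral_eq_integral) auto

text \<open>
  Riesz--Fischer: along a subsequence with increments \<open>\<le> 2\<^sup>-\<^sup>n\<close> in norm, \<open>\<Sum> 2\<^sup>n \<bar>d\<^sub>n\<bar>\<^sup>2\<close> is integrable,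
  so the increments are summable almost everywhere.
\<close>

lemma L2_fields_complete:
  fixes f :: "nat \<Rightarrow> vfield"
  assumes f: "\<And>n. f n \<in> L2_fields"
    and cauchy: "\<And>e. 0 < e \<Longrightarrow> \<exists>n0. \<forall>m\<ge>n0. \<forall>n\<ge>n0. L2norm (\<lambda>x. f m x - f n x) < e"
  obtains g where "g \<in> L2_fields" "(\<lambda>n. L2norm (\<lambda>x. f n x - g x)) \<longlonglongrightarrow> 0"
proof -
  have "\<exists>n0. \<forall>m\<ge>n0. \<forall>n\<ge>n0. L2norm (\<lambda>x. f m x - f n x) < (1/2)^j" for j :: nat
    by (rule cauchy) simp
  then obtain M where M: "\<And>j m n. \<lbrakk>m \<ge> M j; n \<ge> M j\<rbrakk> \<Longrightarrow> L2norm (\<lambda>x. f m x - f n x) < (1/2)^j" by metis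
  define s where "s = rec_nat (M 0) (\<lambda>j p. max (p + 1) (M (Suc j)))"
  have sS: "s (Suc j) = max (s j + 1) (M (Suc j))" and s0: "s 0 = M 0" for j by (simp_all add: s_def)
  have sM: "M j \<le> s j" for j by (cases j) (simp_all add: sS s0)
  have "strict_mono s" by (simp add: strict_mono_Suc_iff sS less_max_iff_disj)
  then have sge: "n \<le> s n" for n by (rule strict_mono_imp_increasing)
  define d where "d n x = f (s (Suc n)) x - f (s n) x" for n x
  have dL: "d n \<in> L2_fields" for n unfolding d_def using f by auto
  have dn: "L2norm (d n) \<le> (1/2)^n" for n
    unfolding d_def using M[of n "s (Suc n)" "s n"] sM[of n] by (simp add: sS less_imp_le)
  have meas: "f n \<in> borel_measurable T3" "d n \<in> borel_measurable T3" for n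
    using L2_fieldsD(2)[OF f] L2_fieldsD(2)[OF dL] by auto
  note [measurable] = meas
  have "(\<integral>\<^sup>+x. (\<Sum>n. ennreal (2^n * (norm (d n x))\<^sup>2)) \<partial>T3) = (\<Sum>n. \<integral>\<^sup>+x. ennreal (2^n * (norm (d n x))\<^sup>2) \<partial>T3)"
    by (rule nn_integral_suminf) measurable
  also have "\<dots> \<le> (\<Sum>n. ennreal ((1/2)^n))"
  proof (intro suminf_le summableI)
    fix n
    have "(\<integral>\<^sup>+x. ennreal (2^n * (norm (d n x))\<^sup>2) \<partial>T3) = ennreal (2^n) * ennreal ((L2norm (d n))\<^sup>2)"
      unfolding nn_integral_L2norm[OF dL, symmetric] by (subst nn_integral_cmult[symmetric]) (auto simp: ennreal_mult)
    also have "\<dots> = ennreal (2^n * (L2norm (d n))\<^sup>2)" by (simp add: ennreal_mult)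
    also have "\<dots> \<le> ennreal (2^n * ((1/2)^n)\<^sup>2)"
      using dn by (intro ennreal_leI mult_left_mono power_mono) auto
    also have "(2::real)^n * ((1/2)^n)\<^sup>2 = (1/2)^n"
      by (simp add: power2_eq_square power_one_over field_simps)
    finally show "(\<integral>\<^sup>+x. ennreal (2^n * (norm (d n x))\<^sup>2) \<partial>T3) \<le> ennreal ((1/2)^n)" .
  qed
  also have "\<dots> = ennreal (\<Sum>n. (1/2)^n)" by (intro suminf_ennreal2) (auto intro: summable_geometric)
  finally have "(\<integral>\<^sup>+x. (\<Sum>n. ennreal (2^n * (norm (d n x))\<^sup>2)) \<partial>T3) \<noteq> \<infinity>"
    by (auto simp: top_unique)
  then have "AE x in T3. (\<Sum>n. ennreal (2^n * (norm (d n x))\<^sup>2)) \<noteq> \<infinity>"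
    by (intro nn_integral_PInf_AE) auto
  then have conv: "AE x in T3. convergent (\<lambda>n. f (s n) x)"
  proof eventually_elim
    case (elim x)
    then have "summable (\<lambda>n. 2^n * (norm (d n x))\<^sup>2)"
      by (intro summable_suminf_not_top) auto
    then have sm: "summable (\<lambda>n. 2^n * (norm (d n x))\<^sup>2 + (1/2)^n)"
      by (intro summable_add summable_geometric) auto
    have "summable (\<lambda>n. d n x)"
    proof (rule summable_comparison_test'[OF sm])
      fix n :: nat
      have "norm (d n x) * 2 \<le> 2^n * (norm (d n x))\<^sup>2 + (1/2)^n"
      proof -
        have "0 \<le> (2^n * norm (d n x) - 1)\<^sup>2 / 2^n" by simp
        also have "\<dots> = 2^n * (norm (d n x))\<^sup>2 + (1/2)^n - norm (d n x) * 2"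
          by (simp add: power2_eq_square field_simps)
        finally show ?thesis by simp
      qed
      then show "norm (d n x) \<le> 2^n * (norm (d n x))\<^sup>2 + (1/2)^n"
        using norm_ge_zero[of "d n x"] by linarith
    qed
    then have "convergent (\<lambda>n. \<Sum>i<n. d i x)" by (simp add: summable_iff_convergent)
    then have "convergent (\<lambda>n. f (s 0) x + (\<Sum>i<n. d i x))" by (intro convergent_add convergent_const)
    moreover have "f (s 0) x + (\<Sum>i<n. d i x) = f (s n) x" for n
      unfolding d_def by (subst sum_lessThan_telescope) simp
    ultimately show ?case by simp
  qed
  \<comment> \<open>The pointwise limit is taken at every point. The sequences at \<open>x\<close>
    and \<open>x + b\<close> coincide, hence \<open>g\<close> is periodic everywhere, also where the
    limit does not exist and \<open>lim\<close> is unspecified.\<close>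
  define g where "g x = lim (\<lambda>n. f (s n) x)" for x
  have gm [measurable]: "g \<in> borel_measurable T3" unfolding g_def by measurable
  have gper: "torus_periodic g"
    using L2_fieldsD(1)[OF f] unfolding torus_periodic_def g_def by simp
  have fatou: "(\<integral>\<^sup>+x. ennreal ((norm (g x - f m x))\<^sup>2) \<partial>T3) \<le> ennreal (((1/2)^j)\<^sup>2)" if m: "M j \<le> m" for m j
  proof -
    have "(\<integral>\<^sup>+x. ennreal ((norm (g x - f m x))\<^sup>2) \<partial>T3)
        = (\<integral>\<^sup>+x. liminf (\<lambda>n. ennreal ((norm (f (s n) x - f m x))\<^sup>2)) \<partial>T3)"
    proof (rule nn_integral_cong_AE, use conv in eventually_elim)
      case (elim x)
      then have "(\<lambda>n. f (s n) x) \<longlonglongrightarrow> g x" unfolding g_def by (simp add: convergent_LIMSEQ_iff)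
      then have "(\<lambda>n. ennreal ((norm (f (s n) x - f m x))\<^sup>2)) \<longlonglongrightarrow> ennreal ((norm (g x - f m x))\<^sup>2)"
        by (intro tendsto_intros)
      then show ?case by (intro lim_imp_Liminf[symmetric]) auto
    qed
    also have "\<dots> \<le> liminf (\<lambda>n. \<integral>\<^sup>+x. ennreal ((norm (f (s n) x - f m x))\<^sup>2) \<partial>T3)"
      by (rule nn_integral_liminf) measurable
    also have "\<dots> \<le> liminf (\<lambda>n. ennreal (((1/2)^j)\<^sup>2))"
    proof (rule Liminf_mono, rule eventually_mono[OF eventually_ge_at_top[of "M j"]])
      fix n assume n: "M j \<le> n"
      have "(\<integral>\<^sup>+x. ennreal ((norm (f (s n) x - f m x))\<^sup>2) \<partial>T3) = ennreal ((L2norm (\<lambda>x. f (s n) x - f m x))\<^sup>2)"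
        using f by (intro nn_integral_L2norm) auto
      also have "\<dots> \<le> ennreal (((1/2)^j)\<^sup>2)"
        using M[of j "s n" m] m n sge[of n] by (intro ennreal_leI power_mono) (auto intro: less_imp_le)
      finally show "(\<integral>\<^sup>+x. ennreal ((norm (f (s n) x - f m x))\<^sup>2) \<partial>T3) \<le> ennreal (((1/2)^j)\<^sup>2)" .
    qed
    finally show ?thesis by (simp add: Liminf_const)
  qed
  have gf: "(\<lambda>x. g x - f m x) \<in> L2_fields" if "M j \<le> m" for m j
    unfolding L2_fields_def
  proof (intro CollectI conjI)
    show "integrable T3 (\<lambda>x. (norm (g x - f m x))\<^sup>2)"
    proof (rule integrableI_bounded)
      show "(\<integral>\<^sup>+x. ennreal (norm ((norm (g x - f m x))\<^sup>2)) \<partial>T3) < \<infinity>"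
        using order_le_less_trans[OF fatou[OF that] ennreal_less_top] by simp
    qed measurable
    show "torus_periodic (\<lambda>x. g x - f m x)"
      using gper L2_fieldsD(1)[OF f[of m]] by (simp add: torus_periodic_def)
    show "(\<lambda>x. g x - f m x) \<in> borel_measurable T3" by measurable
  qed
  have gL: "g \<in> L2_fields" using L2_fields_add[OF gf[OF order_refl] f, of 0 "M 0"] by simp
  have "(\<lambda>n. L2norm (\<lambda>x. f n x - g x)) \<longlonglongrightarrow> 0"
  proof (rule LIMSEQ_I)
    fix e :: real assume e: "0 < e"
    obtain j where j: "(1/2::real)^j < e" using real_arch_pow_inv[OF e, of "1/2"] by auto
    have "norm (L2norm (\<lambda>x. f n x - g x) - 0) < e" if n: "M j \<le> n" for n
    proof -
      have "ennreal ((L2norm (\<lambda>x. g x - f n x))\<^sup>2) \<le> ennreal (((1/2)^j)\<^sup>2)"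
        using fatou[OF n] unfolding nn_integral_L2norm[OF gf[OF n]] .
      then have "(L2norm (\<lambda>x. g x - f n x))\<^sup>2 \<le> ((1/2)^j)\<^sup>2"
        by (subst (asm) ennreal_le_iff) simp_all
      then have "L2norm (\<lambda>x. g x - f n x) \<le> (1/2)^j"
        by (rule power2_le_imp_le) simp
      then show ?thesis using j unfolding L2norm_minus_commute[of "f n" g] by simp
    qed
    then show "\<exists>no. \<forall>n\<ge>no. norm (L2norm (\<lambda>x. f n x - g x) - 0) < e" by blast
  qed
  with gL that show thesis by blast
qed

section \<open>Fourier series of vector fields\<close>

text \<open>
  Polynomials in the coordinates of \<open>x \<mapsto> (e\<^sup>2\<^sup>\<pi>\<^sup>i\<^sup>x\<^sub>j)\<^sub>j\<close> are
  trigonometric polynomials, so by Stone--Weierstrass a function with vanishing coefficients is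
  orthogonal to every continuous function of this map, hence to indicators of compact subsets of the
  open cube, on which the map is injective.
\<close>

inductive_set trig_poly :: "(real^3 \<Rightarrow> complex) set" where
  trig_wave: "k \<in> frequencies \<Longrightarrow> (\<lambda>x. c * wave k x) \<in> trig_poly"
| trig_add: "f \<in> trig_poly \<Longrightarrow> g \<in> trig_poly \<Longrightarrow> (\<lambda>x. f x + g x) \<in> trig_poly"

lemma trig_poly_mult_wave:
  "f \<in> trig_poly \<Longrightarrow> k \<in> frequencies \<Longrightarrow> (\<lambda>x. f x * (c * wave k x)) \<in> trig_poly"
proof (induction rule: trig_poly.induct)
  case (trig_wave l d)
  have "(\<lambda>x. d * wave l x * (c * wave k x)) = (\<lambda>x. (d * c) * wave (l + k) x)"
    by (simp add: wave_add mult_ac)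
  then show ?case using trig_wave by (metis trig_poly.trig_wave frequencies_closed(2))
next
  case (trig_add f g)
  then show ?case by (simp add: distrib_right trig_poly.trig_add)
qed

lemma trig_poly_mult:
  "g \<in> trig_poly \<Longrightarrow> f \<in> trig_poly \<Longrightarrow> (\<lambda>x. f x * g x) \<in> trig_poly"
proof (induction rule: trig_poly.induct)
  case (trig_wave k c)
  then show ?case by (simp add: trig_poly_mult_wave)
next
  case (trig_add g h)
  then show ?case by (simp add: distrib_left trig_poly.trig_add)
qed

definition torus_embedding :: "real^3 \<Rightarrow> complex^3" where
  "torus_embedding x = (\<chi> j. cis (2 * pi * x $ j))"

lemma axis_frequency: "axis j 1 \<in> frequencies"
  by (simp add: frequencies_iff axis_def)

text \<open>On one coordinate a real-linear functional is a combination of cosine and sine, that is,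
  of the two conjugate waves with frequencies \<open>axis j 1\<close> and
  \<open>- axis j 1\<close>.\<close>

lemma trig_poly_bounded_linear:
  fixes h :: "complex^3 \<Rightarrow> real"
  assumes "bounded_linear h"
  shows "(\<lambda>x. of_real (h (torus_embedding x))) \<in> trig_poly"
proof -
  interpret bounded_linear h by fact
  have coord: "(\<lambda>x. of_real (h (axis j (cis (2 * pi * x $ j))))) \<in> trig_poly" for j
  proof -
    define p q where "p = h (axis j 1)" and "q = h (axis j \<i>)"
    have "of_real (h (axis j (cis (2 * pi * x $ j))))
        = ((of_real p - \<i> * of_real q) / 2) * wave (axis j 1) x + ((of_real p + \<i> * of_real q) / 2) * wave (- axis j 1) x" for x
    proof -
      have "axis j z = Re z *\<^sub>R axis j 1 + Im z *\<^sub>R axis j (\<i>::complex)" for z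
        by (simp add: vec_eq_iff axis_def complex_eq_iff)
      then have "h (axis j z) = Re z * p + Im z * q" for z
        by (metis add scaleR p_def q_def real_scaleR_def)
      moreover have "wave (axis j 1) x = cis (2 * pi * x $ j)" "wave (- axis j 1) x = cis (- (2 * pi * x $ j))"
        by (simp_all add: wave_def inner_axis')
      ultimately show ?thesis by (simp add: complex_eq_iff field_simps)
    qed
    then show ?thesis
      by (simp only:) (intro trig_poly.intros axis_frequency frequencies_closed)
  qed
  have "torus_embedding x = axis 1 (cis (2 * pi * x $ 1)) + axis 2 (cis (2 * pi * x $ 2)) + axis 3 (cis (2 * pi * x $ 3))" for x
    by (simp add: torus_embedding_def vec_eq_iff forall_3 axis_def)
  then have "(\<lambda>x. complex_of_real (h (torus_embedding x))) = (\<lambda>x. of_real (h (axis 1 (cis (2 * pi * x $ 1))))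
      + of_real (h (axis 2 (cis (2 * pi * x $ 2)))) + of_real (h (axis 3 (cis (2 * pi * x $ 3)))))"
    by (simp add: add)
  then show ?thesis by (simp only:) (intro trig_add coord)
qed

lemma trig_poly_polynomial:
  fixes p :: "complex^3 \<Rightarrow> real"
  assumes "real_polynomial_function p"
  shows "(\<lambda>x. of_real (p (torus_embedding x))) \<in> trig_poly"
  using assms
proof (induction rule: real_polynomial_function.induct)
  case (linear f)
  then show ?case by (rule trig_poly_bounded_linear)
next
  case (const c)
  then show ?case using trig_wave[of 0 "of_real c"] by simp
next
  case (add f g)
  then show ?case by (simp add: trig_poly.trig_add)
next
  case (mult f g)
  then show ?case by (simp add: trig_poly_mult)
qed

lemma continuous_torus_embedding: "continuous_on S torus_embedding"
  unfolding torus_embedding_def by (intro continuous_intros)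

text \<open>The embedding identifies opposite faces of the closed cube, so one of the points is
  taken from the open cube; then the coordinates differ by an integer strictly between -1 and
  1.\<close>

lemma torus_embedding_inj:
  assumes x: "x \<in> box 0 One" and y: "y \<in> cbox 0 One" and eq: "torus_embedding x = torus_embedding y"
  shows "x = y"
proof -
  have "x $ j = y $ j" for j
  proof -
    have xj: "0 < x $ j" "x $ j < 1" "0 \<le> y $ j" "y $ j \<le> 1"
    proof -
      have B: "axis j (1::real) \<in> (Basis :: (real^3) set)" by simp
      have "(One :: real^3) \<bullet> axis j 1 = 1" using B by simp
      then have "(One :: real^3) $ j = 1" by (simp only: inner_axis) simp
      then show "0 < x $ j" "x $ j < 1" "0 \<le> y $ j" "y $ j \<le> 1"
        using x[unfolded mem_box, rule_format, OF B] y[unfolded mem_box, rule_format, OF B]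
        by (simp_all only: inner_axis) simp_all
    qed
    have "cis (2 * pi * (x $ j)) = cis (2 * pi * (y $ j))"
      using eq by (simp add: torus_embedding_def vec_eq_iff)
    then have "cis (2 * pi * (x $ j) - 2 * pi * (y $ j)) = 1"
      by (simp flip: cis_divide)
    then have "cos (2 * pi * (x $ j) - 2 * pi * (y $ j)) = 1" by (metis cis.sel(1) one_complex.sel(1))
    then obtain n :: int where "2 * pi * (x $ j) - 2 * pi * (y $ j) = of_int n * 2 * pi"
      unfolding cos_one_2pi_int by auto
    then have "2 * pi * (x $ j) = 2 * pi * (y $ j + n)" by (simp add: algebra_simps)
    then have n: "x $ j = y $ j + n" by simp
    then have "real_of_int n < 1" "-1 < real_of_int n" using xj by linarith+
    then have "n = 0" by linarith
    then show ?thesis using n by simp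
  qed
  then show ?thesis by (simp add: vec_eq_iff)
qed

lemma fourier_zero_imp_orthogonal_trig:
  fixes f :: "real^3 \<Rightarrow> real"
  assumes f: "integrable T3 f"
    and zero: "\<And>k. k \<in> frequencies \<Longrightarrow> (\<integral>x. of_real (f x) * wave k x \<partial>T3) = 0"
    and p: "p \<in> trig_poly"
  shows "integrable T3 (\<lambda>x. of_real (f x) * p x)" "(\<integral>x. of_real (f x) * p x \<partial>T3) = 0"
proof -
  have w: "integrable T3 (\<lambda>x. of_real (f x) * (c * wave k x))" for c k
  proof (rule Bochner_Integration.integrable_bound[of T3 "\<lambda>x. norm c * f x"])
    have "wave k \<in> borel_measurable T3" by (rule T3_measurable_continuous[OF continuous_wave])
    then show "(\<lambda>x. of_real (f x) * (c * wave k x)) \<in> borel_measurable T3" using f by simp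
  qed (use f in \<open>simp_all add: norm_mult mult.commute\<close>)
  have "integrable T3 (\<lambda>x. of_real (f x) * p x) \<and> (\<integral>x. of_real (f x) * p x \<partial>T3) = 0"
    using p
  proof (induction rule: trig_poly.induct)
    case (trig_wave k c)
    have "(\<integral>x. of_real (f x) * (c * wave k x) \<partial>T3) = c * (\<integral>x. of_real (f x) * wave k x \<partial>T3)"
    proof -
      have "(\<lambda>x. of_real (f x) * (c * wave k x)) = (\<lambda>x. c * (of_real (f x) * wave k x))"
        by (simp add: fun_eq_iff mult.left_commute)
      then show ?thesis by (simp only: integral_mult_right_zero)
    qed
    then show ?case using w zero[OF trig_wave] by simp
  next
    case (trig_add g h)
    then show ?case by (simp add: distrib_left)
  qed
  then show "integrable T3 (\<lambda>x. of_real (f x) * p x)" "(\<integral>x. of_real (f x) * p x \<partial>T3) = 0" by auto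
qed

lemma fourier_zero_imp_orthogonal_continuous:
  fixes f :: "real^3 \<Rightarrow> real" and G :: "complex^3 \<Rightarrow> real"
  assumes f: "integrable T3 f"
    and zero: "\<And>k. k \<in> frequencies \<Longrightarrow> (\<integral>x. of_real (f x) * wave k x \<partial>T3) = 0"
    and G: "continuous_on UNIV G"
  shows "(\<integral>x. f x * G (torus_embedding x) \<partial>T3) = 0"
proof (rule ccontr)
  define S where "S = torus_embedding ` cbox 0 One"
  have S: "compact S" unfolding S_def by (intro compact_continuous_image continuous_torus_embedding compact_cbox)
  define J where "J = (\<integral>x. f x * G (torus_embedding x) \<partial>T3)"
  assume "(\<integral>x. f x * G (torus_embedding x) \<partial>T3) \<noteq> 0"
  then have J: "0 < \<bar>J\<bar>" by (simp add: J_def)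
  define m where "m = (\<integral>x. \<bar>f x\<bar> \<partial>T3)"
  have m: "0 \<le> m" unfolding m_def by simp
  \<comment> \<open>The approximation error changes the integral by at most \<open>e * m\<close>,
    which is below \<open>\<bar>J\<bar>\<close>; the \<open>+ 1\<close> covers
    \<open>m = 0\<close>.\<close>
  define e where "e = \<bar>J\<bar> / (2 * (m + 1))"
  have e: "0 < e" using J m by (simp add: e_def)
  obtain p where p: "real_polynomial_function p" "\<And>z. z \<in> S \<Longrightarrow> \<bar>G z - p z\<bar> < e"
    using Stone_Weierstrass_real_polynomial_function[OF S continuous_on_subset[OF G] e] by auto
  have cG: "continuous_on UNIV (\<lambda>x. G (torus_embedding x))"
    by (rule continuous_on_compose2[OF G continuous_torus_embedding]) auto
  have cp: "continuous_on UNIV (\<lambda>x. p (torus_embedding x))"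
    by (rule continuous_on_compose2[OF continuous_on_polymonial_function continuous_torus_embedding])
       (use p(1) in \<open>auto simp: real_polynomial_function_eq\<close>)
  have tp: "integrable T3 (\<lambda>x. complex_of_real (f x) * of_real (p (torus_embedding x)))"
     "(\<integral>x. complex_of_real (f x) * of_real (p (torus_embedding x)) \<partial>T3) = 0"
    using fourier_zero_imp_orthogonal_trig[OF f zero trig_poly_polynomial[OF p(1)]] by auto
  have ip: "integrable T3 (\<lambda>x. f x * p (torus_embedding x))"
    using integrable_Re[OF tp(1)] by simp
  have zp: "(\<integral>x. f x * p (torus_embedding x) \<partial>T3) = 0"
    using integral_Re[OF tp(1)] tp(2) by simp
  have bnd: "\<bar>f x * (G (torus_embedding x) - p (torus_embedding x))\<bar> \<le> e * \<bar>f x\<bar>" if "x \<in> cbox 0 One" for x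
    using mult_left_mono[OF less_imp_le[OF p(2)[of "torus_embedding x"]] abs_ge_zero[of "f x"]] that
    by (simp add: S_def abs_mult mult.commute)
  have mG: "(\<lambda>x. f x * (G (torus_embedding x) - p (torus_embedding x))) \<in> borel_measurable T3"
    using f T3_measurable_continuous[OF cG] T3_measurable_continuous[OF cp] by simp
  have iD: "integrable T3 (\<lambda>x. f x * (G (torus_embedding x) - p (torus_embedding x)))"
    by (rule Bochner_Integration.integrable_bound[of T3 "\<lambda>x. e * f x"])
       (use f mG bnd e in \<open>auto intro!: AE_I2 simp: abs_mult\<close>)
  have iG: "integrable T3 (\<lambda>x. f x * G (torus_embedding x))"
    using Bochner_Integration.integrable_add[OF iD ip] by (simp add: right_diff_distrib)
  have J_eq: "J = (\<integral>x. f x * (G (torus_embedding x) - p (torus_embedding x)) \<partial>T3)"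
    using Bochner_Integration.integral_diff[OF iG ip] by (simp add: J_def zp right_diff_distrib)
  have "\<bar>J\<bar> \<le> (\<integral>x. \<bar>f x * (G (torus_embedding x) - p (torus_embedding x))\<bar> \<partial>T3)"
    unfolding J_eq by (rule integral_abs_bound)
  also have "\<dots> \<le> (\<integral>x. e * \<bar>f x\<bar> \<partial>T3)"
    using f bnd by (intro integral_mono[OF integrable_abs[OF iD]]) simp_all
  also have "\<dots> = e * m" by (simp add: m_def)
  also have "\<dots> < \<bar>J\<bar>"
  proof -
    have "e * m \<le> e * (m + 1)" using e by simp
    also have "\<dots> = \<bar>J\<bar> / 2" using m by (simp add: e_def field_simps)
    finally show ?thesis using J by simp
  qed
  finally show False by simp
qed

text \<open>No point of the closed cube outside \<open>K\<close> is mapped into the image of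
  \<open>K\<close>, so the indicator of \<open>K\<close> is the pointwise limit of continuous
  functions of the embedding, built from the distance to that image.\<close>

lemma fourier_zero_imp_compact_integral:
  fixes f :: "real^3 \<Rightarrow> real"
  assumes f: "integrable T3 f"
    and zero: "\<And>k. k \<in> frequencies \<Longrightarrow> (\<integral>x. of_real (f x) * wave k x \<partial>T3) = 0"
    and K: "compact K" "K \<subseteq> box 0 One"
  shows "(\<integral>x. f x * indicator K x \<partial>T3) = 0"
proof (cases "K = {}")
  case False
  define D where "D = torus_embedding ` K"
  have D: "compact D" "D \<noteq> {}" unfolding D_def
    using False by (auto intro!: compact_continuous_image continuous_torus_embedding K)
  define G where "G n z = max 0 (1 - real n * setdist {z} D)" for n z
  have Gc: "continuous_on UNIV (G n)" for n
    unfolding G_def by (intro continuous_intros continuous_on_setdist)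
  have sd: "0 \<le> setdist {z} D" for z by (rule setdist_pos_le)
  have G1: "0 \<le> G n z" "G n z \<le> 1" for n z unfolding G_def using sd[of z] by auto
  have "(\<lambda>n. \<integral>x. f x * G n (torus_embedding x) \<partial>T3) \<longlonglongrightarrow> (\<integral>x. f x * indicator K x \<partial>T3)"
  proof (rule integral_dominated_convergence[where w="\<lambda>x. \<bar>f x\<bar>"])
    have "K \<in> sets T3"
      using K box_subset_cbox[of 0 "One::real^3"] unfolding T3_def
      by (auto simp: sets_restrict_space_iff compact_imp_closed)
    then show "(\<lambda>x. f x * indicator K x) \<in> borel_measurable T3" using f by simp
    show "(\<lambda>x. f x * G n (torus_embedding x)) \<in> borel_measurable T3" for n
      using f T3_measurable_continuous[OF continuous_on_compose2[OF Gc continuous_torus_embedding]] by simp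
    show "AE x in T3. norm (f x * G n (torus_embedding x)) \<le> \<bar>f x\<bar>" for n
      using G1 by (intro AE_I2) (simp add: abs_mult mult_left_le)
    show "AE x in T3. (\<lambda>n. f x * G n (torus_embedding x)) \<longlonglongrightarrow> f x * indicator K x"
    proof (rule AE_I2)
      fix x assume "x \<in> space T3"
      then have x: "x \<in> cbox 0 One" by simp
      have "(\<lambda>n. G n (torus_embedding x)) \<longlonglongrightarrow> indicator K x"
      proof (cases "x \<in> K")
        case True
        then have "setdist {torus_embedding x} D = 0" by (intro setdist_sing_in_set) (simp add: D_def)
        then show ?thesis using True by (simp add: G_def)
      next
        case False
        have "torus_embedding x \<notin> D"
        proof
          assume "torus_embedding x \<in> D"
          then obtain y where y: "y \<in> K" "torus_embedding y = torus_embedding x" by (auto simp: D_def)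
          then have "y = x" using torus_embedding_inj[OF _ x] K(2) by blast
          then show False using y False by simp
        qed
        then have pos: "0 < setdist {torus_embedding x} D"
          using setdist_eq_0_sing_1[of "torus_embedding x" D] D sd[of "torus_embedding x"]
          by (simp add: compact_imp_closed order_less_le)
        obtain n0 where n0: "1 / setdist {torus_embedding x} D \<le> real n0" using real_arch_simple by blast
        have "G n (torus_embedding x) = 0" if "n0 \<le> n" for n
        proof -
          have "1 / setdist {torus_embedding x} D \<le> real n" using n0 that by (meson of_nat_mono order_trans)
          then have "1 \<le> real n * setdist {torus_embedding x} D" using pos by (simp add: pos_divide_le_eq)
          then show ?thesis by (simp add: G_def)
        qed
        then have "\<forall>\<^sub>F n in sequentially. G n (torus_embedding x) = 0"
          by (auto simp: eventually_sequentially)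
        then show ?thesis using False by (simp add: tendsto_eventually)
      qed
      then show "(\<lambda>n. f x * G n (torus_embedding x)) \<longlonglongrightarrow> f x * indicator K x"
        by (rule tendsto_mult_left)
    qed
  qed (use f in simp)
  moreover have "(\<integral>x. f x * G n (torus_embedding x) \<partial>T3) = 0" for n
    by (rule fourier_zero_imp_orthogonal_continuous[OF f zero Gc])
  ultimately show ?thesis by (simp add: LIMSEQ_const_iff)
qed simp

lemma AE_T3_box: "AE x in T3. x \<in> box 0 One"
proof -
  have "negligible (cbox 0 (One::real^3) - box 0 One)" by (rule negligible_frontier_interval)
  then have "AE x in lebesgue. x \<notin> cbox 0 (One::real^3) - box 0 One"
    by (intro AE_not_in) (simp add: negligible_iff_null_sets)
  then show ?thesis
    unfolding T3_def by (subst AE_restrict_space_iff) (auto elim: eventually_mono)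
qed

text \<open>If \<open>f\<close> exceeded \<open>1 / Suc n\<close> on a set of positive measure in
  the open cube, inner regularity would give a compact subset of positive measure, over which the
  integral of \<open>f\<close> is positive.\<close>

lemma fourier_zero_imp_nonpos:
  fixes f :: "real^3 \<Rightarrow> real"
  assumes f: "integrable T3 f"
    and zero: "\<And>k. k \<in> frequencies \<Longrightarrow> (\<integral>x. of_real (f x) * wave k x \<partial>T3) = 0"
  shows "AE x in T3. f x \<le> 0"
proof -
  have ae: "AE x in T3. \<not> (x \<in> box 0 One \<and> 1 / real (Suc n) < f x)" for n
  proof -
    define A where "A = {x \<in> box 0 One. 1 / real (Suc n) < f x}"
    have fm: "f \<in> borel_measurable T3" using f by auto
    have fs: "{x \<in> space T3. 1 / real (Suc n) < f x} \<in> sets T3" using fm by measurable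
    have bs: "box 0 One \<in> sets T3"
      using box_subset_cbox[of 0 "One::real^3"] by (auto simp: T3_def sets_restrict_space_iff)
    have "A = box 0 One \<inter> {x \<in> space T3. 1 / real (Suc n) < f x}"
      using subsetD[OF box_subset_cbox[of 0 "One::real^3"]] unfolding A_def space_T3 by blast
    then have AT: "A \<in> sets T3" using sets.Int[OF bs fs] by (simp only:)
    have AL: "A \<in> sets lebesgue"
      using AT unfolding T3_def by (subst (asm) sets_restrict_space_iff) simp_all
    have Ab: "bounded A" unfolding A_def by (rule bounded_subset[OF bounded_box[of 0 One]]) blast
    have Alm: "A \<in> lmeasurable" by (rule bounded_set_imp_lmeasurable[OF Ab AL])
    have "measure lebesgue A = 0"
    proof (rule ccontr)
      assume "measure lebesgue A \<noteq> 0"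
      then have pos: "0 < measure lebesgue A" by (simp add: zero_less_measure_iff)
      \<comment> \<open>The allowed error is the whole measure of \<open>A\<close>; it is undercut
        strictly, so \<open>K\<close> has positive measure.\<close>
      obtain K where Kc: "closed K" and KA: "K \<subseteq> A" and diff: "A - K \<in> lmeasurable"
        "emeasure lebesgue (A - K) < ennreal (measure lebesgue A)"
        by (rule sets_lebesgue_inner_closed[OF AL pos])
      have Kcomp: "compact K" using Kc bounded_subset[OF Ab KA] by (simp add: compact_eq_bounded_closed)
      have Klm: "K \<in> lmeasurable" by (rule lmeasurable_compact[OF Kcomp])
      have "measure lebesgue (A - K) = measure lebesgue A - measure lebesgue K"
        by (rule measurable_measure_Diff[OF Alm _ KA]) (use Klm in auto)
      moreover have "measure lebesgue (A - K) < measure lebesgue A"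
        using diff pos by (simp add: emeasure_eq_measure2 ennreal_less_iff)
      ultimately have mpos: "0 < measure lebesgue K" by simp
      have K: "compact K" "K \<subseteq> A" by fact+
      have Kb: "K \<subseteq> box 0 One" using K(2) by (auto simp: A_def)
      have KT: "K \<in> sets T3"
        using K Kb box_subset_cbox[of 0 "One::real^3"] unfolding T3_def
        by (auto simp: sets_restrict_space_iff compact_imp_closed)
      have mK: "measure T3 K = measure lebesgue K"
        unfolding T3_def using Kb box_subset_cbox[of 0 "One::real^3"] by (intro measure_restrict_space) auto
      have "(\<integral>x. 1 / real (Suc n) * indicator K x \<partial>T3) \<le> (\<integral>x. f x * indicator K x \<partial>T3)"
      proof (rule integral_mono)
        show "integrable T3 (\<lambda>x. f x * indicator K x)" by (rule integrable_real_mult_indicator[OF KT f])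
        have "emeasure T3 K < \<infinity>" using T3.emeasure_finite[of K] unfolding top.not_eq_extremum infinity_ennreal_def .
        then show "integrable T3 (\<lambda>x. 1 / real (Suc n) * indicator K x)"
          using KT by (intro integrable_mult_right integrable_real_indicator)
        show "1 / real (Suc n) * indicator K x \<le> f x * indicator K x" for x
          using K(2) by (auto simp: A_def indicator_def less_imp_le)
      qed
      moreover have "K \<inter> space T3 = K" using KT sets.sets_into_space by blast
      then have "(\<integral>x. 1 / real (Suc n) * indicator K x \<partial>T3) = 1 / real (Suc n) * measure T3 K"
        by simp
      ultimately have "measure T3 K \<le> 0"
        using fourier_zero_imp_compact_integral[OF f zero K(1) Kb] by (simp add: field_simps mult_le_0_iff)
      then show False using mpos mK by simp
    qed
    then have "A \<in> null_sets lebesgue" using Alm by (simp add: null_sets_def emeasure_eq_measure2 completion.complete2)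
    then have "AE x in lebesgue. x \<notin> A" by (rule AE_not_in)
    then have "AE x in T3. x \<notin> A"
      unfolding T3_def by (subst AE_restrict_space_iff) (auto elim: eventually_mono)
    then show ?thesis by eventually_elim (simp add: A_def)
  qed
  have "AE x in T3. \<forall>n. \<not> (x \<in> box 0 One \<and> 1 / real (Suc n) < f x)"
    by (rule AE_all_countable[THEN iffD2, rule_format]) (rule ae)
  then show ?thesis using AE_T3_box
  proof eventually_elim
    case (elim x)
    show ?case
    proof (rule ccontr)
      assume "\<not> f x \<le> 0"
      then obtain n where "1 / real (Suc n) < f x" using reals_Archimedean[of "f x"] by (auto simp: inverse_eq_divide)
      then show False using elim by blast
    qed
  qed
qed

lemma fourier_zero_imp_AE_zero:
  assumes "u \<in> L2_fields" "\<And>k. k \<in> frequencies \<Longrightarrow> fourier u k = 0"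
  shows "AE x in T3. u x = 0"
proof -
  have "AE x in T3. u x $ j = 0" for j
  proof -
    have i: "integrable T3 (\<lambda>x. u x $ j)" by (rule integrable_L2(2)[OF assms(1)])
    have z: "(\<integral>x. of_real (u x $ j) * wave k x \<partial>T3) = 0" if "k \<in> frequencies" for k
    proof -
      have "fourier u (- k) $ j = 0" using assms(2)[of "- k"] that by simp
      then show ?thesis by (simp add: fourier_def wave_def)
    qed
    have "AE x in T3. u x $ j \<le> 0" by (rule fourier_zero_imp_nonpos[OF i z])
    moreover have "AE x in T3. - (u x $ j) \<le> 0"
      using i z by (intro fourier_zero_imp_nonpos) auto
    ultimately show ?thesis by eventually_elim simp
  qed
  then have "AE x in T3. \<forall>j\<in>UNIV. u x $ j = 0" by (intro AE_finite_allI) auto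
  then show ?thesis by eventually_elim (simp add: vec_eq_iff)
qed

section \<open>Plane waves and Parseval's identity\<close>

definition cnj_vec :: "complex^3 \<Rightarrow> complex^3" where
  "cnj_vec c = (\<chi> j. cnj (c $ j))"

definition re_part :: "complex^3 \<Rightarrow> complex \<Rightarrow> real^3" where
  "re_part c z = (\<chi> j. Re (c $ j * z))"

definition plane_wave :: "complex^3 \<Rightarrow> real^3 \<Rightarrow> vfield" where
  "plane_wave c k x = re_part c (wave k x)"

lemma bounded_linear_re_part: "bounded_linear (re_part c)"
  unfolding re_part_def
  by (intro linear_conv_bounded_linear[THEN iffD1] linearI) (simp_all add: vec_eq_iff algebra_simps)

lemma has_derivative_linear_wave:
  assumes "bounded_linear L"
  shows "((\<lambda>x. L (wave k x)) has_derivative (\<lambda>v. L (2 * pi * \<i> * of_real (k \<bullet> v) * wave k x))) (at x)"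
  by (rule bounded_linear.has_derivative[OF assms has_derivative_wave])

lemma partial_linear_wave:
  assumes "bounded_linear L"
  shows "partial b (\<lambda>x. L (wave k x)) = (\<lambda>x. L (2 * pi * \<i> * of_real (k \<bullet> b) * wave k x))"
  unfolding partial_def
  by (rule ext) (simp add: frechet_derivative_at[OF has_derivative_linear_wave[OF assms], symmetric])

lemma Ck_linear_wave: "bounded_linear L \<Longrightarrow> Ck n (\<lambda>x. L (wave k x))"
proof (induction n arbitrary: L)
  case 0
  then show ?case
    using continuous_on_compose2[OF linear_continuous_on[OF 0] continuous_wave] by auto
next
  case (Suc n)
  have "Ck n (partial b (\<lambda>x. L (wave k x)))" for b
    unfolding partial_linear_wave[OF Suc.prems]
    by (rule Suc.IH) (intro bounded_linear_compose[OF Suc.prems] bounded_linear_mult_right)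
  moreover have "(\<lambda>x. L (wave k x)) differentiable at x" for x
    using has_derivative_linear_wave[OF Suc.prems] unfolding differentiable_def by blast
  ultimately show ?case by simp
qed

lemma Ck_add: "Ck n f \<Longrightarrow> Ck n g \<Longrightarrow> Ck n (\<lambda>x. f x + g x)"
proof (induction n arbitrary: f g)
  case 0
  then show ?case by (auto intro: continuous_on_add)
next
  case (Suc n)
  then have d: "f differentiable at x" "g differentiable at x" for x by auto
  have "partial b (\<lambda>x. f x + g x) = (\<lambda>x. partial b f x + partial b g x)" for b
    unfolding partial_def
    by (simp add: fun_eq_iff frechet_derivative_at[OF has_derivative_add[OF
          frechet_derivative_works[THEN iffD1, OF d(1)] frechet_derivative_works[THEN iffD1, OF d(2)]], symmetric])
  then show ?case using Suc d by (auto intro: differentiable_add)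
qed

lemma Ck_zero: "Ck n ((\<lambda>x. 0) :: real^3 \<Rightarrow> 'b::real_normed_vector)"
  using Ck_linear_wave[of "\<lambda>z. 0 :: 'b" n 0] by (simp add: bounded_linear_zero)

lemma Ck_sum:
  fixes f :: "'i \<Rightarrow> real^3 \<Rightarrow> 'b::real_normed_vector"
  shows "(\<And>i. i \<in> A \<Longrightarrow> Ck n (f i)) \<Longrightarrow> Ck n (\<lambda>x. \<Sum>i\<in>A. f i x)"
  by (induction A rule: infinite_finite_induct) (auto intro: Ck_add Ck_zero)

lemma plane_wave_periodic: "k \<in> frequencies \<Longrightarrow> torus_periodic (plane_wave c k)"
  by (simp add: torus_periodic_def plane_wave_def wave_periodic)

lemma continuous_plane_wave: "continuous_on UNIV (plane_wave c k)"
  unfolding plane_wave_def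
  by (rule continuous_on_compose2[OF linear_continuous_on[OF bounded_linear_re_part] continuous_wave]) auto

lemma plane_wave_L2: "k \<in> frequencies \<Longrightarrow> plane_wave c k \<in> L2_fields"
  by (rule continuous_in_L2_fields[OF continuous_plane_wave plane_wave_periodic])

lemma partial_plane_wave: "partial b (plane_wave c k) = plane_wave (\<chi> j. 2 * pi * \<i> * of_real (k \<bullet> b) * c $ j) k"
  unfolding plane_wave_def partial_linear_wave[OF bounded_linear_re_part]
  by (simp add: re_part_def fun_eq_iff mult_ac)

lemma integrable_component_wave:
  assumes "u \<in> L2_fields"
  shows "integrable T3 (\<lambda>x. complex_of_real (u x $ j) * wave k x)"
proof (rule Bochner_Integration.integrable_bound[OF integrable_L2(2)[OF assms, of j]])
  have "wave k \<in> borel_measurable T3" by (rule T3_measurable_continuous[OF continuous_wave])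
  then show "(\<lambda>x. complex_of_real (u x $ j) * wave k x) \<in> borel_measurable T3"
    using integrable_L2(2)[OF assms, of j] by simp
qed (simp add: norm_mult)

lemma fourier_component: "fourier u k $ j = (\<integral>x. complex_of_real (u x $ j) * wave (- k) x \<partial>T3)"
  by (simp add: fourier_def wave_def)

lemma fourier_scale:
  "fourier (\<lambda>x. a *\<^sub>R u x) k = a *\<^sub>R fourier u k"
proof -
  have "(\<integral>x. complex_of_real (a * (u x $ j)) * wave (- k) x \<partial>T3)
      = of_real a * (\<integral>x. complex_of_real (u x $ j) * wave (- k) x \<partial>T3)" for j
    unfolding of_real_mult mult.assoc by (rule integral_mult_right_zero)
  then show ?thesis by (simp add: vec_eq_iff fourier_component scaleR_conv_of_real[where 'a=complex])
qed

lemma fourier_diff: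
  "u \<in> L2_fields \<Longrightarrow> v \<in> L2_fields \<Longrightarrow> fourier (\<lambda>x. u x - v x) k = fourier u k - fourier v k"
  by (simp add: vec_eq_iff fourier_component left_diff_distrib integrable_component_wave)

lemma fourier_sum:
  assumes "\<And>i. i \<in> A \<Longrightarrow> f i \<in> L2_fields"
  shows "fourier (\<lambda>x. \<Sum>i\<in>A. f i x) k = (\<Sum>i\<in>A. fourier (f i) k)"
  using assms by (simp add: vec_eq_iff fourier_component sum_distrib_right integrable_component_wave)

lemma fourier_uminus_freq: "fourier u (- k) = cnj_vec (fourier u k)"
proof -
  have "(\<integral>x. complex_of_real (u x $ j) * wave k x \<partial>T3) = cnj (\<integral>x. complex_of_real (u x $ j) * wave (- k) x \<partial>T3)" for j
    using Bochner_Integration.integral_cnj[of T3 "\<lambda>x. complex_of_real (u x $ j) * wave (- k) x"]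
    by (simp only: complex_cnj_mult complex_cnj_complex_of_real cnj_wave minus_minus)
  then show ?thesis by (simp add: vec_eq_iff fourier_component cnj_vec_def)
qed

lemma fourier_cong_AE:
  assumes "u \<in> L2_fields" "v \<in> L2_fields" "AE x in T3. u x = v x"
  shows "fourier u k = fourier v k"
proof -
  have "(\<integral>x. complex_of_real (u x $ j) * wave (- k) x \<partial>T3) = (\<integral>x. complex_of_real (v x $ j) * wave (- k) x \<partial>T3)" for j
    using integrable_component_wave[OF assms(1)] integrable_component_wave[OF assms(2)] assms(3)
    by (intro integral_cong_AE) auto
  then show ?thesis by (simp add: vec_eq_iff fourier_component)
qed

lemma ip_plane_wave:
  assumes u: "u \<in> L2_fields"
  shows "ip u (plane_wave c k) = fourier u k \<bullet> c"
proof -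
  have i: "integrable T3 (\<lambda>x. complex_of_real (u x $ j) * wave (- k) x * cnj (c $ j))" for j
    using integrable_component_wave[OF u] by simp
  have "ip u (plane_wave c k) = (\<integral>x. (\<Sum>j\<in>UNIV. Re (complex_of_real (u x $ j) * wave (- k) x * cnj (c $ j))) \<partial>T3)"
    unfolding ip_def plane_wave_def re_part_def inner_vec_def
    by (intro Bochner_Integration.integral_cong refl sum.cong)
       (simp add: algebra_simps cnj_wave[symmetric])
  also have "\<dots> = (\<Sum>j\<in>UNIV. Re (\<integral>x. complex_of_real (u x $ j) * wave (- k) x * cnj (c $ j) \<partial>T3))"
    by (subst Bochner_Integration.integral_sum) (simp_all only: integral_Re[OF i] integrable_Re[OF i])
  also have "\<dots> = (\<Sum>j\<in>UNIV. Re (fourier u k $ j * cnj (c $ j)))"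
    by (simp only: fourier_component integral_mult_left_zero)
  also have "\<dots> = fourier u k \<bullet> c"
    by (simp add: inner_vec_def inner_complex_def)
  finally show ?thesis .
qed

lemma fourier_plane_wave:
  assumes "k \<in> frequencies" "m \<in> frequencies"
  shows "fourier (plane_wave c k) m = (1/2) *\<^sub>R ((if m = k then c else 0) + (if m = - k then cnj_vec c else 0))"
proof -
  have "fourier (plane_wave c k) m $ j = (1/2) * ((if m = k then c $ j else 0) + (if m = - k then cnj (c $ j) else 0))" for j
  proof -
    have r: "complex_of_real (Re z) = (z + cnj z) / 2" for z by (simp add: complex_add_cnj)
    have e: "complex_of_real (Re (z * w)) * v = z / 2 * (w * v) + cnj z / 2 * (cnj w * v)" for z w v
      by (simp only: r complex_cnj_mult) (simp add: algebra_simps add_divide_distrib)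
    have "fourier (plane_wave c k) m $ j
        = (\<integral>x. c $ j / 2 * wave (k - m) x + cnj (c $ j) / 2 * wave (- k - m) x \<partial>T3)"
      unfolding fourier_component plane_wave_def re_part_def vec_lambda_beta e cnj_wave wave_add[symmetric]
      by simp
    also have "\<dots> = c $ j / 2 * (\<integral>x. wave (k - m) x \<partial>T3) + cnj (c $ j) / 2 * (\<integral>x. wave (- k - m) x \<partial>T3)"
      using T3_integrable_continuous[OF continuous_wave] by simp
    also have "\<dots> = (1/2) * ((if m = k then c $ j else 0) + (if m = - k then cnj (c $ j) else 0))"
    proof -
      have "k - m = 0 \<longleftrightarrow> m = k" "- k - m = 0 \<longleftrightarrow> m = - k" by (auto simp: algebra_simps)
      moreover have "k - m \<in> frequencies" "- k - m \<in> frequencies" using assms by auto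
      ultimately show ?thesis by (simp only: integral_wave) simp
    qed
    finally show ?thesis .
  qed
  note comp = this
  show ?thesis
    by (rule vec_eq_iff[THEN iffD2], rule allI, subst comp, cases "m = k"; cases "m = - k")
       (simp_all add: cnj_vec_def scaleR_conv_of_real[where 'a=complex])
qed

lemma cnj_vec_simps [simp]: "cnj_vec 0 = 0" "cnj_vec (cnj_vec c) = c" "norm (cnj_vec c) = norm c"
  by (simp_all add: cnj_vec_def vec_eq_iff norm_vec_def)

definition fourier_partial :: "(real^3 \<Rightarrow> complex^3) \<Rightarrow> (real^3) set \<Rightarrow> vfield" where
  "fourier_partial c A x = (\<Sum>k\<in>A. plane_wave (c k) k x)"

definition freq_ball :: "real \<Rightarrow> (real^3) set" where
  "freq_ball R = {k \<in> frequencies. norm k \<le> R}"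

lemma freq_ball: "finite (freq_ball R)" "freq_ball R \<subseteq> frequencies" "k \<in> freq_ball R \<Longrightarrow> - k \<in> freq_ball R"
  using finite_frequency_ball by (auto simp: freq_ball_def)

lemma fourier_partial_L2: "A \<subseteq> frequencies \<Longrightarrow> fourier_partial c A \<in> L2_fields"
  unfolding fourier_partial_def[abs_def] by (rule L2_fields_sum, rule plane_wave_L2) auto

text \<open>A plane wave is a real part: half of its amplitude sits at \<open>k\<close> and half,
  conjugated, at \<open>- k\<close>. On a symmetric set with coefficients of a real field the two
  halves add up.\<close>

lemma fourier_fourier_partial:
  assumes A: "finite A" "A \<subseteq> frequencies" "\<And>k. k \<in> A \<Longrightarrow> - k \<in> A" and m: "m \<in> frequencies"
    and real: "\<And>k. k \<in> frequencies \<Longrightarrow> c (- k) = cnj_vec (c k)"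
  shows "fourier (fourier_partial c A) m = (if m \<in> A then c m else 0)"
proof -
  have "fourier (fourier_partial c A) m = (\<Sum>k\<in>A. fourier (plane_wave (c k) k) m)"
    unfolding fourier_partial_def[abs_def] by (rule fourier_sum, rule plane_wave_L2) (use A in auto)
  also have "\<dots> = (\<Sum>k\<in>A. (1/2) *\<^sub>R ((if k = m then c m else 0) + (if k = - m then cnj_vec (c (- m)) else 0)))"
    using A m by (intro sum.cong refl, subst fourier_plane_wave) auto
  also have "\<dots> = (1/2) *\<^sub>R ((\<Sum>k\<in>A. if k = m then c m else 0) + (\<Sum>k\<in>A. if k = - m then cnj_vec (c (- m)) else 0))"
    by (simp add: sum.distrib scaleR_right.sum[symmetric] scaleR_right_distrib)
  also have "\<dots> = (if m \<in> A then c m else 0)"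
    using A(1) A(3)[of m] A(3)[of "- m"] real[OF m] by (auto simp flip: scaleR_2)
  finally show ?thesis .
qed

lemma ip_fourier_partial:
  assumes "A \<subseteq> frequencies" "u \<in> L2_fields"
  shows "ip u (fourier_partial c A) = (\<Sum>k\<in>A. fourier u k \<bullet> c k)"
proof -
  have "ip u (fourier_partial c A) = (\<Sum>k\<in>A. ip u (plane_wave (c k) k))"
    unfolding ip_commute[of u] fourier_partial_def[abs_def]
    by (rule ip_sum_left) (use assms plane_wave_L2 in auto)
  then show ?thesis by (simp add: ip_plane_wave[OF assms(2)])
qed

lemma L2norm_fourier_partial_diff:
  assumes A: "finite A" "A \<subseteq> frequencies" "\<And>k. k \<in> A \<Longrightarrow> - k \<in> A"
    and B: "finite B" "B \<subseteq> frequencies" "\<And>k. k \<in> B \<Longrightarrow> - k \<in> B" "B \<subseteq> A"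
    and real: "\<And>k. k \<in> frequencies \<Longrightarrow> c (- k) = cnj_vec (c k)"
  shows "(L2norm (\<lambda>x. fourier_partial c A x - fourier_partial c B x))\<^sup>2 = (\<Sum>k\<in>A - B. (norm (c k))\<^sup>2)"
proof -
  have eq: "(\<lambda>x. fourier_partial c A x - fourier_partial c B x) = fourier_partial c (A - B)"
    using A B by (simp add: fourier_partial_def fun_eq_iff sum_diff)
  have AB: "finite (A - B)" "A - B \<subseteq> frequencies" "\<And>k. k \<in> A - B \<Longrightarrow> - k \<in> A - B"
    using A B(3) by (auto, fastforce)
  have "ip (fourier_partial c (A - B)) (fourier_partial c (A - B))
      = (\<Sum>k\<in>A - B. fourier (fourier_partial c (A - B)) k \<bullet> c k)"
    by (rule ip_fourier_partial[OF AB(2) fourier_partial_L2[OF AB(2)]])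
  also have "\<dots> = (\<Sum>k\<in>A - B. (norm (c k))\<^sup>2)"
  proof (rule sum.cong[OF refl])
    fix k assume k: "k \<in> A - B"
    then have "fourier (fourier_partial c (A - B)) k = c k"
      using fourier_fourier_partial[of "A - B" k c, OF AB _ real] AB(2) by auto
    then show "fourier (fourier_partial c (A - B)) k \<bullet> c k = (norm (c k))\<^sup>2"
      by (simp add: power2_norm_eq_inner)
  qed
  finally show ?thesis by (simp add: L2norm_sq eq)
qed

lemma freq_ball_exhausts: "filterlim (\<lambda>n. freq_ball (real n)) (finite_subsets_at_top frequencies) sequentially"
  unfolding filterlim_finite_subsets_at_top
proof (intro allI impI)
  fix X :: "(real^3) set" assume X: "finite X \<and> X \<subseteq> frequencies"
  obtain n0 where n0: "(\<Sum>k\<in>X. norm k) \<le> real n0" using real_arch_simple by blast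
  have "norm k \<le> real n" if "k \<in> X" "n0 \<le> n" for k n
  proof -
    have "norm k \<le> (\<Sum>k\<in>X. norm k)" using X that by (intro member_le_sum) auto
    then show ?thesis using n0 that by simp
  qed
  then have "\<forall>n\<ge>n0. finite (freq_ball (real n)) \<and> X \<subseteq> freq_ball (real n) \<and> freq_ball (real n) \<subseteq> frequencies"
    using X freq_ball by (auto simp: freq_ball_def)
  then show "\<forall>\<^sub>F n in sequentially. finite (freq_ball (real n)) \<and> X \<subseteq> freq_ball (real n) \<and> freq_ball (real n) \<subseteq> frequencies"
    by (auto simp: eventually_sequentially)
qed

lemma fourier_tendsto:
  assumes f: "\<And>n. f n \<in> L2_fields" and g: "g \<in> L2_fields"
    and lim: "(\<lambda>n. L2norm (\<lambda>x. f n x - g x)) \<longlonglongrightarrow> 0" and k: "k \<in> frequencies"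
  shows "(\<lambda>n. fourier (f n) k) \<longlonglongrightarrow> fourier g k"
proof -
  have "(\<lambda>n. (fourier (f n) k - fourier g k) \<bullet> c) \<longlonglongrightarrow> 0" for c
  proof (rule Lim_null_comparison)
    show "\<forall>\<^sub>F n in sequentially. norm ((fourier (f n) k - fourier g k) \<bullet> c)
        \<le> L2norm (\<lambda>x. f n x - g x) * L2norm (plane_wave c k)"
    proof (rule always_eventually, rule allI)
      fix n
      have w: "(\<lambda>x. f n x - g x) \<in> L2_fields" by (rule L2_fields_diff(1)[OF f g])
      have "(fourier (f n) k - fourier g k) \<bullet> c = ip (\<lambda>x. f n x - g x) (plane_wave c k)"
        by (simp add: ip_plane_wave[OF w] fourier_diff[OF f g])
      then show "norm ((fourier (f n) k - fourier g k) \<bullet> c) \<le> L2norm (\<lambda>x. f n x - g x) * L2norm (plane_wave c k)"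
        using ip_le_L2norm[OF w plane_wave_L2[OF k]] by simp
    qed
    show "(\<lambda>n. L2norm (\<lambda>x. f n x - g x) * L2norm (plane_wave c k)) \<longlonglongrightarrow> 0"
      using tendsto_mult_right[OF lim] by simp
  qed
  then have "(\<lambda>n. fourier (f n) k - fourier g k) \<longlonglongrightarrow> 0"
    by (subst tendsto_componentwise_iff) simp
  then show ?thesis by (simp add: LIM_zero_iff)
qed

text \<open>By orthogonality the partial sums over balls form a Cauchy sequence; the coefficients of
  its limit are read off because each coefficient is continuous in the \<open>L^2\<close>
  norm.\<close>

lemma fourier_series_exists:
  fixes c :: "real^3 \<Rightarrow> complex^3"
  assumes sm: "(\<lambda>k. (norm (c k))\<^sup>2) summable_on frequencies"
    and real: "\<And>k. k \<in> frequencies \<Longrightarrow> c (- k) = cnj_vec (c k)"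
  obtains g where "g \<in> L2_fields" "\<And>k. k \<in> frequencies \<Longrightarrow> fourier g k = c k"
    "(\<lambda>n. L2norm (\<lambda>x. fourier_partial c (freq_ball (real n)) x - g x)) \<longlonglongrightarrow> 0"
proof -
  let ?S = "\<lambda>n. fourier_partial c (freq_ball (real n))"
  have SL: "?S n \<in> L2_fields" for n by (rule fourier_partial_L2[OF freq_ball(2)])
  have lim: "(\<lambda>n. \<Sum>k\<in>freq_ball (real n). (norm (c k))\<^sup>2) \<longlonglongrightarrow> infsum (\<lambda>k. (norm (c k))\<^sup>2) frequencies"
    using filterlim_compose[OF has_sum_infsum[OF sm, unfolded has_sum_def] freq_ball_exhausts] .
  have nrm: "(L2norm (\<lambda>x. ?S m x - ?S n x))\<^sup>2 = (\<Sum>k\<in>freq_ball (real m). (norm (c k))\<^sup>2) - (\<Sum>k\<in>freq_ball (real n). (norm (c k))\<^sup>2)"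
    if "n \<le> m" for m n
  proof -
    have sub: "freq_ball (real n) \<subseteq> freq_ball (real m)" using that by (auto simp: freq_ball_def)
    show ?thesis
      using L2norm_fourier_partial_diff[of "freq_ball (real m)" "freq_ball (real n)" c, OF freq_ball freq_ball sub real]
        sum_diff[OF freq_ball(1)[of "real m"] sub] by simp
  qed
  have "\<exists>n0. \<forall>m\<ge>n0. \<forall>n\<ge>n0. L2norm (\<lambda>x. ?S m x - ?S n x) < e" if e: "0 < e" for e
  proof -
    have "Cauchy (\<lambda>n. \<Sum>k\<in>freq_ball (real n). (norm (c k))\<^sup>2)" using lim by (rule LIMSEQ_imp_Cauchy)
    then obtain n0 where n0: "\<And>m n. \<lbrakk>n0 \<le> m; n0 \<le> n\<rbrakk> \<Longrightarrow>
        \<bar>(\<Sum>k\<in>freq_ball (real m). (norm (c k))\<^sup>2) - (\<Sum>k\<in>freq_ball (real n). (norm (c k))\<^sup>2)\<bar> < e\<^sup>2"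
      using e unfolding Cauchy_def dist_real_def by (metis zero_less_power)
    have *: "L2norm (\<lambda>x. ?S m x - ?S n x) < e" if "n0 \<le> n" "n \<le> m" for m n
    proof (rule power2_less_imp_less)
      show "(L2norm (\<lambda>x. ?S m x - ?S n x))\<^sup>2 < e\<^sup>2" unfolding nrm[OF that(2)] using n0[of m n] that by linarith
    qed (use e in simp)
    have "L2norm (\<lambda>x. ?S m x - ?S n x) < e" if "n0 \<le> n" "n0 \<le> m" for m n
      using *[of n m] *[of m n] that L2norm_minus_commute[of "?S m" "?S n"] by (cases "n \<le> m") auto
    then show ?thesis by blast
  qed
  from L2_fields_complete[OF SL this] obtain g where
    g: "g \<in> L2_fields" "(\<lambda>n. L2norm (\<lambda>x. ?S n x - g x)) \<longlonglongrightarrow> 0" by blast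
  have "fourier g k = c k" if k: "k \<in> frequencies" for k
  proof -
    have "(\<lambda>n. fourier (?S n) k) \<longlonglongrightarrow> fourier g k" by (rule fourier_tendsto[OF SL g k])
    moreover have "(\<lambda>n. fourier (?S n) k) \<longlonglongrightarrow> c k"
    proof (rule tendsto_eventually)
      obtain n0 where n0: "norm k \<le> real n0" using real_arch_simple by blast
      have "fourier (?S n) k = c k" if "n0 \<le> n" for n
        using fourier_fourier_partial[of "freq_ball (real n)" k c, OF freq_ball k real] k n0 that
        by (auto simp: freq_ball_def)
      then show "\<forall>\<^sub>F n in sequentially. fourier (?S n) k = c k" by (auto simp: eventually_sequentially)
    qed
    ultimately show ?thesis by (rule LIMSEQ_unique)
  qed
  with g that show thesis by blast
qed

text \<open>Bessel's inequality. It is first proved on symmetric sets, on which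
  \<open>fourier_partial\<close> has the coefficients of \<open>u\<close>; a general finite set is
  enlarged by its reflection.\<close>

lemma fourier_summable:
  assumes u: "u \<in> L2_fields"
  shows "(\<lambda>k. (norm (fourier u k))\<^sup>2) summable_on frequencies"
proof -
  have sym: "(\<Sum>k\<in>A. (norm (fourier u k))\<^sup>2) \<le> ip u u"
    if A: "finite A" "A \<subseteq> frequencies" "\<And>k. k \<in> A \<Longrightarrow> - k \<in> A" for A
  proof -
    let ?S = "fourier_partial (fourier u) A"
    have S: "?S \<in> L2_fields" by (rule fourier_partial_L2[OF A(2)])
    have a: "ip u ?S = (\<Sum>k\<in>A. (norm (fourier u k))\<^sup>2)"
      unfolding ip_fourier_partial[OF A(2) u] by (simp add: power2_norm_eq_inner)
    have "fourier ?S k = fourier u k" if "k \<in> A" for k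
      using fourier_fourier_partial[of A k "fourier u", OF A _ fourier_uminus_freq] that A(2) by auto
    then have b: "ip ?S ?S = (\<Sum>k\<in>A. (norm (fourier u k))\<^sup>2)"
      unfolding ip_fourier_partial[OF A(2) S] by (simp add: power2_norm_eq_inner)
    have d: "(\<lambda>x. u x - ?S x) \<in> L2_fields" by (rule L2_fields_diff(1)[OF u S])
    have "0 \<le> ip (\<lambda>x. u x - ?S x) (\<lambda>x. u x - ?S x)" by (rule ip_self_nonneg)
    also have "\<dots> = ip u u - ip u ?S - (ip u ?S - ip ?S ?S)"
      unfolding ip_diff_right[OF u S d] ip_diff_left[OF u S u] ip_diff_left[OF u S S] ip_commute[of ?S u] by simp
    finally show ?thesis using a b by simp
  qed
  have "(\<Sum>k\<in>A. (norm (fourier u k))\<^sup>2) \<le> ip u u" if A: "finite A" "A \<subseteq> frequencies" for A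
  proof -
    have "(\<Sum>k\<in>A. (norm (fourier u k))\<^sup>2) \<le> (\<Sum>k\<in>A \<union> uminus ` A. (norm (fourier u k))\<^sup>2)"
      using A by (intro sum_mono2) auto
    also have "\<dots> \<le> ip u u" by (rule sym) (use A in auto)
    finally show ?thesis .
  qed
  then show ?thesis by (intro nonneg_bdd_above_summable_on bdd_aboveI) auto
qed

text \<open>The series converges to some field with the same coefficients, and a field with
  vanishing coefficients is 0 almost everywhere; so the limit is \<open>u\<close>.\<close>

lemma fourier_partial_tendsto:
  assumes u: "u \<in> L2_fields"
  shows "(\<lambda>n. L2norm (\<lambda>x. fourier_partial (fourier u) (freq_ball (real n)) x - u x)) \<longlonglongrightarrow> 0"
    and fourier_unique: "\<And>v. v \<in> L2_fields \<Longrightarrow> (\<And>k. k \<in> frequencies \<Longrightarrow> fourier u k = fourier v k) \<Longrightarrow> AE x in T3. u x = v x"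
proof -
  show *: "AE x in T3. u x = v x" if v: "v \<in> L2_fields" "\<And>k. k \<in> frequencies \<Longrightarrow> fourier u k = fourier v k" for v
  proof -
    have "AE x in T3. u x - v x = 0"
      by (rule fourier_zero_imp_AE_zero[OF L2_fields_diff(1)[OF u v(1)]]) (simp add: fourier_diff[OF u v(1)] v(2))
    then show ?thesis by eventually_elim simp
  qed
  obtain g where g: "g \<in> L2_fields" "\<And>k. k \<in> frequencies \<Longrightarrow> fourier g k = fourier u k"
    "(\<lambda>n. L2norm (\<lambda>x. fourier_partial (fourier u) (freq_ball (real n)) x - g x)) \<longlonglongrightarrow> 0"
    using fourier_series_exists[of "fourier u", OF fourier_summable[OF u] fourier_uminus_freq] by blast
  have ae: "AE x in T3. u x = g x" by (rule *[OF g(1)]) (simp add: g(2))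
  have "L2norm (\<lambda>x. fourier_partial (fourier u) (freq_ball (real n)) x - u x)
      = L2norm (\<lambda>x. fourier_partial (fourier u) (freq_ball (real n)) x - g x)" for n
  proof (rule L2norm_cong_AE)
    show "(\<lambda>x. fourier_partial (fourier u) (freq_ball (real n)) x - u x) \<in> borel_measurable T3"
      "(\<lambda>x. fourier_partial (fourier u) (freq_ball (real n)) x - g x) \<in> borel_measurable T3"
      by (intro borel_measurable_diff L2_fieldsD(2) fourier_partial_L2 freq_ball u g(1))+
  qed (use ae in \<open>auto elim: eventually_mono\<close>)
  then show "(\<lambda>n. L2norm (\<lambda>x. fourier_partial (fourier u) (freq_ball (real n)) x - u x)) \<longlonglongrightarrow> 0"
    using g(3) by simp
qed

lemma ip_tendsto:
  assumes f: "\<And>n. f n \<in> L2_fields" and g: "g \<in> L2_fields" and v: "v \<in> L2_fields"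
    and lim: "(\<lambda>n. L2norm (\<lambda>x. f n x - g x)) \<longlonglongrightarrow> 0"
  shows "(\<lambda>n. ip (f n) v) \<longlonglongrightarrow> ip g v"
proof -
  have "(\<lambda>n. ip (f n) v - ip g v) \<longlonglongrightarrow> 0"
  proof (rule Lim_null_comparison)
    show "\<forall>\<^sub>F n in sequentially. norm (ip (f n) v - ip g v) \<le> L2norm (\<lambda>x. f n x - g x) * L2norm v"
      using ip_le_L2norm[OF L2_fields_diff(1)[OF f g] v]
      by (intro always_eventually allI) (simp add: ip_diff_left[OF f g v])
    show "(\<lambda>n. L2norm (\<lambda>x. f n x - g x) * L2norm v) \<longlonglongrightarrow> 0"
      using tendsto_mult_right[OF lim] by simp
  qed
  then show ?thesis by (simp add: LIM_zero_iff)
qed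

theorem parseval:
  assumes u: "u \<in> L2_fields" and v: "v \<in> L2_fields"
  shows "((\<lambda>k. fourier u k \<bullet> fourier v k) has_sum ip u v) frequencies"
proof -
  have sm: "(\<lambda>k. (norm (fourier u k))\<^sup>2 + (norm (fourier v k))\<^sup>2) summable_on frequencies"
    by (intro summable_on_add fourier_summable u v)
  have le: "norm (fourier u k \<bullet> fourier v k) \<le> (norm (fourier u k))\<^sup>2 + (norm (fourier v k))\<^sup>2" for k
  proof -
    have "\<bar>fourier u k \<bullet> fourier v k\<bar> \<le> norm (fourier u k) * norm (fourier v k)" by (rule Cauchy_Schwarz_ineq2)
    also have "\<dots> \<le> (norm (fourier u k))\<^sup>2 + (norm (fourier v k))\<^sup>2"
    proof -
      have "0 \<le> norm (fourier u k) * norm (fourier v k)" by simp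
      then show ?thesis using sum_squares_bound[of "norm (fourier u k)" "norm (fourier v k)"] by linarith
    qed
    finally show ?thesis by simp
  qed
  have "(\<lambda>k. fourier u k \<bullet> fourier v k) summable_on frequencies"
    by (rule abs_summable_summable, rule Infinite_Sum.abs_summable_on_comparison_test'[OF sm le])
  then have hs: "((\<lambda>k. fourier u k \<bullet> fourier v k) has_sum infsum (\<lambda>k. fourier u k \<bullet> fourier v k) frequencies) frequencies"
    by (rule has_sum_infsum)
  then have "(\<lambda>n. \<Sum>k\<in>freq_ball (real n). fourier u k \<bullet> fourier v k) \<longlonglongrightarrow> infsum (\<lambda>k. fourier u k \<bullet> fourier v k) frequencies"
    unfolding has_sum_def using filterlim_compose freq_ball_exhausts by blast
  moreover have "(\<lambda>n. ip (fourier_partial (fourier u) (freq_ball (real n))) v) \<longlonglongrightarrow> ip u v"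
    by (rule ip_tendsto[OF fourier_partial_L2[OF freq_ball(2)] u v fourier_partial_tendsto(1)[OF u]])
  then have "(\<lambda>n. \<Sum>k\<in>freq_ball (real n). fourier u k \<bullet> fourier v k) \<longlonglongrightarrow> ip u v"
    unfolding ip_commute[of _ v] ip_fourier_partial[OF freq_ball(2) v] by (simp add: inner_commute)
  ultimately show ?thesis using hs LIMSEQ_unique by fastforce
qed

section \<open>Weak derivatives and solenoidal fields\<close>

lemma partial_eq:
  assumes "(f has_derivative f') (at x)"
  shows "partial b f x = f' b"
  unfolding partial_def by (simp add: frechet_derivative_at[OF assms, symmetric])

lemma smoothD:
  assumes "smooth f"
  shows "f differentiable (at x)" "(f has_derivative (\<lambda>v. frechet_derivative f (at x) v)) (at x)"
    "b \<in> Basis \<Longrightarrow> continuous_on UNIV (partial b f)" "continuous_on UNIV f"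
proof -
  have c1: "Ck (Suc 0) f" and c0: "Ck 0 f" using assms by (simp_all only: smooth_def)
  then show "f differentiable (at x)" by simp
  then show "(f has_derivative (\<lambda>v. frechet_derivative f (at x) v)) (at x)"
    by (simp add: frechet_derivative_works)
  show "b \<in> Basis \<Longrightarrow> continuous_on UNIV (partial b f)" using c1 by simp
  show "continuous_on UNIV f" using c0 by simp
qed

text \<open>Up to the factor \<open>2 * pi * \<i>\<close> the symbol of the divergence; complex
  linear in \<open>c\<close>, without conjugation.\<close>

definition kdot :: "real^3 \<Rightarrow> complex^3 \<Rightarrow> complex" where
  "kdot k c = (\<Sum>j\<in>UNIV. of_real (k $ j) * c $ j)"

lemma sum_Basis_vec3: "(\<Sum>b\<in>Basis. g b) = (\<Sum>j\<in>UNIV. g (axis j (1::real) :: real^3))"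
proof -
  have "(Basis :: (real^3) set) = range (\<lambda>j. axis j 1)" by (auto simp: Basis_vec_def)
  moreover have "inj (\<lambda>j. axis j (1::real) :: real^3)" by (auto simp: inj_on_def axis_eq_axis)
  ultimately show ?thesis by (metis (no_types, lifting) sum.reindex_cong)
qed

lemma kdot_add: "kdot k (c + d) = kdot k c + kdot k d"
  by (simp add: kdot_def distrib_left sum.distrib)

lemma kdot_scale: "kdot k (a *\<^sub>R c) = a *\<^sub>R kdot k c"
  by (simp add: kdot_def sum_distrib_left mult_ac scaleR_conv_of_real[where 'a=complex])

lemma smooth_plane_wave: "smooth (plane_wave c k)"
  unfolding smooth_def plane_wave_def[abs_def] using Ck_linear_wave[OF bounded_linear_re_part] by blast

lemma divergence_plane_wave: "(\<Sum>b\<in>Basis. partial b (plane_wave c k) x \<bullet> b) = Re (2 * pi * \<i> * kdot k c * wave k x)"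
proof -
  have "(\<Sum>b\<in>Basis. partial b (plane_wave c k) x \<bullet> b)
      = (\<Sum>j\<in>UNIV. Re (2 * pi * \<i> * of_real (k $ j) * c $ j * wave k x))"
    unfolding partial_plane_wave sum_Basis_vec3
    by (intro sum.cong refl) (simp add: plane_wave_def re_part_def inner_axis)
  also have "\<dots> = Re (\<Sum>j\<in>UNIV. 2 * pi * \<i> * of_real (k $ j) * c $ j * wave k x)" by (rule Re_sum[symmetric])
  also have "(\<Sum>j\<in>UNIV. 2 * pi * \<i> * of_real (k $ j) * c $ j * wave k x) = 2 * pi * \<i> * kdot k c * wave k x"
    by (simp only: kdot_def sum_distrib_left sum_distrib_right mult.assoc)
  finally show ?thesis .
qed

lemma integral_L2_component:
  assumes "u \<in> L2_fields"
  shows "(\<integral>x. u x \<partial>T3) = 0 \<longleftrightarrow> fourier u 0 = 0"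
proof -
  have "(\<integral>x. u x \<partial>T3) $ j = (\<integral>x. u x $ j \<partial>T3)" for j
    using integral_inner_left[OF integrable_L2(1)[OF assms], of "axis j 1"] by (simp add: inner_axis)
  moreover have "fourier u 0 $ j = of_real (\<integral>x. u x $ j \<partial>T3)" for j
    by (simp add: fourier_component)
  ultimately show ?thesis by (simp add: vec_eq_iff)
qed

definition solenoidal_coeffs :: "(real^3 \<Rightarrow> complex^3) \<Rightarrow> bool" where
  "solenoidal_coeffs c \<longleftrightarrow> c 0 = 0 \<and> (\<forall>k\<in>frequencies. kdot k (c k) = 0)"

lemma smooth_solenoidal_L2:
  assumes "v \<in> smooth_solenoidal"
  shows "v \<in> L2_fields"
  using assms unfolding smooth_solenoidal_def by (auto intro: continuous_in_L2_fields smoothD)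

lemma integral_scalar_partial:
  fixes v :: vfield and \<psi> :: "real^3 \<Rightarrow> real"
  assumes v: "smooth v" "torus_periodic v" and \<psi>: "smooth \<psi>" "torus_periodic \<psi>" and b: "b \<in> Basis"
  shows "(\<integral>x. partial b \<psi> x *\<^sub>R v x \<partial>T3) = - (\<integral>x. \<psi> x *\<^sub>R partial b v x \<partial>T3)"
proof -
  have cont: "continuous_on UNIV (\<lambda>x. \<psi> x *\<^sub>R partial b v x)" "continuous_on UNIV (\<lambda>x. partial b \<psi> x *\<^sub>R v x)"
    using smoothD[OF v(1)] smoothD[OF \<psi>(1)] b by (auto intro!: continuous_intros)
  have "(\<integral>x. (\<lambda>h. \<psi> x *\<^sub>R frechet_derivative v (at x) h + frechet_derivative \<psi> (at x) h *\<^sub>R v x) b \<partial>T3) = 0"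
  proof (rule integral_periodic_derivative[where f="\<lambda>x. \<psi> x *\<^sub>R v x"])
    show "((\<lambda>x. \<psi> x *\<^sub>R v x) has_derivative (\<lambda>h. \<psi> x *\<^sub>R frechet_derivative v (at x) h + frechet_derivative \<psi> (at x) h *\<^sub>R v x)) (at x)" for x
      by (rule has_derivative_scaleR[OF smoothD(2)[OF \<psi>(1)] smoothD(2)[OF v(1)]])
    show "continuous_on UNIV (\<lambda>x. \<psi> x *\<^sub>R frechet_derivative v (at x) b + frechet_derivative \<psi> (at x) b *\<^sub>R v x)"
      using continuous_on_add[OF cont] by (simp add: partial_def)
    show "\<psi> (x + b) *\<^sub>R v (x + b) = \<psi> x *\<^sub>R v x" for x
      using v(2) \<psi>(2) b by (simp add: torus_periodic_def)
  qed (rule b)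
  then have "(\<integral>x. \<psi> x *\<^sub>R partial b v x \<partial>T3) + (\<integral>x. partial b \<psi> x *\<^sub>R v x \<partial>T3) = 0"
    using T3_integrable_continuous[OF cont(1)] T3_integrable_continuous[OF cont(2)] by (simp add: partial_def)
  then show ?thesis by (simp add: eq_neg_iff_add_eq_0 add.commute)
qed

text \<open>Weak derivatives are tested with real functions. Letting \<open>z\<close> vary in the
  complex plane recovers the full complex coefficient from these real tests.\<close>

definition re_wave :: "complex \<Rightarrow> real^3 \<Rightarrow> real^3 \<Rightarrow> real" where
  "re_wave z k x = Re (z * wave k x)"

lemma bounded_linear_Re_mult: "bounded_linear (\<lambda>w. Re (z * w))"
  by (intro bounded_linear_compose[OF bounded_linear_Re] bounded_linear_mult_right)

lemma smooth_re_wave: "smooth (re_wave z k)"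
  unfolding smooth_def re_wave_def[abs_def] using Ck_linear_wave[OF bounded_linear_Re_mult] by blast

lemma periodic_re_wave: "k \<in> frequencies \<Longrightarrow> torus_periodic (re_wave z k)"
  by (simp add: torus_periodic_def re_wave_def wave_periodic)

lemma partial_re_wave: "partial b (re_wave z k) = re_wave (2 * pi * \<i> * of_real (k \<bullet> b) * z) k"
  unfolding re_wave_def[abs_def] partial_linear_wave[OF bounded_linear_Re_mult] by (simp add: mult_ac)

lemma integral_re_wave:
  assumes "u \<in> L2_fields"
  shows "integrable T3 (\<lambda>x. re_wave z k x *\<^sub>R u x)"
    and "(\<integral>x. re_wave z k x *\<^sub>R u x \<partial>T3) $ j = Re (z * cnj (fourier u k $ j))"
proof -
  have c: "continuous_on UNIV (re_wave z k)" by (rule smoothD[OF smooth_re_wave])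
  show i: "integrable T3 (\<lambda>x. re_wave z k x *\<^sub>R u x)"
  proof (rule Bochner_Integration.integrable_bound[of T3 "\<lambda>x. norm z * norm (u x)"])
    show "(\<lambda>x. re_wave z k x *\<^sub>R u x) \<in> borel_measurable T3"
      by (intro borel_measurable_scaleR T3_measurable_continuous[OF c] L2_fieldsD(2)[OF assms])
    have "\<bar>re_wave z k x\<bar> \<le> norm z" for x
      unfolding re_wave_def using abs_Re_le_cmod[of "z * wave k x"] by (simp add: norm_mult)
    then show "AE x in T3. norm (re_wave z k x *\<^sub>R u x) \<le> norm (norm z * norm (u x))"
      by (intro AE_I2) (simp add: mult_right_mono)
  qed (use integrable_L2(1)[OF assms] in simp)
  have "(\<integral>x. re_wave z k x *\<^sub>R u x \<partial>T3) $ j = (\<integral>x. re_wave z k x * u x $ j \<partial>T3)"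
    using integral_inner_left[OF i, of "axis j 1"] by (simp add: inner_axis)
  also have "\<dots> = (\<integral>x. Re (z * (complex_of_real (u x $ j) * wave k x)) \<partial>T3)"
    by (intro Bochner_Integration.integral_cong refl) (simp add: re_wave_def algebra_simps)
  also have "\<dots> = Re (\<integral>x. z * (complex_of_real (u x $ j) * wave k x) \<partial>T3)"
    by (rule integral_Re) (intro integrable_mult_right integrable_component_wave assms)
  also have "\<dots> = Re (z * (fourier u (- k) $ j))"
    by (simp only: integral_mult_right_zero fourier_component minus_minus)
  finally show "(\<integral>x. re_wave z k x *\<^sub>R u x \<partial>T3) $ j = Re (z * cnj (fourier u k $ j))"
    by (simp add: fourier_uminus_freq cnj_vec_def)
qed

lemma complex_eqI_Re_mult: "(\<And>z. Re (z * cnj a) = Re (z * cnj b)) \<Longrightarrow> a = b"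
proof -
  assume *: "\<And>z. Re (z * cnj a) = Re (z * cnj b)"
  show "a = b" using *[of 1] *[of \<i>] by (simp add: complex_eq_iff)
qed

lemma fourier_partial_of_weak:
  assumes u: "u \<in> L2_fields" and w: "is_weak_partial b u w" and b: "b \<in> Basis" and k: "k \<in> frequencies"
  shows "fourier w k = (\<chi> j. 2 * pi * \<i> * of_real (k \<bullet> b) * fourier u k $ j)"
proof -
  have wL: "w \<in> L2_fields" using w by (simp add: is_weak_partial_def)
  have "fourier w k $ j = 2 * pi * \<i> * of_real (k \<bullet> b) * fourier u k $ j" for j
  proof (rule complex_eqI_Re_mult)
    fix z
    have "(\<integral>x. partial b (re_wave z k) x *\<^sub>R u x \<partial>T3) = - (\<integral>x. re_wave z k x *\<^sub>R w x \<partial>T3)"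
      using w smooth_re_wave periodic_re_wave[OF k] unfolding is_weak_partial_def by blast
    then have "(\<integral>x. re_wave (2 * pi * \<i> * of_real (k \<bullet> b) * z) k x *\<^sub>R u x \<partial>T3) $ j = - ((\<integral>x. re_wave z k x *\<^sub>R w x \<partial>T3) $ j)"
      by (simp add: partial_re_wave)
    then have "Re (2 * pi * \<i> * of_real (k \<bullet> b) * z * cnj (fourier u k $ j)) = - Re (z * cnj (fourier w k $ j))"
      by (simp only: integral_re_wave(2)[OF u] integral_re_wave(2)[OF wL])
    then show "Re (z * cnj (fourier w k $ j)) = Re (z * cnj (2 * pi * \<i> * of_real (k \<bullet> b) * fourier u k $ j))"
      by (simp add: algebra_simps)
  qed
  then show ?thesis by (simp add: vec_eq_iff)
qed

lemma smooth_is_weak_partial: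
  assumes v: "smooth v" "torus_periodic v" and b: "b \<in> Basis"
  shows "is_weak_partial b v (partial b v)"
  unfolding is_weak_partial_def
proof (intro conjI allI impI)
  have "partial b v (x + c) = partial b v x" if c: "c \<in> Basis" for x c
  proof -
    have "((\<lambda>y. v (y + c)) has_derivative frechet_derivative v (at (x + c))) (at x)"
      using has_derivative_compose[OF has_derivative_add[OF has_derivative_ident has_derivative_const[of c]] smoothD(2)[OF v(1), of "x + c"]]
      by simp
    moreover have "(\<lambda>y. v (y + c)) = v" using v(2) c by (simp add: torus_periodic_def)
    ultimately have "(v has_derivative frechet_derivative v (at (x + c))) (at x)" by simp
    from partial_eq[OF this] show ?thesis by (simp add: partial_def)
  qed
  then show "partial b v \<in> L2_fields"
    by (intro continuous_in_L2_fields smoothD(3)[OF v(1) b]) (simp add: torus_periodic_def)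
qed (use integral_scalar_partial[OF v _ _ b] in auto)

text \<open>
  Integrate by parts in the trigonometric polynomials
  \<open>fourier_partial\<close>, which converge together with their derivatives.
\<close>

lemma weak_partial_exists:
  assumes u: "u \<in> L2_fields" and b: "b \<in> Basis"
    and sm: "(\<lambda>k. (norm k)\<^sup>2 * (norm (fourier u k))\<^sup>2) summable_on frequencies"
  shows "is_weak_partial b u (weak_partial b u)"
proof -
  define c where "c k = (\<chi> j. 2 * pi * \<i> * of_real (k \<bullet> b) * fourier u k $ j)" for k
  let ?A = "\<lambda>n. freq_ball (real n)"
  let ?f = "\<lambda>n. fourier_partial (fourier u) (?A n)"
  have creal: "c (- k) = cnj_vec (c k)" for k
    by (simp add: c_def cnj_vec_def vec_eq_iff fourier_uminus_freq)
  have nc: "(norm (c k))\<^sup>2 \<le> (2 * pi)\<^sup>2 * ((norm k)\<^sup>2 * (norm (fourier u k))\<^sup>2)" for k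
  proof -
    have "norm (c k) = 2 * pi * \<bar>k \<bullet> b\<bar> * norm (fourier u k)"
    proof -
      have "c k = (2 * pi * (k \<bullet> b)) *\<^sub>R (\<chi> j. \<i> * fourier u k $ j)"
        by (simp add: c_def vec_eq_iff scaleR_conv_of_real[where 'a=complex])
      moreover have "norm (\<chi> j. \<i> * fourier u k $ j) = norm (fourier u k)"
        by (simp add: norm_vec_def norm_mult)
      ultimately show ?thesis by (simp add: abs_mult)
    qed
    also have "\<dots> \<le> 2 * pi * norm k * norm (fourier u k)"
      using Basis_le_norm[OF b, of k] by (intro mult_right_mono mult_left_mono) auto
    finally have "(norm (c k))\<^sup>2 \<le> (2 * pi * norm k * norm (fourier u k))\<^sup>2" by (intro power_mono) auto
    then show ?thesis by (simp add: power_mult_distrib mult.assoc)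
  qed
  have "(\<lambda>k. (norm (c k))\<^sup>2) summable_on frequencies"
    by (rule summable_on_comparison_test[OF summable_on_cmult_right[OF sm]]) (use nc in auto)
  from fourier_series_exists[OF this creal] obtain w where w: "w \<in> L2_fields"
    "(\<lambda>n. L2norm (\<lambda>x. fourier_partial c (?A n) x - w x)) \<longlonglongrightarrow> 0" by blast
  have fL: "?f n \<in> L2_fields" and cL: "fourier_partial c (?A n) \<in> L2_fields" for n
    by (rule fourier_partial_L2[OF freq_ball(2)])+
  have fs: "smooth (?f n)" for n
    unfolding smooth_def fourier_partial_def[abs_def]
    by (intro allI Ck_sum) (use smooth_plane_wave in \<open>auto simp: smooth_def\<close>)
  have dpw: "(plane_wave d k has_derivative frechet_derivative (plane_wave d k) (at x)) (at x)" for d k x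
    using smoothD(2)[OF smooth_plane_wave] by simp
  have fpart: "partial b (?f n) = fourier_partial c (?A n)" for n
  proof
    fix x
    have "((\<lambda>x. \<Sum>k\<in>?A n. plane_wave (fourier u k) k x) has_derivative
        (\<lambda>h. \<Sum>k\<in>?A n. frechet_derivative (plane_wave (fourier u k) k) (at x) h)) (at x)"
      by (intro has_derivative_sum dpw)
    then have "partial b (?f n) x = (\<Sum>k\<in>?A n. frechet_derivative (plane_wave (fourier u k) k) (at x) b)"
      unfolding fourier_partial_def[abs_def] by (rule partial_eq)
    also have "\<dots> = (\<Sum>k\<in>?A n. plane_wave (c k) k x)"
      using partial_plane_wave[of b] by (simp add: partial_def c_def fun_eq_iff)
    finally show "partial b (?f n) x = fourier_partial c (?A n) x" by (simp add: fourier_partial_def)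
  qed
  have "is_weak_partial b u w"
    unfolding is_weak_partial_def
  proof (intro conjI allI impI)
    fix \<psi> :: "real^3 \<Rightarrow> real" assume \<psi>: "smooth \<psi> \<and> torus_periodic \<psi>"
    have test: "(\<integral>x. g x *\<^sub>R h x \<partial>T3) $ j = ip h (\<lambda>x. g x *\<^sub>R axis j 1)"
      if h: "h \<in> L2_fields" and g: "continuous_on UNIV g" "torus_periodic g" for g :: "real^3 \<Rightarrow> real" and h j
    proof -
      have gL: "(\<lambda>x. g x *\<^sub>R axis j 1) \<in> L2_fields" for j
        using g by (intro continuous_in_L2_fields) (auto intro!: continuous_intros simp: torus_periodic_def)
      have i: "integrable T3 (\<lambda>x. g x *\<^sub>R h x)"
      proof (rule integrable_product_bound[of "\<lambda>x. \<bar>g x\<bar>" "\<lambda>x. norm (h x)"])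
        show "integrable T3 (\<lambda>x. \<bar>g x\<bar>\<^sup>2)" using g by (intro T3_integrable_continuous continuous_intros)
        show "(\<lambda>x. g x *\<^sub>R h x) \<in> borel_measurable T3"
          by (intro borel_measurable_scaleR T3_measurable_continuous[OF g(1)] L2_fieldsD(2)[OF h])
      qed (use L2_fieldsD(3)[OF h] in simp_all)
      show ?thesis
        using integral_inner_left[OF i, of "axis j 1"] by (simp add: inner_axis ip_def mult.commute)
    qed
    have per: "torus_periodic (partial b \<psi>)"
    proof -
      have "partial b \<psi> (x + d) = partial b \<psi> x" if d: "d \<in> Basis" for x d
      proof -
        have "((\<lambda>y. \<psi> (y + d)) has_derivative frechet_derivative \<psi> (at (x + d))) (at x)"
          using has_derivative_compose[OF has_derivative_add[OF has_derivative_ident has_derivative_const[of d]] smoothD(2)[of \<psi> "x + d"]] \<psi>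
          by simp
        moreover have "(\<lambda>y. \<psi> (y + d)) = \<psi>" using \<psi> d by (simp add: torus_periodic_def)
        ultimately have "(\<psi> has_derivative frechet_derivative \<psi> (at (x + d))) (at x)" by simp
        from partial_eq[OF this] show ?thesis by (simp add: partial_def)
      qed
      then show ?thesis by (simp add: torus_periodic_def)
    qed
    have c\<psi>: "continuous_on UNIV (partial b \<psi>)" "continuous_on UNIV \<psi>" using \<psi> b smoothD by auto
    have "(\<integral>x. partial b \<psi> x *\<^sub>R u x \<partial>T3) $ j = - ((\<integral>x. \<psi> x *\<^sub>R w x \<partial>T3) $ j)" for j
    proof -
      have L: "(\<lambda>x. partial b \<psi> x *\<^sub>R axis j 1) \<in> L2_fields" "(\<lambda>x. \<psi> x *\<^sub>R axis j 1) \<in> L2_fields"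
        using c\<psi> per \<psi> by (auto intro!: continuous_in_L2_fields continuous_intros simp: torus_periodic_def)
      have "ip (?f n) (\<lambda>x. partial b \<psi> x *\<^sub>R axis j 1) = - ip (fourier_partial c (?A n)) (\<lambda>x. \<psi> x *\<^sub>R axis j 1)" for n
        using integral_scalar_partial[OF fs[of n] L2_fieldsD(1)[OF fL] _ _ b, of \<psi>] \<psi>
        unfolding fpart test[OF fL c\<psi>(1) per, symmetric] test[OF cL c\<psi>(2) conjunct2[OF \<psi>], symmetric] by simp
      moreover have "(\<lambda>n. ip (?f n) (\<lambda>x. partial b \<psi> x *\<^sub>R axis j 1)) \<longlonglongrightarrow> ip u (\<lambda>x. partial b \<psi> x *\<^sub>R axis j 1)"
        by (rule ip_tendsto[OF fL u L(1) fourier_partial_tendsto(1)[OF u]])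
      moreover have "(\<lambda>n. - ip (fourier_partial c (?A n)) (\<lambda>x. \<psi> x *\<^sub>R axis j 1)) \<longlonglongrightarrow> - ip w (\<lambda>x. \<psi> x *\<^sub>R axis j 1)"
        by (intro tendsto_minus ip_tendsto[OF cL w(1) L(2) w(2)])
      ultimately have "ip u (\<lambda>x. partial b \<psi> x *\<^sub>R axis j 1) = - ip w (\<lambda>x. \<psi> x *\<^sub>R axis j 1)"
        using LIMSEQ_unique by fastforce
      then show ?thesis using \<psi> by (simp add: test u w(1) c\<psi> per)
    qed
    then show "(\<integral>x. partial b \<psi> x *\<^sub>R u x \<partial>T3) = - (\<integral>x. \<psi> x *\<^sub>R w x \<partial>T3)" by (simp add: vec_eq_iff)
  qed (rule w(1))
  then show ?thesis unfolding weak_partial_def by (rule someI[of "is_weak_partial b u"])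
qed

lemma bounded_linear_kdot: "bounded_linear (kdot k)"
  by (intro linear_conv_bounded_linear[THEN iffD1] linearI kdot_add kdot_scale)

lemma kdot_0 [simp]: "kdot 0 c = 0" "kdot k 0 = 0"
  by (simp_all add: kdot_def)

lemma fourier_solenoidal_smooth:
  assumes v: "v \<in> smooth_solenoidal"
  shows "solenoidal_coeffs (fourier v)"
  unfolding solenoidal_coeffs_def
proof (intro conjI ballI)
  have vL: "v \<in> L2_fields" by (rule smooth_solenoidal_L2[OF v])
  have sm: "smooth v" "torus_periodic v" and dv: "\<And>x. (\<Sum>b\<in>Basis. partial b v x \<bullet> b) = 0" and mean: "(\<integral>x. v x \<partial>T3) = 0"
    using v by (auto simp: smooth_solenoidal_def)
  show "fourier v 0 = 0" using integral_L2_component[OF vL] mean by simp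
  fix k assume k: "k \<in> frequencies"
  have B: "axis j (1::real) \<in> (Basis :: (real^3) set)" for j by simp
  note wp = smooth_is_weak_partial[OF sm B]
  have pL: "partial (axis j 1) v \<in> L2_fields" for j using wp[of j] by (simp add: is_weak_partial_def)
  have "(\<Sum>j\<in>UNIV. fourier (partial (axis j 1) v) k $ j) = (\<Sum>j\<in>UNIV. 2 * pi * \<i> * of_real (k $ j) * fourier v k $ j)"
    by (intro sum.cong refl) (simp add: fourier_partial_of_weak[OF vL wp B k] inner_axis)
  also have "\<dots> = 2 * pi * \<i> * kdot k (fourier v k)"
    by (simp only: kdot_def sum_distrib_left mult.assoc)
  finally have "2 * pi * \<i> * kdot k (fourier v k) = (\<Sum>j\<in>UNIV. \<integral>x. complex_of_real (partial (axis j 1) v x $ j) * wave (- k) x \<partial>T3)"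
    by (simp only: fourier_component)
  also have "\<dots> = (\<integral>x. (\<Sum>j\<in>UNIV. complex_of_real (partial (axis j 1) v x $ j) * wave (- k) x) \<partial>T3)"
    by (rule Bochner_Integration.integral_sum[symmetric]) (rule integrable_component_wave[OF pL])
  also have "\<dots> = (\<integral>x. complex_of_real (\<Sum>b\<in>Basis. partial b v x \<bullet> b) * wave (- k) x \<partial>T3)"
    unfolding sum_Basis_vec3 by (simp add: inner_axis sum_distrib_right)
  also have "\<dots> = 0" by (simp add: dv)
  finally show "kdot k (fourier v k) = 0" by simp
qed

lemma fourier_partial_smooth_solenoidal:
  assumes c: "solenoidal_coeffs c" and A: "finite A" "A \<subseteq> frequencies"
  shows "fourier_partial c A \<in> smooth_solenoidal"
  unfolding smooth_solenoidal_def
proof (intro CollectI conjI allI)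
  have L: "fourier_partial c A \<in> L2_fields" by (rule fourier_partial_L2[OF A(2)])
  show "smooth (fourier_partial c A)"
    unfolding smooth_def fourier_partial_def[abs_def]
    by (intro allI Ck_sum) (use smooth_plane_wave in \<open>auto simp: smooth_def\<close>)
  show "torus_periodic (fourier_partial c A)" by (rule L2_fieldsD(1)[OF L])
  have "fourier (fourier_partial c A) 0 = (\<Sum>k\<in>A. fourier (plane_wave (c k) k) 0)"
    unfolding fourier_partial_def[abs_def] by (rule fourier_sum, rule plane_wave_L2) (use A in auto)
  also have "\<dots> = 0"
  proof (rule sum.neutral, rule ballI)
    fix k assume "k \<in> A"
    then show "fourier (plane_wave (c k) k) 0 = 0"
      using A c by (subst fourier_plane_wave) (auto simp: solenoidal_coeffs_def)
  qed
  finally show "(\<integral>x. fourier_partial c A x \<partial>T3) = 0" using integral_L2_component[OF L] by simp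
  fix x
  have dpw: "(plane_wave d k has_derivative frechet_derivative (plane_wave d k) (at x)) (at x)" for d k
    using smoothD(2)[OF smooth_plane_wave] by simp
  have "((\<lambda>x. \<Sum>k\<in>A. plane_wave (c k) k x) has_derivative
      (\<lambda>h. \<Sum>k\<in>A. frechet_derivative (plane_wave (c k) k) (at x) h)) (at x)"
    by (intro has_derivative_sum dpw)
  then have "partial b (fourier_partial c A) x = (\<Sum>k\<in>A. partial b (plane_wave (c k) k) x)" for b
    unfolding fourier_partial_def[abs_def] using partial_eq by (simp add: partial_def)
  then have "(\<Sum>b\<in>Basis. partial b (fourier_partial c A) x \<bullet> b)
      = (\<Sum>k\<in>A. \<Sum>b\<in>Basis. partial b (plane_wave (c k) k) x \<bullet> b)"
    by (simp only: inner_sum_left) (rule sum.swap)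
  also have "\<dots> = 0"
  proof (rule sum.neutral, rule ballI)
    fix k assume "k \<in> A"
    then have "kdot k (c k) = 0" using c A by (auto simp: solenoidal_coeffs_def)
    then show "(\<Sum>b\<in>Basis. partial b (plane_wave (c k) k) x \<bullet> b) = 0" by (simp only: divergence_plane_wave) simp
  qed
  finally show "(\<Sum>b\<in>Basis. partial b (fourier_partial c A) x \<bullet> b) = 0" .
qed

lemma solenoidal_coeffs_tendsto:
  assumes f: "\<And>n. solenoidal_coeffs (f n)"
    and lim: "\<And>k. k \<in> frequencies \<Longrightarrow> (\<lambda>n. f n k) \<longlonglongrightarrow> c k"
  shows "solenoidal_coeffs c"
  unfolding solenoidal_coeffs_def
proof (intro conjI ballI)
  show "c 0 = 0"
    using f lim[of 0] by (auto simp: solenoidal_coeffs_def LIMSEQ_const_iff)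
  fix k assume k: "k \<in> frequencies"
  have "(\<lambda>n. kdot k (f n k)) \<longlonglongrightarrow> kdot k (c k)"
    by (rule bounded_linear.tendsto[OF bounded_linear_kdot lim[OF k]])
  then show "kdot k (c k) = 0" using f k by (simp add: solenoidal_coeffs_def LIMSEQ_const_iff)
qed

text \<open>Coefficients are continuous in the \<open>L^2\<close> norm, so the closure inherits the
  linear conditions on them; conversely the partial sums of such a field are smooth, solenoidal and
  converge to it.\<close>

lemma H_space_iff: "u \<in> H_space \<longleftrightarrow> u \<in> L2_fields \<and> solenoidal_coeffs (fourier u)"
proof
  assume u: "u \<in> H_space"
  then have uL: "u \<in> L2_fields" by (simp add: H_space_def)
  have "\<exists>v\<in>smooth_solenoidal. L2norm (u - v) < 1 / real (Suc n)" for n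
    using u unfolding H_space_def by auto
  then obtain v where v: "\<And>n. v n \<in> smooth_solenoidal" "\<And>n. L2norm (u - v n) < 1 / real (Suc n)" by metis
  have "(\<lambda>n. L2norm (\<lambda>x. v n x - u x)) \<longlonglongrightarrow> 0"
  proof (rule Lim_null_comparison)
    have "L2norm (\<lambda>x. v n x - u x) = L2norm (u - v n)" for n
      using L2norm_minus_commute[of "v n" u] by (simp add: fun_diff_def)
    then show "\<forall>\<^sub>F n in sequentially. norm (L2norm (\<lambda>x. v n x - u x)) \<le> 1 / real (Suc n)"
      using v(2) by (simp add: less_imp_le)
    show "(\<lambda>n. 1 / real (Suc n)) \<longlonglongrightarrow> 0" by (rule LIMSEQ_Suc[OF lim_1_over_n])
  qed
  then have "solenoidal_coeffs (fourier u)"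
    using fourier_tendsto[of v u, OF smooth_solenoidal_L2[OF v(1)] uL] fourier_solenoidal_smooth[OF v(1)]
    by (rule_tac solenoidal_coeffs_tendsto[of "\<lambda>n. fourier (v n)" "fourier u"])
  with uL show "u \<in> L2_fields \<and> solenoidal_coeffs (fourier u)" by simp
next
  assume u: "u \<in> L2_fields \<and> solenoidal_coeffs (fourier u)"
  then have uL: "u \<in> L2_fields" by simp
  show "u \<in> H_space"
    unfolding H_space_def
  proof (intro CollectI conjI allI impI uL)
    fix e :: real assume e: "0 < e"
    obtain n where "\<forall>m\<ge>n. norm (L2norm (\<lambda>x. fourier_partial (fourier u) (freq_ball (real m)) x - u x) - 0) < e"
      using LIMSEQ_D[OF fourier_partial_tendsto(1)[OF uL] e] by (rule exE)
    then have "norm (L2norm (\<lambda>x. fourier_partial (fourier u) (freq_ball (real n)) x - u x) - 0) < e"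
      by simp
    then have "L2norm (u - fourier_partial (fourier u) (freq_ball (real n))) < e"
      using L2norm_minus_commute[of u "fourier_partial (fourier u) (freq_ball (real n))"] by (simp add: fun_diff_def)
    then show "\<exists>v\<in>smooth_solenoidal. L2norm (u - v) < e"
      using fourier_partial_smooth_solenoidal[OF conjunct2[OF u] freq_ball(1,2)] by (rule bexI)
  qed
qed

lemma solenoidal_coeffs_linear:
  shows "solenoidal_coeffs c \<Longrightarrow> solenoidal_coeffs d \<Longrightarrow> solenoidal_coeffs (\<lambda>k. c k + d k)"
    and "solenoidal_coeffs c \<Longrightarrow> solenoidal_coeffs (\<lambda>k. a k *\<^sub>R c k)"
  by (simp_all add: solenoidal_coeffs_def kdot_add kdot_scale)

lemma solenoidal_coeffs_sum:
  assumes "\<And>i. i \<in> I \<Longrightarrow> solenoidal_coeffs (f i)"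
  shows "solenoidal_coeffs (\<lambda>k. \<Sum>i\<in>I. f i k)"
  unfolding solenoidal_coeffs_def
proof (intro conjI ballI)
  show "(\<Sum>i\<in>I. f i 0) = 0" by (rule sum.neutral) (use assms in \<open>simp add: solenoidal_coeffs_def\<close>)
  fix k :: "real^3" assume k: "k \<in> frequencies"
  have "kdot k (\<Sum>i\<in>I. f i k) = (\<Sum>i\<in>I. kdot k (f i k))"
    by (rule linear_sum[OF bounded_linear.linear[OF bounded_linear_kdot]])
  also have "\<dots> = 0" by (rule sum.neutral) (use assms k in \<open>simp add: solenoidal_coeffs_def\<close>)
  finally show "kdot k (\<Sum>i\<in>I. f i k) = 0" .
qed

lemma H_space_L2: "u \<in> H_space \<Longrightarrow> u \<in> L2_fields"
  by (simp add: H_space_iff)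

lemma H_space_scale: "u \<in> H_space \<Longrightarrow> (\<lambda>x. a *\<^sub>R u x) \<in> H_space"
  using solenoidal_coeffs_linear(2)[of "fourier u" "\<lambda>_. a"] L2_fields_scale[of u a]
  by (simp add: H_space_iff fourier_scale[abs_def])

lemma H_space_sum:
  assumes "\<And>i. i \<in> I \<Longrightarrow> f i \<in> H_space"
  shows "(\<lambda>x. \<Sum>i\<in>I. f i x) \<in> H_space"
proof -
  have "fourier (\<lambda>x. \<Sum>i\<in>I. f i x) = (\<lambda>k. \<Sum>i\<in>I. fourier (f i) k)"
    by (intro ext fourier_sum H_space_L2 assms)
  moreover have "solenoidal_coeffs (\<lambda>k. \<Sum>i\<in>I. fourier (f i) k)"
    by (rule solenoidal_coeffs_sum) (use assms in \<open>simp add: H_space_iff\<close>)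
  moreover have "(\<lambda>x. \<Sum>i\<in>I. f i x) \<in> L2_fields" by (intro L2_fields_sum H_space_L2 assms)
  ultimately show ?thesis by (simp add: H_space_iff)
qed

lemma H_space_diff:
  assumes "u \<in> H_space" "v \<in> H_space"
  shows "(\<lambda>x. u x - v x) \<in> H_space"
proof -
  have "(\<lambda>x. u x - v x) \<in> L2_fields" using assms by (intro L2_fields_diff H_space_L2)
  moreover have "solenoidal_coeffs (\<lambda>k. fourier u k - fourier v k)"
    using solenoidal_coeffs_linear(1)[of "fourier u" "\<lambda>k. - 1 *\<^sub>R fourier v k"] solenoidal_coeffs_linear(2)[of "fourier v" "\<lambda>_. -1"] assms
    by (simp add: H_space_iff)
  moreover have "fourier (\<lambda>x. u x - v x) = (\<lambda>k. fourier u k - fourier v k)"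
    using assms by (intro ext fourier_diff H_space_L2)
  ultimately show ?thesis by (simp add: H_space_iff)
qed

text \<open>On \<open>H_space\<close> the field itself has the property that defines
  \<open>leray\<close>, so the choice is not void, and whatever was chosen differs from
  \<open>f\<close> by an element of \<open>H_space\<close> that is orthogonal to itself.\<close>

lemma leray_AE:
  assumes f: "f \<in> H_space"
  shows "leray f \<in> H_space" "AE x in T3. leray f x = f x"
proof -
  have "leray f \<in> H_space \<and> (\<forall>v\<in>H_space. ip (f - leray f) v = 0)"
    unfolding leray_def
    by (rule someI[of "\<lambda>g. g \<in> H_space \<and> (\<forall>v\<in>H_space. ip (f - g) v = 0)" f]) (simp add: f ip_def)
  then have g: "leray f \<in> H_space" and o: "\<And>v. v \<in> H_space \<Longrightarrow> ip (f - leray f) v = 0" by auto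
  show "leray f \<in> H_space" by (rule g)
  have d: "(\<lambda>x. f x - leray f x) \<in> H_space" by (rule H_space_diff[OF f g])
  have "ip (\<lambda>x. f x - leray f x) (\<lambda>x. f x - leray f x) = 0" using o[OF d] by (simp add: fun_diff_def)
  then have "AE x in T3. f x - leray f x = 0"
    by (intro L2norm_eq_0_AE H_space_L2[OF d]) (simp add: L2norm_def)
  then show "AE x in T3. leray f x = f x" by eventually_elim simp
qed

section \<open>Sobolev weights and the symbol of the Stokes operator\<close>

lemma sobolev_summable_weight:
  assumes "u \<in> sobolev s" "\<And>k. k \<in> frequencies \<Longrightarrow> 0 \<le> g k"
    and "\<And>k. k \<in> frequencies \<Longrightarrow> g k \<le> (1 + (2 * pi * norm k)\<^sup>2) powr s"
  shows "(\<lambda>k. g k * (norm (fourier u k))\<^sup>2) summable_on frequencies"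
proof (rule summable_on_comparison_test)
  show "sobolev_weight s u summable_on frequencies" using assms(1) by (simp add: sobolev_def)
qed (use assms(2,3) in \<open>auto simp: sobolev_weight_def intro: mult_right_mono\<close>)

lemma sobolev_L2: "u \<in> sobolev s \<Longrightarrow> u \<in> L2_fields"
  by (simp add: sobolev_def)

lemma sobolev_weak_partial:
  assumes u: "u \<in> sobolev s" and s: "1 \<le> s" and b: "b \<in> Basis"
  shows "is_weak_partial b u (weak_partial b u)"
    and "k \<in> frequencies \<Longrightarrow> fourier (weak_partial b u) k = (\<chi> j. 2 * pi * \<i> * of_real (k \<bullet> b) * fourier u k $ j)"
proof -
  have "(\<lambda>k. (norm k)\<^sup>2 * (norm (fourier u k))\<^sup>2) summable_on frequencies"
  proof (rule sobolev_summable_weight[OF u])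
    fix k :: "real^3"
    have pi: "1 \<le> (2 * pi)\<^sup>2" by (rule one_le_power) (use pi_gt3 in simp)
    have "(norm k)\<^sup>2 \<le> (2 * pi)\<^sup>2 * (norm k)\<^sup>2" using mult_right_mono[OF pi, of "(norm k)\<^sup>2"] by simp
    also have "\<dots> \<le> (1 + (2 * pi * norm k)\<^sup>2) powr 1" by (simp add: power_mult_distrib add_nonneg_nonneg)
    also have "\<dots> \<le> (1 + (2 * pi * norm k)\<^sup>2) powr s" using s by (intro powr_mono) auto
    finally show "(norm k)\<^sup>2 \<le> (1 + (2 * pi * norm k)\<^sup>2) powr s" .
  qed simp
  then show w: "is_weak_partial b u (weak_partial b u)"
    by (rule weak_partial_exists[OF sobolev_L2[OF u] b])
  show "k \<in> frequencies \<Longrightarrow> fourier (weak_partial b u) k = (\<chi> j. 2 * pi * \<i> * of_real (k \<bullet> b) * fourier u k $ j)"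
    by (rule fourier_partial_of_weak[OF sobolev_L2[OF u] w b])
qed

text \<open>The Laplacian multiplies each coefficient by a real scalar and hence preserves
  \<open>H_space\<close>; on it \<open>leray\<close> is the identity almost everywhere.\<close>

lemma stokes_fourier:
  assumes u: "u \<in> stokes_domain" and k: "k \<in> frequencies"
  shows "stokes u \<in> L2_fields" "fourier (stokes u) k = (2 * pi * norm k)\<^sup>2 *\<^sub>R fourier u k"
proof -
  have us: "u \<in> sobolev 2" and uH: "u \<in> H_space" using u by (auto simp: stokes_domain_def)
  define f where "f x = - (\<Sum>b\<in>Basis. weak_partial b (weak_partial b u) x)" for x
  have w1: "is_weak_partial b u (weak_partial b u)"
    "\<And>k. k \<in> frequencies \<Longrightarrow> fourier (weak_partial b u) k = (\<chi> j. 2 * pi * \<i> * of_real (k \<bullet> b) * fourier u k $ j)"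
    if "b \<in> Basis" for b using sobolev_weak_partial[OF us _ that] by auto
  have wL: "weak_partial b u \<in> L2_fields" if "b \<in> Basis" for b using w1(1)[OF that] by (simp add: is_weak_partial_def)
  have w2: "is_weak_partial b (weak_partial b u) (weak_partial b (weak_partial b u))" if b: "b \<in> Basis" for b
  proof (rule weak_partial_exists[OF wL[OF b] b])
    have "(\<lambda>k. ((norm k)\<^sup>2 * (2 * pi * (k \<bullet> b))\<^sup>2) * (norm (fourier u k))\<^sup>2) summable_on frequencies"
    proof (rule sobolev_summable_weight[OF us])
      fix k :: "real^3"
      have "(k \<bullet> b)\<^sup>2 \<le> (norm k)\<^sup>2" using Basis_le_norm[OF b, of k] by (simp add: abs_le_square_iff[symmetric])
      then have "(norm k)\<^sup>2 * (2 * pi * (k \<bullet> b))\<^sup>2 \<le> (norm k)\<^sup>2 * (2 * pi * norm k)\<^sup>2"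
        by (intro mult_left_mono) (auto simp: power_mult_distrib)
      also have "\<dots> \<le> (2 * pi * norm k)\<^sup>2 * (2 * pi * norm k)\<^sup>2"
      proof (intro mult_right_mono power_mono)
        show "norm k \<le> 2 * pi * norm k" using pi_gt3 mult_right_mono[of 1 "2 * pi" "norm k"] by simp
      qed auto
      also have "\<dots> \<le> (1 + (2 * pi * norm k)\<^sup>2) * (1 + (2 * pi * norm k)\<^sup>2)"
        by (intro mult_mono) auto
      also have "\<dots> = (1 + (2 * pi * norm k)\<^sup>2) powr 2"
        by (subst powr_numeral) (auto simp: power2_eq_square add_pos_nonneg)
      finally show "(norm k)\<^sup>2 * (2 * pi * (k \<bullet> b))\<^sup>2 \<le> (1 + (2 * pi * norm k)\<^sup>2) powr 2" .
    qed simp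
    moreover have "(norm k)\<^sup>2 * (norm (fourier (weak_partial b u) k))\<^sup>2
        = ((norm k)\<^sup>2 * (2 * pi * (k \<bullet> b))\<^sup>2) * (norm (fourier u k))\<^sup>2" if k: "k \<in> frequencies" for k
    proof -
      have "fourier (weak_partial b u) k = (2 * pi * (k \<bullet> b)) *\<^sub>R (\<chi> j. \<i> * fourier u k $ j)"
        unfolding w1(2)[OF b k] by (simp add: vec_eq_iff scaleR_conv_of_real[where 'a=complex])
      moreover have "norm (\<chi> j. \<i> * fourier u k $ j) = norm (fourier u k)"
        by (simp add: norm_vec_def norm_mult)
      ultimately show ?thesis by (simp add: power_mult_distrib)
    qed
    ultimately show "(\<lambda>k. (norm k)\<^sup>2 * (norm (fourier (weak_partial b u) k))\<^sup>2) summable_on frequencies"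
      by (subst summable_on_cong) assumption+
  qed
  have w2L: "weak_partial b (weak_partial b u) \<in> L2_fields" if "b \<in> Basis" for b
    using w2[OF that] by (simp add: is_weak_partial_def)
  have sL: "(\<lambda>x. \<Sum>b\<in>Basis. weak_partial b (weak_partial b u) x) \<in> L2_fields"
    by (rule L2_fields_sum[OF w2L])
  have f_eq: "f = (\<lambda>x. (-1) *\<^sub>R (\<Sum>b\<in>Basis. weak_partial b (weak_partial b u) x))" by (simp add: f_def fun_eq_iff)
  have fL: "f \<in> L2_fields" unfolding f_eq by (rule L2_fields_scale[OF sL])
  have ff: "fourier f k = (2 * pi * norm k)\<^sup>2 *\<^sub>R fourier u k" if k: "k \<in> frequencies" for k
  proof -
    have "fourier f k = (-1) *\<^sub>R (\<Sum>b\<in>Basis. fourier (weak_partial b (weak_partial b u)) k)"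
      unfolding f_eq fourier_scale using fourier_sum[OF w2L] by simp
    also have "\<dots> = (-1) *\<^sub>R (\<Sum>b\<in>Basis. (- ((2 * pi)\<^sup>2 * (k \<bullet> b)\<^sup>2)) *\<^sub>R fourier u k)"
    proof (intro arg_cong[where f="\<lambda>v. (-1) *\<^sub>R v"] sum.cong refl)
      fix b :: "real^3" assume b: "b \<in> Basis"
      show "fourier (weak_partial b (weak_partial b u)) k = (- ((2 * pi)\<^sup>2 * (k \<bullet> b)\<^sup>2)) *\<^sub>R fourier u k"
        unfolding fourier_partial_of_weak[OF wL[OF b] w2[OF b] b k] w1(2)[OF b k]
        by (simp add: vec_eq_iff scaleR_conv_of_real[where 'a=complex] power2_eq_square algebra_simps)
    qed
    also have "\<dots> = ((2 * pi)\<^sup>2 * (\<Sum>b\<in>Basis. (k \<bullet> b)\<^sup>2)) *\<^sub>R fourier u k"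
      by (simp add: sum_negf sum_distrib_left flip: scaleR_sum_left)
    also have "(\<Sum>b\<in>Basis. (k \<bullet> b)\<^sup>2) = (norm k)\<^sup>2"
      unfolding power2_norm_eq_inner euclidean_inner[of k k] by (simp add: power2_eq_square)
    finally show ?thesis by (simp add: power_mult_distrib)
  qed
  have "solenoidal_coeffs (fourier f)"
  proof -
    have "solenoidal_coeffs (\<lambda>k. (2 * pi * norm k)\<^sup>2 *\<^sub>R fourier u k)"
      using uH by (intro solenoidal_coeffs_linear(2)) (simp add: H_space_iff)
    then show ?thesis by (simp add: solenoidal_coeffs_def ff)
  qed
  then have fH: "f \<in> H_space" using fL by (simp add: H_space_iff)
  have st: "stokes u = leray f" by (simp add: stokes_def f_def[abs_def])
  show L: "stokes u \<in> L2_fields" unfolding st by (rule H_space_L2[OF leray_AE(1)[OF fH]])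
  show "fourier (stokes u) k = (2 * pi * norm k)\<^sup>2 *\<^sub>R fourier u k"
    using fourier_cong_AE[OF L fL] leray_AE(2)[OF fH] ff[OF k] by (simp add: st)
qed

section \<open>The Stokes eigenbasis\<close>

definition wave_eigenvalue :: "real^3 \<Rightarrow> real" where
  "wave_eigenvalue m = (2 * pi * norm m)\<^sup>2"

definition freq_sphere :: "real \<Rightarrow> (real^3) set" where
  "freq_sphere \<rho> = {m \<in> frequencies. wave_eigenvalue m = \<rho>}"

lemma finite_freq_wave_eigenvalue_le: "finite {m \<in> frequencies. wave_eigenvalue m \<le> R}"
proof -
  have "norm m \<le> sqrt R" if "wave_eigenvalue m \<le> R" for m
  proof (rule real_le_rsqrt)
    have "1 * norm m \<le> 2 * pi * norm m" using pi_gt3 by (intro mult_right_mono) auto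
    then have "(norm m)\<^sup>2 \<le> wave_eigenvalue m" unfolding wave_eigenvalue_def by (intro power_mono) auto
    then show "(norm m)\<^sup>2 \<le> R" using that by linarith
  qed
  then have "{m \<in> frequencies. wave_eigenvalue m \<le> R} \<subseteq> {m \<in> frequencies. norm m \<le> sqrt R}" by blast
  then show ?thesis by (rule finite_subset) (rule finite_frequency_ball)
qed

lemma finite_freq_sphere: "finite (freq_sphere \<rho>)"
  by (rule finite_subset[OF _ finite_freq_wave_eigenvalue_le[of \<rho>]]) (auto simp: freq_sphere_def)

lemma wave_eigenvalue_ge_1:
  assumes "m \<in> frequencies" "m \<noteq> 0"
  shows "1 \<le> wave_eigenvalue m"
proof -
  have "1 * 1 \<le> 2 * pi * norm m"
    using norm_frequency_ge_1[OF assms] pi_gt3 by (intro mult_mono) auto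
  then show ?thesis unfolding wave_eigenvalue_def by (intro one_le_power) simp
qed

lemma summable_on_finite_sum:
  fixes f :: "'i \<Rightarrow> 'a \<Rightarrow> 'b::{topological_comm_monoid_add, t2_space}"
  shows "(\<And>i. i \<in> I \<Longrightarrow> f i summable_on A) \<Longrightarrow> (\<lambda>x. \<Sum>i\<in>I. f i x) summable_on A"
  by (induction I rule: infinite_finite_induct) (simp_all add: summable_on_add)

text \<open>The definition of the eigenbasis provides neither finite multiplicities nor a gap above
  0; both are obtained by comparing eigenfunctions with plane waves.\<close>

locale stokes_basis =
  fixes \<phi> :: "nat \<Rightarrow> vfield" and lam :: "nat \<Rightarrow> real"
  assumes eigenbasis: "stokes_eigenbasis \<phi> lam"
begin

lemma phi_domain: "\<phi> n \<in> stokes_domain" and phi_H: "\<phi> n \<in> H_space" and phi_L2: "\<phi> n \<in> L2_fields"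
  and lam_pos: "0 < lam n" and phi_eigen: "AE x in T3. stokes (\<phi> n) x = lam n *\<^sub>R \<phi> n x"
  and phi_orthonormal: "ip (\<phi> j) (\<phi> k) = (if j = k then 1 else 0)"
  and phi_complete: "u \<in> H_space \<Longrightarrow>
    (\<lambda>n. L2norm (\<lambda>x. u x - (\<Sum>k<n. ip u (\<phi> k) *\<^sub>R \<phi> k x))) \<longlonglongrightarrow> 0"
  using eigenbasis unfolding stokes_eigenbasis_def by (auto simp: stokes_domain_def intro: H_space_L2)

abbreviation coord :: "vfield \<Rightarrow> nat \<Rightarrow> real" where
  "coord u \<equiv> (\<lambda>k. ip u (\<phi> k))"

definition phi_sum :: "(nat \<Rightarrow> real) \<Rightarrow> nat set \<Rightarrow> vfield" where
  "phi_sum c K x = (\<Sum>k\<in>K. c k *\<^sub>R \<phi> k x)"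

lemma phi_sum_H: "phi_sum c K \<in> H_space"
  unfolding phi_sum_def[abs_def] by (intro H_space_sum H_space_scale phi_H)

lemma phi_sum_L2: "phi_sum c K \<in> L2_fields"
  by (rule H_space_L2[OF phi_sum_H])

lemma ip_phi_sum: "u \<in> L2_fields \<Longrightarrow> ip (phi_sum c K) u = (\<Sum>k\<in>K. c k * ip u (\<phi> k))"
  unfolding phi_sum_def[abs_def]
  by (subst ip_sum_left) (auto simp: ip_scale_left ip_commute[of "\<phi> _"] intro: L2_fields_scale phi_L2)

lemma coord_phi: "coord (\<phi> j) = unit_seq j"
  by (auto simp: phi_orthonormal unit_seq_def fun_eq_iff)

lemma coord_phi_sum: "finite K \<Longrightarrow> coord (phi_sum c K) j = (if j \<in> K then c j else 0)"
  by (simp add: ip_phi_sum phi_L2 phi_orthonormal sum.delta' if_distrib[of "\<lambda>x. c _ * x"] cong: if_cong)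

lemma phi_complete': "u \<in> H_space \<Longrightarrow> (\<lambda>n. L2norm (\<lambda>x. phi_sum (coord u) {..<n} x - u x)) \<longlonglongrightarrow> 0"
  using phi_complete[of u] unfolding phi_sum_def L2norm_minus_commute[of u] by simp

lemma coord_parseval:
  assumes "u \<in> H_space" "v \<in> H_space"
  shows "(\<lambda>k. coord u k * coord v k) sums ip u v"
proof -
  have "(\<lambda>n. ip (phi_sum (coord u) {..<n}) v) \<longlonglongrightarrow> ip u v"
    by (rule ip_tendsto[OF phi_sum_L2 _ _ phi_complete']) (use assms in \<open>auto intro: H_space_L2\<close>)
  then show ?thesis by (simp add: sums_def ip_phi_sum[OF H_space_L2[OF assms(2)]])
qed

text \<open>In Fourier variables the eigenvalue equation reads \<open>(wave_eigenvalue m - lam n)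
  *\<^sub>R fourier (\<phi> n) m = 0\<close>. In particular eigenfunctions are trigonometric
  polynomials up to null sets.\<close>

lemma phi_fourier_support:
  assumes m: "m \<in> frequencies" and nz: "fourier (\<phi> n) m \<noteq> 0"
  shows "lam n = wave_eigenvalue m"
proof -
  have "fourier (stokes (\<phi> n)) m = fourier (\<lambda>x. lam n *\<^sub>R \<phi> n x) m"
    by (rule fourier_cong_AE[OF stokes_fourier(1)[OF phi_domain m] L2_fields_scale[OF phi_L2] phi_eigen])
  then have "(wave_eigenvalue m - lam n) *\<^sub>R fourier (\<phi> n) m = 0"
    by (simp add: stokes_fourier(2)[OF phi_domain m] fourier_scale wave_eigenvalue_def scaleR_diff_left)
  then show ?thesis using nz by simp
qed

lemma fourier_ip_sphere:
  assumes "lam j = \<rho>" "u \<in> L2_fields"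
  shows "ip (\<phi> j) u = (\<Sum>m\<in>freq_sphere \<rho>. fourier (\<phi> j) m \<bullet> fourier u m)"
proof -
  have "((\<lambda>m. fourier (\<phi> j) m \<bullet> fourier u m) has_sum (\<Sum>m\<in>freq_sphere \<rho>. fourier (\<phi> j) m \<bullet> fourier u m)) (freq_sphere \<rho>)"
    by (rule has_sum_finite[OF finite_freq_sphere])
  then have "((\<lambda>m. fourier (\<phi> j) m \<bullet> fourier u m) has_sum (\<Sum>m\<in>freq_sphere \<rho>. fourier (\<phi> j) m \<bullet> fourier u m)) frequencies"
    by (rule has_sum_cong_neutral[THEN iffD1, rotated -1])
       (auto simp: freq_sphere_def assms(1)[symmetric], metis phi_fourier_support inner_zero_left)
  then show ?thesis using parseval[OF phi_L2 assms(2), of j] has_sum_unique by blast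
qed

lemma lam_ge_1: "1 \<le> lam n"
proof -
  have "\<exists>m\<in>freq_sphere (lam n). fourier (\<phi> n) m \<noteq> 0"
  proof (rule ccontr)
    assume "\<not> ?thesis"
    then have "ip (\<phi> n) (\<phi> n) = 0" unfolding fourier_ip_sphere[OF refl phi_L2] by (intro sum.neutral) simp
    then show False by (simp add: phi_orthonormal)
  qed
  then obtain m where m: "m \<in> freq_sphere (lam n)" "fourier (\<phi> n) m \<noteq> 0" by (rule bexE)
  have "fourier (\<phi> n) 0 = 0" using phi_H[of n] by (simp add: H_space_iff solenoidal_coeffs_def)
  then have "m \<noteq> 0" using m by auto
  then show ?thesis using wave_eigenvalue_ge_1[of m] m(1) by (simp add: freq_sphere_def)
qed

lemma bessel_phi:
  assumes K: "finite K" and u: "u \<in> L2_fields"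
  shows "(\<Sum>k\<in>K. (ip (\<phi> k) u)\<^sup>2) \<le> ip u u"
proof -
  let ?p = "phi_sum (coord u) K"
  have "ip ?p ?p = (\<Sum>k\<in>K. (coord u k)\<^sup>2)"
    unfolding ip_phi_sum[OF phi_sum_L2] using K
    by (intro sum.cong refl) (simp add: coord_phi_sum[OF K] power2_eq_square)
  moreover have "ip ?p u = (\<Sum>k\<in>K. (coord u k)\<^sup>2)" by (simp add: ip_phi_sum[OF u] power2_eq_square)
  moreover have "0 \<le> ip (\<lambda>x. u x - ?p x) (\<lambda>x. u x - ?p x)" by (rule ip_self_nonneg)
  moreover have "ip (\<lambda>x. u x - ?p x) (\<lambda>x. u x - ?p x) = ip u u - ip ?p u - (ip ?p u - ip ?p ?p)"
    unfolding ip_diff_right[OF u phi_sum_L2 L2_fields_diff(1)[OF u phi_sum_L2]]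
      ip_diff_left[OF u phi_sum_L2 u] ip_diff_left[OF u phi_sum_L2 phi_sum_L2] ip_commute[of u ?p] by simp
  ultimately show ?thesis by (simp add: ip_commute[of "\<phi> _" u])
qed

text \<open>
  \<open>\<Sum>k. (norm (fourier (\<phi> k) m))\<^sup>2\<close> is bounded for each \<open>m\<close> by Bessel's inequality, while each \<open>\<phi> k\<close> has
  unit mass on its sphere.
\<close>

lemma finite_lam_le: "finite {k. lam k \<le> R}"
proof -
  define A where "A = {m \<in> frequencies. wave_eigenvalue m \<le> R}"
  have A: "finite A" unfolding A_def by (rule finite_freq_wave_eigenvalue_le)
  define B where "B = (\<Sum>m\<in>A. \<Sum>e\<in>Basis. ip (plane_wave e m) (plane_wave e m))"
  have cB: "real (card K) \<le> B" if K: "finite K" "K \<subseteq> {k. lam k \<le> R}" for K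
  proof -
    have "1 \<le> (\<Sum>m\<in>A. \<Sum>e\<in>Basis. (ip (\<phi> k) (plane_wave e m))\<^sup>2)" if k: "k \<in> K" for k
    proof -
      have "1 = (\<Sum>m\<in>freq_sphere (lam k). fourier (\<phi> k) m \<bullet> fourier (\<phi> k) m)"
        using fourier_ip_sphere[OF refl phi_L2, of k k] by (simp add: phi_orthonormal)
      also have "\<dots> \<le> (\<Sum>m\<in>A. fourier (\<phi> k) m \<bullet> fourier (\<phi> k) m)"
        using k K by (intro sum_mono2 A) (auto simp: A_def freq_sphere_def)
      also have "\<dots> = (\<Sum>m\<in>A. \<Sum>e\<in>Basis. (ip (\<phi> k) (plane_wave e m))\<^sup>2)"
        by (intro sum.cong refl, subst euclidean_inner) (simp add: ip_plane_wave[OF phi_L2] power2_eq_square)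
      finally show ?thesis .
    qed
    then have "(\<Sum>k\<in>K. 1) \<le> (\<Sum>k\<in>K. \<Sum>m\<in>A. \<Sum>e\<in>Basis. (ip (\<phi> k) (plane_wave e m))\<^sup>2)" by (rule sum_mono)
    also have "\<dots> = (\<Sum>m\<in>A. \<Sum>e\<in>Basis. \<Sum>k\<in>K. (ip (\<phi> k) (plane_wave e m))\<^sup>2)"
      by (subst sum.swap, intro sum.cong refl, rule sum.swap)
    also have "\<dots> \<le> B"
      unfolding B_def by (intro sum_mono bessel_phi K plane_wave_L2) (auto simp: A_def)
    finally show ?thesis by simp
  qed
  have "card K \<le> nat \<lceil>B\<rceil>" if "finite K" "K \<subseteq> {k. lam k \<le> R}" for K
    by (rule of_nat_le_iff[where 'a=real, THEN iffD1], rule order_trans[OF cB[OF that] real_nat_ceiling_ge])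
  then show ?thesis
    by (intro finite_if_finite_subsets_card_bdd[of _ "nat \<lceil>B\<rceil>", THEN conjunct1] allI impI) auto
qed

lemma finite_lam_eq: "finite {k. lam k = \<rho>}"
  by (rule finite_subset[OF _ finite_lam_le[of \<rho>]]) auto

text \<open>The Fourier coefficient at \<open>m\<close> of the field with Stokes coordinates
  \<open>x\<close>. Only modes with the eigenvalue of \<open>m\<close> contribute, so the sum is
  finite and makes sense for every sequence.\<close>

definition mode_fourier :: "(nat \<Rightarrow> real) \<Rightarrow> real^3 \<Rightarrow> complex^3" where
  "mode_fourier x m = (\<Sum>k\<in>{k. lam k = wave_eigenvalue m}. x k *\<^sub>R fourier (\<phi> k) m)"

lemma mode_fourier_add: "mode_fourier (\<lambda>k. x k + y k) m = mode_fourier x m + mode_fourier y m"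
  by (simp add: mode_fourier_def scaleR_add_left sum.distrib)

lemma mode_fourier_scale: "mode_fourier (\<lambda>k. a * x k) m = a *\<^sub>R mode_fourier x m"
  by (simp add: mode_fourier_def scaleR_sum_right)

lemma cnj_vec_linear: "cnj_vec (a + b) = cnj_vec a + cnj_vec b" "cnj_vec (r *\<^sub>R a) = r *\<^sub>R cnj_vec a"
  by (simp_all add: cnj_vec_def vec_eq_iff)

lemma mode_fourier_uminus: "mode_fourier x (- m) = cnj_vec (mode_fourier x m)"
proof -
  have "linear cnj_vec" by (rule linearI) (simp_all add: cnj_vec_linear)
  then show ?thesis
    by (simp add: mode_fourier_def wave_eigenvalue_def linear_sum cnj_vec_linear fourier_uminus_freq)
qed

lemma mode_fourier_solenoidal: "solenoidal_coeffs (mode_fourier x)"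
  unfolding solenoidal_coeffs_def
proof (intro conjI ballI)
  have s: "fourier (\<phi> k) 0 = 0" "m \<in> frequencies \<Longrightarrow> kdot m (fourier (\<phi> k) m) = 0" for k m
    using phi_H[of k] by (auto simp: H_space_iff solenoidal_coeffs_def)
  show "mode_fourier x 0 = 0" by (simp add: mode_fourier_def s)
  fix m :: "real^3" assume "m \<in> frequencies"
  then show "kdot m (mode_fourier x m) = 0"
    unfolding mode_fourier_def linear_sum[OF bounded_linear.linear[OF bounded_linear_kdot]]
    by (simp add: kdot_scale s)
qed

lemma fourier_eq_mode_fourier:
  assumes u: "u \<in> H_space" and m: "m \<in> frequencies"
  shows "fourier u m = mode_fourier (coord u) m"
proof -
  let ?I = "{k. lam k = wave_eigenvalue m}"
  have "(\<lambda>n. fourier (phi_sum (coord u) {..<n}) m) \<longlonglongrightarrow> fourier u m"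
    by (rule fourier_tendsto[OF phi_sum_L2 H_space_L2[OF u] phi_complete'[OF u] m])
  moreover have "(\<lambda>n. fourier (phi_sum (coord u) {..<n}) m) \<longlonglongrightarrow> mode_fourier (coord u) m"
  proof (rule tendsto_eventually)
    obtain n0 where n0: "?I \<subseteq> {..<n0}"
      using finite_nat_iff_bounded finite_lam_eq by blast
    have "fourier (phi_sum (coord u) {..<n}) m = mode_fourier (coord u) m" if "n0 \<le> n" for n
    proof -
      have "fourier (phi_sum (coord u) {..<n}) m = (\<Sum>k<n. coord u k *\<^sub>R fourier (\<phi> k) m)"
        unfolding phi_sum_def[abs_def]
        by (subst fourier_sum) (auto simp: fourier_scale intro: L2_fields_scale phi_L2)
      also have "\<dots> = mode_fourier (coord u) m"
        unfolding mode_fourier_def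
        by (rule sum.mono_neutral_right) (use n0 that phi_fourier_support[OF m] in auto)
      finally show ?thesis .
    qed
    then show "\<forall>\<^sub>F n in sequentially. fourier (phi_sum (coord u) {..<n}) m = mode_fourier (coord u) m"
      by (auto simp: eventually_sequentially)
  qed
  ultimately show ?thesis by (rule LIMSEQ_unique)
qed

text \<open>Within one eigenspace the passage from coordinates to Fourier coefficients is isometric,
  by Parseval's identity and orthonormality.\<close>

lemma mode_fourier_sphere:
  "(\<Sum>m\<in>freq_sphere \<rho>. (norm (mode_fourier x m))\<^sup>2) = (\<Sum>k\<in>{k. lam k = \<rho>}. (x k)\<^sup>2)"
proof -
  let ?I = "{k. lam k = \<rho>}"
  have "(\<Sum>m\<in>freq_sphere \<rho>. (norm (mode_fourier x m))\<^sup>2)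
      = (\<Sum>m\<in>freq_sphere \<rho>. \<Sum>j\<in>?I. \<Sum>k\<in>?I. x j * x k * (fourier (\<phi> k) m \<bullet> fourier (\<phi> j) m))"
    by (intro sum.cong refl)
       (simp add: power2_norm_eq_inner mode_fourier_def freq_sphere_def inner_sum_left inner_sum_right sum_distrib_left mult_ac)
  also have "\<dots> = (\<Sum>j\<in>?I. \<Sum>k\<in>?I. \<Sum>m\<in>freq_sphere \<rho>. x j * x k * (fourier (\<phi> k) m \<bullet> fourier (\<phi> j) m))"
    by (subst sum.swap, intro sum.cong refl, rule sum.swap)
  also have "\<dots> = (\<Sum>j\<in>?I. \<Sum>k\<in>?I. x j * x k * ip (\<phi> k) (\<phi> j))"
    by (intro sum.cong refl) (simp add: fourier_ip_sphere[OF _ phi_L2] sum_distrib_left)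
  also have "\<dots> = (\<Sum>j\<in>?I. (x j)\<^sup>2)"
    by (intro sum.cong refl)
       (simp add: phi_orthonormal finite_lam_eq power2_eq_square if_distrib[of "\<lambda>y. _ * y"] cong: if_cong)
  finally show ?thesis .
qed

lemma mode_fourier_weighted_sum:
  assumes P: "finite P"
  shows "(\<Sum>m\<in>{m \<in> frequencies. wave_eigenvalue m \<in> P}. g (wave_eigenvalue m) * (norm (mode_fourier x m))\<^sup>2)
    = (\<Sum>k\<in>{k. lam k \<in> P}. g (lam k) * (x k)\<^sup>2)"
proof -
  have "(\<Sum>m\<in>(\<Union>\<rho>\<in>P. freq_sphere \<rho>). g (wave_eigenvalue m) * (norm (mode_fourier x m))\<^sup>2)
      = (\<Sum>\<rho>\<in>P. \<Sum>m\<in>freq_sphere \<rho>. g (wave_eigenvalue m) * (norm (mode_fourier x m))\<^sup>2)"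
    by (rule sum.UNION_disjoint[OF P]) (auto simp: finite_freq_sphere, auto simp: freq_sphere_def)
  also have "\<dots> = (\<Sum>\<rho>\<in>P. g \<rho> * (\<Sum>m\<in>freq_sphere \<rho>. (norm (mode_fourier x m))\<^sup>2))"
    by (intro sum.cong refl) (simp add: freq_sphere_def sum_distrib_left)
  also have "\<dots> = (\<Sum>\<rho>\<in>P. \<Sum>k\<in>{k. lam k = \<rho>}. g (lam k) * (x k)\<^sup>2)"
    unfolding mode_fourier_sphere by (intro sum.cong refl) (simp add: sum_distrib_left)
  also have "\<dots> = (\<Sum>k\<in>(\<Union>\<rho>\<in>P. {k. lam k = \<rho>}). g (lam k) * (x k)\<^sup>2)"
    by (rule sum.UNION_disjoint[OF P, symmetric]) (auto simp: finite_lam_eq)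
  also have "(\<Union>\<rho>\<in>P. {k. lam k = \<rho>}) = {k. lam k \<in> P}" by auto
  also have "(\<Union>\<rho>\<in>P. freq_sphere \<rho>) = {m \<in> frequencies. wave_eigenvalue m \<in> P}" by (auto simp: freq_sphere_def)
  finally show ?thesis .
qed

lemma finite_lam_in: "finite P \<Longrightarrow> finite {k. lam k \<in> P}"
  and finite_wave_in: "finite P \<Longrightarrow> finite {m \<in> frequencies. wave_eigenvalue m \<in> P}"
proof -
  have "{k. lam k \<in> P} = (\<Union>\<rho>\<in>P. {k. lam k = \<rho>})" by auto
  then show "finite P \<Longrightarrow> finite {k. lam k \<in> P}" using finite_lam_eq by simp
  have "{m \<in> frequencies. wave_eigenvalue m \<in> P} = (\<Union>\<rho>\<in>P. freq_sphere \<rho>)" by (auto simp: freq_sphere_def)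
  then show "finite P \<Longrightarrow> finite {m \<in> frequencies. wave_eigenvalue m \<in> P}" using finite_freq_sphere by simp
qed

lemma mode_fourier_sum_le_nsq:
  assumes x: "x \<in> ell lam s" and A: "finite A" "A \<subseteq> frequencies"
  shows "(\<Sum>m\<in>A. wave_eigenvalue m powr s * (norm (mode_fourier x m))\<^sup>2) \<le> nsq lam s x"
proof -
  let ?P = "wave_eigenvalue ` A"
  have P: "finite ?P" using A by simp
  have "(\<Sum>m\<in>A. wave_eigenvalue m powr s * (norm (mode_fourier x m))\<^sup>2)
      \<le> (\<Sum>m\<in>{m \<in> frequencies. wave_eigenvalue m \<in> ?P}. wave_eigenvalue m powr s * (norm (mode_fourier x m))\<^sup>2)"
    using A by (intro sum_mono2 finite_wave_in P) auto
  also have "\<dots> = (\<Sum>k\<in>{k. lam k \<in> ?P}. lam k powr s * (x k)\<^sup>2)" by (rule mode_fourier_weighted_sum[OF P])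
  also have "\<dots> \<le> nsq lam s x"
    unfolding nsq_def using x by (intro sum_le_suminf finite_lam_in P) (auto simp: ell_def)
  finally show ?thesis .
qed

text \<open>A finite set of modes is enlarged to complete eigenspaces, where the sum can be
  rewritten over frequencies; there the weight is at most the Sobolev weight.\<close>

lemma coord_sobolev:
  assumes uH: "u \<in> H_space" and us: "u \<in> sobolev s" and s: "0 \<le> s"
  shows "coord u \<in> ell lam s" "nsq lam s (coord u) \<le> (sobolev_norm s u)\<^sup>2"
proof -
  have sw: "sobolev_weight s u summable_on frequencies" using us by (simp add: sobolev_def)
  have nn: "0 \<le> infsum (sobolev_weight s u) frequencies"
    by (rule infsum_nonneg) (simp add: sobolev_weight_def)
  have fin: "(\<Sum>k\<in>K. lam k powr s * (coord u k)\<^sup>2) \<le> (sobolev_norm s u)\<^sup>2" if K: "finite K" for K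
  proof -
    let ?P = "lam ` K"
    have P: "finite ?P" using K by simp
    have "(\<Sum>k\<in>K. lam k powr s * (coord u k)\<^sup>2) \<le> (\<Sum>k\<in>{k. lam k \<in> ?P}. lam k powr s * (coord u k)\<^sup>2)"
      using K by (intro sum_mono2 finite_lam_in P) auto
    also have "\<dots> = (\<Sum>m\<in>{m \<in> frequencies. wave_eigenvalue m \<in> ?P}. wave_eigenvalue m powr s * (norm (mode_fourier (coord u) m))\<^sup>2)"
      by (rule mode_fourier_weighted_sum[OF P, symmetric])
    also have "\<dots> \<le> (\<Sum>m\<in>{m \<in> frequencies. wave_eigenvalue m \<in> ?P}. sobolev_weight s u m)"
    proof (rule sum_mono)
      fix m assume "m \<in> {m \<in> frequencies. wave_eigenvalue m \<in> ?P}"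
      then have "mode_fourier (coord u) m = fourier u m" using fourier_eq_mode_fourier[OF uH] by simp
      moreover have "wave_eigenvalue m powr s \<le> (1 + (2 * pi * norm m)\<^sup>2) powr s"
        unfolding wave_eigenvalue_def using s by (intro powr_mono2) auto
      ultimately show "wave_eigenvalue m powr s * (norm (mode_fourier (coord u) m))\<^sup>2 \<le> sobolev_weight s u m"
        by (simp add: sobolev_weight_def mult_right_mono)
    qed
    also have "\<dots> \<le> infsum (sobolev_weight s u) frequencies"
      by (rule finite_sum_le_infsum[OF sw finite_wave_in[OF P]]) (auto simp: sobolev_weight_def)
    also have "\<dots> = (sobolev_norm s u)\<^sup>2" using nn by (simp add: sobolev_norm_def)
    finally show ?thesis .
  qed
  have "summable (\<lambda>k. lam k powr s * (coord u k)\<^sup>2)"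
    by (rule summableI_nonneg_bounded[OF _ fin]) auto
  then show "coord u \<in> ell lam s" "nsq lam s (coord u) \<le> (sobolev_norm s u)\<^sup>2"
    unfolding ell_def nsq_def using fin by (auto intro: suminf_le_const)
qed

text \<open>Closeness in the Sobolev norm should force closeness of each coefficient, but
  \<open>sobolev_norm\<close> is an \<open>infsum\<close> and equals 0 when the series diverges.
  Summability for the difference from a smooth field has to come first: since
  \<open>s \<le> 1\<close>, the square-summable coefficients of the smooth field and of its first
  derivatives dominate its share.\<close>

lemma V_space_H:
  assumes u: "u \<in> V_space s" and s: "0 \<le> s" "s \<le> 1"
  shows "u \<in> H_space"
proof -
  have us: "u \<in> sobolev s" using u by (simp add: V_space_def)
  have uL: "u \<in> L2_fields" by (rule sobolev_L2[OF us])
  have "\<exists>v\<in>smooth_solenoidal. sobolev_norm s (u - v) < 1 / real (Suc n)" for n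
    using u unfolding V_space_def by auto
  then obtain v where v: "\<And>n. v n \<in> smooth_solenoidal" "\<And>n. sobolev_norm s (u - v n) < 1 / real (Suc n)" by metis
  have bound: "norm (fourier u k - fourier w k) \<le> sobolev_norm s (u - w)"
    if w: "w \<in> smooth_solenoidal" and k: "k \<in> frequencies" for w k
  proof -
    have wL: "w \<in> L2_fields" by (rule smooth_solenoidal_L2[OF w])
    have wm: "smooth w" "torus_periodic w" using w by (auto simp: smooth_solenoidal_def)
    define G where "G m = 2 * (1 + (2 * pi * norm m)\<^sup>2) powr s * (norm (fourier u m))\<^sup>2
        + 2 * ((norm (fourier w m))\<^sup>2 + (\<Sum>b\<in>Basis. (norm (fourier (partial b w) m))\<^sup>2))" for m
    have pL: "partial b w \<in> L2_fields" if "b \<in> Basis" for b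
      using smooth_is_weak_partial[OF wm that] by (simp add: is_weak_partial_def)
    have Gs: "G summable_on frequencies"
    proof -
      have "(\<lambda>m. 2 * sobolev_weight s u m) summable_on frequencies"
        using us by (intro summable_on_cmult_right) (simp add: sobolev_def)
      moreover have "(\<lambda>m. 2 * ((norm (fourier w m))\<^sup>2 + (\<Sum>b\<in>Basis. (norm (fourier (partial b w) m))\<^sup>2))) summable_on frequencies"
        by (intro summable_on_cmult_right summable_on_add summable_on_finite_sum fourier_summable wL pL)
      ultimately show ?thesis
        unfolding G_def sobolev_weight_def mult.assoc by (rule summable_on_add)
    qed
    have le: "sobolev_weight s (u - w) m \<le> G m" if m: "m \<in> frequencies" for m
    proof -
      let ?W = "(1 + (2 * pi * norm m)\<^sup>2) powr s"
      have "(norm (fourier u m - fourier w m))\<^sup>2 \<le> 2 * (norm (fourier u m))\<^sup>2 + 2 * (norm (fourier w m))\<^sup>2"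
      proof -
        have "(norm (fourier u m - fourier w m))\<^sup>2 \<le> (norm (fourier u m) + norm (fourier w m))\<^sup>2"
          by (intro power_mono norm_triangle_ineq4) auto
        then show ?thesis using sum_squares_bound[of "norm (fourier u m)" "norm (fourier w m)"] by (simp add: power2_sum)
      qed
      then have "sobolev_weight s (u - w) m \<le> ?W * (2 * (norm (fourier u m))\<^sup>2 + 2 * (norm (fourier w m))\<^sup>2)"
        unfolding sobolev_weight_def using fourier_diff[OF uL wL, of m]
        by (simp add: fun_diff_def mult_left_mono)
      also have "\<dots> = 2 * ?W * (norm (fourier u m))\<^sup>2 + 2 * (?W * (norm (fourier w m))\<^sup>2)"
        by (simp add: algebra_simps)
      also have "?W * (norm (fourier w m))\<^sup>2 \<le> (1 + (2 * pi * norm m)\<^sup>2) powr 1 * (norm (fourier w m))\<^sup>2"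
        using s by (intro mult_right_mono powr_mono) auto
      also have "\<dots> = (norm (fourier w m))\<^sup>2 + (\<Sum>b\<in>Basis. (norm (fourier (partial b w) m))\<^sup>2)"
      proof -
        have "(norm (fourier (partial b w) m))\<^sup>2 = (2 * pi * (m \<bullet> b))\<^sup>2 * (norm (fourier w m))\<^sup>2" if b: "b \<in> Basis" for b
        proof -
          have "fourier (partial b w) m = (2 * pi * (m \<bullet> b)) *\<^sub>R (\<chi> j. \<i> * fourier w m $ j)"
            unfolding fourier_partial_of_weak[OF wL smooth_is_weak_partial[OF wm b] b m]
            by (simp add: vec_eq_iff scaleR_conv_of_real[where 'a=complex])
          moreover have "norm (\<chi> j. \<i> * fourier w m $ j) = norm (fourier w m)"
            by (simp add: norm_vec_def norm_mult)
          ultimately show ?thesis by (simp add: power_mult_distrib)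
        qed
        then have "(\<Sum>b\<in>Basis. (norm (fourier (partial b w) m))\<^sup>2) = (2 * pi)\<^sup>2 * (\<Sum>b\<in>Basis. (m \<bullet> b)\<^sup>2) * (norm (fourier w m))\<^sup>2"
          by (simp add: power_mult_distrib sum_distrib_left sum_distrib_right)
        also have "(\<Sum>b\<in>Basis. (m \<bullet> b)\<^sup>2) = (norm m)\<^sup>2"
          unfolding power2_norm_eq_inner euclidean_inner[of m m] by (simp add: power2_eq_square)
        finally show ?thesis by (simp add: power_mult_distrib algebra_simps add_nonneg_nonneg)
      qed
      finally show ?thesis by (simp add: G_def fun_diff_def)
    qed
    have sws: "sobolev_weight s (u - w) summable_on frequencies"
      by (rule summable_on_comparison_test[OF Gs]) (use le in \<open>auto simp: sobolev_weight_def\<close>)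
    have "(norm (fourier u k - fourier w k))\<^sup>2 \<le> sobolev_weight s (u - w) k"
    proof -
      have "1 \<le> (1 + (2 * pi * norm k)\<^sup>2) powr s" using s by (intro ge_one_powr_ge_zero) auto
      then show ?thesis
        unfolding sobolev_weight_def using fourier_diff[OF uL wL, of k]
          mult_right_mono[of 1 "(1 + (2 * pi * norm k)\<^sup>2) powr s" "(norm (fourier u k - fourier w k))\<^sup>2"]
        by (simp add: fun_diff_def)
    qed
    also have "\<dots> \<le> infsum (sobolev_weight s (u - w)) frequencies"
      using finite_sum_le_infsum[OF sws, of "{k}"] k by (simp add: sobolev_weight_def)
    finally show ?thesis unfolding sobolev_norm_def by (rule real_le_rsqrt)
  qed
  have "(\<lambda>n. fourier (v n) k) \<longlonglongrightarrow> fourier u k" if k: "k \<in> frequencies" for k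
  proof -
    have "(\<lambda>n. fourier (v n) k - fourier u k) \<longlonglongrightarrow> 0"
    proof (rule Lim_null_comparison)
      show "\<forall>\<^sub>F n in sequentially. norm (fourier (v n) k - fourier u k) \<le> 1 / real (Suc n)"
        by (intro always_eventually allI, subst norm_minus_commute)
           (rule order_trans[OF bound[OF v(1) k] less_imp_le[OF v(2)]])
      show "(\<lambda>n. 1 / real (Suc n)) \<longlonglongrightarrow> 0" by (rule LIMSEQ_Suc[OF lim_1_over_n])
    qed
    then show ?thesis by (simp add: LIM_zero_iff)
  qed
  then have "solenoidal_coeffs (fourier u)"
    by (rule solenoidal_coeffs_tendsto[of "\<lambda>n. fourier (v n)" "fourier u", OF fourier_solenoidal_smooth[OF v(1)]])
  with uL show ?thesis by (simp add: H_space_iff)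
qed

text \<open>Makes the eigenfunctions admissible as test functions in both weak formulations. The
  approximating smooth field can be one and the same for all \<epsilon>: a trigonometric polynomial
  with exactly the coefficients of \<open>\<phi> n\<close>.\<close>

lemma phi_V_space: "\<phi> n \<in> V_space s"
proof -
  define A where "A = {m \<in> frequencies. wave_eigenvalue m \<le> lam n}"
  define v where "v = fourier_partial (fourier (\<phi> n)) A"
  have A: "finite A" "A \<subseteq> frequencies" "\<And>k. k \<in> A \<Longrightarrow> - k \<in> A"
    unfolding A_def using finite_freq_wave_eigenvalue_le by (auto simp: wave_eigenvalue_def)
  have vs: "v \<in> smooth_solenoidal"
    unfolding v_def using phi_H[of n] A by (intro fourier_partial_smooth_solenoidal) (auto simp: H_space_iff)
  have supp: "fourier (\<phi> n) m = 0" if "m \<in> frequencies - A" for m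
    using that phi_fourier_support[of m n] by (cases "fourier (\<phi> n) m = 0") (auto simp: A_def)
  have fv: "fourier v m = fourier (\<phi> n) m" if m: "m \<in> frequencies" for m
    unfolding v_def using fourier_fourier_partial[of A m "fourier (\<phi> n)", OF A m fourier_uminus_freq] supp m by auto
  have n0: "sobolev_norm s (\<phi> n - v) = 0"
  proof -
    have "infsum (sobolev_weight s (\<phi> n - v)) frequencies = infsum (\<lambda>_. 0) frequencies"
      using fourier_diff[OF phi_L2 smooth_solenoidal_L2[OF vs]] fv
      by (intro infsum_cong) (simp add: sobolev_weight_def fun_diff_def)
    then show ?thesis by (simp add: sobolev_norm_def)
  qed
  have ps: "\<phi> n \<in> sobolev s"
  proof -
    have "sobolev_weight s (\<phi> n) summable_on A" using A(1) by (rule summable_on_finite)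
    then have "sobolev_weight s (\<phi> n) summable_on frequencies"
      by (rule summable_on_cong_neutral[THEN iffD1, rotated -1]) (use supp A(2) in \<open>auto simp: sobolev_weight_def\<close>)
    then show ?thesis using phi_L2 by (simp add: sobolev_def)
  qed
  have "\<exists>v\<in>smooth_solenoidal. sobolev_norm s (\<phi> n - v) < e" if "0 < e" for e
  proof -
    have "sobolev_norm s (\<phi> n - v) < e" using n0 that by (simp only:)
    then show ?thesis using vs by (rule_tac x=v in bexI)
  qed
  with ps show ?thesis unfolding V_space_def mem_Collect_eq by (simp only:) simp
qed

end

section \<open>Fractional powers of the Stokes operator\<close>

context stokes_basis
begin

text \<open>The weighted coordinates are square summable, so their series converges in
  \<open>H_space\<close> and the choice in \<open>stokes_powr\<close> is not void; convergence then
  fixes the coordinates of whatever field was chosen.\<close>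

lemma stokes_powr:
  assumes u: "coord u \<in> ell lam (2 * s)"
  shows "stokes_powr \<phi> lam s u \<in> H_space"
    and "ip (stokes_powr \<phi> lam s u) (\<phi> k) = lam k powr s * ip u (\<phi> k)"
proof -
  define d where "d k = lam k powr s * coord u k" for k
  have d2: "(d k)\<^sup>2 = lam k powr (2 * s) * (coord u k)\<^sup>2" for k
  proof -
    have "lam k powr (2 * s) = (lam k powr s)\<^sup>2" by (simp only: mult_2 powr_add power2_eq_square)
    then show ?thesis by (simp only: d_def power_mult_distrib)
  qed
  have ds: "summable (\<lambda>k. (d k)\<^sup>2)" using u unfolding d2 ell_def mem_Collect_eq .
  let ?S = "\<lambda>n. phi_sum d {..<n}"
  have nrm: "(L2norm (\<lambda>x. ?S m x - ?S n x))\<^sup>2 = (\<Sum>k\<in>{n..<m}. (d k)\<^sup>2)" if "n \<le> m" for m n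
  proof -
    have "{n..<m} = {..<m} - {..<n}" by auto
    then have "(\<lambda>x. ?S m x - ?S n x) = phi_sum d {n..<m}"
      using that by (simp only: phi_sum_def fun_eq_iff) (subst sum_diff, auto)
    then show ?thesis
      by (simp only: L2norm_sq) (simp add: ip_phi_sum[OF phi_sum_L2] coord_phi_sum power2_eq_square)
  qed
  have "\<exists>n0. \<forall>m\<ge>n0. \<forall>n\<ge>n0. L2norm (\<lambda>x. ?S m x - ?S n x) < e" if e: "0 < e" for e
  proof -
    obtain n0 where n0: "\<forall>m\<ge>n0. \<forall>n. norm (\<Sum>k\<in>{m..<n}. (d k)\<^sup>2) < e\<^sup>2"
      using ds[unfolded summable_Cauchy, rule_format, of "e\<^sup>2"] e by auto
    have *: "L2norm (\<lambda>x. ?S m x - ?S n x) < e" if "n0 \<le> n" "n \<le> m" for m n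
    proof (rule power2_less_imp_less)
      show "(L2norm (\<lambda>x. ?S m x - ?S n x))\<^sup>2 < e\<^sup>2" 
        unfolding nrm[OF that(2)] using n0[rule_format, OF that(1), of m] by (simp add: sum_nonneg)
    qed (use e in simp)
    have "L2norm (\<lambda>x. ?S m x - ?S n x) < e" if "n0 \<le> n" "n0 \<le> m" for m n
      using *[of n m] *[of m n] that L2norm_minus_commute[of "?S m" "?S n"] by (cases "n \<le> m") auto
    then show ?thesis by blast
  qed
  from L2_fields_complete[OF phi_sum_L2 this] obtain g where
    g: "g \<in> L2_fields" "(\<lambda>n. L2norm (\<lambda>x. ?S n x - g x)) \<longlonglongrightarrow> 0" by blast
  have "solenoidal_coeffs (fourier (?S n))" for n using phi_sum_H[of d] by (simp add: H_space_iff)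
  then have "solenoidal_coeffs (fourier g)"
    by (rule solenoidal_coeffs_tendsto) (rule fourier_tendsto[OF phi_sum_L2 g])
  then have gH: "g \<in> H_space" using g(1) by (simp add: H_space_iff)
  define w where "w = stokes_powr \<phi> lam s u"
  have "w \<in> H_space \<and> (\<lambda>n. L2norm (\<lambda>x. w x - (\<Sum>k<n. (lam k powr s * ip u (\<phi> k)) *\<^sub>R \<phi> k x))) \<longlonglongrightarrow> 0"
    unfolding w_def stokes_powr_def
    by (rule someI[of "\<lambda>w. w \<in> H_space \<and> (\<lambda>n. L2norm (\<lambda>x. w x - (\<Sum>k<n. (lam k powr s * ip u (\<phi> k)) *\<^sub>R \<phi> k x))) \<longlonglongrightarrow> 0" g])
       (use gH g(2) in \<open>simp add: L2norm_minus_commute[of g] phi_sum_def d_def\<close>)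
  then have wH: "w \<in> H_space" and lim: "(\<lambda>n. L2norm (\<lambda>x. ?S n x - w x)) \<longlonglongrightarrow> 0"
    by (simp_all add: L2norm_minus_commute[of w] phi_sum_def d_def)
  show "stokes_powr \<phi> lam s u \<in> H_space" using wH by (simp add: w_def)
  have "coord w j = d j" for j
  proof -
    have "(\<lambda>n. coord (?S n) j) \<longlonglongrightarrow> coord w j" by (rule ip_tendsto[OF phi_sum_L2 H_space_L2[OF wH] phi_L2 lim])
    moreover have "(\<lambda>n. coord (?S n) j) \<longlonglongrightarrow> d j"
      by (rule tendsto_eventually, rule eventually_mono[OF eventually_gt_at_top[of j]]) (simp add: coord_phi_sum)
    ultimately show ?thesis by (rule LIMSEQ_unique)
  qed
  from this[of k] show "ip (stokes_powr \<phi> lam s u) (\<phi> k) = lam k powr s * ip u (\<phi> k)" by (simp only: w_def d_def)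
qed

lemma ip_stokes_powr:
  assumes "coord u \<in> ell lam (2 * s)" "coord v \<in> ell lam (2 * s)"
  shows "(\<lambda>k. lam k powr (2 * s) * (coord u k * coord v k)) sums ip (stokes_powr \<phi> lam s u) (stokes_powr \<phi> lam s v)"
proof -
  have e: "lam k powr s * coord u k * (lam k powr s * coord v k) = lam k powr (2 * s) * (coord u k * coord v k)" for k
  proof -
    have "lam k powr s * coord u k * (lam k powr s * coord v k) = (lam k powr s * lam k powr s) * (coord u k * coord v k)"
      by (simp only: mult.assoc mult.left_commute)
    also have "lam k powr s * lam k powr s = lam k powr (s + s)" by (rule powr_add[symmetric])
    finally show ?thesis by (simp only: mult_2)
  qed
  show ?thesis
    using coord_parseval[OF stokes_powr(1)[OF assms(1)] stokes_powr(1)[OF assms(2)]]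
    unfolding stokes_powr(2)[OF assms(1)] stokes_powr(2)[OF assms(2)] e .
qed

lemma L2norm_stokes_powr:
  assumes "coord u \<in> ell lam (2 * s)"
  shows "(L2norm (stokes_powr \<phi> lam s u))\<^sup>2 = nsq lam (2 * s) (coord u)"
proof -
  have "(L2norm (stokes_powr \<phi> lam s u))\<^sup>2 = ip (stokes_powr \<phi> lam s u) (stokes_powr \<phi> lam s u)" by (rule L2norm_sq)
  also have "\<dots> = (\<Sum>k. lam k powr (2 * s) * (coord u k * coord u k))"
    by (rule sums_unique[OF ip_stokes_powr[OF assms assms]])
  finally show ?thesis by (simp add: nsq_def power2_eq_square)
qed

lemma coord_phi_ell: "coord (\<phi> j) \<in> ell lam s"
  unfolding ell_def coord_phi by (auto simp: unit_seq_def intro!: summable_finite[of "{j}"] split: if_splits)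

lemma ip_stokes_powr_phi:
  assumes "coord u \<in> ell lam (2 * s)"
  shows "ip (stokes_powr \<phi> lam s u) (stokes_powr \<phi> lam s (\<phi> j)) = lam j powr (2 * s) * coord u j"
proof -
  have "(\<lambda>k. lam k powr (2 * s) * (coord u k * coord (\<phi> j) k))
      sums (\<Sum>k\<in>{j}. lam k powr (2 * s) * (coord u k * coord (\<phi> j) k))"
    by (rule sums_finite) (simp_all add: phi_orthonormal)
  then have "ip (stokes_powr \<phi> lam s u) (stokes_powr \<phi> lam s (\<phi> j))
      = (\<Sum>k\<in>{j}. lam k powr (2 * s) * (coord u k * coord (\<phi> j) k))"
    by (rule sums_unique2[OF ip_stokes_powr[OF assms coord_phi_ell[of j]]])
  also have "\<dots> = lam j powr (2 * s) * coord u j" by (simp add: phi_orthonormal)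
  finally show ?thesis .
qed

end

section \<open>The nonlinearity in Fourier variables\<close>

definition herm :: "complex^3 \<Rightarrow> complex^3 \<Rightarrow> complex" where
  "herm c d = (\<Sum>j\<in>UNIV. c $ j * cnj (d $ j))"

lemma norm_herm: "norm (herm c d) \<le> norm c * norm d"
proof -
  have "norm (herm c d) \<le> (\<Sum>j\<in>UNIV. \<bar>norm (c $ j)\<bar> * \<bar>norm (d $ j)\<bar>)"
    unfolding herm_def by (rule order_trans[OF norm_sum]) (simp add: norm_mult)
  also have "\<dots> \<le> norm c * norm d" unfolding norm_vec_def by (rule L2_set_mult_ineq)
  finally show ?thesis .
qed

lemma norm_kdot: "norm (kdot k c) \<le> norm k * norm c"
proof -
  have "norm (kdot k c) \<le> (\<Sum>j\<in>UNIV. \<bar>norm (k $ j)\<bar> * \<bar>norm (c $ j)\<bar>)"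
    unfolding kdot_def by (rule order_trans[OF norm_sum]) (simp add: norm_mult)
  also have "\<dots> \<le> norm k * norm c" unfolding norm_vec_def by (rule L2_set_mult_ineq)
  finally show ?thesis .
qed

lemma herm_linear:
  "herm (c + c') d = herm c d + herm c' d" "herm c (d + d') = herm c d + herm c d'"
  "herm c (a *\<^sub>R d) = a *\<^sub>R herm c d" "cnj (herm c d) = herm d c"
  by (simp_all add: herm_def algebra_simps sum.distrib scaleR_sum_right scaleR_conv_of_real[where 'a=complex] sum_distrib_left)

lemma kdot_cnj_vec: "kdot k (cnj_vec c) = cnj (kdot k c)"
  by (simp add: kdot_def cnj_vec_def)

lemma kdot_add_left: "kdot (k + l) c = kdot k c + kdot l c"
  by (simp add: kdot_def algebra_simps sum.distrib)

text \<open>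
  The Fourier form of \<open>\<integral> ((u \<cdot> \<nabla>) v) \<cdot> w\<close> for real fields with coefficients \<open>X\<close>, \<open>Y\<close>, \<open>Z\<close>.
\<close>

definition tri_term :: "(real^3 \<Rightarrow> complex^3) \<Rightarrow> (real^3 \<Rightarrow> complex^3) \<Rightarrow> (real^3 \<Rightarrow> complex^3)
    \<Rightarrow> (real^3) \<times> (real^3) \<Rightarrow> real" where
  "tri_term X Y Z = (\<lambda>(k, l). Re (2 * pi * \<i> * (kdot l (X k) * herm (Y l) (Z (k + l)))))"

definition tri :: "(real^3 \<Rightarrow> complex^3) \<Rightarrow> (real^3 \<Rightarrow> complex^3) \<Rightarrow> (real^3 \<Rightarrow> complex^3) \<Rightarrow> real" where
  "tri X Y Z = infsum (tri_term X Y Z) (frequencies \<times> frequencies)"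

lemma tri_term_bound:
  "\<bar>tri_term X Y Z (k, l)\<bar> \<le> 2 * pi * (norm (kdot l (X k)) * (norm (Y l) * norm (Z (k + l))))"
proof -
  have "\<bar>tri_term X Y Z (k, l)\<bar> \<le> norm (2 * pi * \<i> * (kdot l (X k) * herm (Y l) (Z (k + l))))"
    unfolding tri_term_def prod.case by (rule abs_Re_le_cmod)
  also have "\<dots> = 2 * pi * (norm (kdot l (X k)) * norm (herm (Y l) (Z (k + l))))"
    by (simp add: norm_mult)
  also have "\<dots> \<le> 2 * pi * (norm (kdot l (X k)) * (norm (Y l) * norm (Z (k + l))))"
    by (intro mult_left_mono norm_herm) auto
  finally show ?thesis .
qed

lemma tri_dominated:
  assumes G: "G summable_on (frequencies \<times> frequencies)" "infsum G (frequencies \<times> frequencies) \<le> B"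
    and le: "\<And>k l. k \<in> frequencies \<Longrightarrow> l \<in> frequencies \<Longrightarrow> \<bar>tri_term X Y Z (k, l)\<bar> \<le> 2 * pi * G (k, l)"
  shows "tri_term X Y Z summable_on (frequencies \<times> frequencies)" "\<bar>tri X Y Z\<bar> \<le> 2 * pi * B"
proof -
  have G': "(\<lambda>p. 2 * pi * G p) summable_on (frequencies \<times> frequencies)" by (rule summable_on_cmult_right[OF G(1)])
  have le': "norm (tri_term X Y Z p) \<le> 2 * pi * G p" if "p \<in> frequencies \<times> frequencies" for p
    using le that by (cases p) auto
  have abs: "(\<lambda>p. norm (tri_term X Y Z p)) summable_on (frequencies \<times> frequencies)"
    by (rule Infinite_Sum.abs_summable_on_comparison_test'[OF G' le'])
  then show "tri_term X Y Z summable_on (frequencies \<times> frequencies)" by (rule abs_summable_summable)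
  have "norm (infsum (tri_term X Y Z) (frequencies \<times> frequencies)) \<le> infsum (\<lambda>p. norm (tri_term X Y Z p)) (frequencies \<times> frequencies)"
    by (rule norm_infsum_bound[OF abs])
  also have "\<dots> \<le> infsum (\<lambda>p. 2 * pi * G p) (frequencies \<times> frequencies)"
    by (rule infsum_mono[OF abs G' le'])
  also have "\<dots> = 2 * pi * infsum G (frequencies \<times> frequencies)" by (rule infsum_cmult_right'[THEN trans]) simp
  also have "\<dots> \<le> 2 * pi * B" using G(2) by (intro mult_left_mono) auto
  finally show "\<bar>tri X Y Z\<bar> \<le> 2 * pi * B" by (simp add: tri_def)
qed

lemma tri_cong:
  assumes "\<And>k. k \<in> frequencies \<Longrightarrow> X k = X' k \<and> Y k = Y' k \<and> Z k = Z' k"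
  shows "tri X Y Z = tri X' Y' Z'"
  unfolding tri_def by (rule infsum_cong) (use assms in \<open>auto simp: tri_term_def\<close>)

text \<open>An involution of the frequency pairs that exchanges \<open>l\<close> with
  \<open>k + l\<close>. For the trilinear form it plays the part of integration by parts, swapping
  the last two arguments.\<close>

lemma bij_freq_shift: "bij_betw (\<lambda>(k, l). (- k, k + l)) (frequencies \<times> frequencies) (frequencies \<times> frequencies)"
  by (rule bij_betwI[of _ _ _ "\<lambda>(k, l). (- k, k + l)"]) auto

text \<open>Incompressibility replaces \<open>kdot (k + l) (X k)\<close> by
  \<open>kdot l (X k)\<close>. After the shift the term has become its conjugate up to the outer
  factor \<open>\<i>\<close>, which changes the sign of the real part.\<close>

lemma tri_antisym:
  assumes X: "\<And>k. X (- k) = cnj_vec (X k)" "\<And>k. k \<in> frequencies \<Longrightarrow> kdot k (X k) = 0"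
  shows "tri X Z Y = - tri X Y Z"
proof -
  have "tri X Z Y = infsum (\<lambda>p. tri_term X Z Y ((\<lambda>(k, l). (- k, k + l)) p)) (frequencies \<times> frequencies)"
    unfolding tri_def by (rule infsum_reindex_bij_betw[OF bij_freq_shift, symmetric])
  also have "\<dots> = infsum (\<lambda>p. - tri_term X Y Z p) (frequencies \<times> frequencies)"
  proof (rule infsum_cong)
    fix p assume p: "p \<in> frequencies \<times> frequencies"
    obtain k l where kl: "p = (k, l)" by (cases p)
    have "kdot (k + l) (X k) = kdot l (X k)" using X(2) p kl by (simp add: kdot_add_left)
    then have "kdot (k + l) (X (- k)) * herm (Z (k + l)) (Y l) = cnj (kdot l (X k) * herm (Y l) (Z (k + l)))"
      by (simp add: X(1) kdot_cnj_vec herm_linear(4))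
    then have "tri_term X Z Y (- k, k + l) = Re (2 * pi * \<i> * cnj (kdot l (X k) * herm (Y l) (Z (k + l))))"
      by (simp only: tri_term_def prod.case) (simp only: minus_add_cancel)
    also have "\<dots> = - tri_term X Y Z (k, l)"
    proof -
      have "Re (2 * pi * \<i> * cnj q) = - Re (2 * pi * \<i> * q)" for q by simp
      then show ?thesis by (simp only: tri_term_def prod.case)
    qed
    finally show "tri_term X Z Y ((\<lambda>(k, l). (- k, k + l)) p) = - tri_term X Y Z p" by (simp add: kl)
  qed
  finally show ?thesis by (simp add: tri_def infsum_uminus)
qed

section \<open>Bounds for the trilinear form on mode sequences\<close>

context stokes_basis
begin

lemma norm_le_wave: "norm k \<le> wave_eigenvalue k powr (1/2)" "(norm k)\<^sup>2 \<le> wave_eigenvalue k powr 1"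
proof -
  have "1 * norm k \<le> 2 * pi * norm k" using pi_gt3 by (intro mult_right_mono) auto
  then have n: "norm k \<le> 2 * pi * norm k" by simp
  then show "norm k \<le> wave_eigenvalue k powr (1/2)"
    by (simp add: wave_eigenvalue_def powr_half_sqrt)
  have "(norm k)\<^sup>2 \<le> (2 * pi * norm k)\<^sup>2" by (rule power_mono[OF n]) simp
  then show "(norm k)\<^sup>2 \<le> wave_eigenvalue k powr 1" by (simp add: wave_eigenvalue_def)
qed

lemma mode_fourier_0 [simp]: "mode_fourier x 0 = 0"
  using mode_fourier_solenoidal by (simp add: solenoidal_coeffs_def)

lemma mode_weight_bound:
  assumes x: "x \<in> ell lam s" and A: "finite A" "A \<subseteq> frequencies"
    and w: "\<And>k. k \<in> frequencies \<Longrightarrow> k \<noteq> 0 \<Longrightarrow> w k \<le> wave_eigenvalue k powr s"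
  shows "(\<Sum>k\<in>A. w k * (norm (mode_fourier x k))\<^sup>2) \<le> (sqrt (nsq lam s x))\<^sup>2"
proof -
  have "(\<Sum>k\<in>A. w k * (norm (mode_fourier x k))\<^sup>2)
      \<le> (\<Sum>k\<in>A. wave_eigenvalue k powr s * (norm (mode_fourier x k))\<^sup>2)"
  proof (rule sum_mono)
    fix k assume k: "k \<in> A"
    show "w k * (norm (mode_fourier x k))\<^sup>2 \<le> wave_eigenvalue k powr s * (norm (mode_fourier x k))\<^sup>2"
      using w[OF subsetD[OF A(2) k]] by (cases "k = 0") (simp_all add: mult_right_mono)
  qed
  also have "\<dots> \<le> nsq lam s x" by (rule mode_fourier_sum_le_nsq[OF x A])
  finally show ?thesis using nsq_nonneg[OF x] by simp
qed

lemma wave_powr_0: "k \<in> frequencies \<Longrightarrow> k \<noteq> 0 \<Longrightarrow> 1 \<le> wave_eigenvalue k powr 0"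
  using wave_eigenvalue_ge_1[of k] by auto

abbreviation mtri :: "(nat \<Rightarrow> real) \<Rightarrow> (nat \<Rightarrow> real) \<Rightarrow> (nat \<Rightarrow> real) \<Rightarrow> real" where
  "mtri x y z \<equiv> tri (mode_fourier x) (mode_fourier y) (mode_fourier z)"

abbreviation mtri_summable :: "(nat \<Rightarrow> real) \<Rightarrow> (nat \<Rightarrow> real) \<Rightarrow> (nat \<Rightarrow> real) \<Rightarrow> bool" where
  "mtri_summable x y z \<equiv> tri_term (mode_fourier x) (mode_fourier y) (mode_fourier z) summable_on (frequencies \<times> frequencies)"

text \<open>The lattice estimate with the derivative on \<open>y\<close>: the sequence
  \<open>norm l * norm (mode_fourier y l)\<close> is square summable, and \<open>x\<close>,
  \<open>z\<close> carry the exponents \<open>1/2\<close> and 1.\<close>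

lemma mtri_bound1:
  assumes x: "x \<in> ell lam (1/2)" and y: "y \<in> ell lam 1" and z: "z \<in> ell lam 1"
  shows "mtri_summable x y z"
    "\<bar>mtri x y z\<bar> \<le> 2 * pi * (16 * sqrt (nsq lam (1/2) x) * sqrt (nsq lam 1 y) * sqrt (nsq lam 1 z))"
proof -
  let ?x = "\<lambda>k. norm (mode_fourier x k)" and ?y = "\<lambda>k. norm k * norm (mode_fourier y k)"
    and ?z = "\<lambda>k. norm (mode_fourier z k)"
  have bx: "(\<Sum>k\<in>S. norm k * (?x k)\<^sup>2) \<le> (sqrt (nsq lam (1/2) x))\<^sup>2" if "finite S" "S \<subseteq> frequencies" for S
    by (rule mode_weight_bound[OF x that norm_le_wave(1)])
  have yb: "(\<Sum>k\<in>S. (?y k)\<^sup>2) \<le> (sqrt (nsq lam 1 y))\<^sup>2" if "finite S" "S \<subseteq> frequencies" for S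
    unfolding power_mult_distrib by (rule mode_weight_bound[OF y that norm_le_wave(2)])
  have bz: "(\<Sum>k\<in>S. (norm k)\<^sup>2 * (?z k)\<^sup>2) \<le> (sqrt (nsq lam 1 z))\<^sup>2" if "finite S" "S \<subseteq> frequencies" for S
    by (rule mode_weight_bound[OF z that norm_le_wave(2)])
  note tri_sum = lattice_trilinear[of ?x ?y ?z, OF _ _ _ _ _ _ bx _ yb _ bz]
  have s: "(\<lambda>(k, l). ?x k * ?y l * ?z (k + l)) summable_on (frequencies \<times> frequencies)"
    by (rule tri_sum(1)) (simp_all add: nsq_nonneg x y z)
  have s': "(\<Sum>\<^sub>\<infinity>(k, l)\<in>frequencies \<times> frequencies. ?x k * ?y l * ?z (k + l))
      \<le> 16 * sqrt (nsq lam (1/2) x) * sqrt (nsq lam 1 y) * sqrt (nsq lam 1 z)"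
    by (rule tri_sum(2)) (simp_all add: nsq_nonneg x y z)
  have le: "\<bar>tri_term (mode_fourier x) (mode_fourier y) (mode_fourier z) (k, l)\<bar>
      \<le> 2 * pi * (\<lambda>(k, l). ?x k * ?y l * ?z (k + l)) (k, l)" for k l
  proof -
    have "norm (kdot l (mode_fourier x k)) * (norm (mode_fourier y l) * ?z (k + l))
        \<le> (norm l * ?x k) * (norm (mode_fourier y l) * ?z (k + l))"
      by (intro mult_right_mono norm_kdot) auto
    then have "2 * pi * (norm (kdot l (mode_fourier x k)) * (norm (mode_fourier y l) * ?z (k + l)))
        \<le> 2 * pi * (?x k * ?y l * ?z (k + l))"
      by (intro mult_left_mono) (simp_all add: mult_ac)
    then show ?thesis using order_trans[OF tri_term_bound] by simp
  qed
  show "mtri_summable x y z"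
    "\<bar>mtri x y z\<bar> \<le> 2 * pi * (16 * sqrt (nsq lam (1/2) x) * sqrt (nsq lam 1 y) * sqrt (nsq lam 1 z))"
    by (rule tri_dominated[OF s s' le])+
qed

text \<open>The substitution that sends \<open>(k, l)\<close> to \<open>(k + l, - l)\<close> brings
  \<open>z\<close> into the slot with exponent \<open>1/2\<close> and \<open>x\<close> into the slot
  with exponent 1.\<close>

lemma mtri_bound3:
  assumes x: "x \<in> ell lam 1" and y: "y \<in> ell lam 1" and z: "z \<in> ell lam (1/2)"
  shows "\<bar>mtri x y z\<bar> \<le> 2 * pi * (16 * sqrt (nsq lam (1/2) z) * sqrt (nsq lam 1 y) * sqrt (nsq lam 1 x))"
proof -
  let ?x = "\<lambda>k. norm (mode_fourier x k)" and ?y = "\<lambda>k. norm k * norm (mode_fourier y k)"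
    and ?z = "\<lambda>k. norm (mode_fourier z k)"
  let ?G = "\<lambda>(k, l). ?z k * ?y l * ?x (k + l)"
  have bz: "(\<Sum>k\<in>S. norm k * (?z k)\<^sup>2) \<le> (sqrt (nsq lam (1/2) z))\<^sup>2" if "finite S" "S \<subseteq> frequencies" for S
    by (rule mode_weight_bound[OF z that norm_le_wave(1)])
  have yb: "(\<Sum>k\<in>S. (?y k)\<^sup>2) \<le> (sqrt (nsq lam 1 y))\<^sup>2" if "finite S" "S \<subseteq> frequencies" for S
    unfolding power_mult_distrib by (rule mode_weight_bound[OF y that norm_le_wave(2)])
  have bx: "(\<Sum>k\<in>S. (norm k)\<^sup>2 * (?x k)\<^sup>2) \<le> (sqrt (nsq lam 1 x))\<^sup>2" if "finite S" "S \<subseteq> frequencies" for S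
    by (rule mode_weight_bound[OF x that norm_le_wave(2)])
  note tri_sum = lattice_trilinear[of ?z ?y ?x, OF _ _ _ _ _ _ bz _ yb _ bx]
  have s: "?G summable_on (frequencies \<times> frequencies)"
    by (rule tri_sum(1)) (simp_all add: nsq_nonneg x y z)
  have s': "infsum ?G (frequencies \<times> frequencies)
      \<le> 16 * sqrt (nsq lam (1/2) z) * sqrt (nsq lam 1 y) * sqrt (nsq lam 1 x)"
    by (rule tri_sum(2)) (simp_all add: nsq_nonneg x y z)
  have bij: "bij_betw (\<lambda>(k, l). (k + l, - l)) (frequencies \<times> frequencies) (frequencies \<times> frequencies)"
    by (rule bij_betwI[of _ _ _ "\<lambda>(k, l). (k + l, - l)"]) auto
  have s1: "(\<lambda>p. ?G ((\<lambda>(k, l). (k + l, - l)) p)) summable_on (frequencies \<times> frequencies)"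
    using s summable_on_reindex_bij_betw[OF bij, of ?G] by simp
  have s2: "infsum (\<lambda>p. ?G ((\<lambda>(k, l). (k + l, - l)) p)) (frequencies \<times> frequencies)
      \<le> 16 * sqrt (nsq lam (1/2) z) * sqrt (nsq lam 1 y) * sqrt (nsq lam 1 x)"
    using s' infsum_reindex_bij_betw[OF bij, of ?G] by simp
  have le: "\<bar>tri_term (mode_fourier x) (mode_fourier y) (mode_fourier z) (k, l)\<bar>
      \<le> 2 * pi * (\<lambda>p. ?G ((\<lambda>(k, l). (k + l, - l)) p)) (k, l)" for k l
  proof -
    have "norm (kdot l (mode_fourier x k)) * (norm (mode_fourier y l) * ?z (k + l))
        \<le> (norm l * ?x k) * (norm (mode_fourier y l) * ?z (k + l))"
      by (intro mult_right_mono norm_kdot) auto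
    then have "2 * pi * (norm (kdot l (mode_fourier x k)) * (norm (mode_fourier y l) * ?z (k + l)))
        \<le> 2 * pi * (?z (k + l) * ?y (- l) * ?x (k + l + - l))"
      by (intro mult_left_mono) (simp_all add: mult_ac mode_fourier_uminus)
    then show ?thesis using order_trans[OF tri_term_bound] by simp
  qed
  show ?thesis by (rule tri_dominated(2)[OF s1 s2 le])
qed

text \<open>By incompressibility the derivative can be moved from \<open>y\<close> to the
  eigenfunction, which has all weighted norms finite. Then \<open>y\<close> is measured in the
  0-norm only, so that the form makes sense along sequences that are merely in
  \<open>ell lam (1/2)\<close>.\<close>

lemma mtri_bound2:
  assumes x: "x \<in> ell lam (1/2)" and y: "y \<in> ell lam 0"
  shows "mtri_summable x y (unit_seq j)"
    "\<bar>mtri x y (unit_seq j)\<bar> \<le> 2 * pi * (16 * sqrt (nsq lam (1/2) x) * sqrt (nsq lam 0 y) * sqrt (nsq lam 2 (unit_seq j)))"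
proof -
  let ?x = "\<lambda>k. norm (mode_fourier x k)" and ?y = "\<lambda>k. norm (mode_fourier y k)"
    and ?z = "\<lambda>k. norm k * norm (mode_fourier (unit_seq j) k)"
  have z: "unit_seq j \<in> ell lam 2" using coord_phi_ell[of j 2] unfolding coord_phi .
  have w2: "(norm k)\<^sup>2 * (norm k)\<^sup>2 \<le> wave_eigenvalue k powr 2" for k :: "real^3"
  proof -
    have "(norm k)\<^sup>2 * (norm k)\<^sup>2 \<le> wave_eigenvalue k * wave_eigenvalue k"
      using norm_le_wave(2)[of k] by (intro mult_mono) (auto simp: wave_eigenvalue_def)
    then show ?thesis by (simp add: wave_eigenvalue_def power2_eq_square)
  qed
  have bx: "(\<Sum>k\<in>S. norm k * (?x k)\<^sup>2) \<le> (sqrt (nsq lam (1/2) x))\<^sup>2" if "finite S" "S \<subseteq> frequencies" for S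
    by (rule mode_weight_bound[OF x that norm_le_wave(1)])
  have yb: "(\<Sum>k\<in>S. (?y k)\<^sup>2) \<le> (sqrt (nsq lam 0 y))\<^sup>2" if "finite S" "S \<subseteq> frequencies" for S
    using mode_weight_bound[OF y that wave_powr_0] by simp
  have bz: "(\<Sum>k\<in>S. (norm k)\<^sup>2 * (?z k)\<^sup>2) \<le> (sqrt (nsq lam 2 (unit_seq j)))\<^sup>2" if "finite S" "S \<subseteq> frequencies" for S
    unfolding power_mult_distrib mult.assoc[symmetric] by (rule mode_weight_bound[OF z that w2])
  note tri_sum = lattice_trilinear[of ?x ?y ?z, OF _ _ _ _ _ _ bx _ yb _ bz]
  have s: "(\<lambda>(k, l). ?x k * ?y l * ?z (k + l)) summable_on (frequencies \<times> frequencies)"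
    by (rule tri_sum(1)) (simp_all add: nsq_nonneg x y z)
  have s': "(\<Sum>\<^sub>\<infinity>(k, l)\<in>frequencies \<times> frequencies. ?x k * ?y l * ?z (k + l))
      \<le> 16 * sqrt (nsq lam (1/2) x) * sqrt (nsq lam 0 y) * sqrt (nsq lam 2 (unit_seq j))"
    by (rule tri_sum(2)) (simp_all add: nsq_nonneg x y z)
  have le: "\<bar>tri_term (mode_fourier x) (mode_fourier y) (mode_fourier (unit_seq j)) (k, l)\<bar>
      \<le> 2 * pi * (\<lambda>(k, l). ?x k * ?y l * ?z (k + l)) (k, l)" if k: "k \<in> frequencies" for k l
  proof -
    have "kdot k (mode_fourier x k) = 0" using mode_fourier_solenoidal k by (auto simp: solenoidal_coeffs_def)
    then have "kdot l (mode_fourier x k) = kdot (k + l) (mode_fourier x k)" by (simp add: kdot_add_left)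
    then have "norm (kdot l (mode_fourier x k)) \<le> norm (k + l) * ?x k" using norm_kdot[of "k + l" "mode_fourier x k"] by simp
    then have "norm (kdot l (mode_fourier x k)) * (?y l * norm (mode_fourier (unit_seq j) (k + l)))
        \<le> (norm (k + l) * ?x k) * (?y l * norm (mode_fourier (unit_seq j) (k + l)))"
      by (intro mult_right_mono) auto
    then have "2 * pi * (norm (kdot l (mode_fourier x k)) * (?y l * norm (mode_fourier (unit_seq j) (k + l))))
        \<le> 2 * pi * (?x k * ?y l * ?z (k + l))"
      by (intro mult_left_mono) (simp_all add: mult_ac)
    then show ?thesis using order_trans[OF tri_term_bound] by simp
  qed
  show "mtri_summable x y (unit_seq j)"
    "\<bar>mtri x y (unit_seq j)\<bar> \<le> 2 * pi * (16 * sqrt (nsq lam (1/2) x) * sqrt (nsq lam 0 y) * sqrt (nsq lam 2 (unit_seq j)))"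
    by (rule tri_dominated[OF s s' le], assumption)+
qed

lemma mtri_add1:
  assumes "mtri_summable x y z" "mtri_summable x' y z"
  shows "mtri (\<lambda>k. x k + x' k) y z = mtri x y z + mtri x' y z"
proof -
  have "tri_term (mode_fourier (\<lambda>k. x k + x' k)) (mode_fourier y) (mode_fourier z)
      = (\<lambda>p. tri_term (mode_fourier x) (mode_fourier y) (mode_fourier z) p + tri_term (mode_fourier x') (mode_fourier y) (mode_fourier z) p)"
    by (simp add: tri_term_def fun_eq_iff mode_fourier_add kdot_add algebra_simps)
  then show ?thesis unfolding tri_def using infsum_add[OF assms] by simp
qed

lemma mtri_add2:
  assumes "mtri_summable x y z" "mtri_summable x y' z"
  shows "mtri x (\<lambda>k. y k + y' k) z = mtri x y z + mtri x y' z"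
proof -
  have "tri_term (mode_fourier x) (mode_fourier (\<lambda>k. y k + y' k)) (mode_fourier z)
      = (\<lambda>p. tri_term (mode_fourier x) (mode_fourier y) (mode_fourier z) p + tri_term (mode_fourier x) (mode_fourier y') (mode_fourier z) p)"
    by (simp add: tri_term_def fun_eq_iff mode_fourier_add herm_linear algebra_simps)
  then show ?thesis unfolding tri_def using infsum_add[OF assms] by simp
qed

lemma mtri_scale3: "mtri x y (\<lambda>k. a * z k) = a * mtri x y z"
proof -
  have "tri_term (mode_fourier x) (mode_fourier y) (mode_fourier (\<lambda>k. a * z k))
      = (\<lambda>p. a * tri_term (mode_fourier x) (mode_fourier y) (mode_fourier z) p)"
    by (simp add: tri_term_def fun_eq_iff mode_fourier_scale herm_linear scaleR_conv_of_real[where 'a=complex] algebra_simps)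
  then show ?thesis unfolding tri_def by (simp add: infsum_cmult_right')
qed

lemma ell_half: "x \<in> ell lam 1 \<Longrightarrow> x \<in> ell lam (1/2)"
proof -
  assume x: "x \<in> ell lam 1"
  have "norm (lam k powr (1/2) * (x k)\<^sup>2) \<le> lam k powr 1 * (x k)\<^sup>2" for k
    using lam_ge_1[of k] unfolding real_norm_def
    by (subst abs_of_nonneg) (intro mult_nonneg_nonneg mult_right_mono powr_mono; simp)+
  then show "x \<in> ell lam (1/2)"
    using x unfolding ell_def mem_Collect_eq by (rule summable_comparison_test'[rotated])
qed

text \<open>In the constant, \<open>2 * pi\<close> comes from the gradient and 16 from the lattice
  estimate.\<close>

sublocale mode_system lam mtri "32 * pi"
proof
  show "1 \<le> lam k" for k by (rule lam_ge_1)
  show "finite {k. lam k \<le> R}" for R by (rule finite_lam_le)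
  show "mtri (\<lambda>k. x k + x' k) y z = mtri x y z + mtri x' y z"
    if "x \<in> ell lam 1" "x' \<in> ell lam 1" "y \<in> ell lam 1" "z \<in> ell lam 1" for x x' y z
    using that by (intro mtri_add1 mtri_bound1 ell_half)
  show "mtri x (\<lambda>k. y k + y' k) z = mtri x y z + mtri x y' z"
    if "x \<in> ell lam 1" "y \<in> ell lam 1" "y' \<in> ell lam 1" "z \<in> ell lam 1" for x y y' z
    using that by (intro mtri_add2 mtri_bound1 ell_half)
  show "mtri x y (\<lambda>k. a * z k) = a * mtri x y z" for x y z a by (rule mtri_scale3)
  show "mtri x z y = - mtri x y z" for x y z
    using mode_fourier_solenoidal[of x] by (intro tri_antisym mode_fourier_uminus) (simp add: solenoidal_coeffs_def)
  show "\<bar>mtri x y z\<bar> \<le> 32 * pi * sqrt (nsq lam (1/2) x) * sqrt (nsq lam 1 y) * sqrt (nsq lam 1 z)"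
    if "x \<in> ell lam 1" "y \<in> ell lam 1" "z \<in> ell lam 1" for x y z
    using mtri_bound1(2)[OF ell_half[OF that(1)] that(2,3)] by simp
  show "\<bar>mtri x y z\<bar> \<le> 32 * pi * sqrt (nsq lam 1 x) * sqrt (nsq lam 1 y) * sqrt (nsq lam (1/2) z)"
    if "x \<in> ell lam 1" "y \<in> ell lam 1" "z \<in> ell lam 1" for x y z
    using mtri_bound3[OF that(1,2) ell_half[OF that(3)]] by (simp add: mult_ac)
qed simp

end

section \<open>The pairing of the nonlinearity with an eigenfunction\<close>

lemma norm_re_part: "norm (re_part c z) \<le> (\<Sum>j\<in>UNIV. norm (c $ j)) * norm z"
proof -
  have "norm (re_part c z) \<le> (\<Sum>j\<in>UNIV. norm (re_part c z $ j))" by (rule norm_le_l1_cart[unfolded real_norm_def[symmetric]])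
  also have "\<dots> \<le> (\<Sum>j\<in>UNIV. norm (c $ j) * norm z)"
  proof (rule sum_mono)
    fix j show "norm (re_part c z $ j) \<le> norm (c $ j) * norm z"
      using abs_Re_le_cmod[of "c $ j * z"] by (simp only: re_part_def vec_lambda_beta real_norm_def norm_mult)
  qed
  finally show ?thesis by (simp add: sum_distrib_right)
qed

lemma fourier_partial_bounded: "norm (fourier_partial c A x) \<le> (\<Sum>m\<in>A. \<Sum>j\<in>UNIV. norm (c m $ j))"
proof -
  have "norm (fourier_partial c A x) \<le> (\<Sum>m\<in>A. norm (plane_wave (c m) m x))"
    unfolding fourier_partial_def by (rule norm_sum)
  also have "\<dots> \<le> (\<Sum>m\<in>A. \<Sum>j\<in>UNIV. norm (c m $ j))"
    by (intro sum_mono order_trans[OF norm_re_part[of "c _" "wave _ x", folded plane_wave_def]]) simp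
  finally show ?thesis .
qed

lemma fourier_partial_complex:
  assumes neg: "\<And>k. k \<in> A \<Longrightarrow> - k \<in> A" and real: "\<And>k. k \<in> A \<Longrightarrow> c (- k) = cnj_vec (c k)"
  shows "complex_of_real (fourier_partial c A x $ i) = (\<Sum>m\<in>A. cnj (c m $ i) * wave (- m) x)"
proof -
  have half: "complex_of_real (Re z) = (z + cnj z) / 2" for z by (simp add: complex_eq_iff)
  have "(\<Sum>m\<in>A. c m $ i * wave m x) = (\<Sum>m\<in>A. cnj (c m $ i) * wave (- m) x)"
    by (rule sum.reindex_bij_witness[of _ uminus uminus]) (auto simp: neg real cnj_vec_def)
  moreover have "complex_of_real (fourier_partial c A x $ i)
      = (\<Sum>m\<in>A. (c m $ i * wave m x + cnj (c m $ i) * wave (- m) x) / 2)"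
    unfolding fourier_partial_def plane_wave_def re_part_def sum_component vec_lambda_beta of_real_sum half
    by (simp only: complex_cnj_mult cnj_wave)
  ultimately show ?thesis by (simp add: sum.distrib flip: sum_divide_distrib)
qed

lemma L2_fields_inner_bounded:
  assumes w: "w \<in> L2_fields" and p: "p \<in> L2_fields" and M: "\<And>x. norm (p x) \<le> M"
  shows "(\<lambda>x. (w x \<bullet> p x) *\<^sub>R b) \<in> L2_fields"
  unfolding L2_fields_def mem_Collect_eq
proof (intro conjI)
  note wD = L2_fieldsD[OF w] and pD = L2_fieldsD[OF p]
  show "torus_periodic (\<lambda>x. (w x \<bullet> p x) *\<^sub>R b)" using wD(1) pD(1) by (simp add: torus_periodic_def)
  show meas: "(\<lambda>x. (w x \<bullet> p x) *\<^sub>R b) \<in> borel_measurable T3" using wD(2) pD(2) by measurable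
  have M0: "0 \<le> M" using order_trans[OF norm_ge_zero M] .
  have "integrable T3 (\<lambda>x. (M * norm b)\<^sup>2 * (norm (w x))\<^sup>2)" using wD(3) by simp
  then show "integrable T3 (\<lambda>x. (norm ((w x \<bullet> p x) *\<^sub>R b))\<^sup>2)"
  proof (rule Bochner_Integration.integrable_bound)
    show "(\<lambda>x. (norm ((w x \<bullet> p x) *\<^sub>R b))\<^sup>2) \<in> borel_measurable T3" using meas by measurable
    have "(norm ((w x \<bullet> p x) *\<^sub>R b))\<^sup>2 \<le> (M * norm b)\<^sup>2 * (norm (w x))\<^sup>2" for x
    proof -
      have "\<bar>w x \<bullet> p x\<bar> \<le> norm (w x) * M"
        using Cauchy_Schwarz_ineq2[of "w x" "p x"] mult_left_mono[OF M[of x], of "norm (w x)"] by simp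
      then have "\<bar>w x \<bullet> p x\<bar> * norm b \<le> norm (w x) * M * norm b" by (rule mult_right_mono) simp
      then have "(norm ((w x \<bullet> p x) *\<^sub>R b))\<^sup>2 \<le> (norm (w x) * M * norm b)\<^sup>2" by (intro power_mono) auto
      then show ?thesis by (simp add: power_mult_distrib mult_ac)
    qed
    then show "AE x in T3. norm ((norm ((w x \<bullet> p x) *\<^sub>R b))\<^sup>2) \<le> norm ((M * norm b)\<^sup>2 * (norm (w x))\<^sup>2)" by simp
  qed
qed

text \<open>Multiplication by a trigonometric polynomial is a finite convolution of
  coefficients.\<close>

lemma fourier_inner_partial:
  assumes w: "w \<in> L2_fields"
    and A: "\<And>k. k \<in> A \<Longrightarrow> - k \<in> A" and real: "\<And>k. k \<in> A \<Longrightarrow> c (- k) = cnj_vec (c k)"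
  shows "(\<integral>x. complex_of_real (w x \<bullet> fourier_partial c A x) * wave (- k) x \<partial>T3)
    = (\<Sum>m\<in>A. herm (fourier w (k + m)) (c m))"
proof -
  have i: "integrable T3 (\<lambda>x. cnj (c m $ i) * (complex_of_real (w x $ i) * wave (- (k + m)) x))" for m i
    by (intro integrable_mult_right integrable_component_wave w)
  have "complex_of_real (w x \<bullet> fourier_partial c A x) * wave (- k) x
      = (\<Sum>m\<in>A. \<Sum>i\<in>UNIV. cnj (c m $ i) * (complex_of_real (w x $ i) * wave (- (k + m)) x))" for x
  proof -
    have "complex_of_real (w x \<bullet> fourier_partial c A x) * wave (- k) x
        = (\<Sum>i\<in>UNIV. complex_of_real (w x $ i) * complex_of_real (fourier_partial c A x $ i) * wave (- k) x)"
      by (simp add: inner_vec_def sum_distrib_right)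
    also have "\<dots> = (\<Sum>i\<in>UNIV. \<Sum>m\<in>A. cnj (c m $ i) * (complex_of_real (w x $ i) * wave (- (k + m)) x))"
      by (simp add: fourier_partial_complex[where c=c] A real)
         (simp add: sum_distrib_left sum_distrib_right wave_add[of "- k" "- m" for m, simplified] mult_ac)
    also have "\<dots> = (\<Sum>m\<in>A. \<Sum>i\<in>UNIV. cnj (c m $ i) * (complex_of_real (w x $ i) * wave (- (k + m)) x))"
      by (rule sum.swap)
    finally show ?thesis .
  qed
  then have "(\<integral>x. complex_of_real (w x \<bullet> fourier_partial c A x) * wave (- k) x \<partial>T3)
      = (\<Sum>m\<in>A. \<Sum>i\<in>UNIV. cnj (c m $ i) * (\<integral>x. complex_of_real (w x $ i) * wave (- (k + m)) x \<partial>T3))"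
    using i by (simp add: Bochner_Integration.integral_sum Bochner_Integration.integrable_sum)
  also have "\<dots> = (\<Sum>m\<in>A. herm (fourier w (k + m)) (c m))"
    by (simp add: herm_def fourier_component mult.commute)
  finally show ?thesis .
qed

context stokes_basis
begin

text \<open>The field \<open>advection u u\<close> need not be square integrable, so Parseval's
  identity cannot be applied to it. The integrand is regrouped as \<open>u \<bullet> g\<close>,
  where the components of \<open>g\<close> are the products of a weak derivative of \<open>u\<close>
  with the bounded polynomial; \<open>u\<close> and \<open>g\<close> are both in
  \<open>L^2\<close>.\<close>

lemma ip_advection_partial:
  assumes u: "u \<in> sobolev 1"
    and A: "finite A" "A \<subseteq> frequencies" "\<And>k. k \<in> A \<Longrightarrow> - k \<in> A" and real: "\<And>k. k \<in> A \<Longrightarrow> c (- k) = cnj_vec (c k)"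
  shows "((\<lambda>k. \<Sum>m\<in>A. tri_term (fourier u) (fourier u) c (- k, k + m)) has_sum
    ip (advection u u) (fourier_partial c A)) frequencies"
proof -
  let ?p = "fourier_partial c A"
  define w where "w b = weak_partial b u" for b
  have uL: "u \<in> L2_fields" by (rule sobolev_L2[OF u])
  have wL: "w b \<in> L2_fields" if "b \<in> Basis" for b
    using sobolev_weak_partial(1)[OF u order_refl that] by (simp add: w_def is_weak_partial_def)
  have wF: "fourier (w b) k = (\<chi> j. 2 * pi * \<i> * of_real (k \<bullet> b) * fourier u k $ j)" if "b \<in> Basis" "k \<in> frequencies" for b k
    unfolding w_def by (rule sobolev_weak_partial(2)[OF u order_refl that])
  have pL: "?p \<in> L2_fields" by (rule fourier_partial_L2[OF A(2)])
  define g where "g x = (\<Sum>b\<in>Basis. (w b x \<bullet> ?p x) *\<^sub>R b)" for x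
  have gL: "g \<in> L2_fields"
    unfolding g_def[abs_def] by (intro L2_fields_sum L2_fields_inner_bounded[OF _ pL fourier_partial_bounded] wL)
  have ip_g: "ip (advection u u) ?p = ip u g"
    unfolding ip_def by (rule Bochner_Integration.integral_cong[OF refl])
      (simp add: advection_def g_def w_def inner_sum_left inner_sum_right mult.commute)
  have gF: "fourier g k $ j = (\<Sum>m\<in>A. herm (fourier (w (axis j 1)) (k + m)) (c m))" for k j
  proof -
    have "g x $ j = w (axis j 1) x \<bullet> ?p x" for x
      unfolding g_def sum_Basis_vec3 by (simp add: axis_def if_distrib[of "\<lambda>y. _ * y"] cong: if_cong)
    then show ?thesis
      unfolding fourier_component
      by (simp add: fourier_inner_partial[where c=c] wL A(3) real axis_in_Basis_iff)
  qed
  have term_eq: "fourier u k \<bullet> fourier g k = (\<Sum>m\<in>A. tri_term (fourier u) (fourier u) c (- k, k + m))"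
    if k: "k \<in> frequencies" for k
  proof -
    have inner: "a \<bullet> b = Re (\<Sum>j\<in>UNIV. cnj (a $ j) * b $ j)" for a b :: "complex^3"
      by (simp add: inner_vec_def inner_complex_def)
    have h: "herm (fourier (w (axis j 1)) (k + m)) (c m) = 2 * pi * \<i> * of_real ((k + m) $ j) * herm (fourier u (k + m)) (c m)"
      if m: "m \<in> A" for m j
    proof -
      have km: "k + m \<in> frequencies" using k m A(2) by auto
      have b: "axis j (1::real) \<in> Basis" by (simp add: axis_in_Basis_iff)
      show ?thesis
        unfolding wF[OF b km] herm_def sum_distrib_left vec_lambda_beta by (simp only: inner_axis inner_real_def mult_1_right mult.assoc)
    qed
    have "(\<Sum>j\<in>UNIV. cnj (fourier u k $ j) * fourier g k $ j)
        = (\<Sum>j\<in>UNIV. \<Sum>m\<in>A. cnj (fourier u k $ j) * (2 * pi * \<i> * of_real ((k + m) $ j) * herm (fourier u (k + m)) (c m)))"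
      unfolding gF sum_distrib_left by (intro sum.cong refl) (simp only: h)
    also have "\<dots> = (\<Sum>m\<in>A. \<Sum>j\<in>UNIV. cnj (fourier u k $ j) * (2 * pi * \<i> * of_real ((k + m) $ j) * herm (fourier u (k + m)) (c m)))"
      by (rule sum.swap)
    also have "\<dots> = (\<Sum>m\<in>A. 2 * pi * \<i> * (kdot (k + m) (fourier u (- k)) * herm (fourier u (k + m)) (c m)))"
      by (intro sum.cong refl)
         (simp only: fourier_uminus_freq kdot_def cnj_vec_def vec_lambda_beta sum_distrib_left sum_distrib_right mult_ac)
    finally show ?thesis unfolding inner by (simp only: Re_sum tri_term_def prod.case minus_add_cancel)
  qed
  show ?thesis
    using parseval[OF uL gL] unfolding ip_g
    by (rule has_sum_cong[THEN iffD1, rotated]) (simp add: term_eq)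
qed

lemma leray_phi_eq_partial:
  obtains A where "finite A" "A \<subseteq> frequencies" "\<And>k. k \<in> A \<Longrightarrow> - k \<in> A"
    "\<And>m. m \<in> frequencies - A \<Longrightarrow> fourier (\<phi> j) m = 0"
    "AE x in T3. leray (\<phi> j) x = fourier_partial (fourier (\<phi> j)) A x"
proof
  let ?A = "{m \<in> frequencies. wave_eigenvalue m \<le> lam j}"
  show A: "finite ?A" "?A \<subseteq> frequencies" "\<And>k. k \<in> ?A \<Longrightarrow> - k \<in> ?A"
    by (rule finite_freq_wave_eigenvalue_le) (auto simp: wave_eigenvalue_def)
  show z: "fourier (\<phi> j) m = 0" if "m \<in> frequencies - ?A" for m
    using phi_fourier_support[of m j] that by force
  have "AE x in T3. \<phi> j x = fourier_partial (fourier (\<phi> j)) ?A x"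
    by (rule fourier_unique[OF phi_L2 fourier_partial_L2[OF A(2)]])
       (use fourier_fourier_partial[OF A, of _ "fourier (\<phi> j)"] z in \<open>auto simp: fourier_uminus_freq\<close>)
  with leray_AE(2)[OF phi_H[of j]]
  show "AE x in T3. leray (\<phi> j) x = fourier_partial (fourier (\<phi> j)) ?A x" by eventually_elim simp
qed

text \<open>Parseval's identity delivers an iterated sum in shifted frequencies. The summability in
  \<open>mtri_bound2\<close> allows it to be read as a double sum, after which the shift is
  undone.\<close>

lemma B_pairing_phi:
  assumes u: "u \<in> V_space 1"
  shows "B_pairing u u (\<phi> j) = mtri (coord u) (coord u) (unit_seq j)"
proof -
  have us: "u \<in> sobolev 1" using u by (simp add: V_space_def)
  have uH: "u \<in> H_space" by (rule V_space_H[OF u]) auto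
  have uL: "u \<in> L2_fields" by (rule sobolev_L2[OF us])
  have u1: "coord u \<in> ell lam 1" by (rule coord_sobolev(1)[OF uH us]) simp
  have u0: "coord u \<in> ell lam 0" by (rule ell_mono(1)[OF _ u1]) simp
  obtain A where A: "finite A" "A \<subseteq> frequencies" "\<And>k. k \<in> A \<Longrightarrow> - k \<in> A"
    and z: "\<And>m. m \<in> frequencies - A \<Longrightarrow> fourier (\<phi> j) m = 0"
    and ae: "AE x in T3. leray (\<phi> j) x = fourier_partial (fourier (\<phi> j)) A x"
    by (rule leray_phi_eq_partial[of j]) blast
  let ?c = "fourier (\<phi> j)"
  have wm: "weak_partial b u \<in> borel_measurable T3" if "b \<in> Basis" for b
    using sobolev_weak_partial(1)[OF us order_refl that] by (auto simp: is_weak_partial_def L2_fields_def)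
  have advm: "advection u u \<in> borel_measurable T3"
    unfolding advection_def
    by (intro borel_measurable_sum borel_measurable_scaleR borel_measurable_inner L2_fieldsD(2)[OF uL] wm) auto
  have "B_pairing u u (\<phi> j) = ip (advection u u) (fourier_partial ?c A)"
    unfolding B_pairing_def ip_def
  proof (rule integral_cong_AE)
    show "(\<lambda>x. advection u u x \<bullet> leray (\<phi> j) x) \<in> borel_measurable T3"
      by (intro borel_measurable_inner advm L2_fieldsD(2)[OF H_space_L2[OF leray_AE(1)[OF phi_H]]])
    show "(\<lambda>x. advection u u x \<bullet> fourier_partial ?c A x) \<in> borel_measurable T3"
      by (intro borel_measurable_inner advm L2_fieldsD(2)[OF fourier_partial_L2[OF A(2)]])
    show "AE x in T3. advection u u x \<bullet> leray (\<phi> j) x = advection u u x \<bullet> fourier_partial ?c A x"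
      using ae by eventually_elim simp
  qed
  also have "\<dots> = infsum (\<lambda>k. \<Sum>m\<in>A. tri_term (fourier u) (fourier u) ?c (- k, k + m)) frequencies"
    by (rule infsumI[symmetric], rule ip_advection_partial[OF us A]) (auto simp: fourier_uminus_freq)
  also have "\<dots> = infsum (\<lambda>k. infsum (\<lambda>m. tri_term (fourier u) (fourier u) ?c (- k, k + m)) frequencies) frequencies"
  proof (rule infsum_cong)
    fix k
    have "infsum (\<lambda>m. tri_term (fourier u) (fourier u) ?c (- k, k + m)) frequencies
        = infsum (\<lambda>m. tri_term (fourier u) (fourier u) ?c (- k, k + m)) A"
      by (rule infsum_cong_neutral) (use z A(2) in \<open>auto simp: tri_term_def herm_def\<close>)
    then show "(\<Sum>m\<in>A. tri_term (fourier u) (fourier u) ?c (- k, k + m))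
        = infsum (\<lambda>m. tri_term (fourier u) (fourier u) ?c (- k, k + m)) frequencies"
      using A(1) by simp
  qed
  also have "\<dots> = infsum (\<lambda>p. tri_term (fourier u) (fourier u) ?c ((\<lambda>(k, l). (- k, k + l)) p)) (frequencies \<times> frequencies)"
  proof -
    have "mtri_summable (coord u) (coord u) (unit_seq j)" by (rule mtri_bound2(1)[OF ell_half[OF u1] u0])
    then have "tri_term (fourier u) (fourier u) ?c summable_on (frequencies \<times> frequencies)"
      by (rule summable_on_cong[THEN iffD1, rotated])
         (auto simp: tri_term_def fourier_eq_mode_fourier[OF uH] fourier_eq_mode_fourier[OF phi_H] coord_phi)
    then have "(\<lambda>p. tri_term (fourier u) (fourier u) ?c ((\<lambda>(k, l). (- k, k + l)) p)) summable_on (frequencies \<times> frequencies)"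
      by (rule summable_on_reindex_bij_betw[OF bij_freq_shift, THEN iffD2])
    from infsum_Sigma'_banach[of "\<lambda>k m. tri_term (fourier u) (fourier u) ?c (- k, k + m)" frequencies "\<lambda>_. frequencies"] this
    show ?thesis by (simp add: case_prod_unfold)
  qed
  also have "\<dots> = tri (fourier u) (fourier u) ?c"
    unfolding tri_def by (rule infsum_reindex_bij_betw[OF bij_freq_shift])
  also have "\<dots> = mtri (coord u) (coord u) (unit_seq j)"
    by (rule tri_cong) (simp add: fourier_eq_mode_fourier[OF uH] fourier_eq_mode_fourier[OF phi_H] coord_phi)
  finally show ?thesis .
qed

end

section \<open>From solutions to mode sequences\<close>

text \<open>The integrands of the weak formulations are known only almost everywhere; the continuous
  function \<open>g\<close> supplies the integrability of \<open>f\<close> and a value to which the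
  fundamental theorem of calculus applies.\<close>

lemma lebesgue_on_integral_eq_continuous:
  fixes f g :: "real \<Rightarrow> real"
  assumes g: "continuous_on {a..b} g" and ae: "AE x in lebesgue_on {a..b}. f x = g x"
  shows "integral\<^sup>L (lebesgue_on {a..b}) f = integral {a..b} g"
proof -
  have "AE x in lebesgue. x \<in> {a..b} \<longrightarrow> f x = g x"
    using ae by (subst (asm) AE_restrict_space_iff) auto
  then obtain S where S: "S \<in> null_sets lebesgue" "{x \<in> space lebesgue. \<not> (x \<in> {a..b} \<longrightarrow> f x = g x)} \<subseteq> S"
    unfolding eventually_ae_filter by blast
  have neg: "negligible S" using S(1) by (simp add: negligible_iff_null_sets)
  have eq: "f x = g x" if "x \<in> {a..b} - S" for x using S(2) that by auto
  have "g absolutely_integrable_on {a..b}" using absolutely_integrable_continuous[of a b g] g by simp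
  then have "f absolutely_integrable_on {a..b}" by (rule absolutely_integrable_spike[OF _ neg eq])
  then have "integrable (lebesgue_on {a..b}) f" by (rule absolutely_integrable_imp_integrable) simp
  then have "integral\<^sup>L (lebesgue_on {a..b}) f = integral {a..b} f" by (rule lebesgue_integral_eq_integral) simp
  also have "\<dots> = integral {a..b} g" by (rule integral_spike[OF neg]) (simp add: eq)
  finally show ?thesis .
qed

lemma sobolev_diff:
  assumes u: "u \<in> sobolev s" and v: "v \<in> sobolev s"
  shows "u - v \<in> sobolev s"
  unfolding sobolev_def mem_Collect_eq
proof
  note uL = sobolev_L2[OF u] and vL = sobolev_L2[OF v]
  show "u - v \<in> L2_fields" by (rule L2_fields_diff(2)[OF uL vL])
  have "(\<lambda>k. 2 * sobolev_weight s u k + 2 * sobolev_weight s v k) summable_on frequencies"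
    using u v by (intro summable_on_add summable_on_cmult_right) (auto simp: sobolev_def)
  then show "sobolev_weight s (u - v) summable_on frequencies"
  proof (rule summable_on_comparison_test)
    fix k
    have "(norm (fourier u k - fourier v k))\<^sup>2 \<le> (norm (fourier u k) + norm (fourier v k))\<^sup>2"
      by (intro power_mono norm_triangle_ineq4) auto
    then have "(norm (fourier u k - fourier v k))\<^sup>2 \<le> 2 * (norm (fourier u k))\<^sup>2 + 2 * (norm (fourier v k))\<^sup>2"
      using sum_squares_bound[of "norm (fourier u k)" "norm (fourier v k)"] by (simp add: power2_sum)
    then have "(1 + (2 * pi * norm k)\<^sup>2) powr s * (norm (fourier u k - fourier v k))\<^sup>2
        \<le> (1 + (2 * pi * norm k)\<^sup>2) powr s * (2 * (norm (fourier u k))\<^sup>2 + 2 * (norm (fourier v k))\<^sup>2)"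
      by (rule mult_left_mono) simp
    then show "sobolev_weight s (u - v) k \<le> 2 * sobolev_weight s u k + 2 * sobolev_weight s v k"
      unfolding sobolev_weight_def fun_diff_def fourier_diff[OF uL vL] by (simp only: distrib_left mult.left_commute)
  qed (simp add: sobolev_weight_def)
qed

lemma sobolev_norm_nonneg: "0 \<le> sobolev_norm s u"
  by (simp add: sobolev_norm_def infsum_nonneg sobolev_weight_def)

section \<open>Continuity in time of the coordinates\<close>

context stokes_basis
begin

lemma coord_V_space:
  assumes "u \<in> V_space s" "0 \<le> s" "s \<le> 1"
  shows "coord u \<in> E s" "sqrt (N s (coord u)) \<le> sobolev_norm s u"
proof -
  have us: "u \<in> sobolev s" using assms(1) by (simp add: V_space_def)
  note c = coord_sobolev[OF V_space_H[OF assms] us assms(2)]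
  show "coord u \<in> E s" by (rule c(1))
  show "sqrt (N s (coord u)) \<le> sobolev_norm s u"
    using real_sqrt_le_mono[OF c(2)] sobolev_norm_nonneg[of s u] by simp
qed

lemma coord_V_space_diff:
  assumes u: "u \<in> V_space s" and v: "v \<in> V_space s" and s: "0 \<le> s" "s \<le> 1"
  shows "sqrt (N s (\<lambda>k. coord u k - coord v k)) \<le> sobolev_norm s (u - v)"
proof -
  note uH = V_space_H[OF u s] and vH = V_space_H[OF v s]
  have d: "u - v \<in> sobolev s" using u v by (intro sobolev_diff) (auto simp: V_space_def)
  have H: "u - v \<in> H_space" using H_space_diff[OF uH vH] by (simp add: fun_diff_def)
  have e: "coord (u - v) = (\<lambda>k. coord u k - coord v k)"
    using ip_diff_left[OF H_space_L2[OF uH] H_space_L2[OF vH] phi_L2] by (simp add: fun_diff_def)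
  show ?thesis
    using real_sqrt_le_mono[OF coord_sobolev(2)[OF H d s(1)]] sobolev_norm_nonneg[of s "u - v"] by (simp add: e)
qed

definition ell_continuous :: "real \<Rightarrow> real \<Rightarrow> (real \<Rightarrow> nat \<Rightarrow> real) \<Rightarrow> bool" where
  "ell_continuous s T a \<longleftrightarrow> (\<forall>t\<in>{0..T}. a t \<in> E s) \<and>
     (\<forall>t\<^sub>0\<in>{0..T}. ((\<lambda>t. sqrt (N s (\<lambda>k. a t k - a t\<^sub>0 k))) \<longlongrightarrow> 0) (at t\<^sub>0 within {0..T}))"

lemma tendsto_within_comparison:
  fixes f g :: "real \<Rightarrow> real"
  assumes "(g \<longlongrightarrow> 0) (at t within S)" "\<And>t. t \<in> S \<Longrightarrow> \<bar>f t\<bar> \<le> g t"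
  shows "(f \<longlongrightarrow> 0) (at t within S)"
  by (rule Lim_null_comparison[OF _ assms(1)]) (use assms(2) in \<open>auto simp: eventually_at_filter\<close>)

lemma continuous_on_by_modulus:
  fixes f :: "real \<Rightarrow> real"
  assumes "\<And>t\<^sub>0. t\<^sub>0 \<in> S \<Longrightarrow> (g t\<^sub>0 \<longlongrightarrow> 0) (at t\<^sub>0 within S)"
    and "\<And>t t\<^sub>0. t \<in> S \<Longrightarrow> t\<^sub>0 \<in> S \<Longrightarrow> \<bar>f t - f t\<^sub>0\<bar> \<le> g t\<^sub>0 t"
  shows "continuous_on S f"
  unfolding continuous_on_def
proof
  fix t\<^sub>0 assume t: "t\<^sub>0 \<in> S"
  have "((\<lambda>t. f t - f t\<^sub>0) \<longlongrightarrow> 0) (at t\<^sub>0 within S)"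
    by (rule tendsto_within_comparison[OF assms(1)[OF t]]) (rule assms(2)[OF _ t])
  then show "(f \<longlongrightarrow> f t\<^sub>0) (at t\<^sub>0 within S)" by (rule LIM_zero_cancel)
qed

lemma ell_continuous_coord_V:
  assumes "continuous_into T (V_space s) (sobolev_norm s) u" "0 \<le> s" "s \<le> 1"
  shows "ell_continuous s T (\<lambda>t. coord (u t))"
  unfolding ell_continuous_def
proof (intro conjI ballI)
  have V: "u t \<in> V_space s" if "t \<in> {0..T}" for t using assms(1) that by (auto simp: continuous_into_def)
  fix t assume t: "t \<in> {0..T}"
  show "coord (u t) \<in> E s" by (rule coord_V_space(1)[OF V[OF t] assms(2,3)])
  show "((\<lambda>t'. sqrt (N s (\<lambda>k. coord (u t') k - coord (u t) k))) \<longlongrightarrow> 0) (at t within {0..T})"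
  proof (rule tendsto_within_comparison)
    show "((\<lambda>t'. sobolev_norm s (u t' - u t)) \<longlongrightarrow> 0) (at t within {0..T})"
      using assms(1) t by (auto simp: continuous_into_def)
    fix t' assume t': "t' \<in> {0..T}"
    have "(\<lambda>k. coord (u t') k - coord (u t) k) \<in> E s"
      by (intro ell_diff(1) coord_V_space(1)[OF V] assms(2,3) t t')
    then show "\<bar>sqrt (N s (\<lambda>k. coord (u t') k - coord (u t) k))\<bar> \<le> sobolev_norm s (u t' - u t)"
      using coord_V_space_diff[OF V[OF t'] V[OF t] assms(2,3)] nsq_nonneg by simp
  qed
qed

lemma ell_continuous_mono:
  assumes a: "ell_continuous s T a" and s: "s' \<le> s"
  shows "ell_continuous s' T a"
  unfolding ell_continuous_def
proof (intro conjI ballI)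
  have aE: "a t \<in> E s" if "t \<in> {0..T}" for t using a that by (auto simp: ell_continuous_def)
  fix t assume t: "t \<in> {0..T}"
  show "a t \<in> E s'" by (rule ell_mono(1)[OF s aE[OF t]])
  show "((\<lambda>t'. sqrt (N s' (\<lambda>k. a t' k - a t k))) \<longlongrightarrow> 0) (at t within {0..T})"
  proof (rule tendsto_within_comparison)
    show "((\<lambda>t'. sqrt (N s (\<lambda>k. a t' k - a t k))) \<longlongrightarrow> 0) (at t within {0..T})"
      using a t by (auto simp: ell_continuous_def)
    fix t' assume t': "t' \<in> {0..T}"
    note d = ell_diff(1)[OF aE[OF t'] aE[OF t]]
    show "\<bar>sqrt (N s' (\<lambda>k. a t' k - a t k))\<bar> \<le> sqrt (N s (\<lambda>k. a t' k - a t k))"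
      using ell_mono[OF s d] nsq_nonneg by simp
  qed
qed

lemma ell_continuous_sqrt_nsq:
  assumes a: "ell_continuous s T a"
  shows "continuous_on {0..T} (\<lambda>t. sqrt (N s (a t)))"
  by (rule continuous_on_by_modulus[where g="\<lambda>t\<^sub>0 t. sqrt (N s (\<lambda>k. a t k - a t\<^sub>0 k))"])
     (use a in \<open>auto simp: ell_continuous_def intro: nsq_abs_diff\<close>)

lemma ell_continuous_nsq:
  assumes a: "ell_continuous s T a"
  shows "continuous_on {0..T} (\<lambda>t. N s (a t))"
proof -
  have "continuous_on {0..T} (\<lambda>t. (sqrt (N s (a t)))\<^sup>2)"
    by (intro continuous_on_power ell_continuous_sqrt_nsq a)
  then show ?thesis
    by (rule continuous_on_cong[THEN iffD1, rotated -1]) (use a nsq_nonneg in \<open>auto simp: ell_continuous_def\<close>)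
qed

lemma ell_continuous_component:
  assumes a: "ell_continuous 0 T a"
  shows "continuous_on {0..T} (\<lambda>t. a t k)"
proof (rule continuous_on_by_modulus[where g="\<lambda>t\<^sub>0 t. sqrt (N 0 (\<lambda>k. a t k - a t\<^sub>0 k))"])
  show "((\<lambda>t. sqrt (N 0 (\<lambda>k. a t k - a t\<^sub>0 k))) \<longlongrightarrow> 0) (at t\<^sub>0 within {0..T})" if "t\<^sub>0 \<in> {0..T}" for t\<^sub>0
    using a that by (auto simp: ell_continuous_def)
  fix t t\<^sub>0 assume t: "t \<in> {0..T}" "t\<^sub>0 \<in> {0..T}"
  have "(\<lambda>k. a t k - a t\<^sub>0 k) \<in> E 0" using a t by (intro ell_diff(1)) (auto simp: ell_continuous_def)
  from nsq_ge_term[OF this, of k] have "(a t k - a t\<^sub>0 k)\<^sup>2 \<le> N 0 (\<lambda>k. a t k - a t\<^sub>0 k)"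
    using lam_pos[of k] by simp
  from real_sqrt_le_mono[OF this] show "\<bar>a t k - a t\<^sub>0 k\<bar> \<le> sqrt (N 0 (\<lambda>k. a t k - a t\<^sub>0 k))" by simp
qed

text \<open>The difference of the quadratic expressions is telescoped and each part bounded by
  \<open>mtri_bound2\<close>, so continuity into \<open>E (1/2)\<close> suffices. Through this the
  condition \<open>1/2 \<le> r\<close> reaches the mode equations.\<close>

lemma ell_continuous_mtri:
  assumes a: "ell_continuous (1/2) T a"
  shows "continuous_on {0..T} (\<lambda>t. mtri (a t) (a t) (unit_seq j))"
proof -
  define K where "K = 2 * pi * 16 * sqrt (N 2 (unit_seq j))"
  have K: "0 \<le> K" using nsq_nonneg[OF unit_ell] by (simp add: K_def)
  have a0: "ell_continuous 0 T a" by (rule ell_continuous_mono[OF a]) simp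
  have bound: "\<bar>mtri x y (unit_seq j)\<bar> \<le> K * (sqrt (N (1/2) x) * sqrt (N 0 y))"
    if "x \<in> E (1/2)" "y \<in> E 0" for x y
    using mtri_bound2(2)[OF that, of j] by (simp add: K_def mult_ac)
  define D where "D s t\<^sub>0 t = sqrt (N s (\<lambda>k. a t k - a t\<^sub>0 k))" for s t\<^sub>0 t
  define g where "g t\<^sub>0 t = K * (D (1/2) t\<^sub>0 t * sqrt (N 0 (a t))) + K * (sqrt (N (1/2) (a t\<^sub>0)) * D 0 t\<^sub>0 t)" for t\<^sub>0 t
  show ?thesis
  proof (rule continuous_on_by_modulus[where g=g])
    fix t\<^sub>0 assume t: "t\<^sub>0 \<in> {0..T}"
    have D0: "(D s t\<^sub>0 \<longlongrightarrow> 0) (at t\<^sub>0 within {0..T})" if "ell_continuous s T a" for s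
      using that t by (auto simp: ell_continuous_def D_def[abs_def])
    have n: "((\<lambda>t. sqrt (N 0 (a t))) \<longlongrightarrow> sqrt (N 0 (a t\<^sub>0))) (at t\<^sub>0 within {0..T})"
      using ell_continuous_sqrt_nsq[OF a0] t by (auto simp: continuous_on_def)
    have "(g t\<^sub>0 \<longlongrightarrow> K * (0 * sqrt (N 0 (a t\<^sub>0))) + K * (sqrt (N (1/2) (a t\<^sub>0)) * 0)) (at t\<^sub>0 within {0..T})"
      unfolding g_def[abs_def] by (intro tendsto_add tendsto_mult tendsto_const D0 a a0 n)
    then show "(g t\<^sub>0 \<longlongrightarrow> 0) (at t\<^sub>0 within {0..T})" by simp
  next
    fix t t\<^sub>0 assume t: "t \<in> {0..T}" and t0: "t\<^sub>0 \<in> {0..T}"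
    let ?d = "\<lambda>k. a t k - a t\<^sub>0 k"
    have h: "a t \<in> E (1/2)" "a t\<^sub>0 \<in> E (1/2)" and z: "a t \<in> E 0" "a t\<^sub>0 \<in> E 0"
      using a a0 t t0 by (auto simp: ell_continuous_def)
    note dh = ell_diff(1)[OF h] and dz = ell_diff(1)[OF z]
    have "mtri (a t) (a t) (unit_seq j) = mtri ?d (a t) (unit_seq j) + mtri (a t\<^sub>0) (a t) (unit_seq j)"
      using mtri_add1[OF mtri_bound2(1)[OF dh z(1)] mtri_bound2(1)[OF h(2) z(1)], of j] by simp
    also have "mtri (a t\<^sub>0) (a t) (unit_seq j) = mtri (a t\<^sub>0) ?d (unit_seq j) + mtri (a t\<^sub>0) (a t\<^sub>0) (unit_seq j)"
      using mtri_add2[OF mtri_bound2(1)[OF h(2) dz] mtri_bound2(1)[OF h(2) z(2)], of j] by simp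
    finally have "\<bar>mtri (a t) (a t) (unit_seq j) - mtri (a t\<^sub>0) (a t\<^sub>0) (unit_seq j)\<bar>
        \<le> \<bar>mtri ?d (a t) (unit_seq j)\<bar> + \<bar>mtri (a t\<^sub>0) ?d (unit_seq j)\<bar>" by simp
    also have "\<dots> \<le> g t\<^sub>0 t"
      unfolding g_def D_def by (intro add_mono bound dh dz h z)
    finally show "\<bar>mtri (a t) (a t) (unit_seq j) - mtri (a t\<^sub>0) (a t\<^sub>0) (unit_seq j)\<bar> \<le> g t\<^sub>0 t" .
  qed
qed

text \<open>
  \<open>u t \<in> V_space 1\<close> holds only for almost every \<open>t\<close>, but almost everywhere the integrands agree with functions
  that are continuous in time.
\<close>

lemma mode_derivative:
  assumes a: "ell_continuous (1/2) T (\<lambda>t. coord (u t))"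
    and V: "AE t in lebesgue_on {0..T}. u t \<in> V_space 1"
    and eq: "\<And>t. t \<in> {0..T} \<Longrightarrow>
      m * coord (u t) k + \<nu> * (\<integral>\<tau>. ip (stokes_powr \<phi> lam (1/2) (u \<tau>)) (stokes_powr \<phi> lam (1/2) (\<phi> k)) \<partial>lebesgue_on {0..t})
        = - (\<integral>\<tau>. B_pairing (u \<tau>) (u \<tau>) (\<phi> k) \<partial>lebesgue_on {0..t}) + c"
    and t: "t \<in> {0..T}"
  shows "((\<lambda>t. m * coord (u t) k) has_real_derivative
    - (\<nu> * lam k * coord (u t) k) - mtri (coord (u t)) (coord (u t)) (unit_seq k)) (at t within {0..T})"
proof -
  let ?b = "\<lambda>t. mtri (coord (u t)) (coord (u t)) (unit_seq k)"
  have ca: "continuous_on {0..T} (\<lambda>t. lam k * coord (u t) k)"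
    by (intro continuous_on_mult_left ell_continuous_component ell_continuous_mono[OF a]) simp
  have cb: "continuous_on {0..T} ?b" by (rule ell_continuous_mtri[OF a])
  have e: "m * coord (u t) k = c - \<nu> * integral {0..t} (\<lambda>t. lam k * coord (u t) k) - integral {0..t} ?b"
    if t: "t \<in> {0..T}" for t
  proof -
    have sub: "{0..t} \<subseteq> {0..T}" using t by auto
    have V': "AE \<tau> in lebesgue_on {0..t}. u \<tau> \<in> V_space 1" by (rule AE_lebesgue_on_subset[OF V sub]) auto
    have "(\<integral>\<tau>. ip (stokes_powr \<phi> lam (1/2) (u \<tau>)) (stokes_powr \<phi> lam (1/2) (\<phi> k)) \<partial>lebesgue_on {0..t})
        = integral {0..t} (\<lambda>t. lam k * coord (u t) k)"
    proof (rule lebesgue_on_integral_eq_continuous[OF continuous_on_subset[OF ca sub]])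
      from V' show "AE \<tau> in lebesgue_on {0..t}.
          ip (stokes_powr \<phi> lam (1/2) (u \<tau>)) (stokes_powr \<phi> lam (1/2) (\<phi> k)) = lam k * coord (u \<tau>) k"
      proof eventually_elim
        case (elim \<tau>)
        have "coord (u \<tau>) \<in> E (2 * (1/2))" using coord_V_space(1)[OF elim] by simp
        from ip_stokes_powr_phi[OF this, of k] show ?case using lam_pos[of k] by simp
      qed
    qed
    moreover have "(\<integral>\<tau>. B_pairing (u \<tau>) (u \<tau>) (\<phi> k) \<partial>lebesgue_on {0..t}) = integral {0..t} ?b"
    proof (rule lebesgue_on_integral_eq_continuous[OF continuous_on_subset[OF cb sub]])
      from V' show "AE \<tau> in lebesgue_on {0..t}. B_pairing (u \<tau>) (u \<tau>) (\<phi> k) = ?b \<tau>"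
        by eventually_elim (rule B_pairing_phi)
    qed
    ultimately show ?thesis using eq[OF t] by simp
  qed
  have "((\<lambda>t. c - \<nu> * integral {0..t} (\<lambda>t. lam k * coord (u t) k) - integral {0..t} ?b) has_real_derivative
      0 - \<nu> * (lam k * coord (u t) k) - ?b t) (at t within {0..T})"
    by (intro DERIV_diff DERIV_const DERIV_cmult integral_has_real_derivative[OF ca t] integral_has_real_derivative[OF cb t])
  then have "((\<lambda>t. m * coord (u t) k) has_real_derivative 0 - \<nu> * (lam k * coord (u t) k) - ?b t) (at t within {0..T})"
    by (rule has_field_derivative_transform_within[OF _ zero_less_one t]) (simp add: e)
  then show ?thesis by (simp add: mult.assoc)
qed

text \<open>Serves both equations. The majorant \<open>G\<close> is the
  \<open>sobolev_norm 1\<close> of the solution for Navier--Stokes and its \<open>V_cap_norm\<close>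
  for Voigt.\<close>

lemma mode_flow_coord:
  assumes cont: "continuous_into T (V_space r) (sobolev_norm r) u" and r: "1/2 \<le> r" "r \<le> 1"
    and V: "AE t in lebesgue_on {0..T}. u t \<in> V_space 1"
    and G: "integrable (lebesgue_on {0..T}) (\<lambda>t. (G t)\<^sup>2)" "\<And>t. sobolev_norm 1 (u t) \<le> G t"
    and eq: "\<And>t k. t \<in> {0..T} \<Longrightarrow>
      (1 + \<epsilon> * lam k powr r) * coord (u t) k
        + \<nu> * (\<integral>\<tau>. ip (stokes_powr \<phi> lam (1/2) (u \<tau>)) (stokes_powr \<phi> lam (1/2) (\<phi> k)) \<partial>lebesgue_on {0..t})
        = - (\<integral>\<tau>. B_pairing (u \<tau>) (u \<tau>) (\<phi> k) \<partial>lebesgue_on {0..t}) + c k"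
  shows "mode_flow \<nu> \<epsilon> r T (\<lambda>t. coord (u t))"
  unfolding mode_flow_def
proof (intro conjI allI ballI)
  have ar: "ell_continuous r T (\<lambda>t. coord (u t))" by (rule ell_continuous_coord_V[OF cont]) (use r in auto)
  have ah: "ell_continuous (1/2) T (\<lambda>t. coord (u t))" by (rule ell_continuous_mono[OF ar r(1)])
  have a0: "ell_continuous 0 T (\<lambda>t. coord (u t))" by (rule ell_continuous_mono[OF ah]) simp
  show "coord (u t) \<in> E r" if "t \<in> {0..T}" for t using ar that by (auto simp: ell_continuous_def)
  show "\<exists>K. \<forall>t\<in>{0..T}. N (1/2) (coord (u t)) \<le> K"
  proof -
    have "bounded ((\<lambda>t. N (1/2) (coord (u t))) ` {0..T})"
      by (intro compact_imp_bounded compact_continuous_image ell_continuous_nsq ah) auto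
    then obtain K where "\<forall>t\<in>{0..T}. norm (N (1/2) (coord (u t))) \<le> K" unfolding bounded_iff by blast
    then have "\<forall>t\<in>{0..T}. N (1/2) (coord (u t)) \<le> K" by (simp add: abs_le_iff)
    then show ?thesis ..
  qed
  show "AE t in lebesgue_on {0..T}. coord (u t) \<in> E 1"
    using V by eventually_elim (rule coord_V_space(1), auto)
  show "integrable (lebesgue_on {0..T}) (\<lambda>t. N 1 (coord (u t)))"
  proof (rule Bochner_Integration.integrable_bound[OF G(1)])
    \<comment> \<open>Measurability of the squared norm does not come from \<open>G\<close>: it is a
      series of functions that are continuous in time.\<close>
    have "(\<lambda>t. coord (u t) k) \<in> borel_measurable (lebesgue_on {0..T})" for k
      by (rule continuous_imp_measurable_on_sets_lebesgue[OF ell_continuous_component[OF a0]]) simp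
    then show "(\<lambda>t. N 1 (coord (u t))) \<in> borel_measurable (lebesgue_on {0..T})"
      unfolding nsq_def by (intro borel_measurable_suminf borel_measurable_times borel_measurable_power borel_measurable_const)
    from V show "AE t in lebesgue_on {0..T}. norm (N 1 (coord (u t))) \<le> norm ((G t)\<^sup>2)"
    proof eventually_elim
      case (elim t)
      have c: "coord (u t) \<in> E 1" "sqrt (N 1 (coord (u t))) \<le> G t"
        using coord_V_space[OF elim] G(2)[of t] by auto
      have "(sqrt (N 1 (coord (u t))))\<^sup>2 \<le> (G t)\<^sup>2" by (intro power_mono c) (simp add: nsq_nonneg[OF c(1)])
      then show ?case using nsq_nonneg[OF c(1)] by simp
    qed
  qed
  show "continuous_on {0..T} (\<lambda>t. N 0 (coord (u t)))" by (rule ell_continuous_nsq[OF a0])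
  show "continuous_on {0..T} (\<lambda>t. mtri (coord (u t)) (coord (u t)) (unit_seq k))" for k
    by (rule ell_continuous_mtri[OF ah])
  show "((\<lambda>t. (1 + \<epsilon> * lam k powr r) * coord (u t) k) has_real_derivative
      - (\<nu> * lam k * coord (u t) k) - mtri (coord (u t)) (coord (u t)) (unit_seq k)) (at t within {0..T})"
    if "t \<in> {0..T}" for k t
    by (rule mode_derivative[OF ah V eq that])
qed

lemma L2_into_AE: "L2_into T X n u \<Longrightarrow> AE t in lebesgue_on {0..T}. u t \<in> X"
  unfolding L2_into_def strongly_measurable_into_def by (auto elim: eventually_mono)

lemma integral_lebesgue_on_point: "integral\<^sup>L (lebesgue_on {0..0::real}) f = 0"
  by (rule integral_eq_zero_null_sets) simp

lemma mode_flow_nse: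
  assumes u: "nse_strong_solution \<phi> lam \<nu> T u\<^sub>0 u" and T: "0 \<le> T"
  shows "mode_flow \<nu> 0 1 T (\<lambda>t. coord (u t))" "coord (u 0) = coord u\<^sub>0"
    and "ell_continuous 1 T (\<lambda>t. coord (u t))"
proof -
  have cont: "continuous_into T (V_space 1) (sobolev_norm 1) u"
    and L2: "L2_into T (V_space 1) (sobolev_norm 1) u"
    and eq: "\<And>t k. t \<in> {0..T} \<Longrightarrow> ip (u t) (\<phi> k)
        + \<nu> * (\<integral>\<tau>. ip (stokes_powr \<phi> lam (1 / 2) (u \<tau>)) (stokes_powr \<phi> lam (1 / 2) (\<phi> k)) \<partial>lebesgue_on {0..t})
        = - (\<integral>\<tau>. B_pairing (u \<tau>) (u \<tau>) (\<phi> k) \<partial>lebesgue_on {0..t}) + ip u\<^sub>0 (\<phi> k)"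
    using u phi_V_space unfolding nse_strong_solution_def nse_weak_solution_def by blast+
  show "mode_flow \<nu> 0 1 T (\<lambda>t. coord (u t))"
    by (rule mode_flow_coord[OF cont _ _ L2_into_AE[OF L2], where G="\<lambda>t. sobolev_norm 1 (u t)" and c="coord u\<^sub>0"])
       (use L2 eq in \<open>auto simp: L2_into_def\<close>)
  show "coord (u 0) = coord u\<^sub>0"
    using eq[of 0] T by (simp only: integral_lebesgue_on_point) simp
  show "ell_continuous 1 T (\<lambda>t. coord (u t))" by (rule ell_continuous_coord_V[OF cont]) auto
qed

text \<open>The regularity of \<open>coord u\<^sub>0\<close> gives meaning to
  \<open>stokes_powr\<close> of the initial field, which otherwise is an arbitrary choice.\<close>

lemma mode_flow_nsv:
  assumes u: "nsv_solution \<phi> lam \<nu> r \<alpha> T u\<^sub>0 u" and r: "1/2 \<le> r" "r \<le> 1" and T: "0 \<le> T"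
    and u0: "coord u\<^sub>0 \<in> E r"
  shows "mode_flow \<nu> (\<alpha> powr (2 * r)) r T (\<lambda>t. coord (u t))" "coord (u 0) = coord u\<^sub>0"
proof -
  let ?\<epsilon> = "\<alpha> powr (2 * r)"
  have cont: "continuous_into T (V_space r) (sobolev_norm r) u"
    and L2: "L2_into T (V_space 1 \<inter> V_space r) (V_cap_norm r) u"
    and eq0: "\<And>t k. t \<in> {0..T} \<Longrightarrow> ip (u t) (\<phi> k)
        + ?\<epsilon> * ip (stokes_powr \<phi> lam (r / 2) (u t)) (stokes_powr \<phi> lam (r / 2) (\<phi> k))
        + \<nu> * (\<integral>\<tau>. ip (stokes_powr \<phi> lam (1 / 2) (u \<tau>)) (stokes_powr \<phi> lam (1 / 2) (\<phi> k)) \<partial>lebesgue_on {0..t})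
        = - (\<integral>\<tau>. B_pairing (u \<tau>) (u \<tau>) (\<phi> k) \<partial>lebesgue_on {0..t}) + ip u\<^sub>0 (\<phi> k)
          + ?\<epsilon> * ip (stokes_powr \<phi> lam (r / 2) u\<^sub>0) (stokes_powr \<phi> lam (r / 2) (\<phi> k))"
    using u phi_V_space unfolding nsv_solution_def by blast+
  have A: "ip (stokes_powr \<phi> lam (r / 2) v) (stokes_powr \<phi> lam (r / 2) (\<phi> k)) = lam k powr r * coord v k"
    if "coord v \<in> E r" for v k
    using ip_stokes_powr_phi[of v "r / 2" k] that by simp
  have uE: "coord (u t) \<in> E r" if "t \<in> {0..T}" for t
    using ell_continuous_coord_V[OF cont] r that by (auto simp: ell_continuous_def)
  have eq: "(1 + ?\<epsilon> * lam k powr r) * coord (u t) k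
        + \<nu> * (\<integral>\<tau>. ip (stokes_powr \<phi> lam (1 / 2) (u \<tau>)) (stokes_powr \<phi> lam (1 / 2) (\<phi> k)) \<partial>lebesgue_on {0..t})
        = - (\<integral>\<tau>. B_pairing (u \<tau>) (u \<tau>) (\<phi> k) \<partial>lebesgue_on {0..t}) + (1 + ?\<epsilon> * lam k powr r) * coord u\<^sub>0 k"
    if t: "t \<in> {0..T}" for t k
    using eq0[OF t, of k] unfolding A[OF uE[OF t]] A[OF u0] by (simp only: distrib_right mult_1 mult.assoc)
  show "mode_flow \<nu> ?\<epsilon> r T (\<lambda>t. coord (u t))"
  proof (rule mode_flow_coord[OF cont r _ _ _ eq])
    show "AE t in lebesgue_on {0..T}. u t \<in> V_space 1" using L2_into_AE[OF L2] by eventually_elim simp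
    show "integrable (lebesgue_on {0..T}) (\<lambda>t. (V_cap_norm r (u t))\<^sup>2)" using L2 by (simp add: L2_into_def)
    show "sobolev_norm 1 (u t) \<le> V_cap_norm r (u t)" for t by (simp add: V_cap_norm_def sobolev_norm_nonneg)
  qed
  show "coord (u 0) = coord u\<^sub>0"
  proof
    fix k
    have "0 \<le> ?\<epsilon> * lam k powr r" by simp
    then have "1 + ?\<epsilon> * lam k powr r \<noteq> 0" by linarith
    moreover have "(1 + ?\<epsilon> * lam k powr r) * coord (u 0) k = (1 + ?\<epsilon> * lam k powr r) * coord u\<^sub>0 k"
      using eq[of 0 k] T by (simp only: integral_lebesgue_on_point) simp
    ultimately show "coord (u 0) k = coord u\<^sub>0 k" by simp
  qed
qed

text \<open>Translates the vanishing of the energy from \<epsilon> back to \<open>\<alpha>\<close>,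
  and from coordinates back to the norm of \<open>stokes_powr\<close>.\<close>

lemma voigt_energy_Limsup:
  assumes w: "nse_strong_solution \<phi> lam \<nu> T u\<^sub>0 w" and \<nu>: "0 < \<nu>" and r: "1/2 \<le> r" "r \<le> 1"
    and u: "\<And>\<alpha>. 0 < \<alpha> \<Longrightarrow> nsv_solution \<phi> lam \<nu> r \<alpha> T u\<^sub>0 (u \<alpha>)" and t: "t \<in> {0..T}"
  shows "Limsup (at_right 0) (\<lambda>\<alpha>. ereal (\<alpha> powr (2 * r) * (L2norm (stokes_powr \<phi> lam (r / 2) (u \<alpha> t)))\<^sup>2)) \<le> 0"
    (is "Limsup _ ?f \<le> 0")
proof (rule dense_ge)
  have T: "0 \<le> T" using t by auto
  note b = mode_flow_nse[OF w T]
  have bE: "coord (w t) \<in> E 1" if "t \<in> {0..T}" for t using b(3) that by (auto simp: ell_continuous_def)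
  \<comment> \<open>The initial field inherits its regularity from the strong solution, with whose
    initial value it shares all coordinates.\<close>
  have u0: "coord u\<^sub>0 \<in> E r" unfolding b(2)[symmetric] by (rule ell_mono(1)[OF r(2) bE]) (use T in simp)
  have "bounded ((\<lambda>t. sqrt (N 1 (coord (w t)))) ` {0..T})"
    by (intro compact_imp_bounded compact_continuous_image ell_continuous_sqrt_nsq b(3)) auto
  then obtain M where M: "\<And>t. t \<in> {0..T} \<Longrightarrow> \<bar>sqrt (N 1 (coord (w t)))\<bar> \<le> M"
    unfolding bounded_iff by (metis imageI real_norm_def)
  have M0: "0 \<le> M" using M[OF t] by linarith
  have M2: "N 1 (coord (w s)) \<le> M\<^sup>2" if s: "s \<in> {0..T}" for s
    using power_mono[OF M[OF s], of 2] nsq_nonneg[OF bE[OF s]] by simp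
  fix y :: ereal assume "0 < y"
  then obtain \<delta> where \<delta>: "0 < ereal \<delta>" "ereal \<delta> < y" using ereal_dense2 by blast
  have d: "0 < \<delta>" using \<delta>(1) by simp
  obtain \<epsilon>\<^sub>0 where e: "0 < \<epsilon>\<^sub>0" and vanish: "\<And>\<epsilon> a. \<lbrakk>0 < \<epsilon>; \<epsilon> < \<epsilon>\<^sub>0; mode_flow \<nu> \<epsilon> r T a; a 0 = coord (w 0)\<rbrakk>
      \<Longrightarrow> \<epsilon> * N r (a t) \<le> \<delta>"
    by (rule voigt_energy_vanishes[OF b(1) \<nu> _ r(2) M0 M2 t d]) (use r in auto)
  \<comment> \<open>The solution of
    \<open>\<alpha> powr (2 * r) = \<epsilon>\<^sub>0\<close>.\<close>
  define \<alpha>\<^sub>0 where "\<alpha>\<^sub>0 = \<epsilon>\<^sub>0 powr (1 / (2 * r))"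
  have "?f \<alpha> \<le> ereal \<delta>" if \<alpha>: "0 < \<alpha>" "\<alpha> < \<alpha>\<^sub>0" for \<alpha>
  proof -
    note a = mode_flow_nsv[OF u[OF \<alpha>(1)] r T u0]
    have "\<alpha> powr (2 * r) < \<alpha>\<^sub>0 powr (2 * r)" using \<alpha> r by (intro powr_less_mono2) auto
    then have small: "\<alpha> powr (2 * r) < \<epsilon>\<^sub>0" using r e by (simp add: \<alpha>\<^sub>0_def powr_powr)
    have "\<alpha> powr (2 * r) * N r (coord (u \<alpha> t)) \<le> \<delta>"
      by (rule vanish[OF _ small a(1)]) (use \<alpha> in \<open>simp_all add: a(2) b(2)\<close>)
    moreover have "coord (u \<alpha> t) \<in> E (2 * (r / 2))" 
      using a(1)[unfolded mode_flow_def, THEN conjunct1, THEN bspec, OF t] by simp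
    ultimately show ?thesis by (simp add: L2norm_stokes_powr)
  qed
  moreover have "0 < \<alpha>\<^sub>0" using e by (simp add: \<alpha>\<^sub>0_def)
  ultimately have "eventually (\<lambda>\<alpha>. ?f \<alpha> \<le> ereal \<delta>) (at_right 0)"
    unfolding eventually_at_right_field by blast
  then have "Limsup (at_right 0) ?f \<le> ereal \<delta>" by (rule Limsup_bounded)
  then show "Limsup (at_right 0) ?f \<le> y" using \<delta>(2) by order
qed

end

theorem theorem6p2:
  fixes \<phi> :: "nat \<Rightarrow> vfield" and lam :: "nat \<Rightarrow> real"
    and \<nu> r s T :: real and u\<^sub>0 :: vfield and u :: "real \<Rightarrow> real \<Rightarrow> vfield"
  assumes "stokes_eigenbasis \<phi> lam"
    and "\<nu> > 0" and "1 / 2 \<le> r" and "r \<le> 1" and "s > 1"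
    and "u\<^sub>0 \<in> sobolev (r + s)" and "weakly_divergence_free u\<^sub>0" and "mean_free u\<^sub>0"
    and "\<And>\<alpha> S. \<alpha> > 0 \<Longrightarrow> S > 0 \<Longrightarrow> nsv_solution \<phi> lam \<nu> r \<alpha> S u\<^sub>0 (u \<alpha>)"
    and "T > 0"
    and "(SUP t\<in>{0..<T}. Limsup (at_right 0)
            (\<lambda>\<alpha>. ereal (\<alpha> powr (2 * r) * (L2norm (stokes_powr \<phi> lam (r / 2) (u \<alpha> t)))\<^sup>2))) > 0"
  shows "nse_develops_singularity \<phi> lam \<nu> u\<^sub>0 T"
  unfolding nse_develops_singularity_def
proof
  interpret stokes_basis \<phi> lam by unfold_locales (rule assms(1))
  assume "\<exists>w. nse_strong_solution \<phi> lam \<nu> T u\<^sub>0 w"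
  then obtain w where w: "nse_strong_solution \<phi> lam \<nu> T u\<^sub>0 w" ..
  have "(SUP t\<in>{0..<T}. Limsup (at_right 0)
      (\<lambda>\<alpha>. ereal (\<alpha> powr (2 * r) * (L2norm (stokes_powr \<phi> lam (r / 2) (u \<alpha> t)))\<^sup>2))) \<le> 0"
    by (rule SUP_least, rule voigt_energy_Limsup[OF w assms(2-4)]) (use assms(9,10) in auto)
  then show False using assms(11) by simp
qed

end
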